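(* Let $C=V(G(x,y))\subset\mathbb{C}^2$, with $G\in\mathbb{R}[x,y]$ a reduced defining polynomial, be a real affine plane curve which is polynomial or trigonometric, and which intersects itself solely at hyperbolic nodes, i.e., all singular points of $C$ in $\mathbb{C}^2$ are hyperbolic nodes. Then all critical points of the polynomial $G(x,y)$ (in $\mathbb{C}^2$) are real.
   Context: $V(G)=\{(x,y)\in\mathbb{C}^2: G(x,y)=0\}$. A hyperbolic node is a real point at which the curve has exactly two local branches, both real and smooth, meeting transversally. Polynomial curve: a curve in $\mathbb{C}^2$ having a generically one-to-one parametrization $t\mapsto(X(t),Y(t))$ with $X,Y\in\mathbb{C}[t]$. Trigonometric curve: a real algebraic curve $C$ in $\mathbb{C}^2$ for which there exist real trigonometric polynomials $X(t),Y(t)$ (finite real linear combinations of $\sin(kt),\cos(kt)$, $k\in\mathbb{Z}_{\ge0}$) such that $t\mapsto(X(t),Y(t))$, generically one-to-one on $[0,2\pi)$, parametrizes the real point set of $C$, meaning that $C$ is the complex Zariski closure of the image (so the image is the real point set up to finitely many points). *)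

theory Defs
  imports
    "HOL-Analysis.Analysis"
    "HOL-Computational_Algebra.Computational_Algebra"
begin

text \<open>
  A polynomial in \<open>x, y\<close> is a polynomial in \<open>y\<close> (outer variable) whose coefficients are
  polynomials in \<open>x\<close> (inner variable).
\<close>

definition eval2 :: "'a::comm_ring_1 poly poly \<Rightarrow> 'a \<times> 'a \<Rightarrow> 'a" where
  "eval2 H p = poly (poly H [:snd p:]) (fst p)"

definition partial_x :: "complex poly poly \<Rightarrow> complex poly poly" where
  "partial_x H = map_poly pderiv H"

definition partial_y :: "complex poly poly \<Rightarrow> complex poly poly" where
  "partial_y H = pderiv H"

definition complexify :: "real poly poly \<Rightarrow> complex poly poly" where
  "complexify G = map_poly (map_poly complex_of_real) G"

definition real_point :: "complex \<times> complex \<Rightarrow> bool" where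
  "real_point p \<longleftrightarrow> fst p \<in> \<real> \<and> snd p \<in> \<real>"

definition zero_locus :: "complex poly poly \<Rightarrow> (complex \<times> complex) set" where
  "zero_locus H = {p. eval2 H p = 0}"

definition critical_points :: "complex poly poly \<Rightarrow> (complex \<times> complex) set" where
  "critical_points H = {p. eval2 (partial_x H) p = 0 \<and> eval2 (partial_y H) p = 0}"

text \<open>These are the singular points of the curve \<open>zero_locus H\<close> when \<open>H\<close> is reduced.\<close>

definition singular_points :: "complex poly poly \<Rightarrow> (complex \<times> complex) set" where
  "singular_points H = zero_locus H \<inter> critical_points H"


text \<open>
  Local branches at \<open>p\<close> of the curve with reduced equation \<open>H = 0\<close> are given by the irreducible
  factors of \<open>H (p + (x, y))\<close> in the ring of formal power series in \<open>x, y\<close>; associated factors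
  give the same branch.  As for polynomials, \<open>y\<close> is the outer variable of a series.
\<close>

definition germ_at :: "complex poly poly \<Rightarrow> complex \<times> complex \<Rightarrow> complex fps fps" where
  "germ_at H p =
     fps_of_poly (map_poly fps_of_poly
       (pcompose (map_poly (\<lambda>c. pcompose c [:fst p, 1:]) H) [:[:snd p:], 1:]))"

definition branch_equation ::
    "complex poly poly \<Rightarrow> complex \<times> complex \<Rightarrow> complex fps fps \<Rightarrow> bool" where
  "branch_equation H p f \<longleftrightarrow> irreducible f \<and> f dvd germ_at H p"

definition same_branch :: "complex fps fps \<Rightarrow> complex fps fps \<Rightarrow> bool" where
  "same_branch f g \<longleftrightarrow> f dvd g \<and> g dvd f"

definition coeff_xy :: "complex fps fps \<Rightarrow> nat \<Rightarrow> nat \<Rightarrow> complex" where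
  "coeff_xy f i j = fps_nth (fps_nth f j) i"

definition real_series :: "complex fps fps \<Rightarrow> bool" where
  "real_series f \<longleftrightarrow> (\<forall>i j. coeff_xy f i j \<in> \<real>)"

definition smooth_branch :: "complex fps fps \<Rightarrow> bool" where
  "smooth_branch f \<longleftrightarrow> coeff_xy f 1 0 \<noteq> 0 \<or> coeff_xy f 0 1 \<noteq> 0"

text \<open>
  The tangent line of a smooth branch \<open>f = 0\<close> is the zero set of the linear part of \<open>f\<close>; two
  smooth branches are transversal when their tangent lines differ.
\<close>

definition transversal :: "complex fps fps \<Rightarrow> complex fps fps \<Rightarrow> bool" where
  "transversal f g \<longleftrightarrow> coeff_xy f 1 0 * coeff_xy g 0 1 \<noteq> coeff_xy f 0 1 * coeff_xy g 1 0"

text \<open>A branch at a real point is real when it has an equation with real coefficients.\<close>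

definition hyperbolic_node :: "complex poly poly \<Rightarrow> complex \<times> complex \<Rightarrow> bool" where
  "hyperbolic_node H p \<longleftrightarrow>
     real_point p \<and>
     (\<exists>f g. branch_equation H p f \<and> branch_equation H p g \<and> \<not> same_branch f g \<and>
            (\<forall>h. branch_equation H p h \<longrightarrow> same_branch h f \<or> same_branch h g) \<and>
            real_series f \<and> real_series g \<and>
            smooth_branch f \<and> smooth_branch g \<and> transversal f g)"


text \<open>
  No closure is taken: the image of a nonconstant polynomial map from the complex line to the
  complex plane is Zariski closed.
\<close>

definition polynomial_curve :: "(complex \<times> complex) set \<Rightarrow> bool" where
  "polynomial_curve C \<longleftrightarrow>
     (\<exists>X Y :: complex poly. \<exists>F. finite F \<and>
        inj_on (\<lambda>t. (poly X t, poly Y t)) (UNIV - F) \<and>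
        C = range (\<lambda>t. (poly X t, poly Y t)))"

definition trig_polynomial :: "(real \<Rightarrow> real) \<Rightarrow> bool" where
  "trig_polynomial X \<longleftrightarrow>
     (\<exists>n (a :: nat \<Rightarrow> real) (b :: nat \<Rightarrow> real).
        \<forall>t. X t = (\<Sum>k\<le>n. a k * cos (real k * t) + b k * sin (real k * t)))"

definition zariski_closure :: "(complex \<times> complex) set \<Rightarrow> (complex \<times> complex) set" where
  "zariski_closure S = \<Inter> {zero_locus H | H. S \<subseteq> zero_locus H}"

text \<open>
  That \<open>C\<close> is moreover defined by a real polynomial is automatic here, since \<open>C\<close> is the Zariski
  closure of a set of real points.
\<close>

definition trigonometric_curve :: "(complex \<times> complex) set \<Rightarrow> bool" where
  "trigonometric_curve C \<longleftrightarrow>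
     (\<exists>X Y F. trig_polynomial X \<and> trig_polynomial Y \<and> finite F \<and>
        inj_on (\<lambda>t. (X t, Y t)) ({0..<2 * pi} - F) \<and>
        C = zariski_closure
              ((\<lambda>t. (complex_of_real (X t), complex_of_real (Y t))) ` {0..<2 * pi}))"

end

theory Submission
  imports
    Defs
    "HOL-Complex_Analysis.Complex_Analysis"
    "HOL-Computational_Algebra.Field_as_Ring"
    "Subresultants.Subresultant"
begin

text \<open>
  Let \<open>\<nu>\<close> be the number of nodes and \<open>\<epsilon> = 0\<close> for a polynomial, \<open>\<epsilon> = 1\<close> for a trigonometric curve.
  Choose real linear coordinates in which the parametrization is proper over the \<open>x\<close>-axis and no node
  has a vertical tangent.

  There are at most \<open>2\<nu> + \<epsilon>\<close> abscissas of critical points.  Let \<open>D\<close> and \<open>Q\<close> be the products of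
  \<open>G\<close> and of \<open>G_x\<close> over the roots \<open>y\<close> of \<open>G_y (x, y)\<close>.  By Puiseux expansions at infinity
  \<open>G_x = O(G / x)\<close> on the polar curve \<open>G_y = 0\<close>, so \<open>deg Q \<le> deg D - (deg G - 1)\<close>; and
  \<open>deg D\<close> is bounded by counting the zeros of \<open>G_y\<close> along the curve, which at smooth points have at most
  the order of those of \<open>X'\<close>, and one more at the branches through nodes.

  On the other hand there are \<open>2\<nu> + \<epsilon>\<close> real critical points: every node has two real parameters, so by
  the Jordan curve theorem the real curve bounds at least \<open>\<nu> + \<epsilon>\<close> bounded regions, each of which contains
  an extremum of \<open>G\<close>; the nodes are the others.  If some critical point were not real, a
  further shear would separate the abscissas of too many critical points.
\<close>

section \<open>Polynomials in two variables\<close>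

text \<open>The two bounds meet exactly, without slack. Let \<open>d\<close> be the number of
  complex parameters over a general point; the common treatment of both kinds of curves uses
  injectivity only for almost all real parameters, so \<open>d\<close> is carried along and
  cancelled at the end. Then \<open>degree A = d * degree G\<close>, and \<open>G_y\<close> has at
  most \<open>degree A - 1 + 2 * d * \<nu>\<close> zeros along a polynomial curve,
  \<open>degree A + 2 * d * \<nu>\<close> along a trigonometric one: differentiating a polynomial
  costs a degree, while the numerator of the derivative of a Laurent polynomial may keep it. This is
  where \<open>\<epsilon>\<close> enters the upper bound; the lower bound gains it from the closing
  of the circle. Only distinct abscissas of critical points are counted, never multiplicities. The
  projection is therefore chosen twice, once to produce the real critical points and once to
  separate them from each other and from a hypothetical non-real one. Formal branches are traded for
  a condition on second derivatives at the outset, because every global argument works with limits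
  of slopes and with the Hessian.\<close>

lemma eval2_simps [simp]:
  "eval2 0 p = 0" "eval2 1 p = 1"
  "eval2 (H + K) p = eval2 H p + eval2 K p"
  "eval2 (H * K) p = eval2 H p * eval2 K p"
  "eval2 (H ^ k) p = eval2 H p ^ k"
  "eval2 (pCons a H) p = poly a (fst p) + snd p * eval2 H p"
  "eval2 (Polynomial.smult a H) p = poly a (fst p) * eval2 H p"
  by (simp_all add: eval2_def)

lemma eval2_diff_minus [simp]:
  "eval2 (H - K) p = eval2 H p - eval2 K p"
  "eval2 (- H) p = - eval2 H p"
  by (simp_all add: eval2_def)

lemma eval2_dvd:
  assumes "H dvd K" "eval2 H p = 0"
  shows "eval2 K p = 0"
  using assms by (auto elim!: dvdE)

definition fibre_poly :: "complex poly poly \<Rightarrow> complex \<Rightarrow> complex poly" where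
  "fibre_poly H x = map_poly (\<lambda>c. poly c x) H"

lemma coeff_fibre_poly [simp]: "coeff (fibre_poly H x) i = poly (coeff H i) x"
  by (simp add: fibre_poly_def coeff_map_poly)

lemma fibre_poly_simps [simp]:
  "fibre_poly 0 x = 0"
  "fibre_poly (pCons a H) x = pCons (poly a x) (fibre_poly H x)"
  by (auto intro!: poly_eqI simp: coeff_pCons split: nat.splits)

lemma poly_fibre_poly [simp]: "poly (fibre_poly H x) y = eval2 H (x, y)"
  by (induction H rule: pCons_induct) auto

lemma degree_fibre_poly_le: "degree (fibre_poly H x) \<le> degree H"
  by (simp add: degree_le coeff_eq_0)

lemma degree_fibre_poly:
  assumes "poly (lead_coeff H) x \<noteq> 0"
  shows "degree (fibre_poly H x) = degree H"
  using assms by (intro antisym[OF degree_fibre_poly_le] le_degree) simp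

lemma fibre_poly_nonzero:
  assumes "poly (lead_coeff H) x \<noteq> 0"
  shows "fibre_poly H x \<noteq> 0"
  using assms by (metis coeff_fibre_poly coeff_0)

lemma finite_zeros_above:
  assumes "fibre_poly H x \<noteq> 0"
  shows "finite {p. eval2 H p = 0 \<and> fst p = x}"
proof -
  have "{p. eval2 H p = 0 \<and> fst p = x} \<subseteq> Pair x ` {y. poly (fibre_poly H x) y = 0}"
    by force
  then show ?thesis
    using poly_roots_finite[OF assms] finite_subset by blast
qed

lemma poly_infinite_roots_eq_0:
  fixes p :: "complex poly"
  assumes "infinite S" "\<And>x. x \<in> S \<Longrightarrow> poly p x = 0"
  shows "p = 0"
  using assms poly_roots_finite[of p] finite_subset[of S "{x. poly p x = 0}"] by blast

text \<open>The ground field is infinite, so identities can be checked by values, in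
  \<open>y\<close> for fixed \<open>x\<close> and then in \<open>x\<close> for each coefficient.
  Most algebraic rules below are obtained in this way.\<close>

lemma eval2_eqI:
  fixes H K :: "complex poly poly"
  assumes "\<And>x y. eval2 H (x, y) = eval2 K (x, y)"
  shows "H = K"
proof -
  have "poly (coeff H i) x = poly (coeff K i) x" for i x
  proof -
    have "fibre_poly H x = fibre_poly K x"
      using assms by (intro poly_eq_poly_eq_iff[THEN iffD1]) auto
    then show ?thesis by (metis coeff_fibre_poly)
  qed
  then have "coeff H i = coeff K i" for i
    by (intro poly_eq_poly_eq_iff[THEN iffD1]) auto
  then show ?thesis by (rule poly_eqI)
qed

lemma partial_y_pCons: "partial_y (pCons a H) = H + pCons 0 (partial_y H)"
  by (simp add: partial_y_def pderiv_pCons)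

lemma partial_x_pCons: "partial_x (pCons a H) = pCons (pderiv a) (partial_x H)"
  unfolding partial_x_def by (rule poly_eqI) (simp add: coeff_map_poly coeff_pCons split: nat.splits)

lemma partial_0 [simp]: "partial_x 0 = 0" "partial_y 0 = 0"
  by (simp_all add: partial_x_def partial_y_def)

lemma eval2_chain:
  assumes "(u has_field_derivative u') (at t within S)"
    and "(v has_field_derivative v') (at t within S)"
  shows "((\<lambda>t. eval2 H (u t, v t)) has_field_derivative
    eval2 (partial_x H) (u t, v t) * u' + eval2 (partial_y H) (u t, v t) * v') (at t within S)"
proof (induction H rule: pCons_induct)
  case 0
  then show ?case by simp
next
  case (pCons a H)
  have "((\<lambda>t. poly a (u t)) has_field_derivative poly (pderiv a) (u t) * u') (at t within S)"
    using DERIV_chain2[OF poly_DERIV assms(1)] by simp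
  from DERIV_add[OF this DERIV_mult[OF assms(2) pCons(2)]] show ?case
    by (simp add: partial_y_pCons partial_x_pCons algebra_simps)
qed

lemma eval2_DERIV_x:
  "((\<lambda>x. eval2 H (x, y)) has_field_derivative eval2 (partial_x H) (x, y)) (at x within S)"
  using eval2_chain[OF DERIV_ident DERIV_const, of H y x S] by simp

lemma eval2_DERIV_y:
  "((\<lambda>y. eval2 H (x, y)) has_field_derivative eval2 (partial_y H) (x, y)) (at y within S)"
  using eval2_chain[OF DERIV_const DERIV_ident, of H x y S] by simp

lemma continuous_on_eval2 [continuous_intros]:
  fixes H :: "complex poly poly"
  assumes "continuous_on S u" "continuous_on S v"
  shows "continuous_on S (\<lambda>t. eval2 H (u t, v t))"
  using assms
proof (induction H rule: pCons_induct)
  case (pCons a H)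
  have "continuous_on S (\<lambda>t. poly a (u t))"
    using pCons(3) by (intro continuous_intros)
  then show ?case using pCons by (auto intro!: continuous_on_add continuous_on_mult)
qed auto

lemma tendsto_eval2 [tendsto_intros]:
  fixes H :: "complex poly poly"
  assumes "(u \<longlongrightarrow> a) F" "(v \<longlongrightarrow> b) F"
  shows "((\<lambda>t. eval2 H (u t, v t)) \<longlongrightarrow> eval2 H (a, b)) F"
proof -
  have "continuous_on UNIV (\<lambda>q. eval2 H (fst q, snd q))"
    by (intro continuous_intros)
  then have "isCont (\<lambda>q. eval2 H q) (a, b)"
    by (simp add: continuous_on_eq_continuous_at)
  from isCont_tendsto_compose[OF this tendsto_Pair[OF assms]] show ?thesis .
qed

lemma fibre_poly_pderiv: "pderiv (fibre_poly H x) = fibre_poly (partial_y H) x"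
proof (rule poly_eq_poly_eq_iff[THEN iffD1], rule ext)
  fix y
  have "((\<lambda>y. poly (fibre_poly H x) y) has_field_derivative poly (pderiv (fibre_poly H x)) y) (at y)"
    by (rule poly_DERIV)
  with eval2_DERIV_y[of H x y UNIV]
  show "poly (pderiv (fibre_poly H x)) y = poly (fibre_poly (partial_y H) x) y"
    by (simp add: DERIV_unique)
qed

lemma eval2_partial_mult:
  "eval2 (partial_x (H * K)) p = eval2 (partial_x H) p * eval2 K p + eval2 H p * eval2 (partial_x K) p"
  "eval2 (partial_y (H * K)) p = eval2 (partial_y H) p * eval2 K p + eval2 H p * eval2 (partial_y K) p"
proof -
  obtain x y where p: "p = (x, y)" by (cases p)
  show "eval2 (partial_x (H * K)) p = eval2 (partial_x H) p * eval2 K p + eval2 H p * eval2 (partial_x K) p"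
    using DERIV_unique[OF eval2_DERIV_x[of "H * K" y x]]
      DERIV_mult[OF eval2_DERIV_x[of H y x] eval2_DERIV_x[of K y x]]
    by (simp add: p algebra_simps)
  show "eval2 (partial_y (H * K)) p = eval2 (partial_y H) p * eval2 K p + eval2 H p * eval2 (partial_y K) p"
    using DERIV_unique[OF eval2_DERIV_y[of "H * K" x y]]
      DERIV_mult[OF eval2_DERIV_y[of H x y] eval2_DERIV_y[of K x y]]
    by (simp add: p algebra_simps)
qed

lemma partial_mult:
  "partial_x (H * K) = partial_x H * K + H * partial_x K"
  "partial_y (H * K) = partial_y H * K + H * partial_y K"
  by (rule eval2_eqI, simp add: eval2_partial_mult)+

lemma partial_add:
  "partial_x (H + K) = partial_x H + partial_x K"
  "partial_y (H + K) = partial_y H + partial_y K"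
proof -
  show "partial_x (H + K) = partial_x H + partial_x K"
    by (rule poly_eqI) (simp add: partial_x_def coeff_map_poly pderiv_add)
  show "partial_y (H + K) = partial_y H + partial_y K"
    by (simp add: partial_y_def pderiv_add)
qed

lemma degree_partial_y: "degree (partial_y H) = degree H - 1"
  unfolding partial_y_def by (simp add: degree_pderiv)

lemma lead_coeff_partial_y: "lead_coeff (partial_y H) = of_nat (degree H) * lead_coeff H"
proof (cases "degree H")
  case 0
  then have "partial_y H = 0" by (metis pderiv_eq_0_iff partial_y_def)
  then show ?thesis by (simp add: 0)
next
  case (Suc k)
  then show ?thesis by (simp add: degree_partial_y) (simp add: partial_y_def coeff_pderiv)
qed

lemma partial_1 [simp]: "partial_x 1 = 0" "partial_y 1 = 0"
  using partial_x_pCons[of 1 0] partial_y_pCons[of 1 0] by (simp_all add: pderiv_1)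

text \<open>The maximal ideal of a point is generated by its two linear forms: division by
  \<open>y - y0\<close> leaves a remainder in \<open>x\<close> alone, and this vanishes at
  \<open>x0\<close>.\<close>

lemma zero_at_point_decomposition:
  assumes "eval2 H (x0, y0) = 0"
  obtains H1 H2 where "H = [:[:- x0, 1:]:] * H1 + [:[:- y0:], 1:] * H2"
proof -
  obtain K r where K: "H = [:- [:y0:], 1:] * K + [:r:]"
  proof -
    have "poly (H - [:poly H [:y0:]:]) [:y0:] = 0" by simp
    then have "[:- [:y0:], 1:] dvd (H - [:poly H [:y0:]:])" by (simp only: poly_eq_0_iff_dvd)
    then obtain K where "H - [:poly H [:y0:]:] = [:- [:y0:], 1:] * K" by (elim dvdE)
    then have "H = [:- [:y0:], 1:] * K + [:poly H [:y0:]:]" by (simp add: algebra_simps)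
    then show thesis using that by blast
  qed
  have "poly r x0 = 0" using assms by (subst (asm) K) simp
  then obtain s where s: "r = [:- x0, 1:] * s" by (metis poly_eq_0_iff_dvd dvdE)
  have "H = [:[:- x0, 1:]:] * [:s:] + [:[:- y0:], 1:] * K"
    by (subst K, subst s) simp
  then show thesis using that by blast
qed

lemma partial_linear [simp]:
  "partial_x [:[:a, 1:]:] = 1" "partial_y [:[:a, 1:]:] = 0"
  "partial_x [:[:b:], 1:] = 0" "partial_y [:[:b:], 1:] = 1"
  by (simp_all add: partial_x_pCons partial_y_pCons pderiv_pCons)

text \<open>Reality of a polynomial is expressed by \<open>conj2 H = H\<close>, a form that is
  compatible with divisibility, derivatives and real shears.\<close>

definition conj2 :: "complex poly poly \<Rightarrow> complex poly poly" where
  "conj2 H = map_poly (map_poly cnj) H"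

lemma conj2_pCons: "conj2 (pCons a H) = pCons (map_poly cnj a) (conj2 H)"
  unfolding conj2_def by (rule poly_eqI) (simp add: coeff_map_poly coeff_pCons split: nat.splits)

lemma conj2_0 [simp]: "conj2 0 = 0"
  by (simp add: conj2_def)

lemma poly_map_cnj: "poly (map_poly cnj a) (cnj x) = cnj (poly a x)"
  by (induction a rule: pCons_induct) (auto simp: map_poly_pCons)

lemma eval2_conj2: "eval2 (conj2 H) (cnj x, cnj y) = cnj (eval2 H (x, y))"
  by (induction H rule: pCons_induct) (auto simp: conj2_pCons poly_map_cnj)

lemma eval2_conj2': "eval2 (conj2 H) (x, y) = cnj (eval2 H (cnj x, cnj y))"
  using eval2_conj2[of H "cnj x" "cnj y"] by simp

lemma conj2_mult: "conj2 (H * K) = conj2 H * conj2 K"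
  by (rule eval2_eqI) (simp add: eval2_conj2')

lemma conj2_conj2 [simp]: "conj2 (conj2 H) = H"
  by (rule eval2_eqI) (simp add: eval2_conj2')

lemma conj2_partial:
  "conj2 (partial_x H) = partial_x (conj2 H)"
  "conj2 (partial_y H) = partial_y (conj2 H)"
proof -
  have pd: "map_poly cnj (pderiv a) = pderiv (map_poly cnj a)" for a
    by (rule poly_eqI) (simp add: coeff_map_poly coeff_pderiv)
  show "conj2 (partial_x H) = partial_x (conj2 H)"
    by (rule poly_eqI) (simp add: conj2_def partial_x_def coeff_map_poly pd)
  have of_nat_cnj: "map_poly cnj (of_nat k * a) = of_nat k * map_poly cnj a" for k and a :: "complex poly"
    by (rule poly_eqI) (simp add: coeff_map_poly of_nat_poly)
  show "conj2 (partial_y H) = partial_y (conj2 H)"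
    by (rule poly_eqI) (use of_nat_cnj[of "Suc _"] in \<open>simp add: conj2_def partial_y_def coeff_map_poly coeff_pderiv del: of_nat_Suc\<close>)
qed

lemma conj2_dvd: "H dvd K \<Longrightarrow> conj2 H dvd conj2 K"
  by (auto elim!: dvdE simp: conj2_mult)

lemma conj2_complexify [simp]: "conj2 (complexify G) = complexify G"
  by (rule poly_eqI, rule poly_eqI) (simp add: conj2_def complexify_def coeff_map_poly)

section \<open>Shears of polynomials\<close>

lemma ex_shear: "\<exists>H'. \<forall>x y. eval2 H' (x, y) = eval2 H (x + l * y, y)"
proof (induction H rule: pCons_induct)
  case 0
  show ?case by (rule exI[of _ 0]) simp
next
  case (pCons a H)
  have "\<exists>a'. \<forall>x y. eval2 a' (x, y) = poly a (x + l * y)"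
  proof (induction a rule: pCons_induct)
    case 0
    show ?case by (rule exI[of _ 0]) simp
  next
    case (pCons c a)
    then obtain a' where a': "\<forall>x y. eval2 a' (x, y) = poly a (x + l * y)" by blast
    show ?case
      by (rule exI[of _ "[:[:c:]:] + [:[:0, 1:], [:l:]:] * a'"]) (simp add: a' algebra_simps del: mult_pCons_left)
  qed
  then obtain a' where a': "\<forall>x y. eval2 a' (x, y) = poly a (x + l * y)" by blast
  obtain H' where H': "\<forall>x y. eval2 H' (x, y) = eval2 H (x + l * y, y)" using pCons by blast
  show ?case
    by (rule exI[of _ "a' + [:0, 1:] * H'"]) (simp add: a' H')
qed

text \<open>Specified by its values only; \<open>eval2_eqI\<close> makes it unique and reduces every
  rule for it to a computation with values.\<close>

definition shear :: "complex \<Rightarrow> complex poly poly \<Rightarrow> complex poly poly" where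
  "shear l H = (SOME H'. \<forall>x y. eval2 H' (x, y) = eval2 H (x + l * y, y))"

lemma eval2_shear [simp]: "eval2 (shear l H) (x, y) = eval2 H (x + l * y, y)"
  using someI_ex[OF ex_shear[of H l]] unfolding shear_def by blast

lemma eval2_shear': "eval2 (shear l H) p = eval2 H (fst p + l * snd p, snd p)"
  by (cases p) simp

lemma shear_mult: "shear l (H * K) = shear l H * shear l K"
  by (rule eval2_eqI) simp

lemma shear_shear [simp]: "shear (- l) (shear l H) = H" "shear l (shear (- l) H) = H"
  by (rule eval2_eqI, simp)+

lemma shear_1 [simp]: "shear l 1 = 1"
  by (rule eval2_eqI) simp

lemma shear_dvd: "H dvd K \<Longrightarrow> shear l H dvd shear l K"
  by (auto elim!: dvdE simp: shear_mult)

lemma squarefree_shear: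
  assumes "squarefree H"
  shows "squarefree (shear l H)"
proof (rule squarefreeI)
  fix K assume "K\<^sup>2 dvd shear l H"
  then have "(shear (- l) K)\<^sup>2 dvd H"
    using shear_dvd[of "K\<^sup>2" "shear l H" "- l"] by (simp add: shear_mult power2_eq_square)
  then have "shear (- l) K dvd 1"
    using assms by (meson squarefreeD)
  then show "K dvd 1"
    using shear_dvd[of "shear (- l) K" 1 l] by simp
qed

lemma partial_shear:
  "partial_x (shear l H) = shear l (partial_x H)"
  "partial_y (shear l H) = [:[:l:]:] * shear l (partial_x H) + shear l (partial_y H)"
proof -
  have x: "((\<lambda>x. eval2 H (x + l * y, y)) has_field_derivative eval2 (partial_x H) (x + l * y, y)) (at x)" for x y
  proof -
    have "((\<lambda>x. x + l * y) has_field_derivative 1) (at x)"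
      by (auto intro!: derivative_eq_intros)
    from eval2_chain[OF this DERIV_const, of H y] show ?thesis by simp
  qed
  have y: "((\<lambda>y. eval2 H (x + l * y, y)) has_field_derivative
      eval2 (partial_x H) (x + l * y, y) * l + eval2 (partial_y H) (x + l * y, y)) (at y)" for x y
  proof -
    have "((\<lambda>y. x + l * y) has_field_derivative l) (at y)"
      by (auto intro!: derivative_eq_intros)
    from eval2_chain[OF this DERIV_ident, of H] show ?thesis by simp
  qed
  show "partial_x (shear l H) = shear l (partial_x H)"
    by (rule eval2_eqI) (use DERIV_unique[OF eval2_DERIV_x[of "shear l H"]] x in simp)
  show "partial_y (shear l H) = [:[:l:]:] * shear l (partial_x H) + shear l (partial_y H)"
    by (rule eval2_eqI) (use DERIV_unique[OF eval2_DERIV_y[of "shear l H"]] y in \<open>simp add: mult.commute\<close>)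
qed

lemma partial_xy_commute: "partial_x (partial_y H) = partial_y (partial_x H)"
proof (rule poly_eqI, rule poly_eqI)
  fix i j
  show "coeff (coeff (partial_x (partial_y H)) i) j = coeff (coeff (partial_y (partial_x H)) i) j"
    by (simp add: partial_x_def partial_y_def coeff_map_poly coeff_pderiv pderiv_mult pderiv_of_nat
        of_nat_poly del: of_nat_Suc)
qed

section \<open>Elimination\<close>

lemma poly_eq_prod_proots:
  fixes p :: "complex poly"
  assumes "p \<noteq> 0"
  shows "poly p z = lead_coeff p * (\<Prod>a\<in>#proots p. z - a)"
proof -
  obtain A where A: "p = Polynomial.smult (lead_coeff p) (\<Prod>x\<in>#A. [:- x, 1:])"
    using alg_closed_imp_factorization[OF assms] by blast
  have "proots (\<Prod>x\<in>#A. [:- x, 1:]) = A"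
  proof (induction A)
    case (add x A)
    have "(\<Prod>x\<in>#A. [:- x, 1:]) \<noteq> 0" by (auto simp: prod_mset_zero_iff)
    then have "proots ([:- x, 1:] * (\<Prod>x\<in>#A. [:- x, 1:]))
        = proots [:- x, 1:] + proots (\<Prod>x\<in>#A. [:- x, 1:])"
      by (intro proots_mult) auto
    then show ?case using add by (simp add: proots_linear_factor[of "- x", simplified] del: mult_pCons_left)
  qed simp
  then have "proots p = A"
    using assms by (subst A) simp
  moreover have "poly (\<Prod>x\<in>#A. [:- x, 1:]) z = (\<Prod>a\<in>#A. z - a)"
    by (induction A) (auto simp: algebra_simps)
  ultimately show ?thesis
    by (subst A) simp
qed

text \<open>Up to leading coefficients both products are the product of all differences between a
  root of \<open>F\<close> and a root of \<open>G\<close>; reversing the differences costs the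
  sign.\<close>

lemma prod_proots_swap:
  fixes F G :: "complex poly"
  assumes "F \<noteq> 0" "G \<noteq> 0"
  shows "lead_coeff F ^ degree G * (\<Prod>a\<in>#proots F. poly G a)
    = (- 1) ^ (degree F * degree G) * (lead_coeff G ^ degree F * (\<Prod>b\<in>#proots G. poly F b))"
proof -
  have expand: "(\<Prod>a\<in>#proots F. poly G a)
      = lead_coeff G ^ degree F * (\<Prod>a\<in>#proots F. \<Prod>b\<in>#proots G. a - b)"
    if "F \<noteq> 0" "G \<noteq> 0" for F G :: "complex poly"
    by (simp add: poly_eq_prod_proots[OF that(2)] prod_mset.distrib size_proots_complex)
  have sign: "(\<Prod>b\<in>#B. a - b) = (- 1) ^ size B * (\<Prod>b\<in>#B. b - a)" for a :: complex and B
    by (induction B) (auto simp: algebra_simps)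
  have "(\<Prod>a\<in>#proots F. \<Prod>b\<in>#proots G. a - b)
      = (\<Prod>a\<in>#proots F. (- 1) ^ degree G * (\<Prod>b\<in>#proots G. b - a))"
    by (subst sign) (simp add: size_proots_complex)
  also have "\<dots> = (- 1) ^ (degree F * degree G) * (\<Prod>a\<in>#proots F. \<Prod>b\<in>#proots G. b - a)"
    by (simp add: prod_mset.distrib size_proots_complex power_mult mult.commute flip: power_mult)
  also have "(\<Prod>a\<in>#proots F. \<Prod>b\<in>#proots G. b - a) = (\<Prod>b\<in>#proots G. \<Prod>a\<in>#proots F. b - a)"
    by (rule prod_mset.swap)
  finally show ?thesis
    unfolding expand[OF assms] expand[OF assms(2,1)] by simp
qed

text \<open>Induction along the Euclidean algorithm: passing from \<open>F\<close> to
  \<open>F mod G\<close> changes both sides by the same sign and the same power of the leading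
  coefficient of \<open>G\<close>. The roots of \<open>G\<close> do not see the difference between
  \<open>F\<close> and its remainder, and \<open>prod_proots_swap\<close> moves the product to these
  roots.\<close>

lemma resultant_eq_prod_proots:
  fixes F G :: "complex poly"
  assumes "F \<noteq> 0" "G \<noteq> 0"
  shows "resultant F G = lead_coeff F ^ degree G * (\<Prod>a\<in>#proots F. poly G a)"
  using assms
proof (induction "degree F + degree G" arbitrary: F G rule: less_induct)
  case less
  define \<rho> where "\<rho> F G = lead_coeff F ^ degree G * (\<Prod>a\<in>#proots F. poly G a)" for F G :: "complex poly"
  have main: "resultant F G = \<rho> F G"
    if FG: "F \<noteq> 0" "G \<noteq> 0" "degree F \<ge> degree G" "degree F + degree G = n"
      and IH: "\<And>F' G'. degree F' + degree G' < n \<Longrightarrow> F' \<noteq> 0 \<Longrightarrow> G' \<noteq> 0 \<Longrightarrow> resultant F' G' = \<rho> F' G'"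
    for F G :: "complex poly" and n
  proof (cases "degree G = 0")
    case True
    then obtain c where c: "G = [:c:]" by (metis degree_eq_zeroE)
    show ?thesis by (simp add: \<rho>_def c size_proots_complex)
  next
    case dG: False
    define H where "H = F mod G"
    have eq: "F + (- (F div G)) * G = H"
      unfolding H_def by (simp add: minus_div_mult_eq_mod)
    have val: "poly H b = poly F b" if "b \<in># proots G" for b
    proof -
      have "poly G b = 0" using that FG by auto
      then show ?thesis by (simp flip: eq)
    qed
    have dH: "degree H < degree G \<or> H = 0"
      using degree_mod_less[OF FG(2)] unfolding H_def by blast
    then have dH': "degree H < degree G" using dG by auto
    have swap: "\<rho> F G = (- 1) ^ (degree F * degree G) * (lead_coeff G ^ degree F * (\<Prod>b\<in>#proots G. poly H b))"
    proof -
      have "(\<Prod>b\<in>#proots G. poly H b) = (\<Prod>b\<in>#proots G. poly F b)"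
        by (rule arg_cong[of _ _ prod_mset]) (rule image_mset_cong, rule val)
      then show ?thesis unfolding \<rho>_def prod_proots_swap[OF FG(1,2)] by simp
    qed
    consider "H = 0" | "H \<noteq> 0" "degree H = 0" | "degree H > 0" by blast
    then show ?thesis
    proof cases
      case 1
      then have F: "F = (F div G) * G" using eq by (simp add: algebra_simps)
      have "resultant F G = 0"
        unfolding coeff_subresultant_0_0_resultant[symmetric] subresultant_product[OF F FG(3)]
        using dG by simp
      moreover have "proots G \<noteq> {#}" using dG size_proots_complex[of G] by (metis size_empty)
      ultimately show ?thesis using 1 by (simp add: swap nonempty_has_size)
    next
      \<comment> \<open>For a constant remainder index 0 is its own degree; the subresultant is then
        a multiple of \<open>H\<close> instead of reducing to that of \<open>G\<close> and
        \<open>H\<close>.\<close>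
      case 2
      then obtain h where h: "H = [:h:]" by (metis degree_eq_zeroE)
      have "subresultant 0 F G = Polynomial.smult ((-1) ^ (degree F * degree G) * lead_coeff G ^ degree F
          * lead_coeff H ^ (degree G - 1)) H"
        using BT_lemma_1_13[OF eq FG(3)] dH' 2 by simp
      then have "resultant F G = (-1) ^ (degree F * degree G) * lead_coeff G ^ degree F * (h ^ (degree G - 1) * h)"
        unfolding coeff_subresultant_0_0_resultant[symmetric] by (simp add: h)
      also have "h ^ (degree G - 1) * h = h ^ degree G"
        using dG by (simp flip: power_Suc2)
      finally show ?thesis by (simp add: swap h size_proots_complex)
    next
      case 3
      have "subresultant 0 F G = Polynomial.smult ((-1) ^ (degree F * degree G) * lead_coeff G ^ (degree F - degree H))
          (subresultant 0 G H)"
        using BT_lemma_1_12[OF eq FG(3), of 0] dH' 3 by simp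
      then have "resultant F G = (-1) ^ (degree F * degree G) * lead_coeff G ^ (degree F - degree H) * resultant G H"
        unfolding coeff_subresultant_0_0_resultant[symmetric] by simp
      also have "resultant G H = \<rho> G H"
        using 3 dH' FG by (intro IH) auto
      also have "(-1) ^ (degree F * degree G) * lead_coeff G ^ (degree F - degree H) * \<rho> G H = \<rho> F G"
        using dH' FG(3) unfolding swap unfolding \<rho>_def by (simp flip: mult.assoc power_add)
      finally show ?thesis .
    qed
  qed
  show ?case
  proof (cases "degree F \<ge> degree G")
    case True
    then show ?thesis
      using main[OF less(2,3) True refl] less(1) unfolding \<rho>_def by blast
  next
    case False
    have "resultant G F = \<rho> G F"
      using main[OF less(3,2) _ refl] less(1) False unfolding \<rho>_def by (simp add: add.commute)
    then show ?thesis
      using prod_proots_swap[OF less(2,3)] unfolding resultant_swap[of F G] \<rho>_def by simp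
  qed
qed

text \<open>Adding a multiple of \<open>P\<close> to \<open>H\<close> makes the degree of the second argument of the resultant
  stable under evaluation, without changing the values at the roots of \<open>P\<close>.\<close>

definition norm_poly :: "'a::idom poly \<Rightarrow> 'a poly \<Rightarrow> 'a" where
  "norm_poly P H = resultant P (H + monom 1 (Suc (degree H)) * P)"

text \<open>Stated for an arbitrary homomorphism because it serves two: evaluation at
  \<open>x\<close>, for products over the roots of \<open>G_y\<close>, and evaluation at
  \<open>(x, y)\<close>, for the equation of a parametrized curve.\<close>

lemma norm_poly_eval:
  fixes P H :: "'a::idom poly" and e :: "'a \<Rightarrow> complex"
  assumes "comm_ring_hom e" "e (lead_coeff P) \<noteq> 0"
  shows "e (norm_poly P H) = e (lead_coeff P) ^ (degree P + Suc (degree H))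
    * (\<Prod>z\<in>#proots (map_poly e P). poly (map_poly e H) z)"
proof -
  interpret comm_ring_hom e by fact
  interpret mp: map_poly_comm_ring_hom e ..
  have P0: "P \<noteq> 0" using assms by auto
  define K where "K = H + monom 1 (Suc (degree H)) * P"
  have dm: "degree (monom (1::'a) (Suc (degree H)) * P) = degree P + Suc (degree H)"
    using P0 by (simp add: degree_mult_eq degree_monom_eq add.commute)
  have dK: "degree K = degree P + Suc (degree H)"
    unfolding K_def using dm by (subst degree_add_eq_right) auto
  have lcK: "coeff K (degree P + Suc (degree H)) = lead_coeff P"
    unfolding K_def by (simp add: coeff_eq_0 coeff_monom_mult)
  have degree_map: "degree (map_poly e Q) = degree Q" if "e (lead_coeff Q) \<noteq> 0" for Q
    using that by (intro antisym degree_map_poly_le le_degree) simp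
  have dP': "degree (map_poly e P) = degree P"
    using assms(2) by (rule degree_map)
  have dK': "degree (map_poly e K) = degree K"
    using assms(2) lcK dK by (intro degree_map) simp
  have P'0: "map_poly e P \<noteq> 0" using assms(2) by (metis coeff_0 coeff_map_poly hom_zero)
  have K'0: "map_poly e K \<noteq> 0" using assms(2) lcK by (metis coeff_0 coeff_map_poly hom_zero)
  have "e (norm_poly P H) = resultant (map_poly e P) (map_poly e K)"
    unfolding norm_poly_def K_def[symmetric] by (rule resultant_map_poly[OF dP' dK', symmetric])
  also have "\<dots> = e (lead_coeff P) ^ degree K * (\<Prod>z\<in>#proots (map_poly e P). poly (map_poly e K) z)"
    by (simp add: resultant_eq_prod_proots[OF P'0 K'0] dP' dK')
  also have "(\<Prod>z\<in>#proots (map_poly e P). poly (map_poly e K) z)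
      = (\<Prod>z\<in>#proots (map_poly e P). poly (map_poly e H) z)"
    by (rule arg_cong[of _ _ prod_mset], rule image_mset_cong)
      (use P'0 in \<open>auto simp: K_def hom_distribs\<close>)
  finally show ?thesis by (simp add: dK)
qed

lemma comm_ring_hom_poly: "comm_ring_hom (\<lambda>a. poly a x)" for x :: "'a::comm_ring_1"
  by unfold_locales auto

lemma comm_ring_hom_eval2: "comm_ring_hom (\<lambda>H. eval2 H p)" for p :: "complex \<times> complex"
  by unfold_locales auto

lemma norm_poly_fibre:
  fixes P H :: "complex poly poly"
  assumes "lead_coeff P = [:c:]" "c \<noteq> 0"
  shows "poly (norm_poly P H) x = c ^ (degree P + Suc (degree H))
    * (\<Prod>y\<in>#proots (fibre_poly P x). eval2 H (x, y))"
  using norm_poly_eval[OF comm_ring_hom_poly, of P x H] assms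
  by (simp flip: fibre_poly_def)

section \<open>Bezout identities and zero sets\<close>

lemma is_unit_poly2: "H dvd 1 \<Longrightarrow> \<exists>c. c \<noteq> 0 \<and> H = [:[:c:]:]" for H :: "complex poly poly"
  by (auto simp: is_unit_poly_iff elim!: degree_eq_zeroE)

lemma prime_elem_dvd_const:
  fixes q H :: "complex poly poly"
  assumes "prime_elem q" "degree q > 0" "q dvd [:a:] * H" "a \<noteq> 0"
  shows "q dvd H"
proof -
  have "\<not> q dvd [:a:]"
    using assms(2,4) by (metis degree_pCons_0 dvd_imp_degree_le leD pCons_eq_0_iff)
  then show ?thesis using assms(1,3) prime_elem_dvd_mult_iff by blast
qed

lemma ex_prime_factor_positive_degree:
  fixes H :: "complex poly poly"
  assumes "degree H > 0"
  shows "\<exists>q. prime q \<and> degree q > 0 \<and> q dvd H"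
proof (rule ccontr)
  assume *: "\<not> ?thesis"
  have H0: "H \<noteq> 0" using assms by auto
  have "degree (prod_mset A) = 0" if "\<And>q. q \<in># A \<Longrightarrow> degree q = 0" for A :: "complex poly poly multiset"
    using that
  proof (induction A)
    case (add q A)
    then have "degree q = 0" "degree (prod_mset A) = 0" by auto
    then show ?case using degree_mult_le[of q "prod_mset A"] by simp
  qed auto
  moreover have "degree q = 0" if "q \<in># prime_factorization H" for q
    using that * by (auto dest: in_prime_factors_imp_prime in_prime_factors_imp_dvd)
  ultimately have "degree (prod_mset (prime_factorization H)) = 0" by blast
  moreover have n: "normalize (prod_mset (prime_factorization H)) = normalize H"
    using H0 by (rule prod_mset_prime_factorization_weak)
  then have "H dvd prod_mset (prime_factorization H)" "prod_mset (prime_factorization H) \<noteq> 0"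
    using associatedD1[OF n[symmetric]] H0 by auto
  ultimately show False using assms dvd_imp_degree_le[of H] by (metis not_gr_zero le_zero_eq)
qed

text \<open>An element of least degree in \<open>y\<close> in the ideal of \<open>P\<close> and
  \<open>H\<close> divides every other one after multiplication by a polynomial in \<open>x\<close>,
  by pseudo-division. Positive degree would therefore give a common prime factor, so the least
  element depends on \<open>x\<close> only.\<close>

lemma bezout_over_x:
  fixes P H :: "complex poly poly"
  assumes "P \<noteq> 0" and "\<And>q. prime q \<Longrightarrow> degree q > 0 \<Longrightarrow> q dvd P \<Longrightarrow> q dvd H \<Longrightarrow> False"
  shows "\<exists>U V D. D \<noteq> 0 \<and> U * P + V * H = [:D:]"
proof -
  define I where "I = {K. \<exists>U V. K = U * P + V * H}"
  have I_P: "P \<in> I" unfolding I_def by (auto intro: exI[of _ 1] exI[of _ 0])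
  have I_H: "H \<in> I" unfolding I_def
    by (rule CollectI, rule exI[of _ 0], rule exI[of _ 1]) simp
  obtain E where E: "E \<in> I" "E \<noteq> 0" "\<And>K. K \<in> I \<Longrightarrow> K \<noteq> 0 \<Longrightarrow> degree E \<le> degree K"
  proof -
    have "\<exists>E. (E \<in> I \<and> E \<noteq> 0) \<and> (\<forall>K. K \<in> I \<and> K \<noteq> 0 \<longrightarrow> degree E \<le> degree K)"
      using I_P assms(1) by (intro ex_has_least_nat[of "\<lambda>K. K \<in> I \<and> K \<noteq> 0" P degree]) auto
    then show ?thesis using that by blast
  qed
  have multiple: "\<exists>a q. a \<noteq> 0 \<and> [:a:] * K = E * q" if K: "K \<in> I" for K
  proof -
    obtain a q where aq: "a \<noteq> 0" "Polynomial.smult a K = E * q + pseudo_mod K E"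
      using pseudo_mod(1)[OF E(2)] by blast
    obtain U V where UV: "K = U * P + V * H" using K unfolding I_def by blast
    obtain U' V' where UV': "E = U' * P + V' * H" using E(1) unfolding I_def by blast
    define A where "A = [:a:]"
    have "pseudo_mod K E = A * K - E * q" using aq(2) by (simp add: algebra_simps A_def)
    also have "\<dots> = (A * U - U' * q) * P + (A * V - V' * q) * H"
      unfolding UV UV' by (simp add: algebra_simps)
    finally have "pseudo_mod K E \<in> I" unfolding I_def by blast
    then have "pseudo_mod K E = 0"
      using pseudo_mod(2)[OF E(2), of K] E(3) by fastforce
    then show ?thesis using aq by auto
  qed
  have "degree E = 0"
  proof (rule ccontr)
    assume "degree E \<noteq> 0"
    then obtain q where q: "prime q" "degree q > 0" "q dvd E"
      using ex_prime_factor_positive_degree by blast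
    have "q dvd K" if "K \<in> I" for K
      using multiple[OF that] prime_elem_dvd_const[of q] q
      by (metis dvd_mult2 prime_def)
    then show False using assms(2) q I_P I_H by blast
  qed
  then obtain D where D: "E = [:D:]" by (metis degree_eq_zeroE)
  obtain U V where UV: "E = U * P + V * H" using E(1) unfolding I_def by blast
  have "D \<noteq> 0" using E(2) D by simp
  then show ?thesis using UV unfolding D by (metis (no_types))
qed

text \<open>The Bezout identity confines the abscissas to the roots of \<open>D\<close>; the
  constant leading coefficient excludes vertical components, so that each vertical line contributes
  finitely many points.\<close>

lemma finite_common_zeros:
  fixes P H :: "complex poly poly"
  assumes "lead_coeff P = [:c:]" "c \<noteq> 0"
    and "\<And>q. prime q \<Longrightarrow> degree q > 0 \<Longrightarrow> q dvd P \<Longrightarrow> q dvd H \<Longrightarrow> False"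
  shows "finite {p. eval2 P p = 0 \<and> eval2 H p = 0}"
proof -
  have "P \<noteq> 0" using assms by auto
  then obtain U V D where D: "D \<noteq> 0" "U * P + V * H = [:D:]"
    using bezout_over_x[of P H] assms(3) by metis
  have "poly D (fst p) = 0" if "eval2 P p = 0" "eval2 H p = 0" for p
    using arg_cong[OF D(2), of "\<lambda>K. eval2 K p"] that by simp
  then have "{p. eval2 P p = 0 \<and> eval2 H p = 0}
      \<subseteq> (\<Union>x\<in>{x. poly D x = 0}. {p. eval2 P p = 0 \<and> fst p = x})"
    by auto
  moreover have "finite \<dots>"
    using D(1) assms by (intro finite_UN_I poly_roots_finite finite_zeros_above fibre_poly_nonzero) auto
  ultimately show ?thesis by (rule finite_subset)
qed

lemma infinite_zeros:
  fixes P :: "complex poly poly"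
  assumes "degree P > 0"
  shows "infinite {p. eval2 P p = 0}"
proof
  assume fin: "finite {p. eval2 P p = 0}"
  have lc: "lead_coeff P \<noteq> 0" using assms by auto
  have "x \<in> fst ` {p. eval2 P p = 0}" if "poly (lead_coeff P) x \<noteq> 0" for x
  proof -
    have "degree (fibre_poly P x) > 0" using degree_fibre_poly[OF that] assms by simp
    then obtain y where "poly (fibre_poly P x) y = 0"
      using alg_closed_imp_poly_has_root by blast
    then show ?thesis by force
  qed
  then have "UNIV \<subseteq> {x. poly (lead_coeff P) x = 0} \<union> fst ` {p. eval2 P p = 0}" by blast
  moreover have "finite \<dots>" using fin lc by (simp add: poly_roots_finite)
  ultimately show False using infinite_UNIV_char_0 finite_subset by blast
qed

lemma dvd_const_lead_coeff:
  fixes F q :: "complex poly poly"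
  assumes "lead_coeff F = [:c:]" "c \<noteq> 0" "q dvd F"
  shows "\<exists>c'. c' \<noteq> 0 \<and> lead_coeff q = [:c':]"
proof -
  obtain K where K: "F = q * K" using assms(3) by (elim dvdE)
  have "lead_coeff q dvd [:c:]" using assms(1) unfolding K by (metis lead_coeff_mult dvd_triv_left)
  then have "degree (lead_coeff q) = 0" using assms(2)
    by (metis degree_pCons_0 dvd_imp_degree_le le_zero_eq pCons_eq_0_iff)
  then obtain c' where "lead_coeff q = [:c':]" by (metis degree_eq_zeroE)
  moreover have "lead_coeff q \<noteq> 0" using K assms by auto
  ultimately show ?thesis by auto
qed

text \<open>A substitute for the Nullstellensatz on an irreducible curve. Some prime factor
  \<open>p0\<close> of \<open>F\<close> vanishes on all of \<open>S\<close>, and \<open>p0\<close>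
  divides whatever has infinitely many zeros on \<open>S\<close>. Hence every prime factor of
  \<open>F\<close> is \<open>p0\<close>, and squarefreeness leaves it exactly once in
  \<open>G\<close>.\<close>

lemma irreducible_locus_equation:
  fixes F G :: "complex poly poly"
  assumes F: "lead_coeff F = [:c:]" "c \<noteq> 0" "degree F > 0" "zero_locus F = S"
    and G: "squarefree G" "zero_locus G = S"
    and irr: "\<And>H K. (\<And>p. p \<in> S \<Longrightarrow> eval2 H p * eval2 K p = 0) \<Longrightarrow>
      (\<forall>p\<in>S. eval2 H p = 0) \<or> (\<forall>p\<in>S. eval2 K p = 0)"
  shows "prime_elem G \<and> (\<exists>d c'. d > 0 \<and> c' \<noteq> 0 \<and> F = [:[:c':]:] * G ^ d)"
proof -
  have F0: "F \<noteq> 0" using F by auto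
  have S: "p \<in> S \<longleftrightarrow> eval2 F p = 0" "p \<in> S \<longleftrightarrow> eval2 G p = 0" for p
    using F(4) G(2) by (auto simp: zero_locus_def)
  have "S = {p. eval2 F p = 0}" using S(1) by blast
  then have infS: "infinite S" using infinite_zeros[OF F(3)] by simp
  then have S_ne: "S \<noteq> {}" by auto
  have some_factor: "\<exists>q\<in>#A. \<forall>p\<in>S. eval2 q p = 0" if "\<forall>p\<in>S. eval2 (prod_mset A) p = 0" for A
    using that
  proof (induction A)
    case empty
    then show ?case using S_ne by auto
  next
    case (add q A)
    then show ?case using irr[of q "prod_mset A"] by auto
  qed
  have n: "normalize (prod_mset (prime_factorization F)) = normalize F"
    using F0 by (rule prod_mset_prime_factorization_weak)
  have "\<forall>p\<in>S. eval2 (prod_mset (prime_factorization F)) p = 0"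
    using S(1) eval2_dvd[OF associatedD1[OF n[symmetric]]] by blast
  then obtain p0 where p0: "p0 \<in># prime_factorization F" "\<And>p. p \<in> S \<Longrightarrow> eval2 p0 p = 0"
    using some_factor by meson
  then have p0': "prime p0" "p0 dvd F" by auto
  have Sp0: "p \<in> S \<longleftrightarrow> eval2 p0 p = 0" for p
    using p0(2) S(1) eval2_dvd[OF p0'(2)] by blast
  obtain c0 where c0: "c0 \<noteq> 0" "lead_coeff p0 = [:c0:]"
    using dvd_const_lead_coeff[OF F(1,2) p0'(2)] by blast
  have dvd_of_zeros: "p0 dvd H" if inf: "infinite (S \<inter> {p. eval2 H p = 0})" for H
  proof (rule ccontr)
    assume nd: "\<not> p0 dvd H"
    have "finite {p. eval2 p0 p = 0 \<and> eval2 H p = 0}"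
    proof (rule finite_common_zeros[OF c0(2,1)])
      fix q assume "prime q" "q dvd p0" "q dvd H"
      then show False using p0'(1) nd primes_dvd_imp_eq by blast
    qed
    moreover have "S \<inter> {p. eval2 H p = 0} = {p. eval2 p0 p = 0 \<and> eval2 H p = 0}"
      using Sp0 by auto
    ultimately show False using inf by simp
  qed
  have "q = p0" if "q \<in># prime_factorization F" for q
  proof -
    have q: "prime q" "q dvd F" using that by auto
    obtain c1 where c1: "c1 \<noteq> 0" "lead_coeff q = [:c1:]"
      using dvd_const_lead_coeff[OF F(1,2) q(2)] by blast
    have "degree q > 0"
    proof (rule ccontr)
      assume "\<not> degree q > 0"
      then have "q = [:lead_coeff q:]" by (metis degree_eq_zeroE lead_coeff_pCons(2) neq0_conv)
      then have "q dvd 1" using c1 by (simp add: is_unit_poly_iff)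
      then show False using q(1) not_prime_unit by blast
    qed
    then have "infinite {p. eval2 q p = 0}" by (rule infinite_zeros)
    moreover have "{p. eval2 q p = 0} = S \<inter> {p. eval2 q p = 0}"
      using eval2_dvd[OF q(2)] S(1) by auto
    ultimately have "p0 dvd q" using dvd_of_zeros by simp
    then show ?thesis using primes_dvd_imp_eq[OF p0'(1) q(1)] by simp
  qed
  then have rep: "prime_factorization F = replicate_mset (size (prime_factorization F)) p0"
    by (intro set_mset_subset_singletonD) blast
  define d where "d = size (prime_factorization F)"
  have d: "d > 0" using p0(1) unfolding d_def by (cases "prime_factorization F") auto
  have "normalize F = normalize (p0 ^ d)"
    using n unfolding d_def by (subst (asm) rep) simp
  then obtain w where w: "w dvd 1" "F = w * p0 ^ d"
    by (metis associatedE1)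
  have "p0 dvd G"
    using infS S(2) by (intro dvd_of_zeros) (simp add: Int_absorb2 subset_eq)
  then obtain H where H: "G = p0 * H" by (elim dvdE)
  have G0: "G \<noteq> 0" using G(1) by auto
  \<comment> \<open>A prime factor of the cofactor could be a polynomial in \<open>x\<close>, but
    then \<open>S\<close> contains a vertical line although \<open>p0\<close> has a constant leading
    coefficient. Otherwise it has infinitely many zeros on \<open>S\<close>, and \<open>p0\<close>
    divides \<open>G\<close> twice.\<close>
  have "H dvd 1"
  proof (rule ccontr)
    assume "\<not> H dvd 1"
    moreover have "H \<noteq> 0" using G0 H by auto
    ultimately obtain q where q: "prime q" "q dvd H" by (meson prime_divisorE)
    have qS: "p \<in> S" if "eval2 q p = 0" for p
      using that eval2_dvd[OF q(2)] S(2) unfolding H by simp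
    show False
    proof (cases "degree q = 0")
      case True
      then obtain u where u: "q = [:u:]" by (metis degree_eq_zeroE)
      then have "\<not> u dvd 1" using q(1) not_prime_unit[of q] by (auto simp: is_unit_poly_iff)
      moreover have "u \<noteq> 0" using u q by auto
      ultimately have "degree u \<noteq> 0" by (simp add: is_unit_iff_degree)
      then obtain x where x: "poly u x = 0"
        using alg_closed_imp_poly_has_root[of u] by blast
      then have "range (Pair x) \<subseteq> {p. eval2 p0 p = 0 \<and> fst p = x}"
        using qS Sp0 u by auto
      moreover have "finite {p. eval2 p0 p = 0 \<and> fst p = x}"
        using c0 by (intro finite_zeros_above fibre_poly_nonzero) simp
      moreover have "infinite (range (Pair x :: complex \<Rightarrow> _))"
        using finite_imageD[of "Pair x" "UNIV :: complex set"] infinite_UNIV_char_0 by (auto simp: inj_on_def)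
      ultimately show False using finite_subset by blast
    next
      case False
      then have "infinite {p. eval2 q p = 0}" by (intro infinite_zeros) simp
      moreover have "{p. eval2 q p = 0} = S \<inter> {p. eval2 q p = 0}" using qS by auto
      ultimately have "p0 dvd q" using dvd_of_zeros by simp
      then have "p0\<^sup>2 dvd G" using q(2) unfolding H power2_eq_square by (meson dvd_trans mult_dvd_mono dvd_refl)
      then show False using squarefreeD[OF G(1)] p0'(1) not_prime_unit by blast
    qed
  qed
  then obtain b where b: "b \<noteq> 0" "H = [:[:b:]:]" using is_unit_poly2 by blast
  obtain a where a: "a \<noteq> 0" "w = [:[:a:]:]" using is_unit_poly2 w(1) by blast
  have "F = [:[:a / b ^ d:]:] * G ^ d"
    by (rule eval2_eqI) (use b a in \<open>simp add: w(2) H power_mult_distrib del: mult_pCons_left\<close>)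
  moreover have "a / b ^ d \<noteq> 0" using a b by simp
  moreover have "prime_elem G" unfolding H using p0'(1) \<open>H dvd 1\<close>
    by (metis mult.commute prime_def prime_elem_mult_unit_left)
  ultimately show ?thesis using d by blast
qed

section \<open>Hyperbolic nodes\<close>

text \<open>The Hessian is a nonzero quadratic form with two independent real null directions, the
  tangents of the two branches. After this section nodes are used in this form only.\<close>

definition real_tangent_pair :: "complex poly poly \<Rightarrow> complex \<times> complex \<Rightarrow> bool" where
  "real_tangent_pair H p \<longleftrightarrow> real_point p \<and>
    (let a = eval2 (partial_x (partial_x H)) p; b = eval2 (partial_y (partial_x H)) p;
         c = eval2 (partial_y (partial_y H)) p;
         q = (\<lambda>v w :: real. a * of_real v ^ 2 + 2 * b * of_real v * of_real w + c * of_real w ^ 2)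
     in (a \<noteq> 0 \<or> b \<noteq> 0 \<or> c \<noteq> 0) \<and>
        (\<exists>v1 v2 w1 w2. v1 * w2 \<noteq> v2 * w1 \<and> q v1 v2 = 0 \<and> q w1 w2 = 0))"

lemma eval2_2 [simp]: "eval2 2 p = 2"
  by (metis eval2_simps(2,3) one_add_one)

text \<open>A Taylor expansion of order two whose coefficients are polynomials. It holds exactly, so
  along a branch it can be divided by powers of \<open>x - x0\<close> before passing to the
  limit.\<close>

lemma second_order_decomposition:
  assumes "p \<in> singular_points H" "p = (x0, y0)"
  obtains A B C where
    "H = [:[:- x0, 1:]:] * [:[:- x0, 1:]:] * A + [:[:- x0, 1:]:] * [:[:- y0:], 1:] * B
      + [:[:- y0:], 1:] * [:[:- y0:], 1:] * C"
    "eval2 (partial_x (partial_x H)) p = 2 * eval2 A p"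
    "eval2 (partial_y (partial_x H)) p = eval2 B p"
    "eval2 (partial_y (partial_y H)) p = 2 * eval2 C p"
proof -
  let ?X = "[:[:- x0, 1:]:]" and ?Y = "[:[:- y0:], 1:]"
  have sing: "eval2 H (x0, y0) = 0" "eval2 (partial_x H) (x0, y0) = 0" "eval2 (partial_y H) (x0, y0) = 0"
    using assms by (auto simp: singular_points_def zero_locus_def critical_points_def)
  obtain H1 H2 where H: "H = ?X * H1 + ?Y * H2"
    using zero_at_point_decomposition[OF sing(1)] by blast
  have "eval2 H1 (x0, y0) = 0" "eval2 H2 (x0, y0) = 0"
    using sing(2,3) unfolding H partial_add partial_mult partial_linear by simp_all
  then obtain A B1 B2 C where AC: "H1 = ?X * A + ?Y * B1" "H2 = ?X * B2 + ?Y * C"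
    using zero_at_point_decomposition by metis
  define X where "X = ?X"
  define Y where "Y = ?Y"
  have H': "H = X * X * A + X * Y * (B1 + B2) + Y * Y * C"
    unfolding H AC X_def[symmetric] Y_def[symmetric] by (simp add: algebra_simps)
  have p: "partial_x X = 1" "partial_y X = 0" "partial_x Y = 0" "partial_y Y = 1"
    "eval2 X p = 0" "eval2 Y p = 0"
    unfolding X_def Y_def by (rule partial_linear | simp add: assms)+
  have "eval2 (partial_x (partial_x H)) p = 2 * eval2 A p"
    "eval2 (partial_y (partial_x H)) p = eval2 (B1 + B2) p"
    "eval2 (partial_y (partial_y H)) p = 2 * eval2 C p"
    unfolding H' by (simp_all add: partial_add partial_mult p)
  then show thesis using that H' unfolding X_def Y_def by blast
qed

section \<open>Germs in the ring of formal power series\<close>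

definition translate :: "complex poly poly \<Rightarrow> complex \<times> complex \<Rightarrow> complex poly poly" where
  "translate H p = pcompose (map_poly (\<lambda>c. pcompose c [:fst p, 1:]) H) [:[:snd p:], 1:]"

lemma eval2_translate: "eval2 (translate H p) (x, y) = eval2 H (fst p + x, snd p + y)"
proof -
  have "eval2 (pcompose K [:[:b:], 1:]) (x, y) = eval2 K (x, b + y)" for K :: "complex poly poly" and b
    by (induction K rule: pCons_induct) (auto simp: pcompose_pCons algebra_simps)
  moreover have "eval2 (map_poly (\<lambda>c. pcompose c [:a, 1:]) K) (x, y) = eval2 K (a + x, y)"
    for K :: "complex poly poly" and a y
  proof (induction K rule: pCons_induct)
    case (pCons c K)
    have "map_poly (\<lambda>c. pcompose c [:a, 1:]) (pCons c K)
        = pCons (pcompose c [:a, 1:]) (map_poly (\<lambda>c. pcompose c [:a, 1:]) K)"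
      by (rule poly_eqI) (simp add: coeff_map_poly coeff_pCons split: nat.splits)
    then show ?case using pCons by (simp add: poly_pcompose)
  qed simp
  ultimately show ?thesis unfolding translate_def by simp
qed

definition series2 :: "complex poly poly \<Rightarrow> complex fps fps" where
  "series2 K = fps_of_poly (map_poly fps_of_poly K)"

lemma coeff_xy_series2: "coeff_xy (series2 K) i j = coeff (coeff K j) i"
  by (simp add: series2_def coeff_xy_def coeff_map_poly)

lemma coeff_xy_eqI: "(\<And>i j. coeff_xy f i j = coeff_xy g i j) \<Longrightarrow> f = g"
  unfolding coeff_xy_def by (intro fps_ext) simp

lemma coeff_xy_add: "coeff_xy (f + g) i j = coeff_xy f i j + coeff_xy g i j"
  by (simp add: coeff_xy_def)

lemma coeff_xy_mult:
  "coeff_xy (f * g) i j = (\<Sum>l=0..j. \<Sum>k=0..i. coeff_xy f k l * coeff_xy g (i - k) (j - l))"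
  unfolding coeff_xy_def by (simp add: fps_mult_nth fps_sum_nth)

lemma series2_add: "series2 (K + L) = series2 K + series2 L"
  by (rule coeff_xy_eqI) (simp add: coeff_xy_series2 coeff_xy_add)

lemma series2_mult: "series2 (K * L) = series2 K * series2 L"
  by (rule coeff_xy_eqI) (simp add: coeff_xy_series2 coeff_xy_mult coeff_mult coeff_sum atMost_atLeast0)

lemma germ_at_eq: "germ_at H p = series2 (translate H p)"
  by (simp add: germ_at_def series2_def translate_def)

lemma germ_at_add: "germ_at (H + K) p = germ_at H p + germ_at K p"
proof -
  have "translate (H + K) p = translate H p + translate K p"
    by (rule eval2_eqI) (simp add: eval2_translate)
  then show ?thesis by (simp add: germ_at_eq series2_add)
qed

lemma germ_at_mult: "germ_at (H * K) p = germ_at H p * germ_at K p"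
proof -
  have "translate (H * K) p = translate H p * translate K p"
    by (rule eval2_eqI) (simp add: eval2_translate)
  then show ?thesis by (simp add: germ_at_eq series2_mult)
qed

abbreviation (input) series_x :: "complex fps fps" where "series_x \<equiv> fps_const fps_X"
abbreviation (input) series_y :: "complex fps fps" where "series_y \<equiv> fps_X"

lemma coeff_series_x: "coeff_xy series_x i j = (if i = 1 \<and> j = 0 then 1 else 0)"
  by (auto simp: coeff_xy_def fps_X_def)

lemma coeff_series_y: "coeff_xy series_y i j = (if i = 0 \<and> j = 1 then 1 else 0)"
  by (auto simp: coeff_xy_def fps_X_def)

lemma germ_at_linear:
  "germ_at [:[:- x0, 1:]:] (x0, y0) = series_x"
  "germ_at [:[:- y0:], 1:] (x0, y0) = series_y"
proof -
  have "translate [:[:- x0, 1:]:] (x0, y0) = [:[:0, 1:]:]" "translate [:[:- y0:], 1:] (x0, y0) = [:0, 1:]"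
    by (rule eval2_eqI, simp add: eval2_translate)+
  then show "germ_at [:[:- x0, 1:]:] (x0, y0) = series_x" "germ_at [:[:- y0:], 1:] (x0, y0) = series_y"
    by (auto intro!: coeff_xy_eqI simp: germ_at_eq coeff_xy_series2 coeff_series_x coeff_series_y
        coeff_pCons split: nat.splits)
qed

lemma coeff_germ_at_00: "coeff_xy (germ_at H p) 0 0 = eval2 H p"
proof -
  have "coeff_xy (germ_at H p) 0 0 = eval2 (translate H p) (0, 0)"
    by (simp add: germ_at_eq coeff_xy_series2 eval2_def poly_0_coeff_0)
  then show ?thesis by (simp add: eval2_translate)
qed

lemma germ_at_eq_0: "germ_at H p = 0 \<Longrightarrow> H = 0"
proof -
  assume "germ_at H p = 0"
  then have "coeff (coeff (translate H p) j) i = 0" for i j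
    using coeff_xy_series2[of "translate H p" i j] by (simp add: germ_at_eq coeff_xy_def)
  then have "translate H p = 0" by (intro poly_eqI) simp
  then have "eval2 H (x, y) = 0" for x y
    using eval2_translate[of H p "x - fst p" "y - snd p"] by simp
  then show "H = 0" by (intro eval2_eqI) simp
qed

lemma germ_at_partial_y: "germ_at (partial_y H) p = fps_deriv (germ_at H p)"
proof -
  have "translate (partial_y H) p = partial_y (translate H p)"
  proof (rule eval2_eqI)
    fix x y
    have "((\<lambda>y. eval2 H (fst p + x, snd p + y)) has_field_derivative
        eval2 (partial_y H) (fst p + x, snd p + y)) (at y)"
    proof -
      have "((\<lambda>y. snd p + y) has_field_derivative 1) (at y)"
        by (auto intro!: derivative_eq_intros)
      from eval2_chain[OF DERIV_const this, of H] show ?thesis by simp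
    qed
    with eval2_DERIV_y[of "translate H p" x y UNIV]
    show "eval2 (translate (partial_y H) p) (x, y) = eval2 (partial_y (translate H p)) (x, y)"
      by (simp add: eval2_translate DERIV_unique)
  qed
  moreover have "series2 (partial_y K) = fps_deriv (series2 K)" for K
    by (rule fps_ext) (simp add: series2_def partial_y_def coeff_map_poly coeff_pderiv fps_of_poly_mult
        fps_eq_iff of_nat_poly flip: fps_of_nat del: of_nat_Suc)
  ultimately show ?thesis by (simp add: germ_at_eq)
qed

lemma unit_series_iff: "f dvd 1 \<longleftrightarrow> coeff_xy f 0 0 \<noteq> 0"
proof
  assume "f dvd 1"
  then obtain g where "1 = f * g" by (elim dvdE)
  moreover have "coeff_xy (f * g) 0 0 = coeff_xy f 0 0 * coeff_xy g 0 0" by (simp add: coeff_xy_mult)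
  ultimately have "coeff_xy 1 0 0 = coeff_xy f 0 0 * coeff_xy g 0 0" by simp
  then show "coeff_xy f 0 0 \<noteq> 0" by (auto simp: coeff_xy_def)
next
  assume "coeff_xy f 0 0 \<noteq> 0"
  then have "inverse (fps_nth f 0) * fps_nth f 0 = 1"
    by (simp add: coeff_xy_def inverse_mult_eq_1)
  then have "fps_left_inverse f (inverse (fps_nth f 0)) * f = 1" by (rule fps_left_inverse)
  then show "f dvd 1" by (metis dvd_triv_right)
qed

lemma coeff_xy_mult_low:
  "coeff_xy (f * g) 0 0 = coeff_xy f 0 0 * coeff_xy g 0 0"
  "coeff_xy (f * g) 1 0 = coeff_xy f 0 0 * coeff_xy g 1 0 + coeff_xy f 1 0 * coeff_xy g 0 0"
  "coeff_xy (f * g) 0 1 = coeff_xy f 0 0 * coeff_xy g 0 1 + coeff_xy f 0 1 * coeff_xy g 0 0"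
  "coeff_xy (f * g) 2 0 = coeff_xy f 0 0 * coeff_xy g 2 0 + coeff_xy f 1 0 * coeff_xy g 1 0
    + coeff_xy f 2 0 * coeff_xy g 0 0"
  "coeff_xy (f * g) 1 1 = coeff_xy f 0 0 * coeff_xy g 1 1 + coeff_xy f 1 0 * coeff_xy g 0 1
    + coeff_xy f 0 1 * coeff_xy g 1 0 + coeff_xy f 1 1 * coeff_xy g 0 0"
  "coeff_xy (f * g) 0 2 = coeff_xy f 0 0 * coeff_xy g 0 2 + coeff_xy f 0 1 * coeff_xy g 0 1
    + coeff_xy f 0 2 * coeff_xy g 0 0"
  by (simp_all add: coeff_xy_mult numeral_2_eq_2)

text \<open>Induction on the total degree of a nonzero coefficient. In a product of non-units such a
  coefficient comes from one in each factor; that of the second factor is not its constant term,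
  which vanishes, so that of the first has smaller degree.\<close>

lemma ex_irreducible_factor_series:
  assumes "f \<noteq> 0" "\<not> f dvd 1"
  shows "\<exists>h :: complex fps fps. irreducible h \<and> h dvd f"
proof -
  have "\<exists>i j. coeff_xy f i j \<noteq> 0"
    using assms(1) coeff_xy_eqI[of f 0] by (auto simp: coeff_xy_def)
  then obtain i j where "coeff_xy f i j \<noteq> 0" by blast
  then show ?thesis using assms(2)
  proof (induction "i + j" arbitrary: f i j rule: less_induct)
    case less
    show ?case
    proof (cases "irreducible f")
      case False
      have "f \<noteq> 0" using less(2) by (auto simp: coeff_xy_def)
      then obtain a b where ab: "f = a * b" "\<not> a dvd 1" "\<not> b dvd 1"
        using False less(3) unfolding irreducible_def by blast
      have "\<exists>k l. k \<le> i \<and> l \<le> j \<and> coeff_xy a k l * coeff_xy b (i - k) (j - l) \<noteq> 0"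
      proof (rule ccontr)
        assume "\<not> ?thesis"
        then have "coeff_xy f i j = 0" unfolding ab coeff_xy_mult by (intro sum.neutral ballI) auto
        then show False using less(2) by simp
      qed
      then obtain k l where kl: "k \<le> i" "l \<le> j" "coeff_xy a k l \<noteq> 0" "coeff_xy b (i - k) (j - l) \<noteq> 0"
        by auto
      have "\<not> (i - k = 0 \<and> j - l = 0)" using kl(4) ab(3) unit_series_iff[of b] by metis
      then have "k + l < i + j" using kl(1,2) by linarith
      from less(1)[OF this kl(3) ab(2)] show ?thesis unfolding ab by (meson dvd_mult2)
    qed auto
  qed
qed

lemma series_x_dvd_iff: "series_x dvd f \<longleftrightarrow> (\<forall>j. coeff_xy f 0 j = 0)"
proof
  assume "series_x dvd f"
  then show "\<forall>j. coeff_xy f 0 j = 0" by (auto elim!: dvdE simp: coeff_xy_def)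
next
  assume *: "\<forall>j. coeff_xy f 0 j = 0"
  have "f = series_x * Abs_fps (\<lambda>j. fps_shift 1 (fps_nth f j))"
  proof (rule fps_ext)
    fix j
    have "fps_nth f j = fps_X * fps_shift 1 (fps_nth f j)"
      using * by (intro fps_ext) (simp add: coeff_xy_def)
    then show "fps_nth f j = fps_nth (series_x * Abs_fps (\<lambda>j. fps_shift 1 (fps_nth f j))) j"
      by simp
  qed
  then show "series_x dvd f" by (metis dvd_triv_left)
qed

text \<open>Setting \<open>x = 0\<close> is a homomorphism into the domain of power series in
  \<open>y\<close>, and its kernel consists of the multiples of \<open>series_x\<close>.\<close>

lemma series_x_prime:
  assumes "series_x dvd f * g"
  shows "series_x dvd f \<or> series_x dvd g"
proof -
  define r where "r f = Abs_fps (coeff_xy f 0)" for f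
  have "r (f * g) = r f * r g"
    by (rule fps_ext) (simp add: r_def coeff_xy_mult fps_mult_nth)
  moreover have r0: "r h = 0 \<longleftrightarrow> series_x dvd h" for h
    unfolding series_x_dvd_iff r_def by (auto simp: fps_eq_iff)
  ultimately show ?thesis using assms by (metis mult_eq_0_iff)
qed

text \<open>Up to a unit the right-hand side is a power of \<open>x\<close>, and \<open>x\<close> is
  prime. Factors \<open>x\<close> are cancelled from the cofactor until one falls to
  \<open>f\<close>; if none did, \<open>f\<close> would divide a unit.\<close>

lemma dvd_series_in_x:
  assumes "f * w = fps_const \<delta>" "\<delta> \<noteq> 0" "\<not> f dvd 1"
  shows "series_x dvd f"
  using assms
proof (induction "subdegree \<delta>" arbitrary: \<delta> w)
  case 0
  then have "fps_nth \<delta> 0 \<noteq> 0" by (metis nth_subdegree_nonzero)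
  then have "fps_const \<delta> dvd 1" unfolding unit_series_iff by (simp add: coeff_xy_def)
  then show ?case using 0 by (metis dvd_mult_left)
next
  case (Suc n)
  have "fps_nth \<delta> 0 = 0" using Suc(2) by (metis nth_less_subdegree_zero zero_less_Suc)
  then have \<delta>: "\<delta> = fps_X * fps_shift 1 \<delta>"
    by (intro fps_ext) auto
  have shift: "subdegree (fps_shift 1 \<delta>) = n" "fps_shift 1 \<delta> \<noteq> 0"
    using Suc(2) fps_shift_subdegree[of 1 \<delta>] by simp (metis Suc(4) \<delta> mult_zero_right)
  have eq: "fps_const \<delta> = series_x * fps_const (fps_shift 1 \<delta>)"
    by (subst \<delta>) (simp only: fps_const_mult)
  then have "series_x dvd f * w" unfolding Suc(3) by (metis dvd_triv_left)
  then consider "series_x dvd f" | "series_x dvd w" using series_x_prime by blast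
  then show ?case
  proof cases
    case 2
    then obtain w' where w': "w = series_x * w'" by (elim dvdE)
    have "series_x * (f * w') = series_x * fps_const (fps_shift 1 \<delta>)"
      using Suc(3) unfolding eq w' by (simp add: mult.left_commute)
    then have "f * w' = fps_const (fps_shift 1 \<delta>)"
      by (metis mult_left_cancel fps_const_eq_0_iff fps_X_neq_zero)
    then show ?thesis using Suc(1)[of "fps_shift 1 \<delta>"] shift Suc(5) by blast
  qed
qed

text \<open>A polynomial in \<open>y\<close> that vanishes as a power series vanishes identically,
  so a vertical formal branch makes the whole vertical line a component.\<close>

lemma series_x_dvd_germ_at:
  assumes "series_x dvd germ_at H (x0, y0)"
  shows "[:[:- x0, 1:]:] dvd H"
proof -
  have "coeff (coeff (translate H (x0, y0)) j) 0 = 0" for j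
    using assms unfolding series_x_dvd_iff germ_at_eq coeff_xy_series2 by blast
  then have "fibre_poly (translate H (x0, y0)) 0 = 0"
    by (intro poly_eqI) (simp add: poly_0_coeff_0)
  then have "eval2 (translate H (x0, y0)) (0, y) = 0" for y
    by (metis poly_0 poly_fibre_poly)
  then have "eval2 H (x0, y) = 0" for y
    using eval2_translate[of H "(x0, y0)" 0 "y - y0"] by simp
  then have "poly (fibre_poly H x0) y = 0" for y by simp
  then have "fibre_poly H x0 = 0" using poly_all_0_iff_0 by blast
  then have "[:- x0, 1:] dvd coeff H i" for i by (metis coeff_fibre_poly coeff_0 poly_eq_0_iff_dvd)
  then show ?thesis by (simp add: const_poly_dvd_iff del: pCons_one)
qed

lemma partial_y_no_common_factor:
  fixes H :: "complex poly poly"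
  assumes "squarefree H" "prime q" "degree q > 0" "q dvd H" "q dvd partial_y H"
  shows False
proof -
  obtain w where w: "H = q * w" using assms(4) by (elim dvdE)
  have "q dvd partial_y q * w"
    using assms(5) unfolding w partial_mult by (metis dvd_add_left_iff dvd_triv_left)
  moreover have "\<not> q dvd partial_y q"
  proof
    assume "q dvd partial_y q"
    moreover have "partial_y q \<noteq> 0" using assms(3) unfolding partial_y_def by (simp add: pderiv_eq_0_iff)
    ultimately have "degree q \<le> degree (partial_y q)" by (rule dvd_imp_degree_le)
    then show False using assms(3) by (simp add: degree_partial_y)
  qed
  ultimately have "q dvd w" using assms(2) prime_dvd_mult_iff by blast
  then have "q\<^sup>2 dvd H" unfolding w power2_eq_square by (simp add: mult_dvd_mono)
  then show False using squarefreeD[OF assms(1)] assms(2) not_prime_unit by blast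
qed

text \<open>The germ of a squarefree polynomial at a singular point stays squarefree: a multiple
  branch would be a common branch of \<open>H\<close> and its derivative, hence vertical by elimination.\<close>

lemma germ_at_no_square_factor:
  assumes H: "squarefree H" and p: "p \<in> singular_points H" and f: "\<not> f dvd 1" "f * f dvd germ_at H p"
  shows False
proof -
  obtain x0 y0 where p': "p = (x0, y0)" by (cases p)
  have nonunit: "\<not> [:[:- x0, 1:]:] dvd (1 :: complex poly poly)"
    by (auto dest!: is_unit_poly2)
  have "[:[:- x0, 1:]:] ^ 2 dvd H"
  proof (cases "degree H = 0")
    case True
    then obtain u where u: "H = [:u:]" by (metis degree_eq_zeroE)
    have "poly u x0 = 0" "poly (pderiv u) x0 = 0"
      using p unfolding p' u by (auto simp: singular_points_def zero_locus_def critical_points_def partial_x_pCons)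
    moreover obtain w where w: "u = [:- x0, 1:] * w"
      using \<open>poly u x0 = 0\<close> by (metis poly_eq_0_iff_dvd dvdE)
    ultimately have "poly w x0 = 0" by (simp add: pderiv_mult pderiv_pCons w del: mult_pCons_left)
    then obtain w' where w': "w = [:- x0, 1:] * w'" by (metis poly_eq_0_iff_dvd dvdE)
    have "H = [:[:- x0, 1:]:] ^ 2 * [:w':]"
      unfolding u w w' by (intro eval2_eqI) (simp add: power2_eq_square algebra_simps)
    then show ?thesis by (metis dvd_triv_left)
  next
    case False
    have H0: "H \<noteq> 0" using H by auto
    obtain U V D where D: "D \<noteq> 0" "U * H + V * partial_y H = [:D:]"
      using bezout_over_x[OF H0, of "partial_y H"] partial_y_no_common_factor[OF H] by blast
    obtain k where k: "germ_at H p = f * f * k" using f(2) by (elim dvdE)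
    have "f dvd germ_at (partial_y H) p"
      unfolding germ_at_partial_y k by (simp add: mult.assoc)
    moreover have "f dvd germ_at H p" unfolding k by (simp add: mult.assoc)
    ultimately have "f dvd germ_at [:D:] p"
      unfolding D(2)[symmetric] germ_at_add germ_at_mult by (intro dvd_add dvd_mult)
    moreover have "germ_at [:D:] p = fps_const (fps_nth (germ_at [:D:] p) 0)"
    proof -
      have "translate [:D:] p = [:pcompose D [:fst p, 1:]:]"
        by (rule eval2_eqI) (simp add: eval2_translate poly_pcompose)
      then show ?thesis
        by (intro fps_ext) (simp add: germ_at_eq series2_def coeff_map_poly coeff_pCons split: nat.splits)
    qed
    moreover have "fps_nth (germ_at [:D:] p) 0 \<noteq> 0"
      using D(1) germ_at_eq_0[of "[:D:]" p] calculation(2) by auto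
    \<comment> \<open>A non-unit that divides a series in \<open>x\<close> alone contains the
      vertical branch. The square of the vertical line then divides \<open>H\<close> itself, not
      only its germ.\<close>
    ultimately have "series_x dvd f" using dvd_series_in_x f(1) by (metis dvdE)
    then have sq: "series_x * series_x dvd germ_at H p"
      using f(2) by (meson dvd_trans mult_dvd_mono)
    then obtain H1 where H1: "H = [:[:- x0, 1:]:] * H1"
      using series_x_dvd_germ_at[of H x0 y0] unfolding p' by (meson dvd_mult_left dvdE)
    have "series_x * series_x dvd series_x * germ_at H1 p"
      using sq unfolding H1 germ_at_mult p' germ_at_linear .
    then have "series_x dvd germ_at H1 p"
      by (metis dvd_times_left_cancel_iff fps_const_eq_0_iff fps_X_neq_zero)
    then have "[:[:- x0, 1:]:] dvd H1" using series_x_dvd_germ_at unfolding p' by blast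
    then show ?thesis unfolding H1 power2_eq_square by (rule mult_dvd_mono[OF dvd_refl])
  qed
  then show False using squarefreeD[OF H] nonunit by blast
qed

text \<open>Splitting off a smooth branch \<open>f\<close> leaves a cofactor without constant term,
  so the quadratic part of the germ is the product of two linear forms, one of them that of
  \<open>f\<close>. Its kernel is thus a null direction. It is real because \<open>f\<close> is, and
  transversality makes the directions of \<open>f\<close> and \<open>g\<close> independent.\<close>

lemma hyperbolic_node_real_tangent_pair:
  assumes H: "squarefree H" and p: "p \<in> singular_points H" and node: "hyperbolic_node H p"
  shows "real_tangent_pair H p"
proof -
  obtain x0 y0 where p': "p = (x0, y0)" by (cases p)
  obtain f g where fg: "branch_equation H p f" "branch_equation H p g" "\<not> same_branch f g"
    "\<And>h. branch_equation H p h \<Longrightarrow> same_branch h f \<or> same_branch h g"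
    "real_series f" "real_series g" "smooth_branch f" "smooth_branch g" "transversal f g"
    using node unfolding hyperbolic_node_def by blast
  obtain A B C where ABC:
    "H = [:[:- x0, 1:]:] * [:[:- x0, 1:]:] * A + [:[:- x0, 1:]:] * [:[:- y0:], 1:] * B
      + [:[:- y0:], 1:] * [:[:- y0:], 1:] * C"
    "eval2 (partial_x (partial_x H)) p = 2 * eval2 A p"
    "eval2 (partial_y (partial_x H)) p = eval2 B p"
    "eval2 (partial_y (partial_y H)) p = 2 * eval2 C p"
    using second_order_decomposition[OF p p'] by metis
  have germ: "germ_at H p = series_x * series_x * germ_at A p + series_x * series_y * germ_at B p
      + series_y * series_y * germ_at C p"
    by (subst ABC(1)) (simp only: germ_at_add germ_at_mult p' germ_at_linear)
  have low: "coeff_xy (germ_at H p) 0 0 = 0" "coeff_xy (germ_at H p) 1 0 = 0" "coeff_xy (germ_at H p) 0 1 = 0"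
    "coeff_xy (germ_at H p) 2 0 = eval2 A p" "coeff_xy (germ_at H p) 1 1 = eval2 B p"
    "coeff_xy (germ_at H p) 0 2 = eval2 C p"
    unfolding germ coeff_xy_add
    by (simp_all only: coeff_xy_mult_low coeff_series_x coeff_series_y coeff_germ_at_00) simp_all
  have cofactor: "\<exists>k. germ_at H p = f * k \<and> coeff_xy k 0 0 = 0
      \<and> eval2 A p = coeff_xy f 1 0 * coeff_xy k 1 0
      \<and> eval2 B p = coeff_xy f 1 0 * coeff_xy k 0 1 + coeff_xy f 0 1 * coeff_xy k 1 0
      \<and> eval2 C p = coeff_xy f 0 1 * coeff_xy k 0 1"
    if br: "branch_equation H p f" and sm: "smooth_branch f" for f
  proof -
    obtain k where k: "germ_at H p = f * k" using br unfolding branch_equation_def dvd_def by blast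
    have f00: "coeff_xy f 0 0 = 0"
      using br unit_series_iff[of f] unfolding branch_equation_def irreducible_def by blast
    have "coeff_xy k 0 0 = 0"
      using low(2,3) sm f00 unfolding k coeff_xy_mult_low smooth_branch_def by auto
    then show ?thesis
      using k low(4-6) f00 unfolding k coeff_xy_mult_low by (intro exI[of _ k]) simp
  qed
  obtain k where k: "germ_at H p = f * k" "coeff_xy k 0 0 = 0"
      "eval2 A p = coeff_xy f 1 0 * coeff_xy k 1 0"
      "eval2 B p = coeff_xy f 1 0 * coeff_xy k 0 1 + coeff_xy f 0 1 * coeff_xy k 1 0"
      "eval2 C p = coeff_xy f 0 1 * coeff_xy k 0 1"
    using cofactor[OF fg(1,7)] by blast
  obtain k' where k': "eval2 A p = coeff_xy g 1 0 * coeff_xy k' 1 0"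
      "eval2 B p = coeff_xy g 1 0 * coeff_xy k' 0 1 + coeff_xy g 0 1 * coeff_xy k' 1 0"
      "eval2 C p = coeff_xy g 0 1 * coeff_xy k' 0 1"
    using cofactor[OF fg(2,8)] by blast
  have nonunit: "\<not> f dvd 1" "\<not> g dvd 1"
    using fg(1,2) unfolding branch_equation_def irreducible_def by auto
  \<comment> \<open>If the quadratic part vanished, \<open>k\<close> would have no linear part. Its
    irreducible factors all belong to \<open>f\<close> or \<open>g\<close>; squarefreeness excludes
    \<open>f\<close>, and as \<open>g\<close> is smooth it would have to occur twice, which is
    excluded as well.\<close>
  have nonzero: "eval2 A p \<noteq> 0 \<or> eval2 B p \<noteq> 0 \<or> eval2 C p \<noteq> 0"
  proof (rule ccontr)
    assume "\<not> ?thesis"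
    then have lin: "coeff_xy k 1 0 = 0" "coeff_xy k 0 1 = 0"
      using k(3-5) fg(7) unfolding smooth_branch_def by auto
    have k0: "k \<noteq> 0" using k(1) germ_at_eq_0[of H p] H by auto
    have factor_cases: "f dvd h \<or> g dvd h" if h: "h dvd k" "h \<noteq> 0" "\<not> h dvd 1" for h
    proof -
      obtain q where q: "irreducible q" "q dvd h" using ex_irreducible_factor_series h(2,3) by blast
      then have "branch_equation H p q"
        using h(1) unfolding branch_equation_def k(1) by (meson dvd_mult dvd_trans)
      then show ?thesis using fg(4) q(2) unfolding same_branch_def by (meson dvd_trans)
    qed
    have no_f: "\<not> f dvd k"
      using germ_at_no_square_factor[OF H p nonunit(1)] unfolding k(1) by (meson mult_dvd_mono dvd_refl)
    have "g dvd k" using factor_cases[OF dvd_refl k0] k(2) no_f unit_series_iff[of k] by metis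
    then obtain k1 where k1: "k = g * k1" by (elim dvdE)
    have "coeff_xy g 0 0 = 0" using nonunit(2) unit_series_iff[of g] by blast
    then have "coeff_xy k1 0 0 = 0"
      using lin fg(8) unfolding k1 coeff_xy_mult_low smooth_branch_def by auto
    then have "f dvd k1 \<or> g dvd k1"
      using factor_cases[of k1] k0 unit_series_iff[of k1] unfolding k1 by auto
    then have "g dvd k1" using no_f unfolding k1 by (meson dvd_mult)
    then have "g * g dvd germ_at H p"
      unfolding k(1) k1 by (meson dvd_mult mult_dvd_mono dvd_refl)
    then show False using germ_at_no_square_factor[OF H p nonunit(2)] by blast
  qed
  have real: "coeff_xy f i j = of_real (Re (coeff_xy f i j))" "coeff_xy g i j = of_real (Re (coeff_xy g i j))" for i j
    using fg(5,6) unfolding real_series_def by (auto simp: of_real_Re)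
  \<comment> \<open>The linear form \<open>f_10 * x + f_01 * y\<close> has the kernel spanned by
    \<open>(f_01, - f_10)\<close>.\<close>
  let ?v1 = "Re (coeff_xy f 0 1)" and ?v2 = "- Re (coeff_xy f 1 0)"
  let ?w1 = "Re (coeff_xy g 0 1)" and ?w2 = "- Re (coeff_xy g 1 0)"
  have "?v1 * ?w2 \<noteq> ?v2 * ?w1"
  proof
    assume "?v1 * ?w2 = ?v2 * ?w1"
    then have "complex_of_real (?v1 * Re (coeff_xy g 1 0)) = complex_of_real (Re (coeff_xy f 1 0) * ?w1)"
      by simp
    then have "coeff_xy f 0 1 * coeff_xy g 1 0 = coeff_xy f 1 0 * coeff_xy g 0 1"
      unfolding of_real_mult by (simp flip: real)
    then show False using fg(9) unfolding transversal_def by simp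
  qed
  moreover have "2 * eval2 A p * of_real ?v1 ^ 2 + 2 * eval2 B p * of_real ?v1 * of_real ?v2
      + 2 * eval2 C p * of_real ?v2 ^ 2 = 0"
    unfolding k(3-5) of_real_minus real(1)[symmetric] by (simp add: power2_eq_square algebra_simps)
  moreover have "2 * eval2 A p * of_real ?w1 ^ 2 + 2 * eval2 B p * of_real ?w1 * of_real ?w2
      + 2 * eval2 C p * of_real ?w2 ^ 2 = 0"
    unfolding k' of_real_minus real(2)[symmetric] by (simp add: power2_eq_square algebra_simps)
  moreover have "real_point p" using node unfolding hyperbolic_node_def by blast
  ultimately show ?thesis
    using nonzero unfolding real_tangent_pair_def Let_def ABC(2-4)
    by (intro conjI exI[of _ ?v1] exI[of _ ?v2] exI[of _ ?w1] exI[of _ ?w2]) (assumption | simp)+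
qed

section \<open>Branches at infinity\<close>

text \<open>With a holomorphic \<open>m\<close>-th root \<open>h\<close> of \<open>k\<close>, the
  equation \<open>w ^ m * k w = s ^ m\<close> follows from \<open>w * h w = s\<close>, whose left
  side has nonzero derivative at 0 and so has a local inverse. The solution is written as
  \<open>s * \<kappa> s\<close> with \<open>\<kappa>\<close> free of zeros, which displays its
  simple zero.\<close>

lemma ex_root_chart:
  fixes k :: "complex \<Rightarrow> complex"
  assumes "r > 0" "k holomorphic_on ball 0 r" "\<And>w. w \<in> ball 0 r \<Longrightarrow> k w \<noteq> 0" "m > 0"
  obtains \<rho> \<kappa> where "\<rho> > 0" "\<kappa> holomorphic_on ball 0 \<rho>"
    "\<And>s. s \<in> ball 0 \<rho> \<Longrightarrow> \<kappa> s \<noteq> 0 \<and> s * \<kappa> s \<in> ball 0 r \<and> (s * \<kappa> s) ^ m * k (s * \<kappa> s) = s ^ m"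
    "inj_on (\<lambda>s. s * \<kappa> s) (ball 0 \<rho>)"
proof -
  obtain g where g: "g holomorphic_on ball 0 r" "\<And>w. w \<in> ball 0 r \<Longrightarrow> exp (g w) = k w"
    using holomorphic_logarithm_exists[of "ball 0 r" k 0] assms by auto
  define h where "h w = exp (g w / of_nat m)" for w
  have hol_h: "h holomorphic_on ball 0 r"
    unfolding h_def using g(1) by (intro holomorphic_intros) (use assms(4) in auto)
  have h: "h w \<noteq> 0" "w \<in> ball 0 r \<Longrightarrow> h w ^ m = k w" for w
    unfolding h_def using g(2)[of w] assms(4) by (auto simp flip: exp_of_nat_mult)
  define \<phi> where "\<phi> w = w * h w" for w
  have hol_phi: "\<phi> holomorphic_on ball 0 r"
    unfolding \<phi>_def using hol_h by (intro holomorphic_intros)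
  have "(\<phi> has_field_derivative 1 * h 0 + deriv h 0 * 0) (at 0)"
    unfolding \<phi>_def using assms(1) hol_h
    by (intro DERIV_mult DERIV_ident holomorphic_derivI[OF hol_h]) auto
  then have "deriv \<phi> 0 = h 0" using DERIV_imp_deriv by fastforce
  then have "deriv \<phi> 0 \<noteq> 0" using h(1)[of 0] by simp
  then obtain \<delta> where \<delta>: "\<delta> > 0" "ball (0::complex) \<delta> \<subseteq> ball 0 r" "inj_on \<phi> (ball 0 \<delta>)"
    using has_complex_derivative_locally_injective[OF hol_phi _ open_ball, of 0] assms(1) by auto
  have hol_phi': "\<phi> holomorphic_on ball 0 \<delta>" using hol_phi \<delta>(2) holomorphic_on_subset by blast
  obtain \<psi> where \<psi>: "\<psi> holomorphic_on \<phi> ` ball 0 \<delta>" "\<And>z. z \<in> ball 0 \<delta> \<Longrightarrow> \<psi> (\<phi> z) = z"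
    using holomorphic_has_inverse[OF hol_phi' open_ball \<delta>(3)] by metis
  have "open (\<phi> ` ball 0 \<delta>)"
    using open_mapping_thm3[OF hol_phi' open_ball \<delta>(3)] .
  moreover have "0 \<in> \<phi> ` ball 0 \<delta>" using \<delta>(1) by (intro image_eqI[of _ _ 0]) (auto simp: \<phi>_def)
  ultimately obtain \<rho> where \<rho>: "\<rho> > 0" "ball 0 \<rho> \<subseteq> \<phi> ` ball 0 \<delta>"
    by (meson openE)
  define \<kappa> where "\<kappa> s = inverse (h (\<psi> s))" for s
  have psi_in: "\<psi> s \<in> ball 0 \<delta>" "\<phi> (\<psi> s) = s" if "s \<in> ball 0 \<rho>" for s
    using that \<rho>(2) \<psi>(2) by force+
  have sk: "s * \<kappa> s = \<psi> s" if "s \<in> ball 0 \<rho>" for s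
    using psi_in(2)[OF that] h(1)[of "\<psi> s"] unfolding \<kappa>_def \<phi>_def by (simp add: field_simps)
  show thesis
  proof (rule that[of \<rho> \<kappa>])
    show "\<kappa> holomorphic_on ball 0 \<rho>"
      unfolding \<kappa>_def
    proof (intro holomorphic_intros)
      show "(\<lambda>s. h (\<psi> s)) holomorphic_on ball 0 \<rho>"
      proof -
        have "\<psi> ` ball 0 \<rho> \<subseteq> ball 0 r" using psi_in(1) \<delta>(2) by blast
        from holomorphic_on_compose_gen[OF holomorphic_on_subset[OF \<psi>(1) \<rho>(2)] hol_h this]
        show ?thesis by (simp add: o_def)
      qed
    qed (use h(1) in auto)
    show "\<kappa> s \<noteq> 0 \<and> s * \<kappa> s \<in> ball 0 r \<and> (s * \<kappa> s) ^ m * k (s * \<kappa> s) = s ^ m" if s: "s \<in> ball 0 \<rho>" for s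
    proof (intro conjI)
      show "\<kappa> s \<noteq> 0" using h(1) unfolding \<kappa>_def by simp
      show in_r: "s * \<kappa> s \<in> ball 0 r" unfolding sk[OF s] using psi_in(1)[OF s] \<delta>(2) by blast
      have "(s * \<kappa> s) ^ m * k (s * \<kappa> s) = (\<psi> s * h (\<psi> s)) ^ m"
        using h(2)[of "\<psi> s"] in_r unfolding sk[OF s] by (simp add: power_mult_distrib)
      then show "(s * \<kappa> s) ^ m * k (s * \<kappa> s) = s ^ m"
        using psi_in(2)[OF s] unfolding \<phi>_def by simp
    qed
    show "inj_on (\<lambda>s. s * \<kappa> s) (ball 0 \<rho>)"
      by (rule inj_onI) (metis sk psi_in(2))
  qed (use \<rho> in auto)
qed

lemma meromorphic_log_derivative_bound:
  assumes "f meromorphic_on {0}"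
  shows "\<exists>C. \<forall>\<^sub>F s in at 0. f field_differentiable (at s) \<and> norm (s * deriv f s) \<le> C * norm (f s)"
proof (cases "\<exists>\<^sub>F w in at 0. f w \<noteq> 0")
  case True
  define n where "n = zorder f 0"
  obtain g r where g: "g 0 \<noteq> 0" "r > 0" "g holomorphic_on cball 0 r"
    "\<And>w. w \<in> cball 0 r - {0} \<Longrightarrow> f w = g w * w powi n \<and> g w \<noteq> 0"
    using zorder_exist[OF meromorphic_on_isolated_singularity[OF assms] meromorphic_on_not_essential[OF assms] True]
    unfolding n_def by (metis diff_zero)
  have holg: "g holomorphic_on ball 0 r" using g(3) holomorphic_on_subset ball_subset_cball by blast
  have "isCont (\<lambda>w. w * deriv g w / g w) 0"
    using holomorphic_on_imp_continuous_on[OF holg] holomorphic_on_imp_continuous_on[OF holomorphic_deriv[OF holg open_ball]]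
      g(1,2) by (intro continuous_intros) (auto simp: continuous_on_eq_continuous_at)
  then have "((\<lambda>w. w * deriv g w / g w) \<longlongrightarrow> 0) (at 0)" by (simp add: isCont_def)
  then have small: "\<forall>\<^sub>F w in at 0. norm (w * deriv g w / g w) < 1"
    by (drule_tac e = 1 in tendstoD) auto
  have near: "\<forall>\<^sub>F w in at 0. w \<in> ball 0 r - {0}"
    using g(2) by (intro eventually_at_in_open) auto
  have "\<forall>\<^sub>F s in at 0. f field_differentiable (at s) \<and> norm (s * deriv f s) \<le> (1 + \<bar>of_int n\<bar>) * norm (f s)"
    using small near
  proof eventually_elim
    case (elim s)
    have s: "s \<noteq> 0" "s \<in> ball 0 r" "g s \<noteq> 0" "f s = g s * s powi n" using elim g(4)[of s] by auto
    have "((\<lambda>w. g w * w powi n) has_field_derivative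
        deriv g s * s powi n + g s * (of_int n * s powi (n - 1))) (at s)"
      using s by (auto intro!: derivative_eq_intros holomorphic_derivI[OF holg])
    then have der: "(f has_field_derivative deriv g s * s powi n + g s * (of_int n * s powi (n - 1))) (at s)"
      by (rule has_field_derivative_transform_within_open[of _ _ _ "ball 0 r - {0}"])
        (use elim g(4) in \<open>auto intro: open_delete\<close>)
    have "s * deriv f s = f s * (s * deriv g s / g s + of_int n)"
    proof -
      have pw: "s powi (n - 1) = s powi n / s" using s(1) by (simp add: power_int_diff)
      have "s * (g' * x + g0 * (k * (x / s))) = g0 * x * (s * g' / g0 + k)" if "g0 \<noteq> 0" for g' g0 x k
        using s(1) that by (simp add: algebra_simps)
      from this[OF s(3)] show ?thesis unfolding DERIV_imp_deriv[OF der] s(4) pw by (simp only: mult.assoc)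
    qed
    then have "norm (s * deriv f s) = norm (f s) * norm (s * deriv g s / g s + of_int n)"
      by (simp add: norm_mult)
    also have "\<dots> \<le> norm (f s) * (1 + \<bar>of_int n\<bar>)"
      using elim(1) norm_triangle_ineq[of "s * deriv g s / g s" "of_int n"]
      by (intro mult_left_mono) (auto simp: norm_of_int)
    finally show ?case using der by (auto simp: field_differentiable_def mult.commute)
  qed
  then show ?thesis by blast
next
  case False
  then have "\<forall>\<^sub>F w in at 0. f w = 0" by (simp add: frequently_def)
  then obtain S where S: "open S" "0 \<in> S" "\<And>w. w \<in> S - {0} \<Longrightarrow> f w = 0"
    unfolding eventually_at_topological by blast
  have "\<forall>\<^sub>F s in at 0. s \<in> S - {0}" using S by (intro eventually_at_in_open) auto
  then have "\<forall>\<^sub>F s in at 0. f field_differentiable (at s) \<and> norm (s * deriv f s) \<le> 0 * norm (f s)"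
  proof eventually_elim
    case (elim s)
    have "(f has_field_derivative 0) (at s)"
      by (rule has_field_derivative_transform_within_open[of "\<lambda>_. 0" _ _ "S - {0}"])
        (use elim S in \<open>auto intro: open_delete\<close>)
    then show ?case by (auto simp: field_differentiable_def DERIV_imp_deriv)
  qed
  then show ?thesis by blast
qed

text \<open>The key estimate.  At a point of the polar curve \<open>F_y = 0\<close> far away, with \<open>\<Phi>\<^sub>1\<close> the branch
  nearest to it, \<open>\<Sum> 1 / (\<eta> - \<Phi>\<^sub>i) = 0\<close> allows to subtract \<open>\<Phi>\<^sub>1'\<close> from every numerator of
  \<open>F_x / F\<close>, while \<open>\<eta>\<close> is at least half as far from \<open>\<Phi>\<^sub>i\<close> as \<open>\<Phi>\<^sub>1\<close> is.\<close>

lemma polar_estimate: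
  fixes F :: "complex poly poly" and \<Phi> :: "'i \<Rightarrow> complex \<Rightarrow> complex"
  assumes I: "finite I" "L > 0"
    and mero: "\<And>i. i \<in> I \<Longrightarrow> \<Phi> i meromorphic_on {0}"
    and F: "\<forall>\<^sub>F s in at 0. \<forall>y. eval2 F (1 / s ^ L, y) = c * (\<Prod>i\<in>I. y - \<Phi> i s)"
  shows "\<exists>C. \<forall>\<^sub>F s in at 0. \<forall>y. eval2 (partial_y F) (1 / s ^ L, y) = 0 \<longrightarrow> eval2 F (1 / s ^ L, y) \<noteq> 0 \<longrightarrow>
    norm (1 / s ^ L) * norm (eval2 (partial_x F) (1 / s ^ L, y)) \<le> C * norm (eval2 F (1 / s ^ L, y))"
proof -
  have "\<exists>C. \<forall>\<^sub>F s in at 0. norm (s * deriv (\<lambda>s. \<Phi> i s - \<Phi> j s) s) \<le> C * norm (\<Phi> i s - \<Phi> j s)"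
    if ij: "i \<in> I" "j \<in> I" for i j
  proof -
    obtain C where "\<forall>\<^sub>F s in at 0. (\<lambda>s. \<Phi> i s - \<Phi> j s) field_differentiable (at s)
        \<and> norm (s * deriv (\<lambda>s. \<Phi> i s - \<Phi> j s) s) \<le> C * norm (\<Phi> i s - \<Phi> j s)"
      using meromorphic_log_derivative_bound[OF meromorphic_on_diff[OF mero[OF ij(1)] mero[OF ij(2)]]] by blast
    then show ?thesis by (auto elim: eventually_mono)
  qed
  then have "\<forall>i j. \<exists>C. i \<in> I \<longrightarrow> j \<in> I \<longrightarrow> (\<forall>\<^sub>F s in at 0.
      norm (s * deriv (\<lambda>s. \<Phi> i s - \<Phi> j s) s) \<le> C * norm (\<Phi> i s - \<Phi> j s))"
    by blast
  then obtain C where C: "\<And>i j. i \<in> I \<Longrightarrow> j \<in> I \<Longrightarrow> (\<forall>\<^sub>F s in at 0.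
      norm (s * deriv (\<lambda>s. \<Phi> i s - \<Phi> j s) s) \<le> C i j * norm (\<Phi> i s - \<Phi> j s))"
    by metis
  define K where "K = (\<Sum>i\<in>I. \<Sum>j\<in>I. \<bar>C i j\<bar>)"
  have K: "C i j \<le> K" if "i \<in> I" "j \<in> I" for i j
  proof -
    have "C i j \<le> \<bar>C i j\<bar>" by simp
    also have "\<dots> \<le> (\<Sum>j\<in>I. \<bar>C i j\<bar>)" using that I by (intro member_le_sum) auto
    also have "\<dots> \<le> K" unfolding K_def using that I
      by (intro member_le_sum[of i I "\<lambda>i. \<Sum>j\<in>I. \<bar>C i j\<bar>"]) (auto intro: sum_nonneg)
    finally show ?thesis .
  qed
  have K0: "K \<ge> 0" unfolding K_def by (intro sum_nonneg) auto
  have "\<forall>\<^sub>F s in at 0. \<forall>i\<in>I. \<forall>j\<in>I. norm (s * deriv (\<lambda>s. \<Phi> i s - \<Phi> j s) s) \<le> C i j * norm (\<Phi> i s - \<Phi> j s)"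
    using C I by (intro eventually_ball_finite ballI) auto
  moreover have "\<forall>\<^sub>F s in at 0. \<Phi> i field_differentiable (at s)" if "i \<in> I" for i
    using meromorphic_log_derivative_bound[OF mero[OF that]] by (auto elim: eventually_mono)
  then have "\<forall>\<^sub>F s in at 0. \<forall>i\<in>I. \<Phi> i field_differentiable (at s)"
    using I(1) by (intro eventually_ball_finite ballI) auto
  \<comment> \<open>The factorization is needed in a neighbourhood of each \<open>s\<close>, in
    order to be differentiated with respect to \<open>s\<close>.\<close>
  moreover have "\<forall>\<^sub>F s in at 0. \<forall>\<^sub>F t in nhds s. \<forall>y. eval2 F (1 / t ^ L, y) = c * (\<Prod>i\<in>I. y - \<Phi> i t)"
  proof -
    obtain S where S: "open S" "0 \<in> S" "\<And>t y. t \<in> S - {0} \<Longrightarrow> eval2 F (1 / t ^ L, y) = c * (\<Prod>i\<in>I. y - \<Phi> i t)"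
      using F unfolding eventually_at_topological by blast
    have "\<forall>\<^sub>F s in at 0. s \<in> S - {0}" using S by (intro eventually_at_in_open) auto
    then show ?thesis
    proof eventually_elim
      case (elim s)
      then show ?case using S by (intro eventually_nhds_in_open[of "S - {0}", THEN eventually_mono]) (auto intro: open_delete)
    qed
  qed
  moreover have "\<forall>\<^sub>F s in at (0::complex). s \<noteq> 0" by (simp add: eventually_neq_at_within)
  ultimately have "\<forall>\<^sub>F s in at 0. \<forall>y. eval2 (partial_y F) (1 / s ^ L, y) = 0 \<longrightarrow> eval2 F (1 / s ^ L, y) \<noteq> 0 \<longrightarrow>
    norm (1 / s ^ L) * norm (eval2 (partial_x F) (1 / s ^ L, y)) \<le> (2 * K * real (card I)) * norm (eval2 F (1 / s ^ L, y))"
  proof eventually_elim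
    case (elim s)
    show ?case
    proof (intro allI impI)
      fix y assume Fy: "eval2 (partial_y F) (1 / s ^ L, y) = 0" and F0: "eval2 F (1 / s ^ L, y) \<noteq> 0"
      define f where "f = eval2 F (1 / s ^ L, y)"
      have s: "s \<noteq> 0" using elim by simp
      have eq: "eval2 F (1 / s ^ L, y) = c * (\<Prod>i\<in>I. y - \<Phi> i s)" for y
        using eventually_nhds_x_imp_x[OF elim(3)] by blast
      have ne: "y - \<Phi> i s \<noteq> 0" if "i \<in> I" for i
        using F0 I that unfolding eq by auto
      have "((\<lambda>y. c * (\<Prod>i\<in>I. y - \<Phi> i s)) has_field_derivative
          c * ((\<Prod>i\<in>I. y - \<Phi> i s) * (\<Sum>i\<in>I. 1 / (y - \<Phi> i s)))) (at y)"
        by (intro DERIV_cmult has_field_derivative_prod') (use ne in \<open>auto intro!: derivative_eq_intros\<close>)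
      then have "eval2 (partial_y F) (1 / s ^ L, y) = f * (\<Sum>i\<in>I. 1 / (y - \<Phi> i s))"
        using DERIV_unique[OF eval2_DERIV_y[of F "1 / s ^ L" y UNIV]] unfolding f_def eq by (simp add: mult.assoc)
      then have sum0: "(\<Sum>i\<in>I. 1 / (y - \<Phi> i s)) = 0" using Fy F0 unfolding f_def by simp
      have d1: "((\<lambda>t. c * (\<Prod>i\<in>I. y - \<Phi> i t)) has_field_derivative
          c * ((\<Prod>i\<in>I. y - \<Phi> i s) * (\<Sum>i\<in>I. (- deriv (\<Phi> i) s) / (y - \<Phi> i s)))) (at s)"
        using elim(2) by (intro DERIV_cmult has_field_derivative_prod')
          (use ne in \<open>auto intro!: derivative_eq_intros field_differentiable_derivI\<close>)
      \<comment> \<open>The derivative of \<open>x = 1 / s ^ L\<close> is \<open>x\<close> times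
        \<open>- L / s\<close>; this supplies the factor \<open>norm x\<close> in the estimate, and
        the remaining \<open>1 / s\<close> cancels against the one from the logarithmic
        derivatives.\<close>
      have d2: "((\<lambda>t. eval2 F (1 / t ^ L, y)) has_field_derivative
          eval2 (partial_x F) (1 / s ^ L, y) * (- of_nat L / s ^ Suc L)) (at s)"
      proof -
        have "((\<lambda>t. 1 / t ^ L) has_field_derivative - of_nat L / s ^ Suc L) (at s)"
          using s I(2) by (auto intro!: derivative_eq_intros simp: field_simps power_Suc[symmetric] simp flip: power_add power_Suc)
        from eval2_chain[OF this DERIV_const] show ?thesis by simp
      qed
      have "\<forall>\<^sub>F t in nhds s. eval2 F (1 / t ^ L, y) = c * (\<Prod>i\<in>I. y - \<Phi> i t)"
        using elim(3) by eventually_elim blast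
      from d2[unfolded DERIV_cong_ev[OF refl this refl]]
      have "eval2 (partial_x F) (1 / s ^ L, y) * (- of_nat L / s ^ Suc L)
          = f * (\<Sum>i\<in>I. (- deriv (\<Phi> i) s) / (y - \<Phi> i s))"
        using DERIV_unique[OF _ d1] unfolding f_def eq by (simp only: mult.assoc)
      then have Fx: "eval2 (partial_x F) (1 / s ^ L, y) * (of_nat L / s ^ Suc L)
          = f * (\<Sum>i\<in>I. deriv (\<Phi> i) s / (y - \<Phi> i s))"
        by (simp add: sum_negf)
      show "norm (1 / s ^ L) * norm (eval2 (partial_x F) (1 / s ^ L, y))
          \<le> (2 * K * real (card I)) * norm (eval2 F (1 / s ^ L, y))"
      proof (cases "I = {}")
        case True
        then have "eval2 (partial_x F) (1 / s ^ L, y) = 0" using Fx s I(2) by simp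
        then show ?thesis using K0 by (simp del: norm_mult)
      next
        case False
        then obtain j where j: "j \<in> I" "\<And>i. i \<in> I \<Longrightarrow> norm (y - \<Phi> j s) \<le> norm (y - \<Phi> i s)"
          using ex_is_arg_min_if_finite[OF I(1) False, of "\<lambda>i. norm (y - \<Phi> i s)"]
          unfolding is_arg_min_linorder by blast
        have "(\<Sum>i\<in>I. deriv (\<Phi> i) s / (y - \<Phi> i s))
            = (\<Sum>i\<in>I. (deriv (\<Phi> i) s - deriv (\<Phi> j) s) / (y - \<Phi> i s)) + deriv (\<Phi> j) s * (\<Sum>i\<in>I. 1 / (y - \<Phi> i s))"
          by (simp add: sum_distrib_left diff_divide_distrib sum_subtractf)
        then have "(\<Sum>i\<in>I. deriv (\<Phi> i) s / (y - \<Phi> i s))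
            = (\<Sum>i\<in>I. (deriv (\<Phi> i) s - deriv (\<Phi> j) s) / (y - \<Phi> i s))"
          by (simp add: sum0)
        moreover have "norm ((deriv (\<Phi> i) s - deriv (\<Phi> j) s) / (y - \<Phi> i s)) \<le> 2 * K / norm s" if i: "i \<in> I" for i
        proof -
          have "norm (\<Phi> i s - \<Phi> j s) \<le> norm (y - \<Phi> i s) + norm (y - \<Phi> j s)"
            using norm_triangle_ineq4[of "y - \<Phi> j s" "y - \<Phi> i s"] by (simp add: algebra_simps)
          then have half: "norm (\<Phi> i s - \<Phi> j s) \<le> 2 * norm (y - \<Phi> i s)" using j(2)[OF i] by simp
          have "deriv (\<lambda>s. \<Phi> i s - \<Phi> j s) s = deriv (\<Phi> i) s - deriv (\<Phi> j) s"
            using elim(2) i j(1) by (intro deriv_diff) auto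
          then have "norm s * norm (deriv (\<Phi> i) s - deriv (\<Phi> j) s) \<le> C i j * norm (\<Phi> i s - \<Phi> j s)"
            using elim(1) i j(1) by (metis norm_mult)
          also have "\<dots> \<le> K * norm (\<Phi> i s - \<Phi> j s)" using K[OF i j(1)] by (intro mult_right_mono) auto
          also have "\<dots> \<le> K * (2 * norm (y - \<Phi> i s))" using half K0 by (intro mult_left_mono) auto
          finally show ?thesis using s ne[OF i] by (simp add: norm_divide field_simps)
        qed
        ultimately have "norm (\<Sum>i\<in>I. deriv (\<Phi> i) s / (y - \<Phi> i s)) \<le> real (card I) * (2 * K / norm s)"
          by (metis (no_types, lifting) sum_norm_bound)
        then have "norm (eval2 (partial_x F) (1 / s ^ L, y) * (of_nat L / s ^ Suc L)) \<le> norm f * (real (card I) * (2 * K / norm s))"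
          unfolding Fx norm_mult by (intro mult_left_mono) auto
        then have "real L * (norm (1 / s ^ L) * norm (eval2 (partial_x F) (1 / s ^ L, y))) / norm s
            \<le> ((2 * K * real (card I)) * norm f) / norm s"
          by (simp add: norm_mult norm_divide norm_power field_simps)
        then have le: "real L * (norm (1 / s ^ L) * norm (eval2 (partial_x F) (1 / s ^ L, y)))
            \<le> (2 * K * real (card I)) * norm f"
          using s by (simp add: divide_right_mono divide_le_cancel)
        have "1 * (norm (1 / s ^ L) * norm (eval2 (partial_x F) (1 / s ^ L, y)))
            \<le> real L * (norm (1 / s ^ L) * norm (eval2 (partial_x F) (1 / s ^ L, y)))"
          using I(2) by (intro mult_right_mono) auto
        with le show ?thesis unfolding f_def by linarith
      qed
    qed
  qed
  then show ?thesis by blast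
qed

lemma proots_eq_mset_set:
  fixes p :: "complex poly"
  assumes "p \<noteq> 0" "finite R" "card R = degree p" "\<And>z. z \<in> R \<Longrightarrow> poly p z = 0"
  shows "proots p = mset_set R"
proof -
  have "mset_set R \<subseteq># proots p"
    using assms by (intro mset_subset_eqI) (auto simp: count_mset_set' Suc_le_eq order_root)
  moreover have "size (mset_set R) = size (proots p)"
    using assms(3) by (simp add: size_proots_complex)
  ultimately show ?thesis by (metis mset_subset_size nless_le subset_mset.le_imp_less_or_eq)
qed

text \<open>The equation \<open>A z / z ^ n = x\<close> freed of its denominator: its roots are the
  parameters over the abscissa \<open>x\<close>.\<close>

definition fibre_eq :: "complex poly \<Rightarrow> nat \<Rightarrow> complex \<Rightarrow> complex poly" where
  "fibre_eq A n x = A - monom x n"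

lemma poly_fibre_eq: "poly (fibre_eq A n x) z = poly A z - x * z ^ n"
  by (simp add: fibre_eq_def poly_monom)

lemma fibre_eq_degree:
  assumes "n < degree A"
  shows "degree (fibre_eq A n x) = degree A" "lead_coeff (fibre_eq A n x) = lead_coeff A" "fibre_eq A n x \<noteq> 0"
proof -
  have c: "coeff (fibre_eq A n x) (degree A) = lead_coeff A"
    using assms by (simp add: fibre_eq_def)
  moreover have "degree (fibre_eq A n x) \<le> degree A"
    unfolding fibre_eq_def using assms by (intro degree_diff_le) (auto intro: order.trans[OF degree_monom_le])
  moreover have lc: "lead_coeff A \<noteq> 0" using assms by auto
  ultimately show d: "degree (fibre_eq A n x) = degree A" by (metis antisym le_degree)
  show "lead_coeff (fibre_eq A n x) = lead_coeff A" using c d by simp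
  show "fibre_eq A n x \<noteq> 0" using c lc by auto
qed

text \<open>Over a distant \<open>x\<close> the parameters lie near the ends of the parameter
  domain: \<open>m = degree A - n\<close> of them near infinity, where \<open>A z / z ^ n\<close>
  has a pole of order \<open>m\<close>, and \<open>n\<close> near the pole at 0. With
  \<open>x = 1 / s ^ L\<close> and a common multiple \<open>L\<close> of both orders each of them
  becomes meromorphic in \<open>s\<close>.\<close>

lemma puiseux_roots:
  assumes A: "n < degree A" "n > 0 \<Longrightarrow> poly A 0 \<noteq> 0"
  obtains L and I :: "(complex \<times> bool) set" and \<zeta> where "L > 0" "finite I"
    "\<And>i. i \<in> I \<Longrightarrow> \<zeta> i meromorphic_on {0}"
    "\<forall>\<^sub>F s in at 0. proots (fibre_eq A n (1 / s ^ L)) = image_mset (\<lambda>i. \<zeta> i s) (mset_set I)"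
proof -
  define m where "m = degree A - n"
  \<comment> \<open>For \<open>n = 0\<close> no parameter tends to a pole at 0, and
    \<open>n' = 1\<close> keeps \<open>L\<close> positive.\<close>
  define n' where "n' = max n 1"
  define L where "L = m * n'"
  have m: "m > 0" "n' > 0" "n > 0 \<Longrightarrow> n' = n" using A by (auto simp: m_def n'_def)
  let ?R = "reflect_poly A"
  have "lead_coeff A \<noteq> 0" using A(1) by auto
  then have R0: "poly ?R 0 \<noteq> 0" by (simp add: poly_0_coeff_0 coeff_0_reflect_poly)
  have small_disc: "\<exists>r>0. r \<le> 1 \<and> (\<forall>w\<in>ball 0 r. poly p w \<noteq> 0)" if p0: "poly p 0 \<noteq> 0" for p :: "complex poly"
  proof -
    have "isCont (poly p) 0" by simp
    then obtain e where e: "e > 0" "\<And>w. dist 0 w < e \<Longrightarrow> poly p w \<noteq> 0"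
      using continuous_at_avoid[of 0 "poly p" 0] p0 by blast
    show ?thesis by (rule exI[of _ "min e 1"]) (use e in auto)
  qed
  obtain r1 where r1: "r1 > 0" "r1 \<le> 1" "\<And>w. w \<in> ball 0 r1 \<Longrightarrow> poly ?R w \<noteq> 0"
    using small_disc[OF R0] by blast
  obtain \<rho>1 \<kappa>1 where c1: "\<rho>1 > 0" "\<kappa>1 holomorphic_on ball 0 \<rho>1"
    "\<And>s. s \<in> ball 0 \<rho>1 \<Longrightarrow> \<kappa>1 s \<noteq> 0 \<and> s * \<kappa>1 s \<in> ball 0 r1 \<and> (s * \<kappa>1 s) ^ m * (1 / poly ?R (s * \<kappa>1 s)) = s ^ m"
    "inj_on (\<lambda>s. s * \<kappa>1 s) (ball 0 \<rho>1)"
  proof (rule ex_root_chart[of r1 "\<lambda>w. 1 / poly ?R w" m])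
    show "(\<lambda>w. 1 / poly ?R w) holomorphic_on ball 0 r1" using r1(3) by (intro holomorphic_intros) auto
  qed (use r1 m in auto)
  obtain \<rho>2 \<kappa>2 where c2: "\<rho>2 > 0" "\<kappa>2 holomorphic_on ball 0 \<rho>2"
    "\<And>s. n > 0 \<Longrightarrow> s \<in> ball 0 \<rho>2 \<Longrightarrow> \<kappa>2 s \<noteq> 0 \<and> s * \<kappa>2 s \<in> ball 0 1 \<and> poly A (s * \<kappa>2 s) \<noteq> 0
      \<and> (s * \<kappa>2 s) ^ n * (1 / poly A (s * \<kappa>2 s)) = s ^ n"
    "n > 0 \<Longrightarrow> inj_on (\<lambda>s. s * \<kappa>2 s) (ball 0 \<rho>2)"
  proof (cases "n > 0")
    case True
    obtain r2 where r2: "r2 > 0" "r2 \<le> 1" "\<And>w. w \<in> ball 0 r2 \<Longrightarrow> poly A w \<noteq> 0"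
      using small_disc[OF A(2)[OF True]] by blast
    have "(\<lambda>w. 1 / poly A w) holomorphic_on ball 0 r2" using r2(3) by (intro holomorphic_intros) auto
    from ex_root_chart[OF r2(1) this _ True] obtain \<rho> \<kappa> where "\<rho> > 0" "\<kappa> holomorphic_on ball 0 \<rho>"
      "\<And>s. s \<in> ball 0 \<rho> \<Longrightarrow> \<kappa> s \<noteq> 0 \<and> s * \<kappa> s \<in> ball 0 r2 \<and> (s * \<kappa> s) ^ n * (1 / poly A (s * \<kappa> s)) = s ^ n"
      "inj_on (\<lambda>s. s * \<kappa> s) (ball 0 \<rho>)" using r2(3) by auto
    then show ?thesis using that[of \<rho> \<kappa>] r2 by (smt (verit, ccfv_threshold) dist_norm mem_ball)
  next
    case False
    then show ?thesis using that[of 1 "\<lambda>_. 1"] by auto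
  qed
  \<comment> \<open>The flag \<open>True\<close> marks the parameters near infinity, found through
    \<open>w = 1 / z\<close>. The first component is the root of unity that selects one of the
    \<open>m\<close>-th or \<open>n\<close>-th roots of \<open>s ^ L\<close>.\<close>
  define I where "I = {z :: complex. z ^ m = 1} \<times> {True} \<union> (if n > 0 then {z. z ^ n = 1} \<times> {False} else {})"
  define u where "u i s = fst i * s ^ (if snd i then n' else m)" for i :: "complex \<times> bool" and s :: complex
  define \<zeta> where "\<zeta> i s = (if snd i then 1 / (u i s * \<kappa>1 (u i s)) else u i s * \<kappa>2 (u i s))"
    for i :: "complex \<times> bool" and s :: complex
  have finI: "finite I" unfolding I_def using m by (auto intro!: finite_cartesian_product finite_roots_unity)
  have cardI: "card I = degree A"
  proof -
    have "card ({z :: complex. z ^ m = 1} \<times> {True}) = m"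
      using m by (simp add: card_roots_unity_eq card_cartesian_product)
    moreover have "card ({z :: complex. z ^ n = 1} \<times> {False}) = n" if "n > 0"
      using that by (simp add: card_roots_unity_eq card_cartesian_product)
    moreover have "card (S \<times> {True} \<union> T \<times> {False}) = card (S \<times> {True}) + card (T \<times> {False})"
      if "finite S" "finite T" for S T :: "complex set"
      using that by (intro card_Un_disjoint) auto
    ultimately show ?thesis unfolding I_def using A m
      by (auto simp: m_def finite_roots_unity)
  qed
  have norm1: "norm z = 1" if "z ^ k = 1" "k > 0" for z :: complex and k
    using power_eq_1_iff[OF that(1)] that(2) by simp
  have mero: "\<zeta> i meromorphic_on {0}" if "i \<in> I" for i
  proof -
    have an_u: "u i analytic_on {0}" unfolding u_def by (intro analytic_intros)
    have u0: "u i 0 = 0" unfolding u_def using m by simp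
    have "\<kappa>1 analytic_on {0}" "\<kappa>2 analytic_on {0}"
      using c1(1,2) c2(1,2) centre_in_ball open_ball unfolding analytic_at by blast+
    then have "(\<lambda>s. \<kappa>1 (u i s)) analytic_on {0}" "(\<lambda>s. \<kappa>2 (u i s)) analytic_on {0}"
      using analytic_on_compose[OF an_u, of \<kappa>1] analytic_on_compose[OF an_u, of \<kappa>2] u0 by (auto simp: o_def)
    then have "(\<lambda>s. u i s * \<kappa>1 (u i s)) meromorphic_on {0}" "(\<lambda>s. u i s * \<kappa>2 (u i s)) meromorphic_on {0}"
      using an_u by (auto intro!: analytic_on_imp_meromorphic_on analytic_on_mult)
    then show ?thesis
      unfolding \<zeta>_def by (cases "snd i") (auto intro!: meromorphic_on_divide)
  qed
  have "\<forall>\<^sub>F s in at (0::complex). s \<in> ball 0 (min 1 (min \<rho>1 \<rho>2)) - {0}"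
    using c1(1) c2(1) by (intro eventually_at_in_open) auto
  then have "\<forall>\<^sub>F s in at 0. proots (fibre_eq A n (1 / s ^ L)) = image_mset (\<lambda>i. \<zeta> i s) (mset_set I)"
  proof eventually_elim
    case (elim s)
    have s: "s \<noteq> 0" "norm s < 1" "norm s < \<rho>1" "norm s < \<rho>2" using elim by auto
    have u_small: "norm (u i s) \<le> norm s" "u i s \<noteq> 0" if "i \<in> I" for i
    proof -
      have pw: "norm s ^ k \<le> norm s" if "k > 0" for k
        using that s by (metis less_eq_real_def norm_ge_zero power_Suc_le_self gr0_conv_Suc)
      have "norm (fst i) = 1" using \<open>i \<in> I\<close> norm1 m unfolding I_def by (auto split: if_splits)
      then show "norm (u i s) \<le> norm s" "u i s \<noteq> 0"
        using pw m s unfolding u_def by (auto simp: norm_mult norm_power)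
    qed
    have u_ball: "u i s \<in> ball 0 \<rho>1" "u i s \<in> ball 0 \<rho>2" if "i \<in> I" for i
      using u_small(1)[OF that] s by auto
    have u_pow: "u i s ^ m = s ^ L" if "i \<in> I" "snd i" for i
    proof -
      have "fst i ^ m = 1" using that unfolding I_def by (auto split: if_splits)
      then show ?thesis using that unfolding u_def L_def by (simp add: power_mult_distrib mult.commute flip: power_mult)
    qed
    have u_pow': "n > 0" "u i s ^ n = s ^ L" if "i \<in> I" "\<not> snd i" for i
    proof -
      have "n > 0 \<and> fst i ^ n = 1" using that unfolding I_def by (auto split: if_splits)
      then show "n > 0" "u i s ^ n = s ^ L" using that m(3) unfolding u_def L_def
        by (simp_all add: power_mult_distrib flip: power_mult)
    qed
    \<comment> \<open>The unit circle separates the two families, so that the constructed roots are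
      pairwise distinct. There are \<open>degree A\<close> of them, hence no others, and all are
      simple.\<close>
    have big: "norm (\<zeta> i s) > 1" if "i \<in> I" "snd i" for i
    proof -
      have "u i s * \<kappa>1 (u i s) \<noteq> 0" "norm (u i s * \<kappa>1 (u i s)) < 1"
        using c1(3)[OF u_ball(1)[OF that(1)]] u_small(2)[OF that(1)] r1(2) by auto
      then show ?thesis using that(2) unfolding \<zeta>_def by (simp add: norm_divide norm_mult divide_simps)
    qed
    have small: "norm (\<zeta> i s) < 1" if "i \<in> I" "\<not> snd i" for i
      using c2(3)[OF u_pow'(1)[OF that] u_ball(2)[OF that(1)]] that(2) unfolding \<zeta>_def by simp
    have inj: "inj_on (\<lambda>i. \<zeta> i s) I"
    proof (rule inj_onI)
      fix i j assume ij: "i \<in> I" "j \<in> I" "\<zeta> i s = \<zeta> j s"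
      have same: "snd i = snd j" using big small ij by (metis less_asym)
      have "u i s = u j s"
      proof (cases "snd i")
        case True
        then have "u i s * \<kappa>1 (u i s) = u j s * \<kappa>1 (u j s)"
        proof -
          have inv: "a = b" if "1 / a = 1 / b" for a b :: complex
            using that by (simp add: divide_inverse)
          have "snd j" using True same by simp
          show ?thesis by (rule inv) (use ij(3) True \<open>snd j\<close> in \<open>simp only: \<zeta>_def if_True\<close>)
        qed
        then show ?thesis using c1(4) u_ball(1) ij by (metis (mono_tags, lifting) inj_onD)
      next
        case False
        then have "u i s * \<kappa>2 (u i s) = u j s * \<kappa>2 (u j s)"
          using ij(3) same unfolding \<zeta>_def by simp
        then show ?thesis using c2(4)[OF u_pow'(1)[OF ij(1) False]] u_ball(2) ij by (metis (mono_tags, lifting) inj_onD)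
      qed
      then have "fst i = fst j" unfolding u_def using same s(1) by auto
      then show "i = j" using same by (simp add: prod_eq_iff)
    qed
    have root: "poly (fibre_eq A n (1 / s ^ L)) (\<zeta> i s) = 0" if i: "i \<in> I" for i
    proof (cases "snd i")
      case True
      define w where "w = u i s * \<kappa>1 (u i s)"
      have w: "w \<noteq> 0" "w ^ m * (1 / poly ?R w) = s ^ L" "poly ?R w \<noteq> 0" "\<zeta> i s = 1 / w"
        using c1(3)[OF u_ball(1)[OF i]] u_small(2)[OF i] u_pow[OF i True] r1(3) True
        unfolding w_def \<zeta>_def by auto
      have RA: "poly ?R w = w ^ degree A * poly A (1 / w)"
        using poly_reflect_poly_nz[OF w(1), of A] by (simp add: inverse_eq_divide)
      have split: "w ^ degree A = w ^ m * w ^ n" using A unfolding m_def by (simp flip: power_add)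
      have "1 / s ^ L = poly ?R w / w ^ m" using w(1,3) unfolding w(2)[symmetric] by simp
      also have "\<dots> = w ^ n * poly A (1 / w)" unfolding RA split using w(1) by simp
      finally show ?thesis unfolding poly_fibre_eq w(4) using w(1) by (simp add: power_one_over field_simps)
    next
      case False
      have n: "n > 0" using u_pow'[OF i False] by simp
      define z where "z = u i s * \<kappa>2 (u i s)"
      have z: "z \<noteq> 0" "z ^ n * (1 / poly A z) = s ^ L" "poly A z \<noteq> 0" "\<zeta> i s = z"
        using c2(3)[OF n u_ball(2)[OF i]] u_small(2)[OF i] u_pow'[OF i False] False
        unfolding z_def \<zeta>_def by auto
      have "1 / s ^ L = poly A z / z ^ n" using z(1,3) unfolding z(2)[symmetric] by simp
      then show ?thesis unfolding poly_fibre_eq z(4) using z(1) by simp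
    qed
    have "proots (fibre_eq A n (1 / s ^ L)) = mset_set ((\<lambda>i. \<zeta> i s) ` I)"
      using fibre_eq_degree[OF A(1)] finI inj root cardI
      by (intro proots_eq_mset_set) (auto simp: card_image)
    then show ?case using image_mset_mset_set[OF inj] by simp
  qed
  moreover have "L > 0" unfolding L_def using m by simp
  ultimately show thesis using that finI mero by blast
qed

section \<open>Complementary components of a plane curve\<close>

text \<open>Lower bounds for the number of components are carried by finite sets of representatives,
  at most one in each component of the complement.\<close>

definition separated_by :: "complex set \<Rightarrow> complex set \<Rightarrow> bool" where
  "separated_by K W \<longleftrightarrow> finite W \<and> W \<inter> K = {} \<and>
     (\<forall>w\<in>W. \<forall>w'\<in>W. connected_component (- K) w w' \<longrightarrow> w = w')"

text \<open>Components of \<open>- K\<close> are open, so none fits into \<open>K'\<close> and each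
  representative can be moved off \<open>K'\<close> inside its own component. Enlarging
  \<open>K\<close> cannot connect what was separate.\<close>

lemma separated_by_superset:
  assumes "separated_by K W" "K \<subseteq> K'" "closed K" "interior K' = {}"
  shows "\<exists>W'. separated_by K' W' \<and> card W' = card W"
proof -
  have "\<exists>x. connected_component (- K) w x \<and> x \<notin> K'" if "w \<in> W" for w
  proof (rule ccontr)
    assume "\<not> ?thesis"
    then have "connected_component_set (- K) w \<subseteq> K'" by auto
    moreover have "open (connected_component_set (- K) w)"
      using assms(3) by (intro open_connected_component) auto
    ultimately have "connected_component_set (- K) w \<subseteq> interior K'" by (rule interior_maximal)
    moreover have "w \<in> connected_component_set (- K) w"
      using that assms(1) by (auto simp: separated_by_def connected_component_refl_eq)
    ultimately show False using assms(4) by blast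
  qed
  then obtain f where f: "\<And>w. w \<in> W \<Longrightarrow> connected_component (- K) w (f w)" "\<And>w. w \<in> W \<Longrightarrow> f w \<notin> K'"
    by metis
  have sep: "w = w'" if "w \<in> W" "w' \<in> W" "connected_component (- K) (f w) (f w')" for w w'
    using assms(1) f(1) that unfolding separated_by_def
    by (meson connected_component_sym connected_component_trans)
  have "inj_on f W"
    by (rule inj_onI) (metis sep f(1) connected_component_refl_eq connected_component_in)
  then have "card (f ` W) = card W" by (rule card_image)
  moreover have "separated_by K' (f ` W)"
    unfolding separated_by_def
  proof (intro conjI ballI impI)
    show "finite (f ` W)" using assms(1) by (simp add: separated_by_def)
    show "f ` W \<inter> K' = {}" using f(2) by auto
    fix v v' assume v: "v \<in> f ` W" "v' \<in> f ` W" "connected_component (- K') v v'"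
    then have "connected_component (- K) v v'"
      using assms(2) connected_component_of_subset[of "- K'" v v' "- K"] by auto
    then show "v = v'" using v sep by auto
  qed
  ultimately show ?thesis by blast
qed

text \<open>Attaching a cross-cut splits a component: together with an arc inside \<open>K\<close> it forms a
  Jordan curve, both of whose sides are seen from an interior point of the cross-cut.\<close>

lemma separated_by_cross_cut:
  assumes K: "compact K" "path_connected K" and g: "arc g"
    and ends: "path_image g \<inter> K = {pathstart g, pathfinish g}"
    and W: "separated_by K W"
  shows "\<exists>W'. separated_by (K \<union> path_image g) W' \<and> card W' \<ge> Suc (card W)"
proof -
  have ne: "pathfinish g \<noteq> pathstart g" using arc_distinct_ends[OF g] by simp
  have "pathstart g \<in> K" "pathfinish g \<in> K" using ends by auto
  then obtain h where h: "arc h" "path_image h \<subseteq> K" "pathstart h = pathfinish g" "pathfinish h = pathstart g"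
    using K(2) ne unfolding path_connected_arcwise by metis
  define c where "c = g +++ h"
  have sc: "simple_path c" "pathfinish c = pathstart c"
    unfolding c_def using g h ends by (auto intro!: simple_path_join_loop)
  have pc: "path_image c = path_image g \<union> path_image h"
    unfolding c_def using h(3) by (simp add: path_image_join)
  note J = Jordan_inside_outside[OF sc]
  define q where "q = g (1/2)"
  have q: "q \<in> path_image g" "q \<noteq> pathstart g" "q \<noteq> pathfinish g"
    using g unfolding q_def arc_def inj_on_def path_image_def pathstart_def pathfinish_def by force+
  then have "q \<in> - K" using ends by blast
  moreover have "open (- K)" by (rule open_Compl[OF compact_imp_closed[OF K(1)]])
  ultimately obtain r where r: "r > 0" "ball q r \<subseteq> - K" by (meson openE)
  have "q \<in> frontier (inside (path_image c))" "q \<in> frontier (outside (path_image c))"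
    using J q(1) pc by auto
  \<comment> \<open>Close to an interior point of the cross-cut lie points on both sides of the
    Jordan curve, within one and the same component of \<open>- K\<close>.\<close>
  then obtain i j where ij: "i \<in> ball q r" "i \<in> inside (path_image c)" "j \<in> ball q r" "j \<in> outside (path_image c)"
    using r(1) unfolding frontier_straddle by (auto simp: dist_commute) metis
  define U where "U = connected_component_set (- K) q"
  have qU: "connected_component (- K) q x" if "x \<in> ball q r" for x
    using r that by (intro connected_componentI[of "ball q r"]) auto
  have notin: "i \<notin> K \<union> path_image g" "j \<notin> K \<union> path_image g"
  proof -
    have "i \<notin> path_image c" "j \<notin> path_image c"
      using ij inside_no_overlap[of "path_image c"] outside_no_overlap[of "path_image c"] by blast+
    then show "i \<notin> K \<union> path_image g" "j \<notin> K \<union> path_image g" using ij(1,3) r(2) pc by blast+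
  qed
  have nij: "\<not> connected_component (- (K \<union> path_image g)) i j"
  proof
    assume "connected_component (- (K \<union> path_image g)) i j"
    then have "connected_component (- path_image c) i j"
      using connected_component_of_subset[of "- (K \<union> path_image g)" i j "- path_image c"] pc h(2) by auto
    then have "connected_component_set (- path_image c) i = connected_component_set (- path_image c) j"
      using connected_component_eq[of j "- path_image c" i] by simp
    then show False using ij(2,4) unfolding inside_def outside_def by simp
  qed
  have arcU: "path_image g - {pathstart g, pathfinish g} \<subseteq> U"
  proof -
    have "connected (path_image g - {pathstart g, pathfinish g})"
      using connected_simple_path_endless[OF arc_imp_simple_path[OF g]] .
    moreover have "path_image g - {pathstart g, pathfinish g} \<subseteq> - K" using ends by blast
    ultimately show ?thesis unfolding U_def using q by (intro connected_component_maximal) auto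
  qed
  \<comment> \<open>At most one point of \<open>W\<close> lies in the divided component. It gives
    way to \<open>i\<close> and \<open>j\<close>, so the count grows by at least one.\<close>
  define W' where "W' = (W - U) \<union> {i, j}"
  have finW: "finite W" using W by (simp add: separated_by_def)
  have iU: "i \<in> U" "j \<in> U" unfolding U_def using qU ij by auto
  have WU: "w \<notin> K" if "w \<in> W" for w using that W by (auto simp: separated_by_def)
  have "separated_by (K \<union> path_image g) W'"
    unfolding separated_by_def
  proof (intro conjI ballI impI)
    show "finite W'" unfolding W'_def using finW by simp
    have "w \<notin> path_image g" if "w \<in> W - U" for w
      using that arcU WU ends by blast
    then show "W' \<inter> (K \<union> path_image g) = {}" unfolding W'_def using notin WU by blast
    fix w w' assume w: "w \<in> W'" "w' \<in> W'" "connected_component (- (K \<union> path_image g)) w w'"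
    then have cc: "connected_component (- K) w w'"
      using connected_component_of_subset[of "- (K \<union> path_image g)" w w' "- K"] by auto
    have "w \<in> U \<longleftrightarrow> w' \<in> U"
      using cc unfolding U_def by (metis connected_component_sym connected_component_trans mem_Collect_eq)
    then consider "w \<in> W" "w' \<in> W" | "w \<in> {i, j}" "w' \<in> {i, j}"
      using w iU unfolding W'_def by auto
    then show "w = w'"
    proof cases
      case 1
      then show ?thesis using W cc unfolding separated_by_def by blast
    next
      case 2
      then show ?thesis using w(3) nij connected_component_sym by blast
    qed
  qed
  moreover have "card W' \<ge> Suc (card W)"
  proof -
    have "i \<noteq> j" using ij inside_Int_outside[of "path_image c"] by blast
    then have "card W' = card (W - U) + 2"
      unfolding W'_def using finW iU by (subst card_Un_disjoint) auto
    moreover have "w = w'" if "w \<in> W \<inter> U" "w' \<in> W \<inter> U" for w w'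
      using that W unfolding U_def separated_by_def
      by (metis IntD1 IntD2 connected_component_sym connected_component_trans mem_Collect_eq)
    then have "card (W \<inter> U) \<le> Suc 0" using finW by (subst card_le_Suc0_iff_eq) auto
    moreover have "card W = card (W - U) + card (W \<inter> U)"
    proof -
      have "W - U \<union> W \<inter> U = W" by blast
      moreover have "card (W - U \<union> W \<inter> U) = card (W - U) + card (W \<inter> U)"
        using finW by (intro card_Un_disjoint) auto
      ultimately show ?thesis by simp
    qed
    ultimately show ?thesis by simp
  qed
  ultimately show ?thesis by blast
qed

text \<open>Induction on the number of parameters at which the curve returns to an earlier point.
  The piece just before the last return \<open>u\<close> is a cross-cut of the curve drawn so far.
  What follows \<open>u\<close> is merely added as a set with empty interior.\<close>

lemma separated_by_curve:
  fixes \<gamma> :: "real \<Rightarrow> complex"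
  assumes cont: "continuous_on {a..b} \<gamma>"
    and fin: "finite {t \<in> {a..b}. \<exists>s\<in>{a..b}. s \<noteq> t \<and> \<gamma> s = \<gamma> t}"
    and int: "interior (\<gamma> ` {a..b}) = {}"
    and t: "t \<in> {a..b}"
  shows "\<exists>W. separated_by (\<gamma> ` {a..t}) W \<and> card W \<ge> Suc (card {u \<in> {a..t}. \<exists>s\<in>{a..<u}. \<gamma> s = \<gamma> u})"
  using t
proof (induction "card {u \<in> {a..t}. \<exists>s\<in>{a..<u}. \<gamma> s = \<gamma> u}" arbitrary: t rule: less_induct)
  case less
  define Co where "Co = {t \<in> {a..b}. \<exists>s\<in>{a..b}. s \<noteq> t \<and> \<gamma> s = \<gamma> t}"
  define V where "V t = {u \<in> {a..t}. \<exists>s\<in>{a..<u}. \<gamma> s = \<gamma> u}" for t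
  have V_Co: "V t \<subseteq> Co" if "t \<le> b" for t using that unfolding V_def Co_def by force
  have finV: "finite (V t)" if "t \<le> b" for t using V_Co[OF that] fin unfolding Co_def by (rule finite_subset)
  have compact: "compact (\<gamma> ` {a..t})" if "t \<le> b" for t
    using that by (intro compact_continuous_image continuous_on_subset[OF cont]) auto
  show ?case
  proof (cases "V t = {}")
    case True
    have "bounded (\<gamma> ` {a..t})" using compact less(2) by (simp add: compact_imp_bounded)
    then obtain w where "w \<notin> \<gamma> ` {a..t}"
      by (metis UNIV_eq_I not_bounded_UNIV)
    then have "separated_by (\<gamma> ` {a..t}) {w}" unfolding separated_by_def by auto
    moreover have "card {u \<in> {a..t}. \<exists>s\<in>{a..<u}. \<gamma> s = \<gamma> u} = 0"
      using True unfolding V_def by (simp only: card.empty)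
    ultimately show ?thesis by (intro exI[of _ "{w}"]) simp
  next
    case False
    define u where "u = Max (V t)"
    have uV: "u \<in> V t" "\<And>v. v \<in> V t \<Longrightarrow> v \<le> u"
      using Max_in[OF finV False] Max_ge[OF finV] less(2) unfolding u_def by auto
    then obtain s where s: "a \<le> s" "s < u" "u \<le> t" "\<gamma> s = \<gamma> u" unfolding V_def by auto
    have ub: "u \<le> b" "t \<le> b" using s less(2) by auto
    define L where "L = {x \<in> Co. x < u}"
    have "finite L" by (rule finite_subset[OF _ fin]) (auto simp: L_def Co_def)
    moreover have "s \<in> L" using s ub unfolding L_def Co_def by auto
    ultimately have L: "finite L" "s \<in> L" by auto
    define m where "m = Max L"
    have m: "m < u" "\<And>x. x \<in> Co \<Longrightarrow> x < u \<Longrightarrow> x \<le> m" "s \<le> m"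
    proof -
      have "m \<in> L" using Max_in[OF L(1)] L(2) unfolding m_def by blast
      then show "m < u" unfolding L_def by blast
      show "x \<le> m" if "x \<in> Co" "x < u" for x
        using Max_ge[OF L(1), of x] that unfolding m_def L_def by blast
      show "s \<le> m" using Max_ge[OF L(1) L(2)] unfolding m_def .
    qed
    \<comment> \<open>All coincidences before \<open>u\<close> occur up to \<open>m\<close>. The arc
      from \<open>p\<close> to \<open>u\<close> is therefore injective and meets the earlier curve
      only at its ends, and \<open>V p\<close> has lost just \<open>u\<close>.\<close>
    define p where "p = (m + u) / 2"
    have p: "m < p" "p < u" "a \<le> p" using m s unfolding p_def by auto
    have pCo: "x \<notin> Co" if "p \<le> x" "x < u" for x using m(2)[of x] p that by auto
    have Vp: "V p = V t - {u}"
    proof (intro equalityI subsetI)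
      fix x assume "x \<in> V p"
      then show "x \<in> V t - {u}" using p s unfolding V_def by auto
    next
      fix x assume x: "x \<in> V t - {u}"
      then have "x < u" using uV(2)[of x] by auto
      moreover have "x \<in> Co" using x V_Co ub by auto
      ultimately have "x \<le> p" using m(2) p by force
      then show "x \<in> V p" using x unfolding V_def by auto
    qed
    have card_Vp: "Suc (card (V p)) = card (V t)"
      unfolding Vp using finV[OF ub(2)] uV(1) by (metis card_Suc_Diff1)
    obtain W where W: "separated_by (\<gamma> ` {a..p}) W" "card W \<ge> Suc (card (V p))"
      using less(1)[of p] card_Vp p ub unfolding V_def by auto
    define g where "g x = \<gamma> (p + x * (u - p))" for x
    have img: "(\<lambda>x. p + x * (u - p)) ` {0..1} = {p..u}"
    proof (intro equalityI subsetI)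
      fix y assume "y \<in> (\<lambda>x. p + x * (u - p)) ` {0..1}"
      then obtain x where x: "x \<in> {0..1}" "y = p + x * (u - p)" by blast
      then have "y = p + x * (u - p)" "0 \<le> x" "x \<le> 1" by auto
      moreover have "x * (u - p) \<le> 1 * (u - p)" using calculation p by (intro mult_right_mono) auto
      moreover have "0 \<le> x * (u - p)" using calculation p by simp
      ultimately show "y \<in> {p..u}" by auto
    next
      fix y assume "y \<in> {p..u}"
      then show "y \<in> (\<lambda>x. p + x * (u - p)) ` {0..1}"
        using p by (intro image_eqI[of _ _ "(y - p) / (u - p)"]) (auto simp: field_simps)
    qed
    have pg: "path_image g = \<gamma> ` {p..u}"
      unfolding path_image_def g_def img[symmetric] by (simp add: image_image)
    have inj: "x = y" if "x \<in> {p..u}" "y \<in> {p..u}" "\<gamma> x = \<gamma> y" for x y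
    proof (rule ccontr)
      assume "x \<noteq> y"
      then have "x \<in> Co" "y \<in> Co" using that p ub unfolding Co_def by auto
      then show False using pCo[of x] pCo[of y] that \<open>x \<noteq> y\<close> by force
    qed
    have "arc g"
      unfolding arc_def path_def
    proof
      have "continuous_on {p..u} \<gamma>" using cont p ub by (auto intro: continuous_on_subset)
      then show "continuous_on {0..1} g" unfolding g_def
        by (rule continuous_on_compose2[of "{p..u}" \<gamma> "{0..1}" "\<lambda>x. p + x * (u - p)"])
          ((intro continuous_on_add continuous_on_mult continuous_on_const continuous_on_id)?, simp only: img order_refl)
      show "inj_on g {0..1}"
      proof (rule inj_onI)
        fix x y :: real assume xy: "x \<in> {0..1}" "y \<in> {0..1}" "g x = g y"
        then have "p + x * (u - p) \<in> {p..u}" "p + y * (u - p) \<in> {p..u}" using img by blast+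
        then have "p + x * (u - p) = p + y * (u - p)"
          using xy(3) unfolding g_def by (rule inj)
        then show "x = y" using p by simp
      qed
    qed
    moreover have st: "pathstart g = \<gamma> p" "pathfinish g = \<gamma> u"
      by (simp_all add: pathstart_def pathfinish_def g_def)
    moreover have "path_image g \<inter> \<gamma> ` {a..p} = {pathstart g, pathfinish g}"
    proof (intro equalityI subsetI)
      fix z assume "z \<in> path_image g \<inter> \<gamma> ` {a..p}"
      then obtain x y where xy: "x \<in> {p..u}" "z = \<gamma> x" "y \<in> {a..p}" "z = \<gamma> y" unfolding pg by auto
      have "x = p \<or> x = u"
      proof (rule ccontr)
        assume "\<not> ?thesis"
        then have "y \<noteq> x" "x \<in> {a..b}" "y \<in> {a..b}" "\<gamma> y = \<gamma> x" using xy ub p by auto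
        then have "x \<in> Co" unfolding Co_def by blast
        then show False using pCo[of x] xy \<open>\<not> (x = p \<or> x = u)\<close> by auto
      qed
      then show "z \<in> {pathstart g, pathfinish g}" using xy st by auto
    next
      fix z assume "z \<in> {pathstart g, pathfinish g}"
      moreover have "\<gamma> u \<in> \<gamma> ` {a..p}" using s m p by (metis atLeastAtMost_iff image_eqI less_le_not_le order_trans)
      ultimately show "z \<in> path_image g \<inter> \<gamma> ` {a..p}" unfolding pg st using p by auto
    qed
    moreover have "path_connected (\<gamma> ` {a..p})"
      using p ub by (intro path_connected_continuous_image continuous_on_subset[OF cont])
        (auto simp: convex_imp_path_connected)
    ultimately obtain W' where W': "separated_by (\<gamma> ` {a..p} \<union> path_image g) W'" "card W' \<ge> Suc (card W)"
      using separated_by_cross_cut[of "\<gamma> ` {a..p}" g W] compact[of p] p ub W(1) by auto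
    have "\<gamma> ` {a..p} \<union> path_image g = \<gamma> ` {a..u}"
      unfolding pg using p by (simp add: image_Un[symmetric] ivl_disj_un_two_touch(4))
    then have un: "separated_by (\<gamma> ` {a..u}) W'" using W'(1) by simp
    have "\<exists>W''. separated_by (\<gamma> ` {a..t}) W'' \<and> card W'' = card W'"
    proof (rule separated_by_superset[OF un])
      show "\<gamma> ` {a..u} \<subseteq> \<gamma> ` {a..t}" using s by (intro image_mono) auto
      show "closed (\<gamma> ` {a..u})" using compact[OF ub(1)] by (rule compact_imp_closed)
      have "\<gamma> ` {a..t} \<subseteq> \<gamma> ` {a..b}" using ub by (intro image_mono) auto
      then show "interior (\<gamma> ` {a..t}) = {}" using int interior_mono by blast
    qed
    then obtain W'' where W'': "separated_by (\<gamma> ` {a..t}) W''" "card W'' = card W'" by blast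
    have "card W'' \<ge> Suc (card (V t))" using W''(2) W'(2) W(2) card_Vp by linarith
    with W''(1) show ?thesis unfolding V_def by blast
  qed
qed

text \<open>At most one of the represented components is unbounded; the surplus of one in
  \<open>separated_by_curve\<close> pays for it.\<close>

lemma bounded_components_curve:
  fixes \<gamma> :: "real \<Rightarrow> complex"
  assumes "a \<le> b" and cont: "continuous_on {a..b} \<gamma>"
    and fin: "finite {t \<in> {a..b}. \<exists>s\<in>{a..b}. s \<noteq> t \<and> \<gamma> s = \<gamma> t}"
    and int: "interior (\<gamma> ` {a..b}) = {}"
  shows "\<exists>\<U>. finite \<U> \<and> card \<U> \<ge> card {u \<in> {a..b}. \<exists>s\<in>{a..<u}. \<gamma> s = \<gamma> u} \<and>
    (\<forall>U\<in>\<U>. U \<in> components (- \<gamma> ` {a..b}) \<and> bounded U)"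
proof -
  let ?K = "\<gamma> ` {a..b}"
  obtain W where W: "separated_by ?K W" "card W \<ge> Suc (card {u \<in> {a..b}. \<exists>s\<in>{a..<u}. \<gamma> s = \<gamma> u})"
    using separated_by_curve[OF cont fin int, of b] assms(1) by auto
  have finW: "finite W" using W(1) by (simp add: separated_by_def)
  have "compact ?K" using cont by (intro compact_continuous_image) auto
  then have bK: "bounded (- (- ?K))" by (simp add: compact_imp_bounded)
  define f where "f w = connected_component_set (- ?K) w" for w
  have comp: "f w \<in> components (- ?K)" if "w \<in> W" for w
    using that W(1) unfolding f_def separated_by_def by (auto intro!: componentsI)
  have inj: "inj_on f W"
  proof (rule inj_onI)
    fix w w' assume w: "w \<in> W" "w' \<in> W" "f w = f w'"
    have "w' \<in> f w'" using w W(1) unfolding f_def separated_by_def by (auto simp: connected_component_refl_eq)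
    then have "connected_component (- ?K) w w'" using w(3) unfolding f_def by auto
    then show "w = w'" using W(1) w unfolding separated_by_def by blast
  qed
  have "U = U'" if "U \<in> f ` W" "U' \<in> f ` W" "\<not> bounded U" "\<not> bounded U'" for U U'
    using that comp cobounded_unique_unbounded_components[OF bK] by (metis DIM_complex image_iff le_refl)
  then have "card {U \<in> f ` W. \<not> bounded U} \<le> 1"
    using finW by (subst One_nat_def, subst card_le_Suc0_iff_eq) auto
  moreover have "card (f ` W) = card {U \<in> f ` W. bounded U} + card {U \<in> f ` W. \<not> bounded U}"
    using finW by (subst card_Un_disjoint[symmetric]) (auto intro!: arg_cong[of _ _ card])
  moreover have "card (f ` W) = card W" using inj by (rule card_image)
  ultimately have "card {U \<in> f ` W. bounded U} \<ge> card {u \<in> {a..b}. \<exists>s\<in>{a..<u}. \<gamma> s = \<gamma> u}"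
    using W(2) by linarith
  then show ?thesis using finW comp by (intro exI[of _ "{U \<in> f ` W. bounded U}"]) auto
qed

section \<open>Parametrized curves\<close>

text \<open>Along the parametrization a polynomial in \<open>x\<close>, \<open>y\<close> becomes a
  Laurent polynomial. For \<open>n = 0\<close> the exponent is required to be 0, since 0 is then a
  parameter and \<open>z ^ e\<close> must not vanish there.\<close>

lemma ex_laurent_numerator:
  fixes A B :: "complex poly" and n :: nat
  defines "\<Omega> \<equiv> {z. n = 0 \<or> z \<noteq> 0}" and "X \<equiv> \<lambda>z. poly A z / z ^ n" and "Y \<equiv> \<lambda>z. poly B z / z ^ n"
  shows "\<exists>E e. (n = 0 \<longrightarrow> e = 0) \<and> (\<forall>z\<in>\<Omega>. poly E z = z ^ e * eval2 H (X z, Y z))"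
proof (induction H rule: pCons_induct)
  case 0
  show ?case by (rule exI[of _ 0], rule exI[of _ 0]) simp
next
  case (pCons a H)
  have numerators: "poly A z = X z * z ^ n" "poly B z = Y z * z ^ n" if "z \<in> \<Omega>" for z
    using that by (auto simp: \<Omega>_def X_def Y_def)
  obtain E e where E: "n = 0 \<longrightarrow> e = 0" "\<And>z. z \<in> \<Omega> \<Longrightarrow> poly E z = z ^ e * eval2 H (X z, Y z)"
    using pCons(2) by blast
  have "\<exists>E e. (n = 0 \<longrightarrow> e = 0) \<and> (\<forall>z\<in>\<Omega>. poly E z = z ^ e * poly a (X z))"
  proof (induction a rule: pCons_induct)
    case 0
    show ?case by (rule exI[of _ 0], rule exI[of _ 0]) simp
  next
    case (pCons c a)
    obtain E e where E: "n = 0 \<longrightarrow> e = 0" "\<And>z. z \<in> \<Omega> \<Longrightarrow> poly E z = z ^ e * poly a (X z)"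
      using pCons(2) by blast
    have "poly (monom c (e + n) + A * E) z = z ^ (e + n) * poly (pCons c a) (X z)" if "z \<in> \<Omega>" for z
      using E(2)[OF that] numerators(1)[OF that] by (simp add: poly_monom power_add algebra_simps)
    then show ?case using E(1) by (intro exI[of _ "monom c (e + n) + A * E"] exI[of _ "e + n"]) auto
  qed
  then obtain E' e' where E': "n = 0 \<longrightarrow> e' = 0" "\<And>z. z \<in> \<Omega> \<Longrightarrow> poly E' z = z ^ e' * poly a (X z)"
    by blast
  have "poly (monom 1 (e + n) * E' + monom 1 e' * B * E) z = z ^ (e + n + e') * eval2 (pCons a H) (X z, Y z)"
    if "z \<in> \<Omega>" for z
    using E(2)[OF that] E'(2)[OF that] numerators(2)[OF that]
    by (simp add: poly_monom power_add algebra_simps)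
  then show ?case using E(1) E'(1)
    by (intro exI[of _ "monom 1 (e + n) * E' + monom 1 e' * B * E"] exI[of _ "e + n + e'"]) auto
qed

text \<open>The parametrization is \<open>z \<mapsto> (A(z)/z\<^sup>n, B(z)/z\<^sup>n)\<close>, on the complex line for \<open>n = 0\<close>
  and on the punctured line otherwise; \<open>\<sigma>\<close> is the antiholomorphic involution whose fixed points, the
  real line or the unit circle, are the real parameters.\<close>

locale param_curve =
  fixes G :: "complex poly poly" and A B :: "complex poly" and n :: nat
    and \<Omega> :: "complex set" and X Y :: "complex \<Rightarrow> complex" and \<phi> :: "complex \<Rightarrow> complex \<times> complex"
    and \<sigma> :: "complex \<Rightarrow> complex"
  defines "\<Omega> \<equiv> {z. n = 0 \<or> z \<noteq> 0}"
    and "X \<equiv> \<lambda>z. poly A z / z ^ n" and "Y \<equiv> \<lambda>z. poly B z / z ^ n"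
    and "\<phi> \<equiv> \<lambda>z. (X z, Y z)"
    and "\<sigma> \<equiv> \<lambda>z. if n = 0 then cnj z else inverse (cnj z)"
  assumes real_G: "conj2 G = G"
    and squarefree_G: "squarefree G"
    and zero_locus_G: "zero_locus G = \<phi> ` \<Omega>"
    and \<phi>_\<sigma>: "z \<in> \<Omega> \<Longrightarrow> \<phi> (\<sigma> z) = (cnj (X z), cnj (Y z))"
    and inj_real: "\<exists>F0. finite F0 \<and> inj_on \<phi> ({z \<in> \<Omega>. \<sigma> z = z} - F0)"
    and nodes: "p \<in> singular_points G \<Longrightarrow> real_tangent_pair G p"

text \<open>The conditions give the first coordinate a pole at each end of the parameter domain. It
  is then proper, and every \<open>x\<close> has \<open>degree A\<close> parameters counted with
  multiplicity.\<close>

locale proper_param_curve = param_curve +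
  assumes degree_A: "n < degree A" and A_0: "n > 0 \<Longrightarrow> poly A 0 \<noteq> 0"

text \<open>At a node the second derivative in \<open>y\<close> is the coefficient of
  \<open>t ^ 2\<close> in the equation for the tangent slopes \<open>t\<close>; if it is nonzero,
  both slopes are finite.\<close>

locale nonvertical_param_curve = proper_param_curve +
  assumes not_vertical: "p \<in> singular_points G \<Longrightarrow> eval2 (partial_y (partial_y G)) p \<noteq> 0"

context param_curve
begin

lemma \<Omega>_pow: "z \<in> \<Omega> \<Longrightarrow> z ^ n \<noteq> 0"
  by (auto simp: \<Omega>_def)

lemma numerators: "z \<in> \<Omega> \<Longrightarrow> poly A z = X z * z ^ n" "z \<in> \<Omega> \<Longrightarrow> poly B z = Y z * z ^ n"
  using \<Omega>_pow by (auto simp: X_def Y_def)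

lemma \<sigma>_in: "z \<in> \<Omega> \<Longrightarrow> \<sigma> z \<in> \<Omega>"
  by (auto simp: \<Omega>_def \<sigma>_def)

lemma \<sigma>_\<sigma>: "\<sigma> (\<sigma> z) = z"
  by (auto simp: \<sigma>_def)

lemma eval2_G_\<phi>: "z \<in> \<Omega> \<Longrightarrow> eval2 G (X z, Y z) = 0"
  using zero_locus_G unfolding zero_locus_def \<phi>_def by blast

lemma open_\<Omega>: "open \<Omega>"
proof (cases "n = 0")
  case False
  then have "\<Omega> = - {0}" by (auto simp: \<Omega>_def)
  then show ?thesis by auto
qed (simp add: \<Omega>_def)

lemma infinite_\<Omega>: "infinite \<Omega>"
proof -
  have "- {0} \<subseteq> \<Omega>" by (auto simp: \<Omega>_def)
  moreover have "infinite (- {0 :: complex})"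
    using infinite_UNIV_char_0[where 'a = complex] by (simp add: Compl_eq_Diff_UNIV)
  ultimately show ?thesis using finite_subset by blast
qed

lemma ex_numerator:
  "\<exists>E e. (n = 0 \<longrightarrow> e = 0) \<and> (\<forall>z\<in>\<Omega>. poly E z = z ^ e * eval2 H (X z, Y z))"
  unfolding \<Omega>_def X_def Y_def by (rule ex_laurent_numerator)

lemma \<Omega>_pow_e: "z \<in> \<Omega> \<Longrightarrow> (n = 0 \<longrightarrow> e = 0) \<Longrightarrow> z ^ e \<noteq> 0"
  by (auto simp: \<Omega>_def)

text \<open>Polynomials in one variable form a domain, and passing to numerators carries this over
  to functions on the curve.\<close>

lemma \<phi>_irreducible:
  assumes "\<And>p. p \<in> \<phi> ` \<Omega> \<Longrightarrow> eval2 H p * eval2 K p = 0"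
  shows "(\<forall>p\<in>\<phi> ` \<Omega>. eval2 H p = 0) \<or> (\<forall>p\<in>\<phi> ` \<Omega>. eval2 K p = 0)"
proof -
  obtain E e where E: "n = 0 \<longrightarrow> e = 0" "\<And>z. z \<in> \<Omega> \<Longrightarrow> poly E z = z ^ e * eval2 H (X z, Y z)"
    using ex_numerator by blast
  obtain E' e' where E': "n = 0 \<longrightarrow> e' = 0" "\<And>z. z \<in> \<Omega> \<Longrightarrow> poly E' z = z ^ e' * eval2 K (X z, Y z)"
    using ex_numerator by blast
  have "poly (E * E') z = 0" if "z \<in> \<Omega>" for z
    using assms[of "\<phi> z"] that unfolding \<phi>_def by (auto simp: E(2) E'(2))
  then have "E * E' = 0" using infinite_\<Omega> by (rule poly_infinite_roots_eq_0[rotated])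
  then consider "E = 0" | "E' = 0" by auto
  then show ?thesis
  proof cases
    case 1
    then have "eval2 H (X z, Y z) = 0" if "z \<in> \<Omega>" for z
      using E(2)[OF that] \<Omega>_pow_e[OF that E(1)] by (metis mult_eq_0_iff poly_0)
    then show ?thesis unfolding \<phi>_def by auto
  next
    case 2
    then have "eval2 K (X z, Y z) = 0" if "z \<in> \<Omega>" for z
      using E'(2)[OF that] \<Omega>_pow_e[OF that E'(1)] by (metis mult_eq_0_iff poly_0)
    then show ?thesis unfolding \<phi>_def by auto
  qed
qed

end

text \<open>The equation is the norm of \<open>y - Y\<close> over the field of rational functions of \<open>x\<close>.\<close>

lemma ex_locus_equation:
  fixes A B :: "complex poly"
  assumes "n < degree A" "n > 0 \<Longrightarrow> poly A 0 \<noteq> 0"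
  obtains F c where "c \<noteq> 0" "degree F = degree A" "lead_coeff F = [:c:]"
    "\<And>x. fibre_poly F x = Polynomial.smult c (\<Prod>z\<in>#proots (fibre_eq A n x). [:- (poly B z / z ^ n), 1:])"
proof -
  \<comment> \<open>The outer variable is \<open>z\<close>: \<open>P\<close> stands for
    \<open>A - x * z ^ n\<close> and \<open>K\<close> for \<open>y * z ^ n - B\<close>, as
    polynomials in \<open>z\<close> over the polynomials in \<open>x\<close> and
    \<open>y\<close>.\<close>
  define P :: "complex poly poly poly" where
    "P = map_poly (\<lambda>a. [:[:a:]:]) A - monom [:[:0, 1:]:] n"
  define K :: "complex poly poly poly" where
    "K = monom [:0, 1:] n - map_poly (\<lambda>a. [:[:a:]:]) B"
  have eP: "map_poly (\<lambda>H. eval2 H (x, y)) P = fibre_eq A n x"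
    and eK: "map_poly (\<lambda>H. eval2 H (x, y)) K = monom y n - B" for x y
    by (rule poly_eqI; simp add: P_def K_def fibre_eq_def coeff_map_poly)+
  have cP: "coeff P (degree A) = [:[:lead_coeff A:]:]"
    using assms(1) by (simp add: P_def coeff_map_poly)
  have lcA: "lead_coeff A \<noteq> 0" using assms(1) by auto
  have "degree P \<le> degree A"
    unfolding P_def using assms(1)
    by (intro degree_diff_le degree_map_poly_le order.trans[OF degree_monom_le]) auto
  moreover have "degree A \<le> degree P" using cP lcA by (intro le_degree) simp
  ultimately have dP: "degree P = degree A" by simp
  then have lcP: "lead_coeff P = [:[:lead_coeff A:]:]" using cP by simp
  define F where "F = norm_poly P K"
  define k where "k = lead_coeff A ^ (degree P + Suc (degree K))"
  \<comment> \<open>By Vieta the product of \<open>z ^ n\<close> over a fibre is free of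
    \<open>x\<close>, because for \<open>n > 0\<close> the constant term \<open>A 0\<close> is.
    Replacing \<open>y * z ^ n - B z\<close> by \<open>y - B z / z ^ n\<close> thus costs only a
    constant.\<close>
  define c where "c = k * ((- 1) ^ degree A * poly A 0 / lead_coeff A) ^ n"
  have c0: "c \<noteq> 0" unfolding c_def k_def using lcA assms(2) by (cases "n = 0") auto
  have prod_roots: "(\<Prod>z\<in>#proots (fibre_eq A n x). z ^ n) = ((- 1) ^ degree A * poly A 0 / lead_coeff A) ^ n" for x
  proof (cases "n = 0")
    case False
    have "poly A 0 = lead_coeff A * (\<Prod>a\<in>#proots (fibre_eq A n x). - a)"
      using poly_eq_prod_proots[OF fibre_eq_degree(3)[OF assms(1)], of x 0] False
      unfolding fibre_eq_degree(2)[OF assms(1)] poly_fibre_eq by (simp add: zero_power)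
    also have "(\<Prod>a\<in>#proots (fibre_eq A n x). - a) = (- 1) ^ degree A * (\<Prod>a\<in>#proots (fibre_eq A n x). a)"
    proof -
      have "(\<Prod>a\<in>#M. - a) = (- 1) ^ size M * (\<Prod>a\<in>#M. a)" for M :: "complex multiset"
        by (induction M) auto
      then show ?thesis using fibre_eq_degree(1)[OF assms(1)] by (simp add: size_proots_complex)
    qed
    finally have "(\<Prod>a\<in>#proots (fibre_eq A n x). a) = (- 1) ^ degree A * poly A 0 / lead_coeff A"
      using lcA by (simp add: field_simps flip: power_mult_distrib)
    moreover have "(\<Prod>z\<in>#M. z ^ n) = (\<Prod>z\<in>#M. z) ^ n" for M :: "complex multiset"
      by (induction M) (auto simp: power_mult_distrib)
    ultimately show ?thesis by simp
  qed simp
  have eF: "eval2 F (x, y) = c * (\<Prod>z\<in>#proots (fibre_eq A n x). y - poly B z / z ^ n)" for x y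
  proof -
    have "eval2 F (x, y) = k * (\<Prod>z\<in>#proots (fibre_eq A n x). poly (monom y n - B) z)"
      using norm_poly_eval[OF comm_ring_hom_eval2[of "(x, y)"], of P K] lcA
      by (simp add: F_def k_def lcP eP eK)
    also have "(\<Prod>z\<in>#proots (fibre_eq A n x). poly (monom y n - B) z)
        = (\<Prod>z\<in>#proots (fibre_eq A n x). z ^ n * (y - poly B z / z ^ n))"
    proof (rule arg_cong[of _ _ prod_mset], rule image_mset_cong)
      fix z assume "z \<in># proots (fibre_eq A n x)"
      then have "poly A z = x * z ^ n"
        using fibre_eq_degree(3)[OF assms(1)] by (simp add: poly_fibre_eq)
      then have "z ^ n \<noteq> 0" using assms(2) by (cases "n = 0") (auto simp: power_0_left)
      moreover have "w * (y - b / w) = y * w - b" if "w \<noteq> 0" for w b :: complex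
        using that by (simp add: field_simps)
      ultimately have "z ^ n * (y - poly B z / z ^ n) = y * z ^ n - poly B z" by blast
      then show "poly (monom y n - B) z = z ^ n * (y - poly B z / z ^ n)"
        by (simp only: poly_monom poly_diff)
    qed
    finally show ?thesis unfolding c_def by (simp add: prod_mset.distrib prod_roots)
  qed
  have fF: "fibre_poly F x = Polynomial.smult c (\<Prod>z\<in>#proots (fibre_eq A n x). [:- (poly B z / z ^ n), 1:])" for x
  proof (rule poly_eq_poly_eq_iff[THEN iffD1], rule ext)
    fix y
    have "poly (\<Prod>z\<in>#M. [:- f z, 1:]) y = (\<Prod>z\<in>#M. y - f z)" for M and f :: "complex \<Rightarrow> complex"
      by (induction M) (auto simp: algebra_simps)
    then show "poly (fibre_poly F x) y = poly (Polynomial.smult c (\<Prod>z\<in>#proots (fibre_eq A n x). [:- (poly B z / z ^ n), 1:])) y"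
      by (simp add: eF)
  qed
  have monic: "lead_coeff (\<Prod>z\<in>#M. [:- f z, 1:]) = 1 \<and> degree (\<Prod>z\<in>#M. [:- f z, 1:]) = size M"
    for M :: "complex multiset" and f :: "complex \<Rightarrow> complex"
  proof (induction M)
    case (add x M)
    define p where "p = (\<Prod>z\<in>#M. [:- f z, 1:])"
    have "p \<noteq> 0" using add unfolding p_def by auto
    then have "degree ([:- f x, 1:] * p) = Suc (size M)"
      by (subst degree_mult_eq) (use add in \<open>auto simp: p_def\<close>)
    moreover have "lead_coeff ([:- f x, 1:] * p) = 1"
      by (subst lead_coeff_mult) (use add in \<open>auto simp: p_def\<close>)
    ultimately show ?case by (simp add: p_def del: mult_pCons_left)
  qed simp
  have cF: "coeff F i = (if i = degree A then [:c:] else 0)" if "i \<ge> degree A" for i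
  proof -
    have "poly (coeff F i) x = poly (if i = degree A then [:c:] else 0) x" for x
    proof -
      let ?p = "\<Prod>z\<in>#proots (fibre_eq A n x). [:- (poly B z / z ^ n), 1:]"
      have d: "degree ?p = degree A" "lead_coeff ?p = 1"
        using monic[of "\<lambda>z. poly B z / z ^ n" "proots (fibre_eq A n x)"] fibre_eq_degree(1)[OF assms(1), of x]
        by (metis size_proots_complex)+
      have "poly (coeff F i) x = c * coeff ?p i"
        unfolding coeff_fibre_poly[symmetric] fF by simp
      also have "coeff ?p i = (if i = degree A then 1 else 0)"
      proof (cases "i = degree A")
        case True
        then show ?thesis using d by metis
      next
        case False
        then show ?thesis using d(1) that by (simp add: coeff_eq_0)
      qed
      finally show ?thesis by simp
    qed
    then show ?thesis by (intro poly_eq_poly_eq_iff[THEN iffD1]) auto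
  qed
  have "degree F = degree A"
    using cF c0 by (intro antisym degree_le le_degree) auto
  moreover have "lead_coeff F = [:c:]" using cF calculation by simp
  ultimately show thesis using that[of c F] c0 fF by blast
qed

lemma locus_of_fibres:
  fixes A B :: "complex poly"
  assumes "n < degree A" "n > 0 \<Longrightarrow> poly A 0 \<noteq> 0" "c \<noteq> 0"
    "\<And>x. fibre_poly F x = Polynomial.smult c (\<Prod>z\<in>#proots (fibre_eq A n x). [:- (poly B z / z ^ n), 1:])"
  shows "zero_locus F = (\<lambda>z. (poly A z / z ^ n, poly B z / z ^ n)) ` {z. n = 0 \<or> z \<noteq> 0}"
proof (rule Set.set_eqI)
  fix p :: "complex \<times> complex"
  obtain x y where p: "p = (x, y)" by (cases p)
  have "poly (\<Prod>z\<in>#M. [:- f z, 1:]) y = (\<Prod>z\<in>#M. y - f z)" for M and f :: "complex \<Rightarrow> complex"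
    by (induction M) (auto simp: algebra_simps)
  then have "eval2 F (x, y) = c * (\<Prod>z\<in>#proots (fibre_eq A n x). y - poly B z / z ^ n)"
    by (simp add: assms(4) flip: poly_fibre_poly)
  then have "p \<in> zero_locus F \<longleftrightarrow> (\<exists>z\<in>#proots (fibre_eq A n x). y = poly B z / z ^ n)"
    using assms(3) by (auto simp: p zero_locus_def prod_mset_zero_iff)
  also have "\<dots> \<longleftrightarrow> (\<exists>z. poly A z = x * z ^ n \<and> y = poly B z / z ^ n)"
    using fibre_eq_degree(3)[OF assms(1)] by (auto simp: poly_fibre_eq)
  also have "\<dots> \<longleftrightarrow> (\<exists>z. (n = 0 \<or> z \<noteq> 0) \<and> x = poly A z / z ^ n \<and> y = poly B z / z ^ n)"
  proof (intro ex_cong1 iffI conjI)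
    fix z assume z: "poly A z = x * z ^ n \<and> y = poly B z / z ^ n"
    then show nz: "n = 0 \<or> z \<noteq> 0" using assms(2) by (auto simp: power_0_left)
    then have "z ^ n \<noteq> 0" by auto
    then show "x = poly A z / z ^ n" using z by (simp add: field_simps)
    show "y = poly B z / z ^ n" using z by simp
  qed (auto simp: field_simps)
  finally show "p \<in> zero_locus F \<longleftrightarrow> p \<in> (\<lambda>z. (poly A z / z ^ n, poly B z / z ^ n)) ` {z. n = 0 \<or> z \<noteq> 0}"
    unfolding p by auto
qed

context proper_param_curve
begin

definition \<Delta> :: "complex \<Rightarrow> complex poly" where "\<Delta> x = fibre_eq A n x"

lemma \<Delta>_nonzero [simp]: "\<Delta> x \<noteq> 0" and degree_\<Delta>: "degree (\<Delta> x) = degree A"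
  and lead_coeff_\<Delta>: "lead_coeff (\<Delta> x) = lead_coeff A"
  unfolding \<Delta>_def using fibre_eq_degree[OF degree_A] by auto

lemma poly_\<Delta>: "poly (\<Delta> x) z = poly A z - x * z ^ n"
  unfolding \<Delta>_def by (rule poly_fibre_eq)

lemma in_proots_\<Delta>: "z \<in># proots (\<Delta> x) \<longleftrightarrow> z \<in> \<Omega> \<and> X z = x"
proof
  assume "z \<in># proots (\<Delta> x)"
  then have eq: "poly A z = x * z ^ n" by (simp add: poly_\<Delta>)
  then have "z \<in> \<Omega>" using A_0 by (auto simp: \<Omega>_def power_0_left)
  then show "z \<in> \<Omega> \<and> X z = x" using \<Omega>_pow eq by (simp add: X_def)
next
  assume "z \<in> \<Omega> \<and> X z = x"
  then show "z \<in># proots (\<Delta> x)" using \<Omega>_pow by (auto simp: poly_\<Delta> X_def)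
qed

lemma finite_fibre: "finite {z \<in> \<Omega>. X z = x}"
proof -
  have "{z \<in> \<Omega>. X z = x} = set_mset (proots (\<Delta> x))" using in_proots_\<Delta> by blast
  then show ?thesis by (metis finite_set_mset)
qed

lemma ex_power_equation:
  "\<exists>d F c. d > 0 \<and> c \<noteq> 0 \<and> prime_elem G \<and> F = [:[:c:]:] * G ^ d \<and>
    (\<exists>c'. c' \<noteq> 0 \<and> degree F = degree A \<and> lead_coeff F = [:c':] \<and>
      (\<forall>x. fibre_poly F x = Polynomial.smult c' (\<Prod>z\<in>#proots (\<Delta> x). [:- Y z, 1:])))"
proof -
  obtain F c where F: "c \<noteq> 0" "degree F = degree A" "lead_coeff F = [:c:]"
    "\<And>x. fibre_poly F x = Polynomial.smult c (\<Prod>z\<in>#proots (fibre_eq A n x). [:- (poly B z / z ^ n), 1:])"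
    by (rule ex_locus_equation[OF degree_A A_0, of B]) (assumption, rule that)
  have zl: "zero_locus F = \<phi> ` \<Omega>"
    using locus_of_fibres[OF degree_A A_0 F(1,4)] unfolding \<phi>_def X_def Y_def \<Omega>_def .
  have dF: "degree F > 0" using degree_A F(2) by simp
  have "prime_elem G \<and> (\<exists>d c'. d > 0 \<and> c' \<noteq> 0 \<and> F = [:[:c':]:] * G ^ d)"
    by (rule irreducible_locus_equation[OF F(3,1) dF zl squarefree_G zero_locus_G]) (rule \<phi>_irreducible)
  then obtain d c' where "prime_elem G" "d > 0" "c' \<noteq> 0" "F = [:[:c':]:] * G ^ d" by blast
  then show ?thesis using F unfolding \<Delta>_def Y_def
    by (intro exI[of _ d] exI[of _ F] exI[of _ c'] exI[of _ c] conjI allI) auto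
qed

text \<open>The number of complex parameters over a general point of the curve, encoded as the
  exponent of \<open>G\<close> in the norm equation.\<close>

definition cover_degree :: nat where
  "cover_degree = (SOME d. d > 0 \<and> (\<exists>F c. c \<noteq> 0 \<and> prime_elem G \<and> F = [:[:c:]:] * G ^ d \<and>
    (\<exists>c'. c' \<noteq> 0 \<and> degree F = degree A \<and> lead_coeff F = [:c':] \<and>
      (\<forall>x. fibre_poly F x = Polynomial.smult c' (\<Prod>z\<in>#proots (\<Delta> x). [:- Y z, 1:])))))"

lemma cover_degree:
  obtains F c c' where "cover_degree > 0" "c \<noteq> 0" "prime_elem G" "F = [:[:c:]:] * G ^ cover_degree"
    "c' \<noteq> 0" "degree F = degree A" "lead_coeff F = [:c':]"
    "\<And>x. fibre_poly F x = Polynomial.smult c' (\<Prod>z\<in>#proots (\<Delta> x). [:- Y z, 1:])"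
proof -
  have "\<exists>d. d > 0 \<and> (\<exists>F c. c \<noteq> 0 \<and> prime_elem G \<and> F = [:[:c:]:] * G ^ d \<and>
    (\<exists>c'. c' \<noteq> 0 \<and> degree F = degree A \<and> lead_coeff F = [:c':] \<and>
      (\<forall>x. fibre_poly F x = Polynomial.smult c' (\<Prod>z\<in>#proots (\<Delta> x). [:- Y z, 1:]))))"
    using ex_power_equation by blast
  from someI_ex[OF this, folded cover_degree_def] show thesis using that by blast
qed

lemma cover_degree_pos: "cover_degree > 0" and prime_G: "prime_elem G"
  using cover_degree by blast+

lemma ex_lead_coeff_G: "\<exists>c. c \<noteq> 0 \<and> lead_coeff G = [:c:]"
proof -
  obtain F c c' where F: "cover_degree > 0" "F = [:[:c:]:] * G ^ cover_degree" "c' \<noteq> 0" "lead_coeff F = [:c':]"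
    using cover_degree by metis
  have "G dvd F" unfolding F(2) using F(1) by (intro dvd_mult dvd_power) auto
  then show ?thesis using dvd_const_lead_coeff[OF F(4,3)] by blast
qed

lemma degree_cover: "degree A = cover_degree * degree G"
proof -
  obtain F c where F: "c \<noteq> 0" "F = [:[:c:]:] * G ^ cover_degree" "degree F = degree A"
    using cover_degree by metis
  have "degree F = degree (G ^ cover_degree)" unfolding F(2) using F(1) by simp
  then show ?thesis using F(3) prime_G by (simp add: degree_power_eq)
qed

lemma degree_G_pos: "degree G > 0"
  using degree_cover degree_A by (metis less_nat_zero_code mult_0_right neq0_conv)

lemma fibre_G_nonzero: "fibre_poly G x \<noteq> 0" and degree_fibre_G: "degree (fibre_poly G x) = degree G"
proof -
  obtain c where "c \<noteq> 0" "lead_coeff G = [:c:]" using ex_lead_coeff_G by blast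
  then have "poly (lead_coeff G) x \<noteq> 0" by simp
  then show "fibre_poly G x \<noteq> 0" "degree (fibre_poly G x) = degree G"
    by (rule fibre_poly_nonzero, rule degree_fibre_poly)
qed

text \<open>Both multisets are the roots of the norm equation over \<open>x\<close>. The
  \<open>cover_degree\<close>-th power of a product over the points above \<open>x\<close> is
  thereby a product over parameters.\<close>

lemma fibre_roots: "repeat_mset cover_degree (proots (fibre_poly G x)) = image_mset Y (proots (\<Delta> x))"
proof -
  obtain F c c' where F: "c \<noteq> 0" "F = [:[:c:]:] * G ^ cover_degree" "c' \<noteq> 0"
    "\<And>x. fibre_poly F x = Polynomial.smult c' (\<Prod>z\<in>#proots (\<Delta> x). [:- Y z, 1:])"
    using cover_degree by metis
  have "fibre_poly F x = Polynomial.smult c (fibre_poly G x ^ cover_degree)"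
    by (rule poly_eq_poly_eq_iff[THEN iffD1], rule ext) (simp add: F(2))
  then have "proots (fibre_poly F x) = repeat_mset cover_degree (proots (fibre_poly G x))"
    using F(1) by (simp add: proots_power)
  moreover have "proots (\<Prod>z\<in>#M. [:- Y z, 1:]) = image_mset Y M" for M
  proof (induction M)
    case (add z M)
    have "(\<Prod>z\<in>#M. [:- Y z, 1:]) \<noteq> 0" by (auto simp: prod_mset_zero_iff)
    then have "proots ([:- Y z, 1:] * (\<Prod>z\<in>#M. [:- Y z, 1:])) = proots [:- Y z, 1:] + image_mset Y M"
      unfolding add[symmetric] by (intro proots_mult) auto
    then show ?case by (simp add: proots_linear_factor[of "- Y z", simplified] del: mult_pCons_left)
  qed simp
  then have "proots (fibre_poly F x) = image_mset Y (proots (\<Delta> x))"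
    unfolding F(4) using F(3) by simp
  ultimately show ?thesis by simp
qed

end

section \<open>Counting critical points\<close>

context proper_param_curve
begin

abbreviation (input) "Gx \<equiv> partial_x G"
abbreviation (input) "Gy \<equiv> partial_y G"

lemma ex_lead_coeff_Gy: "\<exists>c. c \<noteq> 0 \<and> lead_coeff Gy = [:c:]"
proof -
  obtain c where "c \<noteq> 0" "lead_coeff G = [:c:]" using ex_lead_coeff_G by blast
  then have "lead_coeff Gy = [:of_nat (degree G) * c:]"
    unfolding lead_coeff_partial_y by (simp add: of_nat_poly)
  then show ?thesis using \<open>c \<noteq> 0\<close> degree_G_pos by (intro exI[of _ "of_nat (degree G) * c"]) auto
qed

lemma fibre_Gy_nonzero: "fibre_poly Gy x \<noteq> 0" and degree_fibre_Gy: "degree (fibre_poly Gy x) = degree G - 1"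
proof -
  obtain c where "c \<noteq> 0" "lead_coeff Gy = [:c:]" using ex_lead_coeff_Gy by blast
  then have "poly (lead_coeff Gy) x \<noteq> 0" by simp
  then show "fibre_poly Gy x \<noteq> 0" "degree (fibre_poly Gy x) = degree G - 1"
    using fibre_poly_nonzero degree_fibre_poly degree_partial_y by metis+
qed

text \<open>Up to a constant this is the discriminant of \<open>G\<close> in \<open>y\<close>, with
  the abscissas of vertical tangents and of singular points as roots. The abscissas of all critical
  points are roots of \<open>Q\<close>.\<close>

definition D :: "complex poly" where "D = norm_poly Gy G"
definition Q :: "complex poly" where "Q = norm_poly Gy Gx"

lemma norm_Gy: "\<exists>k. k \<noteq> 0 \<and> (\<forall>x. poly (norm_poly Gy H) x = k * (\<Prod>y\<in>#proots (fibre_poly Gy x). eval2 H (x, y)))"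
proof -
  obtain c where c: "c \<noteq> 0" "lead_coeff Gy = [:c:]" using ex_lead_coeff_Gy by blast
  show ?thesis
    using norm_poly_fibre[OF c(2,1), of H] c(1)
    by (intro exI[of _ "c ^ (degree Gy + Suc (degree H))"]) auto
qed

lemma norm_Gy_eq_0_iff:
  "poly (norm_poly Gy H) x = 0 \<longleftrightarrow> (\<exists>y. eval2 Gy (x, y) = 0 \<and> eval2 H (x, y) = 0)"
proof -
  obtain k where k: "k \<noteq> 0" "\<And>x. poly (norm_poly Gy H) x = k * (\<Prod>y\<in>#proots (fibre_poly Gy x). eval2 H (x, y))"
    using norm_Gy by blast
  show ?thesis using k(1) fibre_Gy_nonzero by (auto simp: k(2) prod_mset_zero_iff image_iff)
qed

lemma norm_Gy_nonzero:
  assumes "\<And>q. prime q \<Longrightarrow> degree q > 0 \<Longrightarrow> q dvd Gy \<Longrightarrow> q dvd H \<Longrightarrow> False"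
  shows "norm_poly Gy H \<noteq> 0"
proof
  assume "norm_poly Gy H = 0"
  then have "\<exists>y. eval2 Gy (x, y) = 0 \<and> eval2 H (x, y) = 0" for x
    using norm_Gy_eq_0_iff[of H x] by simp
  then have "UNIV \<subseteq> fst ` {p. eval2 Gy p = 0 \<and> eval2 H p = 0}" by force
  moreover obtain c where "c \<noteq> 0" "lead_coeff Gy = [:c:]" using ex_lead_coeff_Gy by blast
  then have "finite {p. eval2 Gy p = 0 \<and> eval2 H p = 0}"
    using finite_common_zeros assms by blast
  ultimately show False using infinite_UNIV_char_0[where 'a = complex] finite_subset finite_imageI by blast
qed

lemma D_nonzero: "D \<noteq> 0"
  unfolding D_def by (rule norm_Gy_nonzero) (use partial_y_no_common_factor[OF squarefree_G] in blast)

text \<open>A numerator of \<open>G_y\<close> along the parametrization and the exponent of its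
  denominator. They are chosen as a pair to keep the exponent 0 for \<open>n = 0\<close>.\<close>

definition E_ex :: "complex poly \<times> nat" where
  "E_ex = (SOME p. (n = 0 \<longrightarrow> snd p = 0) \<and> (\<forall>z\<in>\<Omega>. poly (fst p) z = z ^ snd p * eval2 Gy (X z, Y z)))"

definition E :: "complex poly" where "E = fst E_ex"
definition e :: nat where "e = snd E_ex"

lemma E: "n = 0 \<Longrightarrow> e = 0" "z \<in> \<Omega> \<Longrightarrow> poly E z = z ^ e * eval2 Gy (X z, Y z)"
proof -
  have "\<exists>p. (n = 0 \<longrightarrow> snd p = 0) \<and> (\<forall>z\<in>\<Omega>. poly (fst p) z = z ^ snd p * eval2 Gy (X z, Y z))"
    using ex_numerator[of Gy] by simp
  note * = someI_ex[OF this, folded E_ex_def, folded E_def e_def]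
  show "e = 0" if "n = 0" using * that by blast
  show "poly E z = z ^ e * eval2 Gy (X z, Y z)" if "z \<in> \<Omega>" using * that by blast
qed

text \<open>For \<open>n > 0\<close> the constant term of \<open>\<Delta> x\<close> does not involve
  \<open>x\<close>, hence by Vieta neither does the product of its roots; for \<open>n = 0\<close>
  the exponent is 0.\<close>

lemma ex_const_prod_pow: "\<exists>k. k \<noteq> 0 \<and> (\<forall>x. (\<Prod>z\<in>#proots (\<Delta> x). z ^ e) = k)"
proof (cases "n = 0")
  case False
  have "poly A 0 = lead_coeff A * (\<Prod>a\<in>#proots (\<Delta> x). - a)" for x
    using poly_eq_prod_proots[OF \<Delta>_nonzero, of x 0] False
    unfolding lead_coeff_\<Delta> poly_\<Delta> by (simp add: zero_power)
  moreover have "(\<Prod>a\<in>#M. - a) = (- 1) ^ size M * (\<Prod>a\<in>#M. a)" for M :: "complex multiset"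
    by (induction M) auto
  ultimately have eq: "poly A 0 = lead_coeff A * (- 1) ^ degree A * (\<Prod>a\<in>#proots (\<Delta> x). a)" for x
    by (metis degree_\<Delta> mult.assoc size_proots_complex)
  have "(\<Prod>z\<in>#proots (\<Delta> x). z ^ e) = (\<Prod>a\<in>#proots (\<Delta> 0). a) ^ e" for x
  proof -
    have "lead_coeff A * (- 1) ^ degree A \<noteq> 0" using degree_A by auto
    then have "(\<Prod>a\<in>#proots (\<Delta> x). a) = (\<Prod>a\<in>#proots (\<Delta> 0). a)"
      using eq[of x] eq[of 0] by (metis mult_left_cancel)
    moreover have "(\<Prod>z\<in>#M. z ^ e) = (\<Prod>z\<in>#M. z) ^ e" for M :: "complex multiset"
      by (induction M) (auto simp: power_mult_distrib)
    ultimately show ?thesis by simp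
  qed
  moreover have "(\<Prod>a\<in>#proots (\<Delta> 0). a) ^ e \<noteq> 0" using eq[of 0] A_0 False by auto
  ultimately show ?thesis by blast
next
  case True
  have "(\<Prod>z\<in>#proots (\<Delta> x). z ^ e) = 1" for x unfolding E(1)[OF True] by simp
  then show ?thesis by (intro exI[of _ 1]) simp
qed

lemma prod_mset_repeat: "(\<Prod>y\<in>#repeat_mset d M. f y) = (\<Prod>y\<in>#M. f y) ^ d" for f :: "complex \<Rightarrow> complex"
  by (induction d) auto

text \<open>Exchanging the roots of \<open>G\<close> and \<open>G_y\<close> as in a resultant, a power of \<open>D x\<close> is, up to constants, the product
  of the \<open>A w - x w\<^sup>n\<close> over the zeros \<open>w\<close> of \<open>G_y\<close> along the curve.\<close>

lemma degree_D_le: "cover_degree * degree D \<le> size (filter_mset (\<lambda>w. w \<in> \<Omega>) (proots E))" and E_nonzero: "E \<noteq> 0"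
proof -
  obtain k1 where k1: "k1 \<noteq> 0" "\<And>x. poly D x = k1 * (\<Prod>y\<in>#proots (fibre_poly Gy x). eval2 G (x, y))"
    using norm_Gy unfolding D_def by blast
  obtain c1 where c1: "c1 \<noteq> 0" "lead_coeff G = [:c1:]" using ex_lead_coeff_G by blast
  obtain c2 where c2: "c2 \<noteq> 0" "lead_coeff Gy = [:c2:]" using ex_lead_coeff_Gy by blast
  have lc: "lead_coeff (fibre_poly G x) = c1" "lead_coeff (fibre_poly Gy x) = c2" for x
    unfolding degree_fibre_G degree_fibre_Gy using c1 c2 by (simp_all add: degree_partial_y)
  define m where "m = degree G"
  define k2 where "k2 = k1 * ((- 1) ^ ((m - 1) * m) * c1 ^ (m - 1)) / c2 ^ m"
  have k2: "k2 \<noteq> 0" using k1 c1 c2 unfolding k2_def by simp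
  have D1: "poly D x = k2 * (\<Prod>y\<in>#proots (fibre_poly G x). eval2 Gy (x, y))" for x
  proof -
    have "c2 ^ m * (\<Prod>y\<in>#proots (fibre_poly Gy x). eval2 G (x, y))
        = (- 1) ^ ((m - 1) * m) * (c1 ^ (m - 1) * (\<Prod>y\<in>#proots (fibre_poly G x). eval2 Gy (x, y)))"
      using prod_proots_swap[OF fibre_Gy_nonzero fibre_G_nonzero, of x x]
      unfolding lc unfolding degree_fibre_G degree_fibre_Gy m_def[symmetric] poly_fibre_poly .
    then have "(\<Prod>y\<in>#proots (fibre_poly Gy x). eval2 G (x, y))
        = (- 1) ^ ((m - 1) * m) * (c1 ^ (m - 1) * (\<Prod>y\<in>#proots (fibre_poly G x). eval2 Gy (x, y))) / c2 ^ m"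
      using c2(1) by (simp add: eq_divide_eq mult.commute)
    then show ?thesis unfolding k1(2) k2_def by simp
  qed
  obtain k3 where k3: "k3 \<noteq> 0" "\<And>x. (\<Prod>z\<in>#proots (\<Delta> x). z ^ e) = k3" using ex_const_prod_pow by blast
  have D2: "poly D x ^ cover_degree = k2 ^ cover_degree / k3 * (\<Prod>z\<in>#proots (\<Delta> x). poly E z)" for x
  proof -
    have "poly D x ^ cover_degree = k2 ^ cover_degree * (\<Prod>y\<in>#repeat_mset cover_degree (proots (fibre_poly G x)). eval2 Gy (x, y))"
      unfolding prod_mset_repeat D1 by (simp add: power_mult_distrib)
    also have "\<dots> = k2 ^ cover_degree * (\<Prod>z\<in>#proots (\<Delta> x). eval2 Gy (x, Y z))"
      unfolding fibre_roots by (simp add: image_mset.compositionality o_def)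
    also have "(\<Prod>z\<in>#proots (\<Delta> x). poly E z) = (\<Prod>z\<in>#proots (\<Delta> x). z ^ e * eval2 Gy (x, Y z))"
      by (rule arg_cong[of _ _ prod_mset], rule image_mset_cong) (use in_proots_\<Delta> E(2) in auto)
    then have "k2 ^ cover_degree * (\<Prod>z\<in>#proots (\<Delta> x). eval2 Gy (x, Y z))
        = k2 ^ cover_degree / k3 * (\<Prod>z\<in>#proots (\<Delta> x). poly E z)"
      using k3 by (simp add: prod_mset.distrib)
    finally show ?thesis .
  qed
  show E0: "E \<noteq> 0"
  proof
    assume "E = 0"
    have "poly D x = 0" for x
    proof -
      have "proots (\<Delta> x) \<noteq> {#}"
        using degree_\<Delta> degree_A size_proots_complex by (metis less_nat_zero_code size_empty)
      then obtain z where "z \<in># proots (\<Delta> x)" by (meson multiset_nonemptyE)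
      then have "0 \<in># image_mset (poly E) (proots (\<Delta> x))"
        unfolding \<open>E = 0\<close> by (metis imageI poly_0 set_image_mset)
      then have "(\<Prod>z\<in>#proots (\<Delta> x). poly E z) = 0" by (simp only: prod_mset_zero_iff)
      then have "poly D x ^ cover_degree = 0" unfolding D2 by (simp only: mult_zero_right)
      then show ?thesis by (simp only: power_eq_0_iff)
    qed
    then show False using D_nonzero poly_all_0_iff_0 by blast
  qed
  define l where "l = lead_coeff A"
  have l: "l \<noteq> 0" unfolding l_def using degree_A by auto
  define k4 where "k4 = k2 ^ cover_degree / k3 * ((- 1) ^ (degree A * degree E) * lead_coeff E ^ degree A) / l ^ degree E"
  \<comment> \<open>A second exchange, now of the parameters over \<open>x\<close> with the roots of
    \<open>E\<close>, makes the dependence on \<open>x\<close> explicit: one linear factor for each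
    root.\<close>
  have D3: "poly D x ^ cover_degree = k4 * (\<Prod>w\<in>#proots E. poly A w - x * w ^ n)" for x
  proof -
    have "l ^ degree E * (\<Prod>z\<in>#proots (\<Delta> x). poly E z)
        = (- 1) ^ (degree A * degree E) * (lead_coeff E ^ degree A * (\<Prod>w\<in>#proots E. poly A w - x * w ^ n))"
      using prod_proots_swap[OF \<Delta>_nonzero E0, of x]
      unfolding lead_coeff_\<Delta> unfolding degree_\<Delta> poly_\<Delta> l_def .
    then have "(\<Prod>z\<in>#proots (\<Delta> x). poly E z)
        = (- 1) ^ (degree A * degree E) * (lead_coeff E ^ degree A * (\<Prod>w\<in>#proots E. poly A w - x * w ^ n)) / l ^ degree E"
      using l by (simp add: eq_divide_eq mult.commute)
    then show ?thesis unfolding D2 k4_def by simp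
  qed
  have "D ^ cover_degree = Polynomial.smult k4 (\<Prod>w\<in>#proots E. [:poly A w, - (w ^ n):])"
  proof (rule poly_eq_poly_eq_iff[THEN iffD1], rule ext)
    fix x
    have "poly (\<Prod>w\<in>#M. [:poly A w, - (w ^ n):]) x = (\<Prod>w\<in>#M. poly A w - x * w ^ n)" for M
      by (induction M) (auto simp: algebra_simps)
    then show "poly (D ^ cover_degree) x = poly (Polynomial.smult k4 (\<Prod>w\<in>#proots E. [:poly A w, - (w ^ n):])) x"
      by (simp add: D3)
  qed
  \<comment> \<open>A root of \<open>E\<close> at the puncture contributes a constant factor because
    there \<open>w ^ n = 0\<close>; so only the roots in \<open>\<Omega>\<close> count.\<close>
  moreover have "degree (\<Prod>w\<in>#M. [:poly A w, - (w ^ n):]) \<le> size (filter_mset (\<lambda>w. w \<in> \<Omega>) M)" for M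
  proof (induction M)
    case (add w M)
    have "degree [:poly A w, - (w ^ n):] \<le> (if w \<in> \<Omega> then 1 else 0)"
      by (auto simp: \<Omega>_def zero_power)
    then show ?case using add degree_mult_le[of "[:poly A w, - (w ^ n):]" "\<Prod>w\<in>#M. [:poly A w, - (w ^ n):]"]
      by (auto simp del: mult_pCons_left split: if_splits)
  qed simp
  then have "degree (Polynomial.smult k4 (\<Prod>w\<in>#proots E. [:poly A w, - (w ^ n):])) \<le> size (filter_mset (\<lambda>w. w \<in> \<Omega>) (proots E))"
    by (meson degree_smult_le order_trans)
  ultimately have "degree (D ^ cover_degree) \<le> size (filter_mset (\<lambda>w. w \<in> \<Omega>) (proots E))"
    by (simp only:)
  moreover have "degree (D ^ cover_degree) = cover_degree * degree D"
    using D_nonzero by (simp add: degree_power_eq)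
  ultimately show "cover_degree * degree D \<le> size (filter_mset (\<lambda>w. w \<in> \<Omega>) (proots E))"
    by linarith
qed

text \<open>The numerator of the derivative of \<open>P / z ^ n\<close>, over
  \<open>z ^ Suc n\<close> for \<open>n > 0\<close>. The case \<open>n = 0\<close> is kept apart
  since the general formula would add a spurious zero at the parameter 0.\<close>

definition numer_deriv :: "complex poly \<Rightarrow> complex poly" where
  "numer_deriv P = (if n = 0 then pderiv P else [:0, 1:] * pderiv P - Polynomial.smult (of_nat n) P)"

lemma numer_deriv:
  assumes "z \<in> \<Omega>"
  shows "((\<lambda>z. poly P z / z ^ n) has_field_derivative poly (numer_deriv P) z / z ^ (if n = 0 then 0 else Suc n)) (at z)"
proof (cases "n = 0")
  case False
  then have z: "z \<noteq> 0" using assms by (simp add: \<Omega>_def)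
  obtain k where k: "n = Suc k" using False not0_implies_Suc by blast
  have nd: "poly (numer_deriv P) z = z * poly (pderiv P) z - of_nat n * poly P z"
    using False unfolding numer_deriv_def by simp
  have "((\<lambda>z. poly P z / z ^ n) has_field_derivative
      (poly (pderiv P) z * z ^ n - poly P z * (of_nat n * z ^ (n - 1))) / (z ^ n * z ^ n)) (at z)"
    using z by (auto intro!: derivative_eq_intros)
  also have "(poly (pderiv P) z * z ^ n - poly P z * (of_nat n * z ^ (n - 1))) / (z ^ n * z ^ n)
      = poly (numer_deriv P) z / z ^ (if n = 0 then 0 else Suc n)"
    using z unfolding nd unfolding k by (simp add: field_simps)
  finally show ?thesis .
next
  case True
  have "numer_deriv P = pderiv P" unfolding numer_deriv_def by (rule if_P[OF True])
  then show ?thesis using True poly_DERIV[of P z] by simp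
qed

text \<open>The degree lost for \<open>n = 0\<close> is the whole difference between the two kinds
  of curves in the upper bound. For \<open>n > 0\<close> nonvanishing is seen at 0, where the value
  is \<open>- n * A 0\<close>.\<close>

lemma numer_deriv_A: "numer_deriv A \<noteq> 0" "degree (numer_deriv A) + (if n = 0 then 1 else 0) \<le> degree A"
proof -
  show "numer_deriv A \<noteq> 0"
  proof (cases "n = 0")
    case True
    then show ?thesis using degree_A pderiv_eq_0_iff[of A] unfolding numer_deriv_def by auto
  next
    case False
    then have "poly (numer_deriv A) 0 \<noteq> 0" using A_0 by (simp add: numer_deriv_def)
    then show ?thesis by auto
  qed
  show "degree (numer_deriv A) + (if n = 0 then 1 else 0) \<le> degree A"
  proof (cases "n = 0")
    case True
    have "numer_deriv A = pderiv A" unfolding numer_deriv_def by (rule if_P[OF True])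
    then show ?thesis using degree_A True by (simp add: degree_pderiv)
  next
    case False
    have "degree ([:0, 1:] * pderiv A) \<le> degree A"
      using degree_mult_le[of "[:0, 1:]" "pderiv A"] degree_A by (simp add: degree_pderiv)
    then have "degree ([:0, 1:] * pderiv A - Polynomial.smult (of_nat n) A) \<le> degree A"
      by (intro degree_diff_le order.trans[OF degree_smult_le]) auto
    then show ?thesis using False by (simp add: numer_deriv_def)
  qed
qed

lemma gradient_along_curve:
  assumes "z \<in> \<Omega>"
  shows "eval2 Gx (X z, Y z) * poly (numer_deriv A) z + eval2 Gy (X z, Y z) * poly (numer_deriv B) z = 0"
proof -
  define k where "k = (if n = 0 then 0 else Suc n)"
  have zk: "z ^ k \<noteq> 0" using assms by (auto simp: k_def \<Omega>_def)
  have "((\<lambda>z. eval2 G (X z, Y z)) has_field_derivative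
      eval2 Gx (X z, Y z) * (poly (numer_deriv A) z / z ^ k) + eval2 Gy (X z, Y z) * (poly (numer_deriv B) z / z ^ k)) (at z)"
    using eval2_chain[OF numer_deriv[OF assms, of A] numer_deriv[OF assms, of B], of G] unfolding X_def Y_def k_def .
  moreover have "((\<lambda>z. eval2 G (X z, Y z)) has_field_derivative 0) (at z)"
    by (rule has_field_derivative_transform_within_open[OF DERIV_const open_\<Omega> assms, of 0])
      (simp add: eval2_G_\<phi>)
  ultimately have "eval2 Gx (X z, Y z) * (poly (numer_deriv A) z / z ^ k)
      + eval2 Gy (X z, Y z) * (poly (numer_deriv B) z / z ^ k) = 0"
    by (rule DERIV_unique)
  moreover have "a * p + b * q = 0" if "a * (p / w) + b * (q / w) = 0" "w \<noteq> 0" for a b p q w :: complex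
    using that by (simp add: field_simps)
  ultimately show ?thesis using zk by blast
qed

text \<open>Differentiating \<open>G = 0\<close> along the curve gives
  \<open>G_x X' = - G_y Y'\<close>. Where \<open>G_y\<close> vanishes at a smooth point
  \<open>G_x\<close> does not, so \<open>G_y\<close> vanishes at most to the order of
  \<open>X'\<close>.\<close>

lemma order_E_smooth:
  assumes w: "w \<in> \<Omega>" and smooth: "\<phi> w \<notin> singular_points G"
  shows "order w E \<le> order w (numer_deriv A)"
proof (cases "eval2 Gy (X w, Y w) = 0")
  case False
  moreover have "w ^ e \<noteq> 0" by (rule \<Omega>_pow_e[OF w]) (use E(1) in blast)
  ultimately have "poly E w \<noteq> 0" unfolding E(2)[OF w] by (metis mult_eq_0_iff)
  then have "order w E = 0" using order_root by blast
  then show ?thesis by simp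
next
  case True
  then have Gx0: "eval2 Gx (X w, Y w) \<noteq> 0"
    using smooth eval2_G_\<phi>[OF w] unfolding singular_points_def zero_locus_def critical_points_def \<phi>_def by auto
  obtain E' e' where E': "n = 0 \<longrightarrow> e' = 0" "\<And>z. z \<in> \<Omega> \<Longrightarrow> poly E' z = z ^ e' * eval2 Gx (X z, Y z)"
    using ex_numerator by blast
  have mon: "order w (monom 1 k) = 0" if "n = 0 \<longrightarrow> k = 0" for k
    using \<Omega>_pow_e[OF w that] order_root[of "monom 1 k" w] by (metis mult_1 poly_monom)
  have "order w E' = 0"
    using order_root[of E' w] E'(2)[OF w] \<Omega>_pow_e[OF w E'(1)] Gx0 by (metis mult_eq_0_iff)
  have id: "monom 1 e * E' * numer_deriv A = - (monom 1 e' * E * numer_deriv B)"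
  proof -
    have "poly (monom 1 e * E' * numer_deriv A + monom 1 e' * E * numer_deriv B) z = 0" if z: "z \<in> \<Omega>" for z
    proof -
      have "poly (monom 1 e * E' * numer_deriv A + monom 1 e' * E * numer_deriv B) z
          = z ^ e * z ^ e' * (eval2 Gx (X z, Y z) * poly (numer_deriv A) z + eval2 Gy (X z, Y z) * poly (numer_deriv B) z)"
        by (simp add: poly_monom E(2)[OF z] E'(2)[OF z] algebra_simps)
      then show ?thesis by (simp add: gradient_along_curve[OF z])
    qed
    then have "monom 1 e * E' * numer_deriv A + monom 1 e' * E * numer_deriv B = 0"
      using infinite_\<Omega> by (rule poly_infinite_roots_eq_0[rotated])
    then show ?thesis by (simp add: eq_neg_iff_add_eq_0)
  qed
  have E'0: "E' \<noteq> 0" using E'(2)[OF w] \<Omega>_pow_e[OF w E'(1)] Gx0 by (metis mult_eq_0_iff poly_0)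
  have nz: "monom 1 e * E' * numer_deriv A \<noteq> 0"
    using E'0 numer_deriv_A(1) by (simp add: monom_eq_0_iff)
  then have nz': "monom 1 e' * E * numer_deriv B \<noteq> 0" unfolding id by simp
  have "order w (monom 1 e * E' * numer_deriv A) = order w (numer_deriv A)"
    using nz mon[of e] E(1) \<open>order w E' = 0\<close> by (simp add: order_mult)
  moreover have "order w (monom 1 e' * E * numer_deriv B) = order w E + order w (numer_deriv B)"
    using nz' mon[OF E'(1)] by (simp add: order_mult)
  ultimately show ?thesis unfolding id by simp
qed

lemma finite_singular: "finite (singular_points G)"
proof -
  have "singular_points G \<subseteq> \<phi> ` {w. poly E w = 0}"
  proof
    fix p assume p: "p \<in> singular_points G"
    then obtain w where w: "w \<in> \<Omega>" "p = \<phi> w" using zero_locus_G unfolding singular_points_def by blast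
    then have "poly E w = 0" using p E(2)[OF w(1)]
      unfolding singular_points_def critical_points_def \<phi>_def by simp
    then show "p \<in> \<phi> ` {w. poly E w = 0}" using w by blast
  qed
  then show ?thesis using poly_roots_finite[OF E_nonzero] finite_subset by blast
qed

end

section \<open>Tangent slopes and limits of slopes at a node\<close>

lemma tangent_slopes:
  assumes "real_tangent_pair H p" "eval2 (partial_y (partial_y H)) p \<noteq> 0"
  defines "a \<equiv> eval2 (partial_x (partial_x H)) p" and "b \<equiv> eval2 (partial_y (partial_x H)) p"
    and "c \<equiv> eval2 (partial_y (partial_y H)) p"
  obtains \<alpha> \<beta> :: real where "\<alpha> \<noteq> \<beta>"
    "\<And>t. a + 2 * b * t + c * t ^ 2 = c * (t - of_real \<alpha>) * (t - of_real \<beta>)"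
    "a = c * of_real \<alpha> * of_real \<beta>" "2 * b = - c * (of_real \<alpha> + of_real \<beta>)"
proof -
  obtain v1 v2 w1 w2 :: real where vw: "v1 * w2 \<noteq> v2 * w1"
    "a * of_real v1 ^ 2 + 2 * b * of_real v1 * of_real v2 + c * of_real v2 ^ 2 = 0"
    "a * of_real w1 ^ 2 + 2 * b * of_real w1 * of_real w2 + c * of_real w2 ^ 2 = 0"
    using assms(1) unfolding real_tangent_pair_def Let_def a_def b_def c_def by blast
  have c0: "c \<noteq> 0" using assms(2) unfolding c_def .
  have slope: "v1 \<noteq> 0 \<and> a + 2 * b * of_real (v2 / v1) + c * of_real (v2 / v1) ^ 2 = 0"
    if "a * of_real v1 ^ 2 + 2 * b * of_real v1 * of_real v2 + c * of_real v2 ^ 2 = 0" "\<not> (v1 = 0 \<and> v2 = 0)"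
    for v1 v2 :: real
  proof -
    have "v1 \<noteq> 0" using that c0 by auto
    moreover have "a + 2 * b * of_real (v2 / v1) + c * of_real (v2 / v1) ^ 2
        = (a * of_real v1 ^ 2 + 2 * b * of_real v1 * of_real v2 + c * of_real v2 ^ 2) / of_real v1 ^ 2"
    proof -
      have "a + 2 * b * (V2 / V1) + c * (V2 / V1) ^ 2 = (a * V1 ^ 2 + 2 * b * V1 * V2 + c * V2 ^ 2) / V1 ^ 2"
        if "V1 \<noteq> 0" for V1 V2 :: complex
        using that by (simp add: add_divide_distrib power_divide power2_eq_square)
      then show ?thesis using \<open>v1 \<noteq> 0\<close> by simp
    qed
    ultimately show ?thesis using that(1) by simp
  qed
  define \<alpha> \<beta> where "\<alpha> = v2 / v1" and "\<beta> = w2 / w1"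
  have s1: "v1 \<noteq> 0" "a + 2 * b * of_real \<alpha> + c * of_real \<alpha> ^ 2 = 0"
  proof -
    have "\<not> (v1 = 0 \<and> v2 = 0)" using vw(1) by auto
    from slope[OF vw(2) this] show "v1 \<noteq> 0" "a + 2 * b * of_real \<alpha> + c * of_real \<alpha> ^ 2 = 0"
      unfolding \<alpha>_def by blast+
  qed
  have s2: "w1 \<noteq> 0" "a + 2 * b * of_real \<beta> + c * of_real \<beta> ^ 2 = 0"
  proof -
    have "\<not> (w1 = 0 \<and> w2 = 0)" using vw(1) by auto
    from slope[OF vw(3) this] show "w1 \<noteq> 0" "a + 2 * b * of_real \<beta> + c * of_real \<beta> ^ 2 = 0"
      unfolding \<beta>_def by blast+
  qed
  have ne: "\<alpha> \<noteq> \<beta>" using vw(1) s1(1) s2(1) unfolding \<alpha>_def \<beta>_def by (auto simp: field_simps)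
  have diff: "(s - t) * (2 * b + c * (s + t)) = (a + 2 * b * s + c * s ^ 2) - (a + 2 * b * t + c * t ^ 2)" for s t
    by (simp add: algebra_simps power2_eq_square)
  have "(of_real \<alpha> - of_real \<beta>) * (2 * b + c * (of_real \<alpha> + of_real \<beta>)) = 0"
    using diff[of "of_real \<alpha>" "of_real \<beta>"] unfolding s1(2) s2(2) diff_self .
  then have b: "2 * b = - c * (of_real \<alpha> + of_real \<beta>)" using ne by (simp add: add_eq_0_iff)
  have "a = (a + 2 * b * of_real \<alpha> + c * of_real \<alpha> ^ 2) - 2 * b * of_real \<alpha> - c * of_real \<alpha> ^ 2" by simp
  then have "a = - (2 * b) * of_real \<alpha> - c * of_real \<alpha> ^ 2" unfolding s1(2) by simp
  then have a: "a = c * of_real \<alpha> * of_real \<beta>" unfolding b by (simp add: algebra_simps power2_eq_square)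
  have "a + 2 * b * t + c * t ^ 2 = c * (t - of_real \<alpha>) * (t - of_real \<beta>)" for t
    unfolding a b by (simp add: algebra_simps power2_eq_square)
  then show thesis using that ne a b by blast
qed

text \<open>If \<open>b ^ 2 = a * c\<close>, then \<open>a\<close> and \<open>c\<close> times the
  form are squares of linear forms, so that every null vector lies in the radical. Two independent
  null vectors leave only the zero form.\<close>

lemma real_tangent_pair_hessian:
  assumes "real_tangent_pair H p"
  shows "eval2 (partial_y (partial_x H)) p ^ 2 \<noteq> eval2 (partial_x (partial_x H)) p * eval2 (partial_y (partial_y H)) p"
proof -
  define a b c where "a = eval2 (partial_x (partial_x H)) p" and "b = eval2 (partial_y (partial_x H)) p"
    and "c = eval2 (partial_y (partial_y H)) p"
  obtain v1 v2 w1 w2 :: real where vw: "v1 * w2 \<noteq> v2 * w1"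
    "a * of_real v1 ^ 2 + 2 * b * of_real v1 * of_real v2 + c * of_real v2 ^ 2 = 0"
    "a * of_real w1 ^ 2 + 2 * b * of_real w1 * of_real w2 + c * of_real w2 ^ 2 = 0"
    and ne: "a \<noteq> 0 \<or> b \<noteq> 0 \<or> c \<noteq> 0"
    using assms unfolding real_tangent_pair_def Let_def a_def b_def c_def by blast
  have "b ^ 2 \<noteq> a * c"
  proof
    assume eq: "b ^ 2 = a * c"
    define V1 V2 W1 W2 where "V1 = complex_of_real v1" and "V2 = complex_of_real v2"
      and "W1 = complex_of_real w1" and "W2 = complex_of_real w2"
    have "V1 * W2 - V2 * W1 = of_real (v1 * w2 - v2 * w1)" unfolding V1_def V2_def W1_def W2_def by simp
    then have dne: "V1 * W2 - V2 * W1 \<noteq> 0" using vw(1) by (metis eq_iff_diff_eq_0 of_real_eq_0_iff)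
    have q: "a * V1 ^ 2 + 2 * b * V1 * V2 + c * V2 ^ 2 = 0" "a * W1 ^ 2 + 2 * b * W1 * W2 + c * W2 ^ 2 = 0"
      using vw(2,3) unfolding V1_def V2_def W1_def W2_def .
    have sq: "a * (a * V1 ^ 2 + 2 * b * V1 * V2 + c * V2 ^ 2) = (a * V1 + b * V2) ^ 2"
      "c * (a * V1 ^ 2 + 2 * b * V1 * V2 + c * V2 ^ 2) = (b * V1 + c * V2) ^ 2"
      "a * (a * W1 ^ 2 + 2 * b * W1 * W2 + c * W2 ^ 2) = (a * W1 + b * W2) ^ 2"
      "c * (a * W1 ^ 2 + 2 * b * W1 * W2 + c * W2 ^ 2) = (b * W1 + c * W2) ^ 2"
    proof -
      have "(a * s + b * t) ^ 2 = a * (a * s ^ 2 + 2 * b * s * t + c * t ^ 2) + (b ^ 2 - a * c) * t ^ 2"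
        "(b * s + c * t) ^ 2 = c * (a * s ^ 2 + 2 * b * s * t + c * t ^ 2) + (b ^ 2 - a * c) * s ^ 2" for s t
        by (simp_all add: power2_eq_square algebra_simps)
      then show "a * (a * V1 ^ 2 + 2 * b * V1 * V2 + c * V2 ^ 2) = (a * V1 + b * V2) ^ 2"
        "c * (a * V1 ^ 2 + 2 * b * V1 * V2 + c * V2 ^ 2) = (b * V1 + c * V2) ^ 2"
        "a * (a * W1 ^ 2 + 2 * b * W1 * W2 + c * W2 ^ 2) = (a * W1 + b * W2) ^ 2"
        "c * (a * W1 ^ 2 + 2 * b * W1 * W2 + c * W2 ^ 2) = (b * W1 + c * W2) ^ 2"
        unfolding eq by simp_all
    qed
    then have "a * V1 + b * V2 = 0" "b * V1 + c * V2 = 0" "a * W1 + b * W2 = 0" "b * W1 + c * W2 = 0"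
      using q by simp_all
    moreover have "(V1 * W2 - V2 * W1) * a = W2 * (a * V1 + b * V2) - V2 * (a * W1 + b * W2)"
      "(V1 * W2 - V2 * W1) * b = W2 * (b * V1 + c * V2) - V2 * (b * W1 + c * W2)"
      "(V1 * W2 - V2 * W1) * c = V1 * (b * W1 + c * W2) - W1 * (b * V1 + c * V2)"
      by (simp_all add: algebra_simps)
    ultimately have "(V1 * W2 - V2 * W1) * a = 0" "(V1 * W2 - V2 * W1) * b = 0" "(V1 * W2 - V2 * W1) * c = 0"
      by (simp_all only: mult_zero_right diff_self)
    then show False using dne ne by auto
  qed
  then show ?thesis unfolding a_def b_def c_def .
qed

text \<open>A quotient of polynomials has a limit in the projective line, by comparing orders. The
  slope of a branch is such a quotient.\<close>

lemma poly_ratio_limit: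
  fixes P R :: "complex poly"
  assumes "P \<noteq> 0"
  shows "(\<exists>l. ((\<lambda>z. poly R z / poly P z) \<longlongrightarrow> l) (at w)) \<or>
    (R \<noteq> 0 \<and> ((\<lambda>z. poly P z / poly R z) \<longlongrightarrow> 0) (at w))"
proof -
  have ratio: "\<exists>l. ((\<lambda>z. poly R z / poly P z) \<longlongrightarrow> l) (at w) \<and> (order w P < order w R \<longrightarrow> l = 0)"
    if PR: "P \<noteq> 0" "R \<noteq> 0" "order w P \<le> order w R" for P R :: "complex poly"
  proof -
    obtain p where p: "P = [:- w, 1:] ^ order w P * p" "\<not> [:- w, 1:] dvd p" using order_decomp[OF PR(1)] by blast
    obtain r where r: "R = [:- w, 1:] ^ order w R * r" using order_decomp[OF PR(2)] by blast
    define k where "k = order w R - order w P"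
    have p0: "poly p w \<noteq> 0" using p(2) by (simp add: poly_eq_0_iff_dvd)
    have "((\<lambda>z. (z - w) ^ k * poly r z / poly p z) \<longlongrightarrow> (w - w) ^ k * poly r w / poly p w) (at w)"
      using p0 by (intro tendsto_intros) auto
    moreover have "\<forall>\<^sub>F z in at w. (z - w) ^ k * poly r z / poly p z = poly R z / poly P z"
    proof -
      have "(z - w) ^ k * poly r z / poly p z = poly R z / poly P z" if "z \<noteq> w" for z
      proof -
        have "poly R z = (z - w) ^ order w P * (z - w) ^ k * poly r z"
          using PR(3) by (subst r) (simp add: k_def flip: power_add)
        moreover have "poly P z = (z - w) ^ order w P * poly p z" by (subst p(1)) simp
        ultimately show ?thesis using that by simp
      qed
      then show ?thesis by (simp add: eventually_at_filter)
    qed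
    ultimately have "((\<lambda>z. poly R z / poly P z) \<longlongrightarrow> (w - w) ^ k * poly r w / poly p w) (at w)"
      by (rule Lim_transform_eventually)
    then show ?thesis unfolding k_def by (intro exI conjI) (assumption, auto simp: zero_power)
  qed
  show ?thesis
  proof (cases "R = 0")
    case True
    then show ?thesis by (intro disjI1 exI[of _ 0]) simp
  next
    case False
    then show ?thesis
      using ratio[OF assms False] ratio[OF False assms] by (cases "order w P \<le> order w R") (auto simp: not_le)
  qed
qed

context nonvertical_param_curve
begin

lemma X_not_constant: "w \<in> \<Omega> \<Longrightarrow> \<forall>\<^sub>F z in at w. z \<in> \<Omega> \<and> X z \<noteq> x"
proof -
  assume w: "w \<in> \<Omega>"
  have "finite ({z \<in> \<Omega>. X z = x} - {w})" using finite_fibre by simp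
  then have "open (\<Omega> - ({z \<in> \<Omega>. X z = x} - {w}))" using open_\<Omega> finite_imp_closed open_Diff by blast
  then have "\<forall>\<^sub>F z in at w. z \<in> \<Omega> - ({z \<in> \<Omega>. X z = x} - {w}) - {w}"
    using w by (intro eventually_at_in_open) auto
  then show "\<forall>\<^sub>F z in at w. z \<in> \<Omega> \<and> X z \<noteq> x" by eventually_elim auto
qed

lemma X_tendsto: "w \<in> \<Omega> \<Longrightarrow> (X \<longlongrightarrow> X w) (at w)" and Y_tendsto: "w \<in> \<Omega> \<Longrightarrow> (Y \<longlongrightarrow> Y w) (at w)"
  unfolding X_def Y_def by (intro tendsto_intros, erule \<Omega>_pow)+

text \<open>Along the branch \<open>G = 0\<close> is divided by \<open>(X - X w) ^ 2\<close> and
  \<open>G_y\<close> by \<open>X - X w\<close>; the second-order expansion then yields both limits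
  in terms of the slope. Quotients of increments instead of derivatives cover the branches on which
  \<open>X'\<close> vanishes as well.\<close>

lemma branch_slope:
  assumes w: "w \<in> \<Omega>" and sing: "\<phi> w \<in> singular_points G"
  obtains \<alpha> where "((\<lambda>z. (Y z - Y w) / (X z - X w)) \<longlongrightarrow> \<alpha>) (at w)"
    "eval2 (partial_x Gx) (\<phi> w) + 2 * eval2 (partial_y Gx) (\<phi> w) * \<alpha> + eval2 (partial_y Gy) (\<phi> w) * \<alpha> ^ 2 = 0"
    "((\<lambda>z. eval2 Gy (X z, Y z) / (X z - X w)) \<longlongrightarrow> eval2 (partial_y Gx) (\<phi> w) + eval2 (partial_y Gy) (\<phi> w) * \<alpha>) (at w)"
proof -
  define x0 y0 where "x0 = X w" and "y0 = Y w"
  have p: "\<phi> w = (x0, y0)" by (simp add: \<phi>_def x0_def y0_def)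
  obtain P0 P1 P2 where dec:
    "G = [:[:- x0, 1:]:] * [:[:- x0, 1:]:] * P0 + [:[:- x0, 1:]:] * [:[:- y0:], 1:] * P1
      + [:[:- y0:], 1:] * [:[:- y0:], 1:] * P2"
    "eval2 (partial_x Gx) (\<phi> w) = 2 * eval2 P0 (\<phi> w)"
    "eval2 (partial_y Gx) (\<phi> w) = eval2 P1 (\<phi> w)"
    "eval2 (partial_y Gy) (\<phi> w) = 2 * eval2 P2 (\<phi> w)"
    using second_order_decomposition[OF sing p] by metis
  have Ge: "eval2 G (x, y) = (x - x0) * (x - x0) * eval2 P0 (x, y) + (x - x0) * (y - y0) * eval2 P1 (x, y)
      + (y - y0) * (y - y0) * eval2 P2 (x, y)" for x y
    by (subst dec(1)) (simp add: algebra_simps)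
  have Gye: "eval2 Gy (x, y) = (x - x0) * (x - x0) * eval2 (partial_y P0) (x, y) + (x - x0) * eval2 P1 (x, y)
      + (x - x0) * (y - y0) * eval2 (partial_y P1) (x, y) + 2 * (y - y0) * eval2 P2 (x, y)
      + (y - y0) * (y - y0) * eval2 (partial_y P2) (x, y)" for x y
  proof -
    define u v where "u = [:[:- x0, 1:]:]" and "v = [:[:- y0:], 1:]"
    have uv: "partial_y u = 0" "partial_y v = 1" "eval2 u (x, y) = x - x0" "eval2 v (x, y) = y - y0"
      unfolding u_def v_def by (rule partial_linear | simp)+
    have "G = u * u * P0 + u * v * P1 + v * v * P2" using dec(1) unfolding u_def v_def .
    then show ?thesis by (simp add: partial_add partial_mult uv algebra_simps)
  qed
  have P2: "eval2 P2 (x0, y0) \<noteq> 0" using not_vertical[OF sing] unfolding dec(4) unfolding p by simp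
  have lim: "((\<lambda>z. eval2 H (X z, Y z)) \<longlongrightarrow> eval2 H (x0, y0)) (at w)" for H
    unfolding x0_def y0_def by (intro tendsto_intros X_tendsto Y_tendsto w)
  have limX: "((\<lambda>z. X z - x0) \<longlongrightarrow> 0) (at w)" and limY: "((\<lambda>z. Y z - y0) \<longlongrightarrow> 0) (at w)"
    using tendsto_diff[OF X_tendsto[OF w] tendsto_const, of x0] tendsto_diff[OF Y_tendsto[OF w] tendsto_const, of y0]
    unfolding x0_def y0_def by simp_all
  define R where "R = fibre_eq B n y0"
  have ev: "\<forall>\<^sub>F z in at w. z \<in> \<Omega> \<and> X z \<noteq> x0" by (rule X_not_constant[OF w])
  have ratio: "(Y z - y0) / (X z - x0) = poly R z / poly (\<Delta> x0) z" if "z \<in> \<Omega>" for z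
    using \<Omega>_pow[OF that] numerators[OF that]
    by (simp add: R_def poly_fibre_eq poly_\<Delta> flip: left_diff_distrib)
  have ratio': "(X z - x0) / (Y z - y0) = poly (\<Delta> x0) z / poly R z" if "z \<in> \<Omega>" for z
    using \<Omega>_pow[OF that] numerators[OF that]
    by (simp add: R_def poly_fibre_eq poly_\<Delta> flip: left_diff_distrib)
  have ev\<Omega>: "\<forall>\<^sub>F z in at w. z \<in> \<Omega>" using ev by eventually_elim simp
  from poly_ratio_limit[OF \<Delta>_nonzero, of R x0 w] show thesis
  proof
    assume "\<exists>l. ((\<lambda>z. poly R z / poly (\<Delta> x0) z) \<longlongrightarrow> l) (at w)"
    then obtain \<alpha> where "((\<lambda>z. poly R z / poly (\<Delta> x0) z) \<longlongrightarrow> \<alpha>) (at w)" by blast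
    then have slope: "((\<lambda>z. (Y z - y0) / (X z - x0)) \<longlongrightarrow> \<alpha>) (at w)"
      by (rule Lim_transform_eventually) (use ev\<Omega> ratio in \<open>auto elim: eventually_mono\<close>)
    define s where "s z = (Y z - y0) / (X z - x0)" for z
    have slope: "(s \<longlongrightarrow> \<alpha>) (at w)" using slope unfolding s_def .
    have "((\<lambda>z. eval2 P0 (X z, Y z) + s z * eval2 P1 (X z, Y z) + s z * s z * eval2 P2 (X z, Y z))
        \<longlongrightarrow> eval2 P0 (x0, y0) + \<alpha> * eval2 P1 (x0, y0) + \<alpha> * \<alpha> * eval2 P2 (x0, y0)) (at w)"
      by (intro tendsto_add tendsto_mult slope lim)
    moreover have "\<forall>\<^sub>F z in at w. eval2 P0 (X z, Y z) + s z * eval2 P1 (X z, Y z) + s z * s z * eval2 P2 (X z, Y z) = 0"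
      using ev
    proof eventually_elim
      case (elim z)
      have "Y z - y0 = s z * (X z - x0)" using elim unfolding s_def by simp
      moreover have "u * u * (p0 + s * p1 + s * s * p2) = u * u * p0 + u * (s * u) * p1 + (s * u) * (s * u) * p2"
        for u s p0 p1 p2 :: complex by (simp add: algebra_simps)
      ultimately have "(X z - x0) * (X z - x0) * (eval2 P0 (X z, Y z) + s z * eval2 P1 (X z, Y z) + s z * s z * eval2 P2 (X z, Y z)) = 0"
        using Ge[of "X z" "Y z"] eval2_G_\<phi>[of z] elim by metis
      then show ?case using elim by (metis eq_iff_diff_eq_0 mult_eq_0_iff)
    qed
    ultimately have "((\<lambda>z. 0) \<longlongrightarrow> eval2 P0 (x0, y0) + \<alpha> * eval2 P1 (x0, y0) + \<alpha> * \<alpha> * eval2 P2 (x0, y0)) (at w)"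
      by (rule Lim_transform_eventually)
    then have q0: "eval2 P0 (x0, y0) + \<alpha> * eval2 P1 (x0, y0) + \<alpha> * \<alpha> * eval2 P2 (x0, y0) = 0"
      by (simp add: tendsto_const_iff)
    have "((\<lambda>z. (X z - x0) * eval2 (partial_y P0) (X z, Y z) + eval2 P1 (X z, Y z)
        + (Y z - y0) * eval2 (partial_y P1) (X z, Y z) + 2 * s z * eval2 P2 (X z, Y z)
        + s z * (Y z - y0) * eval2 (partial_y P2) (X z, Y z))
      \<longlongrightarrow> 0 * eval2 (partial_y P0) (x0, y0) + eval2 P1 (x0, y0) + 0 * eval2 (partial_y P1) (x0, y0)
        + 2 * \<alpha> * eval2 P2 (x0, y0) + \<alpha> * 0 * eval2 (partial_y P2) (x0, y0)) (at w)"
      by (intro tendsto_add tendsto_mult slope lim limX limY tendsto_const)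
    moreover have "\<forall>\<^sub>F z in at w. (X z - x0) * eval2 (partial_y P0) (X z, Y z) + eval2 P1 (X z, Y z)
        + (Y z - y0) * eval2 (partial_y P1) (X z, Y z) + 2 * s z * eval2 P2 (X z, Y z)
        + s z * (Y z - y0) * eval2 (partial_y P2) (X z, Y z) = eval2 Gy (X z, Y z) / (X z - x0)"
      using ev
    proof eventually_elim
      case (elim z)
      then have ne: "X z - x0 \<noteq> 0" by simp
      have gen: "u * q0 + p1 + v * q1 + 2 * (v / u) * p2 + v / u * v * q2
          = (u * u * q0 + u * p1 + u * v * q1 + 2 * v * p2 + v * v * q2) / u"
        if "u \<noteq> 0" for u v q0 p1 q1 p2 q2 :: complex
        using that by (simp add: add_divide_distrib)
      show ?case unfolding Gye s_def by (rule gen[OF ne])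
    qed
    ultimately have "((\<lambda>z. eval2 Gy (X z, Y z) / (X z - x0)) \<longlongrightarrow> eval2 P1 (x0, y0) + 2 * \<alpha> * eval2 P2 (x0, y0)) (at w)"
      by (simp add: Lim_transform_eventually)
    then have lim3: "((\<lambda>z. eval2 Gy (X z, Y z) / (X z - x0)) \<longlongrightarrow>
        eval2 (partial_y Gx) (\<phi> w) + eval2 (partial_y Gy) (\<phi> w) * \<alpha>) (at w)"
      unfolding dec(3,4) unfolding p by (simp only: ac_simps)
    have "eval2 (partial_x Gx) (\<phi> w) + 2 * eval2 (partial_y Gx) (\<phi> w) * \<alpha> + eval2 (partial_y Gy) (\<phi> w) * \<alpha> ^ 2
        = 2 * (eval2 P0 (x0, y0) + \<alpha> * eval2 P1 (x0, y0) + \<alpha> * \<alpha> * eval2 P2 (x0, y0))"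
      unfolding dec(2-4) unfolding p by (simp add: algebra_simps power2_eq_square)
    then have lim2: "eval2 (partial_x Gx) (\<phi> w) + 2 * eval2 (partial_y Gx) (\<phi> w) * \<alpha> + eval2 (partial_y Gy) (\<phi> w) * \<alpha> ^ 2 = 0"
      unfolding q0 by simp
    show thesis
      by (rule that[OF slope[unfolded s_def x0_def y0_def] lim2 lim3[unfolded x0_def]])
  next
    \<comment> \<open>An infinite slope is impossible: after division by
      \<open>(Y - Y w) ^ 2\<close> only the term with \<open>P2\<close> survives in the limit, and
      it is not zero.\<close>
    assume R: "R \<noteq> 0 \<and> ((\<lambda>z. poly (\<Delta> x0) z / poly R z) \<longlongrightarrow> 0) (at w)"
    define s where "s z = (X z - x0) / (Y z - y0)" for z
    have slope: "(s \<longlongrightarrow> 0) (at w)"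
      unfolding s_def by (rule Lim_transform_eventually[OF conjunct2[OF R]])
        (use ev\<Omega> ratio' in \<open>auto elim: eventually_mono\<close>)
    have "finite ({z. poly R z = 0} - {w})" using poly_roots_finite[of R] R by blast
    then have "open (- ({z. poly R z = 0} - {w}))" using finite_imp_closed by blast
    then have "\<forall>\<^sub>F z in at w. z \<in> - ({z. poly R z = 0} - {w}) - {w}" by (intro eventually_at_in_open) auto
    then have evY: "\<forall>\<^sub>F z in at w. z \<in> \<Omega> \<and> Y z \<noteq> y0"
      using ev\<Omega> by eventually_elim (use numerators(2) in \<open>auto simp: R_def poly_fibre_eq\<close>)
    have "((\<lambda>z. s z * s z * eval2 P0 (X z, Y z) + s z * eval2 P1 (X z, Y z) + eval2 P2 (X z, Y z))
        \<longlongrightarrow> 0 * 0 * eval2 P0 (x0, y0) + 0 * eval2 P1 (x0, y0) + eval2 P2 (x0, y0)) (at w)"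
      by (intro tendsto_add tendsto_mult slope lim)
    moreover have "\<forall>\<^sub>F z in at w. s z * s z * eval2 P0 (X z, Y z) + s z * eval2 P1 (X z, Y z) + eval2 P2 (X z, Y z) = 0"
      using evY
    proof eventually_elim
      case (elim z)
      have "X z - x0 = s z * (Y z - y0)" using elim unfolding s_def by simp
      moreover have "u * u * (s * s * p0 + s * p1 + p2) = (s * u) * (s * u) * p0 + (s * u) * u * p1 + u * u * p2"
        for u s p0 p1 p2 :: complex by (simp add: algebra_simps)
      ultimately have "(Y z - y0) * (Y z - y0) * (s z * s z * eval2 P0 (X z, Y z) + s z * eval2 P1 (X z, Y z) + eval2 P2 (X z, Y z)) = 0"
        using Ge[of "X z" "Y z"] eval2_G_\<phi>[of z] elim by metis
      then show ?case using elim by (metis eq_iff_diff_eq_0 mult_eq_0_iff)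
    qed
    ultimately have "((\<lambda>z. 0) \<longlongrightarrow> 0 * 0 * eval2 P0 (x0, y0) + 0 * eval2 P1 (x0, y0) + eval2 P2 (x0, y0)) (at w)"
      by (rule Lim_transform_eventually)
    then have "eval2 P2 (x0, y0) = 0" by (simp add: tendsto_const_iff)
    then show thesis using P2 by simp
  qed
qed

text \<open>\<open>\<Delta> x0\<close> is the numerator of \<open>X - x0\<close>, and the constant
  \<open>x0\<close> disappears on differentiation.\<close>

lemma numer_deriv_\<Delta>: "numer_deriv (\<Delta> x0) = numer_deriv A"
proof (cases "n = 0")
  case True
  then have "\<Delta> x0 = A - [:x0:]" unfolding \<Delta>_def fibre_eq_def by (simp add: monom_0)
  then show ?thesis unfolding numer_deriv_def using True by (simp add: pderiv_diff)
next
  case False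
  then obtain i where i: "n = Suc i" using not0_implies_Suc by blast
  have id: "[:0, 1:] * pderiv (monom x0 n) = Polynomial.smult (of_nat n) (monom x0 n)"
    unfolding i by (rule poly_eqI) (simp add: pderiv_monom coeff_pCons split: nat.splits)
  have "numer_deriv (\<Delta> x0) = [:0, 1:] * pderiv A - Polynomial.smult (of_nat n) A"
    unfolding numer_deriv_def if_not_P[OF False] \<Delta>_def fibre_eq_def pderiv_diff
      smult_diff_right right_diff_distrib id
    by (simp only: diff_diff_eq2 diff_add_cancel)
  then show ?thesis using False unfolding numer_deriv_def by simp
qed

text \<open>The quotient of \<open>G_y\<close> by \<open>X - X w\<close> has a limit by
  \<open>branch_slope\<close>, and it is nonzero because the Hessian is nondegenerate. So
  \<open>G_y\<close> vanishes at most to the order of \<open>X - X w\<close>, which exceeds that of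
  \<open>X'\<close> by at most one.\<close>

lemma order_E_node:
  assumes w: "w \<in> \<Omega>" and sing: "\<phi> w \<in> singular_points G"
  shows "order w E \<le> Suc (order w (numer_deriv A))"
proof -
  define x0 where "x0 = X w"
  define k where "k = order w (\<Delta> x0)"
  obtain \<alpha> where \<alpha>:
    "eval2 (partial_x Gx) (\<phi> w) + 2 * eval2 (partial_y Gx) (\<phi> w) * \<alpha> + eval2 (partial_y Gy) (\<phi> w) * \<alpha> ^ 2 = 0"
    "((\<lambda>z. eval2 Gy (X z, Y z) / (X z - X w)) \<longlongrightarrow> eval2 (partial_y Gx) (\<phi> w) + eval2 (partial_y Gy) (\<phi> w) * \<alpha>) (at w)"
    using branch_slope[OF w sing] by blast
  have ne: "eval2 (partial_y Gx) (\<phi> w) + eval2 (partial_y Gy) (\<phi> w) * \<alpha> \<noteq> 0"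
  proof
    assume "eval2 (partial_y Gx) (\<phi> w) + eval2 (partial_y Gy) (\<phi> w) * \<alpha> = 0"
    moreover have "b ^ 2 = a * c" if "b + c * s = 0" "a + 2 * b * s + c * s ^ 2 = 0" for a b c s :: complex
    proof -
      have b: "b = - (c * s)" using that(1) by (simp add: eq_neg_iff_add_eq_0)
      have "a = c * s ^ 2" using that(2) unfolding b by (simp add: power2_eq_square algebra_simps)
      then show ?thesis unfolding b by (simp add: power2_eq_square)
    qed
    ultimately have "eval2 (partial_y Gx) (\<phi> w) ^ 2 = eval2 (partial_x Gx) (\<phi> w) * eval2 (partial_y Gy) (\<phi> w)"
      using \<alpha>(1) by blast
    then show False using real_tangent_pair_hessian[OF nodes[OF sing]] by blast
  qed
  have "order w E \<le> k"
  proof (rule ccontr)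
    assume "\<not> order w E \<le> k"
    then have "[:- w, 1:] ^ Suc k dvd E" using order_divides[of w "Suc k" E] by simp
    then obtain E1 where E1: "E = [:- w, 1:] ^ Suc k * E1" by (elim dvdE)
    obtain a where a: "\<Delta> x0 = [:- w, 1:] ^ k * a" "\<not> [:- w, 1:] dvd a"
      using order_decomp[OF \<Delta>_nonzero] unfolding k_def by blast
    have a0: "poly a w \<noteq> 0" using a(2) by (simp add: poly_eq_0_iff_dvd)
    have "((\<lambda>z. (z - w) * poly E1 z * z ^ n / (z ^ e * poly a z)) \<longlongrightarrow> (w - w) * poly E1 w * w ^ n / (w ^ e * poly a w)) (at w)"
      using a0 \<Omega>_pow_e[OF w, of e] E(1) by (intro tendsto_intros) auto
    then have "((\<lambda>z. (z - w) * poly E1 z * z ^ n / (z ^ e * poly a z)) \<longlongrightarrow> 0) (at w)" by simp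
    moreover have "\<forall>\<^sub>F z in at w. (z - w) * poly E1 z * z ^ n / (z ^ e * poly a z) = eval2 Gy (X z, Y z) / (X z - X w)"
      using X_not_constant[OF w, of x0] eventually_neq_at_within[of w w UNIV]
    proof eventually_elim
      case (elim z)
      then have z: "z \<in> \<Omega>" "X z \<noteq> x0" "z \<noteq> w" by auto
      have ze: "z ^ e \<noteq> 0" by (rule \<Omega>_pow_e[OF z(1)]) (use E(1) in blast)
      have lin: "poly [:- w, 1:] z = z - w" by simp
      have "poly E z = (z - w) ^ Suc k * poly E1 z"
        using arg_cong[OF E1, of "\<lambda>p. poly p z"] unfolding poly_mult poly_power lin .
      then have Gy: "eval2 Gy (X z, Y z) = (z - w) ^ Suc k * poly E1 z / z ^ e"
        using E(2)[OF z(1)] ze by (metis nonzero_mult_div_cancel_left)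
      have "(X z - x0) * z ^ n = (z - w) ^ k * poly a z"
        using arg_cong[OF a(1), of "\<lambda>p. poly p z"] numerators(1)[OF z(1)] unfolding poly_\<Delta> by (simp add: algebra_simps)
      then have Xz: "X z - x0 = (z - w) ^ k * poly a z / z ^ n" using \<Omega>_pow[OF z(1)] by (simp add: eq_divide_eq)
      have nz: "poly a z \<noteq> 0" "z ^ n \<noteq> 0" using Xz z(2) \<Omega>_pow[OF z(1)] by auto
      have "eval2 Gy (X z, Y z) / (X z - X w) = ((z - w) ^ Suc k * poly E1 z / z ^ e) / ((z - w) ^ k * poly a z / z ^ n)"
        unfolding Gy x0_def[symmetric] Xz ..
      also have "\<dots> = (z - w) * poly E1 z * z ^ n / (z ^ e * poly a z)"
      proof -
        have "(c ^ Suc k * p / q) / (c ^ k * r / t) = c * p * t / (q * r)" if "c \<noteq> 0" for c p q r t :: complex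
          using that by simp
        moreover have "z - w \<noteq> 0" using z(3) by simp
        ultimately show ?thesis by blast
      qed
      finally show ?case by simp
    qed
    ultimately have "((\<lambda>z. eval2 Gy (X z, Y z) / (X z - X w)) \<longlongrightarrow> 0) (at w)"
      by (rule Lim_transform_eventually)
    then show False using tendsto_unique[OF _ \<alpha>(2)] ne by (metis at_neq_bot)
  qed
  also have "k \<le> Suc (order w (numer_deriv A))"
  proof (cases k)
    case (Suc j)
    have dvd0: "[:- w, 1:] ^ Suc j dvd \<Delta> x0" using order_divides[of w "Suc j" "\<Delta> x0"] Suc unfolding k_def by simp
    then obtain a where a: "\<Delta> x0 = [:- w, 1:] ^ Suc j * a" by (elim dvdE)
    have d1: "[:- w, 1:] ^ j dvd pderiv (\<Delta> x0)"
    proof -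
      define L where "L = [:- w, 1:]"
      have "L ^ j dvd L ^ Suc j * pderiv a" by (intro dvd_mult2 le_imp_power_dvd) simp
      moreover have "L ^ j dvd a * (Polynomial.smult (of_nat (Suc j)) (L ^ j) * pderiv L)"
        by (intro dvd_mult dvd_mult2 dvd_smult dvd_refl)
      ultimately show ?thesis
        unfolding a L_def[symmetric] pderiv_mult pderiv_power_Suc by (rule dvd_add)
    qed
    have d2: "[:- w, 1:] ^ j dvd \<Delta> x0" using dvd0 by (metis dvd_mult_right power_Suc)
    have "numer_deriv A = numer_deriv (\<Delta> x0)" by (simp only: numer_deriv_\<Delta>)
    moreover have "[:- w, 1:] ^ j dvd numer_deriv (\<Delta> x0)"
      unfolding numer_deriv_def using d1 d2 by (auto intro!: dvd_diff dvd_smult dvd_mult simp del: mult_pCons_left)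
    ultimately show ?thesis using Suc numer_deriv_A(1) order_divides[of w j "numer_deriv A"] by simp
  qed simp
  finally show ?thesis .
qed

end

section \<open>Counting the parameters over a node\<close>

context nonvertical_param_curve
begin

text \<open>In the blown-up coordinate \<open>w = (y - y0) / (x - x0)\<close> the derivative of
  \<open>G\<close> is \<open>(x - x0) ^ 2\<close> times a continuous function, whose value at the
  branch is the one assumed nonzero. So \<open>G\<close> is injective in \<open>w\<close> near
  \<open>\<alpha>\<close>, uniformly in \<open>x\<close>.\<close>

lemma local_uniqueness:
  assumes sing: "p \<in> singular_points G" and p: "p = (x0, y0)"
    and \<alpha>: "eval2 (partial_y Gx) p + eval2 (partial_y Gy) p * \<alpha> \<noteq> 0"
  obtains \<delta> where "\<delta> > 0" "\<And>x y y'. norm (x - x0) < \<delta> \<Longrightarrow> x \<noteq> x0 \<Longrightarrow>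
    norm ((y - y0) / (x - x0) - \<alpha>) < \<delta> \<Longrightarrow> norm ((y' - y0) / (x - x0) - \<alpha>) < \<delta> \<Longrightarrow>
    eval2 G (x, y) = 0 \<Longrightarrow> eval2 G (x, y') = 0 \<Longrightarrow> y = y'"
proof -
  obtain P0 P1 P2 where dec:
    "G = [:[:- x0, 1:]:] * [:[:- x0, 1:]:] * P0 + [:[:- x0, 1:]:] * [:[:- y0:], 1:] * P1
      + [:[:- y0:], 1:] * [:[:- y0:], 1:] * P2"
    "eval2 (partial_y Gx) p = eval2 P1 p"
    "eval2 (partial_y Gy) p = 2 * eval2 P2 p"
    using second_order_decomposition[OF sing p] by metis
  have Gye: "eval2 Gy (x0 + \<xi>, y0 + \<xi> * w) = \<xi> * (\<xi> * eval2 (partial_y P0) (x0 + \<xi>, y0 + \<xi> * w)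
      + eval2 P1 (x0 + \<xi>, y0 + \<xi> * w) + \<xi> * w * eval2 (partial_y P1) (x0 + \<xi>, y0 + \<xi> * w)
      + 2 * w * eval2 P2 (x0 + \<xi>, y0 + \<xi> * w) + \<xi> * w * w * eval2 (partial_y P2) (x0 + \<xi>, y0 + \<xi> * w))" for \<xi> w
  proof -
    define u v where "u = [:[:- x0, 1:]:]" and "v = [:[:- y0:], 1:]"
    have uv: "partial_y u = 0" "partial_y v = 1" "eval2 u (x0 + \<xi>, y0 + \<xi> * w) = \<xi>" "eval2 v (x0 + \<xi>, y0 + \<xi> * w) = \<xi> * w"
      unfolding u_def v_def by (rule partial_linear | simp)+
    have "G = u * u * P0 + u * v * P1 + v * v * P2" using dec(1) unfolding u_def v_def .
    then show ?thesis by (simp add: partial_add partial_mult uv) (simp add: algebra_simps)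
  qed
  define \<Psi> where "\<Psi> q = (case q of (\<xi>, w) \<Rightarrow> \<xi> * eval2 (partial_y P0) (x0 + \<xi>, y0 + \<xi> * w)
      + eval2 P1 (x0 + \<xi>, y0 + \<xi> * w) + \<xi> * w * eval2 (partial_y P1) (x0 + \<xi>, y0 + \<xi> * w)
      + 2 * w * eval2 P2 (x0 + \<xi>, y0 + \<xi> * w) + \<xi> * w * w * eval2 (partial_y P2) (x0 + \<xi>, y0 + \<xi> * w))" for q
  define c where "c = \<Psi> (0, \<alpha>)"
  have c0: "c \<noteq> 0" using \<alpha> unfolding c_def \<Psi>_def dec(2,3) unfolding p by (simp add: algebra_simps)
  have "continuous_on UNIV \<Psi>" unfolding \<Psi>_def case_prod_beta
    by (intro continuous_on_add continuous_on_mult continuous_on_eval2 continuous_on_const continuous_on_fst continuous_on_snd continuous_on_id)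
  then have "isCont \<Psi> (0, \<alpha>)" by (simp add: continuous_on_eq_continuous_at)
  then obtain d where d: "d > 0" "\<And>q. dist q (0, \<alpha>) < d \<Longrightarrow> dist (\<Psi> q) c < norm c / 2"
    using c0 unfolding continuous_at_eps_delta c_def
    by (metis half_gt_zero zero_less_norm_iff)
  show thesis
  proof (rule that[of "d / 2"])
    show "d / 2 > 0" using d(1) by simp
    fix x y y'
    assume x: "norm (x - x0) < d / 2" "x \<noteq> x0"
      and y: "norm ((y - y0) / (x - x0) - \<alpha>) < d / 2" "norm ((y' - y0) / (x - x0) - \<alpha>) < d / 2"
      and G0: "eval2 G (x, y) = 0" "eval2 G (x, y') = 0"
    define \<xi> where "\<xi> = x - x0"
    have \<xi>: "\<xi> \<noteq> 0" "x = x0 + \<xi>" using x unfolding \<xi>_def by auto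
    define S where "S = ball \<alpha> (d / 2)"
    \<comment> \<open>Subtracting the linear part leaves a function whose Lipschitz constant is at
      most half the slope removed; two zeros of \<open>G\<close> must then coincide.\<close>
    define f where "f w = eval2 G (x, y0 + \<xi> * w) - \<xi> * \<xi> * c * w" for w
    have der: "(f has_field_derivative \<xi> * \<xi> * (\<Psi> (\<xi>, w) - c)) (at w within S)" for w
    proof -
      have "((\<lambda>w. y0 + \<xi> * w) has_field_derivative \<xi>) (at w within S)"
        by (auto intro!: derivative_eq_intros)
      from eval2_chain[OF DERIV_const this, of G x]
      have "((\<lambda>w. eval2 G (x, y0 + \<xi> * w)) has_field_derivative eval2 Gy (x, y0 + \<xi> * w) * \<xi>) (at w within S)"
        by simp
      moreover have "eval2 Gy (x, y0 + \<xi> * w) = \<xi> * \<Psi> (\<xi>, w)" unfolding \<xi>(2) Gye \<Psi>_def by simp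
      ultimately have "(f has_field_derivative \<xi> * \<Psi> (\<xi>, w) * \<xi> - \<xi> * \<xi> * c) (at w within S)"
        unfolding f_def by (auto intro!: derivative_eq_intros)
      then show ?thesis by (simp add: algebra_simps)
    qed
    have bound: "norm (\<xi> * \<xi> * (\<Psi> (\<xi>, w) - c)) \<le> norm (\<xi> * \<xi>) * (norm c / 2)" if "w \<in> S" for w
    proof -
      have "dist (\<xi>, w) (0, \<alpha>) \<le> dist \<xi> 0 + dist w \<alpha>"
        unfolding dist_prod_def by (simp add: real_sqrt_sum_squares_triangle_ineq sqrt_sum_squares_le_sum)
      also have "\<dots> < d"
      proof -
        have "dist \<xi> 0 < d / 2" using x(1) unfolding \<xi>_def by simp
        moreover have "dist w \<alpha> < d / 2" using that unfolding S_def by (simp add: dist_commute)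
        ultimately show ?thesis by linarith
      qed
      finally have "norm (\<Psi> (\<xi>, w) - c) < norm c / 2" using d(2) by (simp add: dist_norm)
      then show ?thesis unfolding norm_mult[of "\<xi> * \<xi>"] by (intro mult_left_mono) auto
    qed
    define w w' where "w = (y - y0) / \<xi>" and "w' = (y' - y0) / \<xi>"
    have ww: "w \<in> S" "w' \<in> S" using y unfolding w_def w'_def S_def \<xi>_def by (auto simp: dist_norm norm_minus_commute)
    have yw: "y = y0 + \<xi> * w" "y' = y0 + \<xi> * w'" using \<xi>(1) unfolding w_def w'_def by auto
    have "norm (f w - f w') \<le> norm (\<xi> * \<xi>) * (norm c / 2) * norm (w - w')"
      by (rule field_differentiable_bound[of S, OF _ der bound ww]) (simp_all add: S_def)
    moreover have "f w - f w' = \<xi> * \<xi> * c * (w' - w)"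
    proof -
      have g: "eval2 G (x, y0 + \<xi> * w) = 0" "eval2 G (x, y0 + \<xi> * w') = 0" using G0 unfolding yw by blast+
      show ?thesis unfolding f_def g by (simp add: algebra_simps)
    qed
    ultimately have "norm (\<xi> * \<xi>) * norm c * norm (w - w') \<le> norm (\<xi> * \<xi>) * (norm c / 2) * norm (w - w')"
      by (simp add: norm_mult norm_minus_commute)
    then have "norm (w - w') \<le> norm (w - w') / 2"
      using \<xi>(1) c0 by (simp add: mult.assoc)
    then have "w = w'" by simp
    then show "y = y'" unfolding yw by simp
  qed
qed

text \<open>Where \<open>D\<close> does not vanish the roots of \<open>G\<close> in \<open>y\<close>
  are simple, and the parameters over \<open>x\<close> cover each root \<open>cover_degree\<close>
  times.\<close>

lemma card_fibre_le:
  assumes "poly D x \<noteq> 0" "finite S" "\<And>z. z \<in> S \<Longrightarrow> z \<in> \<Omega> \<and> X z = x \<and> Y z = y"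
  shows "card S \<le> cover_degree"
proof -
  have simple: "count (proots (fibre_poly G x)) y \<le> 1"
  proof (rule ccontr)
    assume "\<not> ?thesis"
    then have o: "order y (fibre_poly G x) \<ge> 2" using fibre_G_nonzero by simp
    then have r: "poly (fibre_poly G x) y = 0" using order_root[of "fibre_poly G x" y] by (metis not_numeral_le_zero)
    then have "order y (pderiv (fibre_poly G x)) \<noteq> 0"
      using order_pderiv[OF fibre_G_nonzero r] o by linarith
    then have "poly (pderiv (fibre_poly G x)) y = 0" using order_root by blast
    then have "eval2 Gy (x, y) = 0" "eval2 G (x, y) = 0" using r unfolding fibre_poly_pderiv by simp_all
    then have "poly D x = 0" unfolding D_def norm_Gy_eq_0_iff by blast
    then show False using assms(1) by simp
  qed
  have "mset_set S \<subseteq># filter_mset (\<lambda>z. Y z = y) (proots (\<Delta> x))"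
  proof (rule mset_subset_eqI)
    fix z
    show "count (mset_set S) z \<le> count (filter_mset (\<lambda>z. Y z = y) (proots (\<Delta> x))) z"
    proof (cases "z \<in> S")
      case True
      then have "z \<in># filter_mset (\<lambda>z. Y z = y) (proots (\<Delta> x))" using assms(3) in_proots_\<Delta> by simp
      then have "count (filter_mset (\<lambda>z. Y z = y) (proots (\<Delta> x))) z \<ge> 1" by (simp only: count_greater_eq_one_iff)
      moreover have "count (mset_set S) z \<le> 1" using assms(2) by (simp add: count_mset_set')
      ultimately show ?thesis by linarith
    qed (use assms(2) in simp)
  qed
  then have "card S \<le> size (filter_mset (\<lambda>z. Y z = y) (proots (\<Delta> x)))"
    using size_mset_mono by fastforce
  also have "\<dots> = count (image_mset Y (proots (\<Delta> x))) y"
    by (simp only: count_conv_size_mset filter_mset_image_mset size_image_mset)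
  also have "\<dots> = cover_degree * count (proots (fibre_poly G x)) y"
    unfolding fibre_roots[symmetric] by (rule count_repeat_mset)
  also have "\<dots> \<le> cover_degree * 1" using simple by (rule mult_le_mono2)
  finally show ?thesis by simp
qed

lemma X_open_map:
  assumes "open U" "w \<in> U" "U \<subseteq> \<Omega>"
  shows "\<exists>r>0. ball (X w) r \<subseteq> X ` U"
proof -
  obtain r where r: "r > 0" "ball w r \<subseteq> U" using assms openE by blast
  have "X holomorphic_on ball w r"
    unfolding X_def using r(2) assms(3) \<Omega>_pow by (intro holomorphic_intros) blast
  moreover have "\<not> X constant_on ball w r"
  proof
    assume "X constant_on ball w r"
    then obtain c where "\<And>z. z \<in> ball w r \<Longrightarrow> X z = c" unfolding constant_on_def by blast
    then have "ball w r \<subseteq> {z \<in> \<Omega>. X z = c}" using r(2) assms(3) by blast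
    then have "finite (ball w r)" using finite_fibre finite_subset by blast
    then show False using uncountable_ball[OF r(1)] countable_finite by blast
  qed
  ultimately have "open (X ` ball w r)"
    by (intro open_mapping_thm[of X "ball w r"]) auto
  then obtain e where "e > 0" "ball (X w) e \<subseteq> X ` ball w r"
    using r(1) by (meson centre_in_ball imageI openE)
  then show ?thesis using r(2) by (meson image_mono order_trans)
qed

text \<open>Since \<open>X\<close> is open, every \<open>w\<close> can be moved a little to a
  parameter over one common generic abscissa. These parameters stay distinct, while local uniqueness
  forces the same ordinate on all of them, so \<open>card_fibre_le\<close> applies.\<close>

lemma card_branches_slope:
  assumes sing: "p \<in> singular_points G"
    and \<alpha>: "eval2 (partial_y Gx) p + eval2 (partial_y Gy) p * \<alpha> \<noteq> 0"
    and W: "finite W" "\<And>w. w \<in> W \<Longrightarrow> w \<in> \<Omega> \<and> \<phi> w = p \<and> ((\<lambda>z. (Y z - Y w) / (X z - X w)) \<longlongrightarrow> \<alpha>) (at w)"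
  shows "card W \<le> cover_degree"
proof (cases "W = {}")
  case False
  obtain x0 y0 where p: "p = (x0, y0)" by (cases p)
  have XY: "X w = x0" "Y w = y0" if "w \<in> W" for w using W(2)[OF that] unfolding \<phi>_def p by auto
  obtain \<delta> where \<delta>: "\<delta> > 0" "\<And>x y y'. norm (x - x0) < \<delta> \<Longrightarrow> x \<noteq> x0 \<Longrightarrow>
    norm ((y - y0) / (x - x0) - \<alpha>) < \<delta> \<Longrightarrow> norm ((y' - y0) / (x - x0) - \<alpha>) < \<delta> \<Longrightarrow>
    eval2 G (x, y) = 0 \<Longrightarrow> eval2 G (x, y') = 0 \<Longrightarrow> y = y'"
    using local_uniqueness[OF sing p \<alpha>] by metis
  obtain U0 where U0: "\<And>w. w \<in> W \<Longrightarrow> w \<in> U0 w \<and> open (U0 w)" "\<And>v w. v \<in> W \<Longrightarrow> w \<in> W \<Longrightarrow> v \<noteq> w \<Longrightarrow> U0 v \<inter> U0 w = {}"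
  proof -
    obtain e where e: "e > 0" "\<And>v w. v \<in> W \<Longrightarrow> w \<in> W \<Longrightarrow> v \<noteq> w \<Longrightarrow> dist v w > 2 * e"
    proof -
      define d where "d = Min (insert 1 ((\<lambda>(v, w). dist v w) ` {(v, w). v \<in> W \<and> w \<in> W \<and> v \<noteq> w}))"
      have fin: "finite ((\<lambda>(v, w). dist v w) ` {(v, w). v \<in> W \<and> w \<in> W \<and> v \<noteq> w})"
        using finite_subset[of "{(v, w). v \<in> W \<and> w \<in> W \<and> v \<noteq> w}" "W \<times> W"] W(1) by auto
      have "d > 0" unfolding d_def using fin by (subst Min_gr_iff) auto
      moreover have "d \<le> dist v w" if "v \<in> W" "w \<in> W" "v \<noteq> w" for v w
        unfolding d_def using fin that by (intro Min_le) auto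
      ultimately show ?thesis by (intro that[of "d / 4"]) force+
    qed
    show ?thesis
    proof (rule that[of "\<lambda>w. ball w e"])
      show "ball v e \<inter> ball w e = {}" if "v \<in> W" "w \<in> W" "v \<noteq> w" for v w
        using e(2)[OF that] by (intro disjoint_ballI) auto
    qed (use e(1) in auto)
  qed
  have "\<exists>U. open U \<and> w \<in> U \<and> U \<subseteq> \<Omega> \<inter> U0 w \<and> (\<forall>z\<in>U - {w}. norm ((Y z - y0) / (X z - x0) - \<alpha>) < \<delta>)" if w: "w \<in> W" for w
  proof -
    have "\<forall>\<^sub>F z in at w. dist ((Y z - Y w) / (X z - X w)) \<alpha> < \<delta>"
      using W(2)[OF w] \<delta>(1) by (intro tendstoD) auto
    then obtain V where "open V" "w \<in> V" "\<forall>z\<in>V - {w}. norm ((Y z - y0) / (X z - x0) - \<alpha>) < \<delta>"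
      unfolding eventually_at_topological XY[OF w] dist_norm by blast
    then show ?thesis using U0(1)[OF w] open_\<Omega> W(2)[OF w]
      by (intro exI[of _ "V \<inter> (\<Omega> \<inter> U0 w)"]) auto
  qed
  then obtain U where U: "\<And>w. w \<in> W \<Longrightarrow> open (U w) \<and> w \<in> U w \<and> U w \<subseteq> \<Omega> \<inter> U0 w
      \<and> (\<forall>z\<in>U w - {w}. norm ((Y z - y0) / (X z - x0) - \<alpha>) < \<delta>)" by metis
  have "\<forall>w. \<exists>r. w \<in> W \<longrightarrow> r > 0 \<and> ball x0 r \<subseteq> X ` U w"
    using X_open_map U XY(1) by (metis le_inf_iff)
  then obtain r where r: "\<And>w. w \<in> W \<Longrightarrow> r w > 0 \<and> ball x0 (r w) \<subseteq> X ` U w" by metis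
  define \<rho> where "\<rho> = Min (insert \<delta> (r ` W))"
  have \<rho>: "\<rho> > 0" "\<rho> \<le> \<delta>" "\<And>w. w \<in> W \<Longrightarrow> \<rho> \<le> r w"
    unfolding \<rho>_def using W(1) \<delta>(1) r by (auto simp: Min_gr_iff)
  have "infinite (ball x0 \<rho>)" using uncountable_ball[OF \<rho>(1)] countable_finite by blast
  moreover have "finite (insert x0 {x. poly D x = 0})" using D_nonzero by (simp add: poly_roots_finite)
  ultimately obtain x where x: "x \<in> ball x0 \<rho>" "x \<noteq> x0" "poly D x \<noteq> 0"
    by (metis (mono_tags, lifting) finite_subset insert_iff mem_Collect_eq subsetI)
  have "\<exists>z. z \<in> U w \<and> X z = x" if "w \<in> W" for w
    using r[OF that] \<rho>(3)[OF that] x(1) by (auto simp: subset_iff image_iff dest!: spec[of _ x])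
  then obtain \<zeta> where \<zeta>: "\<And>w. w \<in> W \<Longrightarrow> \<zeta> w \<in> U w \<and> X (\<zeta> w) = x" by metis
  have \<zeta>w: "\<zeta> w \<in> \<Omega>" "norm ((Y (\<zeta> w) - y0) / (x - x0) - \<alpha>) < \<delta>" if "w \<in> W" for w
  proof -
    show "\<zeta> w \<in> \<Omega>" using U[OF that] \<zeta>[OF that] by blast
    have "\<zeta> w \<noteq> w" using \<zeta>[OF that] XY[OF that] x(2) by auto
    then show "norm ((Y (\<zeta> w) - y0) / (x - x0) - \<alpha>) < \<delta>" using U[OF that] \<zeta>[OF that] by (metis DiffI singletonD)
  qed
  have inj: "inj_on \<zeta> W"
  proof (rule inj_onI, rule ccontr)
    fix v w assume vw: "v \<in> W" "w \<in> W" "\<zeta> v = \<zeta> w" "v \<noteq> w"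
    then have "\<zeta> v \<in> U0 v \<inter> U0 w" using U \<zeta> by (metis IntI le_inf_iff subsetD)
    then show False using U0(2)[OF vw(1,2,4)] by blast
  qed
  obtain w0 where w0: "w0 \<in> W" using False by blast
  have same: "Y z = Y (\<zeta> w0)" if z: "z \<in> \<zeta> ` W" for z
  proof -
    obtain w where w: "w \<in> W" "z = \<zeta> w" using z by blast
    have "norm (x - x0) < \<delta>" using x(1) \<rho>(2) by (simp add: dist_norm norm_minus_commute)
    moreover have "eval2 G (x, Y (\<zeta> v)) = 0" if "v \<in> W" for v
      using eval2_G_\<phi>[OF \<zeta>w(1)[OF that]] \<zeta>[OF that] by simp
    ultimately show ?thesis using \<delta>(2)[OF _ x(2) \<zeta>w(2)[OF w(1)] \<zeta>w(2)[OF w0]] w w0 by blast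
  qed
  have "card (\<zeta> ` W) \<le> cover_degree"
    by (rule card_fibre_le[OF x(3), of _ "Y (\<zeta> w0)"]) (use W(1) \<zeta> \<zeta>w same in auto)
  then show ?thesis using card_image[OF inj] by simp
qed simp

lemma card_over_node:
  assumes sing: "p \<in> singular_points G"
  shows "finite {w \<in> \<Omega>. \<phi> w = p} \<and> card {w \<in> \<Omega>. \<phi> w = p} \<le> 2 * cover_degree"
proof -
  let ?c = "eval2 (partial_y Gy) p"
  obtain \<alpha> \<beta> :: real where ab: "\<alpha> \<noteq> \<beta>"
    "\<And>t. eval2 (partial_x Gx) p + 2 * eval2 (partial_y Gx) p * t + ?c * t ^ 2 = ?c * (t - of_real \<alpha>) * (t - of_real \<beta>)"
    "2 * eval2 (partial_y Gx) p = - ?c * (of_real \<alpha> + of_real \<beta>)"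
    using tangent_slopes[OF nodes[OF sing] not_vertical[OF sing]] by metis
  have fin: "finite {w \<in> \<Omega>. \<phi> w = p}"
    by (rule finite_subset[OF _ finite_fibre[of "fst p"]]) (auto simp: \<phi>_def)
  define W where "W s = {w \<in> \<Omega>. \<phi> w = p \<and> ((\<lambda>z. (Y z - Y w) / (X z - X w)) \<longlongrightarrow> s) (at w)}" for s :: complex
  \<comment> \<open>The value is half the derivative of the slope equation at \<open>s\<close>, and
    that equation has two distinct roots.\<close>
  have ne: "eval2 (partial_y Gx) p + ?c * s \<noteq> 0" if s: "s \<in> {of_real \<alpha>, of_real \<beta>}" for s
  proof
    assume "eval2 (partial_y Gx) p + ?c * s = 0"
    moreover have "2 * b + 2 * c * s = 2 * (b + c * s)" for b c s :: complex by (simp add: algebra_simps)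
    ultimately have "2 * eval2 (partial_y Gx) p + 2 * ?c * s = 0" by (metis mult_zero_right)
    then have "?c * (2 * s - of_real \<alpha> - of_real \<beta>) = 0" unfolding ab(3) by (simp add: algebra_simps)
    then have "2 * s - of_real \<alpha> - of_real \<beta> = 0" using not_vertical[OF sing] by (metis mult_eq_0_iff)
    then have "2 * s = of_real (\<alpha> + \<beta>)" by (metis diff_diff_eq eq_iff_diff_eq_0 of_real_add)
    moreover obtain r where r: "r \<in> {\<alpha>, \<beta>}" "s = of_real r" using s by blast
    ultimately have "complex_of_real (2 * r) = of_real (\<alpha> + \<beta>)" by simp
    then have "2 * r = \<alpha> + \<beta>" by (simp only: of_real_eq_iff)
    then show False using r(1) ab(1) by auto
  qed
  have sub: "{w \<in> \<Omega>. \<phi> w = p} \<subseteq> W (of_real \<alpha>) \<union> W (of_real \<beta>)"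
  proof
    fix w assume w: "w \<in> {w \<in> \<Omega>. \<phi> w = p}"
    then obtain s where s: "((\<lambda>z. (Y z - Y w) / (X z - X w)) \<longlongrightarrow> s) (at w)"
      "eval2 (partial_x Gx) p + 2 * eval2 (partial_y Gx) p * s + ?c * s ^ 2 = 0"
      using branch_slope[of w] sing by auto
    then have "s = of_real \<alpha> \<or> s = of_real \<beta>" unfolding ab(2) using not_vertical[OF sing] by auto
    then show "w \<in> W (of_real \<alpha>) \<union> W (of_real \<beta>)" using w s(1) unfolding W_def by auto
  qed
  have card: "card (W s) \<le> cover_degree" if "s \<in> {of_real \<alpha>, of_real \<beta>}" for s
  proof (rule card_branches_slope[OF sing ne[OF that]])
    show "finite (W s)" by (rule finite_subset[OF _ fin]) (auto simp: W_def)
  qed (auto simp: W_def)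
  have "card {w \<in> \<Omega>. \<phi> w = p} \<le> card (W (of_real \<alpha>) \<union> W (of_real \<beta>))"
    by (rule card_mono[OF finite_subset[OF _ fin] sub]) (auto simp: W_def)
  also have "\<dots> \<le> card (W (of_real \<alpha>)) + card (W (of_real \<beta>))" by (rule card_Un_le)
  finally show ?thesis using card[of "of_real \<alpha>"] card[of "of_real \<beta>"] fin by auto
qed

text \<open>The orders of \<open>X'\<close> add up to at most the degree of its numerator. The
  parameters over nodes, at most \<open>2 * cover_degree\<close> for each node, contribute one more
  apiece.\<close>

lemma degree_D_bound:
  "cover_degree * degree D \<le> degree A - (if n = 0 then 1 else 0) + 2 * cover_degree * card (singular_points G)"
proof -
  let ?N = "{w \<in> \<Omega>. \<phi> w \<in> singular_points G}"
  have N: "?N = (\<Union>p\<in>singular_points G. {w \<in> \<Omega>. \<phi> w = p})" by auto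
  have finN: "finite ?N" unfolding N using finite_singular card_over_node by blast
  have "card ?N \<le> (\<Sum>p\<in>singular_points G. card {w \<in> \<Omega>. \<phi> w = p})"
    unfolding N by (rule card_UN_le[OF finite_singular])
  also have "\<dots> \<le> (\<Sum>p\<in>singular_points G. 2 * cover_degree)"
    by (rule sum_mono) (use card_over_node in blast)
  finally have cardN: "card ?N \<le> 2 * cover_degree * card (singular_points G)" by (simp add: mult.commute)
  define R where "R = {w \<in> \<Omega>. poly E w = 0}"
  have finR: "finite R" unfolding R_def using poly_roots_finite[OF E_nonzero] by simp
  have setE: "set_mset (filter_mset (\<lambda>w. w \<in> \<Omega>) (proots E)) = R"
    unfolding R_def using E_nonzero by auto
  have "size (filter_mset (\<lambda>w. w \<in> \<Omega>) (proots E)) = (\<Sum>w\<in>R. order w E)"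
    unfolding size_multiset_overloaded_eq setE
    by (rule sum.cong) (use E_nonzero in \<open>auto simp: R_def\<close>)
  also have "\<dots> \<le> (\<Sum>w\<in>R. order w (numer_deriv A) + (if w \<in> ?N then 1 else 0))"
  proof (rule sum_mono)
    fix w assume "w \<in> R"
    then have w: "w \<in> \<Omega>" unfolding R_def by simp
    show "order w E \<le> order w (numer_deriv A) + (if w \<in> ?N then 1 else 0)"
      using order_E_node[OF w] order_E_smooth[OF w] w by auto
  qed
  also have "\<dots> = (\<Sum>w\<in>R. order w (numer_deriv A)) + card (R \<inter> ?N)"
    unfolding sum.distrib using finR by (simp add: sum.If_cases Int_def)
  also have "card (R \<inter> ?N) \<le> card ?N" using finN by (intro card_mono) auto
  also have "(\<Sum>w\<in>R. order w (numer_deriv A)) \<le> degree (numer_deriv A)"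
  proof -
    have "(\<Sum>w\<in>R. order w (numer_deriv A)) = (\<Sum>w\<in>R \<inter> {w. poly (numer_deriv A) w = 0}. order w (numer_deriv A))"
      by (rule sum.mono_neutral_right[OF finR]) (auto simp: order_0I)
    also have "\<dots> \<le> (\<Sum>w\<in>{w. poly (numer_deriv A) w = 0}. order w (numer_deriv A))"
      by (rule sum_mono2) (use poly_roots_finite[OF numer_deriv_A(1)] in auto)
    also have "\<dots> = size (proots (numer_deriv A))"
      unfolding size_multiset_overloaded_eq using numer_deriv_A(1) by (intro sum.cong) auto
    finally show ?thesis by (simp add: size_proots_complex)
  qed
  finally show ?thesis using degree_D_le cardN numer_deriv_A(2) by linarith
qed

end

section \<open>Growth at infinity and the degree of \<open>Q\<close>\<close>

lemma eventually_poly_nonzero: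
  fixes P :: "complex poly"
  assumes "P \<noteq> 0"
  shows "\<forall>\<^sub>F x in at_infinity. poly P x \<noteq> 0"
proof -
  have "bounded {x. poly P x = 0}" using poly_roots_finite[OF assms] by (rule finite_imp_bounded)
  then obtain b where b: "\<And>x. poly P x = 0 \<Longrightarrow> norm x \<le> b" unfolding bounded_iff by blast
  have "poly P x \<noteq> 0" if "b + 1 \<le> norm x" for x using b[of x] that by auto
  then show ?thesis unfolding eventually_at_infinity by blast
qed

text \<open>Otherwise \<open>R / (x ^ k * P)\<close> would tend to 0 at infinity, against the bound.
  Growth is tested along \<open>x = 1 / s ^ L\<close>, the form in which the Puiseux expansions
  provide it.\<close>

lemma degree_le_of_bound:
  fixes P R :: "complex poly"
  assumes "P \<noteq> 0" "L > 0" "C \<ge> 0"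
    and ev: "\<forall>\<^sub>F s in at (0::complex). norm (1 / s ^ L) ^ k * norm (poly P (1 / s ^ L)) \<le> C * norm (poly R (1 / s ^ L))"
  shows "degree P + k \<le> degree R"
proof (rule ccontr)
  assume neg: "\<not> ?thesis"
  define T where "T = monom 1 k * P"
  have T: "degree T = degree P + k" "T \<noteq> 0"
    using assms(1) unfolding T_def by (simp_all add: degree_mult_eq degree_monom_eq)
  have "degree R < degree T" using T(1) neg by simp
  then have "((\<lambda>x. poly R x / poly T x) \<longlongrightarrow> 0) at_infinity"
    by (rule poly_divide_tendsto_0_at_infinity)
  moreover have "filterlim (\<lambda>s::complex. 1 / s ^ L) at_infinity (at 0)"
  proof -
    have "filterlim (\<lambda>s::complex. s ^ L) (at 0) (at 0)"
      using assms(2) by (intro filterlim_atI) (auto intro!: tendsto_eq_intros simp: eventually_at_filter)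
    then show ?thesis
      unfolding divide_inverse mult_1 using filterlim_compose[OF filterlim_inverse_at_infinity] by blast
  qed
  ultimately have "((\<lambda>s. poly R (1 / s ^ L) / poly T (1 / s ^ L)) \<longlongrightarrow> 0) (at 0)"
    by (rule filterlim_compose)
  then have "\<forall>\<^sub>F s in at 0. norm (poly R (1 / s ^ L) / poly T (1 / s ^ L)) < 1 / (C + 1)"
    using assms(3) by (auto dest: tendstoD[where e = "1 / (C + 1)"])
  moreover have "\<forall>\<^sub>F s in at 0. poly T (1 / s ^ L) \<noteq> 0"
  proof -
    have "\<forall>\<^sub>F x in at_infinity. poly T x \<noteq> 0" using eventually_poly_nonzero[OF T(2)] .
    moreover have "filterlim (\<lambda>s::complex. 1 / s ^ L) at_infinity (at 0)" by fact
    ultimately show ?thesis by (rule eventually_compose_filterlim)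
  qed
  ultimately have "\<forall>\<^sub>F s in at (0::complex). False"
    using ev
  proof eventually_elim
    case (elim s)
    define x where "x = 1 / s ^ L"
    have "norm (poly T x) = norm x ^ k * norm (poly P x)"
      unfolding T_def by (simp add: poly_monom norm_mult norm_power)
    then have "norm (poly T x) \<le> C * norm (poly R x)" using elim(3) unfolding x_def by simp
    also have "\<dots> \<le> (C + 1) * norm (poly R x)" by (simp add: mult_right_mono)
    also have "norm (poly R x) < norm (poly T x) / (C + 1)"
      using elim(1,2) unfolding x_def[symmetric] by (simp add: norm_divide divide_less_eq)
    then have "(C + 1) * norm (poly R x) < norm (poly T x)" using assms(3) by (simp add: less_divide_eq mult.commute)
    finally show ?case by simp
  qed
  then show False by simp
qed

context nonvertical_param_curve
begin

text \<open>A common factor of \<open>G_x\<close> and \<open>G_y\<close> cannot vanish on the curve, because the Hessian at a node is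
  nondegenerate.  Hence the greatest one is a monomial along the parametrization, and
  constant because it is real.\<close>

lemma Q_nonzero: "Q \<noteq> 0"
proof
  assume "Q = 0"
  then obtain q where q: "prime q" "degree q > 0" "q dvd Gy" "q dvd Gx"
    using norm_Gy_nonzero[of Gx] unfolding Q_def by blast
  define h where "h = gcd Gy Gx"
  have Gy0: "Gy \<noteq> 0" using ex_lead_coeff_Gy by auto
  have h0: "h \<noteq> 0" using Gy0 unfolding h_def by simp
  have "q dvd h" using q unfolding h_def by simp
  then have dh: "degree h > 0" using dvd_imp_degree_le[OF _ h0] q(2) by fastforce
  have "degree h \<le> degree Gy" unfolding h_def by (rule dvd_imp_degree_le) (use Gy0 in auto)
  then have dh': "degree h < degree G" using degree_G_pos unfolding degree_partial_y by simp
  \<comment> \<open>As \<open>G\<close> is real, conjugation permutes the common divisors of its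
    derivatives, so the greatest one is real up to a constant factor.\<close>
  have conj_h: "conj2 h dvd h"
    unfolding h_def
  proof (rule gcd_greatest)
    have "conj2 (gcd Gy Gx) dvd conj2 Gy" "conj2 (gcd Gy Gx) dvd conj2 Gx" by (simp_all add: conj2_dvd)
    then show "conj2 (gcd Gy Gx) dvd Gy" "conj2 (gcd Gy Gx) dvd Gx" by (simp_all add: conj2_partial real_G)
  qed
  then have "h dvd conj2 h" using conj2_dvd[OF conj_h] by simp
  then obtain v where v: "conj2 h = h * v" by (elim dvdE)
  obtain v' where v': "h = conj2 h * v'" using conj_h by (elim dvdE)
  have "h * (v * v') = h * 1" using v v' by (metis mult.assoc mult_1_right)
  then have "v * v' = 1" using h0 by (metis mult_left_cancel)
  then have "v dvd 1" by (metis dvd_triv_left)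
  then obtain \<mu> where \<mu>: "\<mu> \<noteq> 0" "v = [:[:\<mu>:]:]" using is_unit_poly2 by blast
  \<comment> \<open>At a zero of \<open>h\<close> the gradients of \<open>G_x = h * t\<close> and
    \<open>G_y = h * u\<close> are both multiples of the gradient of \<open>h\<close>, and the
    Hessian determinant would vanish.\<close>
  have nz: "eval2 h (X z, Y z) \<noteq> 0" if z: "z \<in> \<Omega>" for z
  proof
    assume hz: "eval2 h (X z, Y z) = 0"
    obtain u where u: "Gy = h * u" using gcd_dvd1[of Gy Gx] unfolding h_def[symmetric] by (elim dvdE)
    obtain t where t: "Gx = h * t" using gcd_dvd2[of Gy Gx] unfolding h_def[symmetric] by (elim dvdE)
    let ?p = "\<phi> z"
    have hp: "eval2 h ?p = 0" using hz by (simp add: \<phi>_def)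
    have "?p \<in> singular_points G"
      using eval2_G_\<phi>[OF z] hz unfolding singular_points_def zero_locus_def critical_points_def u t \<phi>_def by simp
    then have ne: "eval2 (partial_y Gx) ?p ^ 2 \<noteq> eval2 (partial_x Gx) ?p * eval2 (partial_y Gy) ?p"
      using real_tangent_pair_hessian nodes by blast
    have "eval2 (partial_y Gx) ?p = eval2 (partial_y h) ?p * eval2 t ?p"
      "eval2 (partial_x Gx) ?p = eval2 (partial_x h) ?p * eval2 t ?p"
      "eval2 (partial_y Gy) ?p = eval2 (partial_y h) ?p * eval2 u ?p"
      "eval2 (partial_x Gy) ?p = eval2 (partial_x h) ?p * eval2 u ?p"
      unfolding u t eval2_partial_mult hp by simp_all
    moreover have "eval2 (partial_x Gy) ?p = eval2 (partial_y Gx) ?p" by (simp add: partial_xy_commute)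
    ultimately have "eval2 (partial_y Gx) ?p ^ 2 = eval2 (partial_x Gx) ?p * eval2 (partial_y Gy) ?p"
      by (simp add: power2_eq_square) (metis mult.assoc mult.commute)
    then show False using ne by simp
  qed
  obtain P k where P: "n = 0 \<longrightarrow> k = 0" "\<And>z. z \<in> \<Omega> \<Longrightarrow> poly P z = z ^ k * eval2 h (X z, Y z)"
    using ex_numerator by blast
  have Pnz: "poly P z \<noteq> 0" if "z \<in> \<Omega>" for z
    using P(2)[OF that] nz[OF that] \<Omega>_pow_e[OF that P(1)] by simp
  then have P0: "P \<noteq> 0" using infinite_\<Omega> infinite_imp_nonempty by fastforce
  \<comment> \<open>A polynomial without zeros in \<open>\<Omega>\<close> can vanish at the puncture
    only, which makes it a monomial.\<close>
  obtain a j where aj: "a \<noteq> 0" "\<And>z. poly P z = a * z ^ j" "n = 0 \<longrightarrow> j = 0"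
  proof -
    have roots: "z = 0 \<and> n > 0" if "z \<in># proots P" for z
    proof -
      have "poly P z = 0" using that P0 by simp
      then have "z \<notin> \<Omega>" using Pnz by blast
      then show ?thesis unfolding \<Omega>_def by auto
    qed
    have rep: "proots P = replicate_mset (size (proots P)) 0"
      by (rule set_mset_subset_singletonD) (use roots in blast)
    have "poly P z = lead_coeff P * z ^ degree P" for z
      using poly_eq_prod_proots[OF P0, of z] by (subst (asm) rep) (simp add: size_proots_complex)
    moreover have "n = 0 \<longrightarrow> degree P = 0"
      using roots size_proots_complex[of P] by (metis less_irrefl multiset_nonemptyE size_empty)
    ultimately show ?thesis using that P0 by (metis leading_coeff_0_iff)
  qed
  have h_val: "eval2 h (X z, Y z) * z ^ k = a * z ^ j" if "z \<in> \<Omega>" for z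
    using P(2)[OF that] aj(2)[of z] by (simp add: mult.commute)
  \<comment> \<open>Along the curve \<open>h\<close> is a constant times the power
    \<open>j - k\<close> of the parameter. By reality its moduli at \<open>t\<close> and at
    \<open>\<sigma> t\<close>, a point of modulus \<open>1 / norm t\<close>, have the fixed ratio
    \<open>norm \<mu>\<close>. Taking 1 and 2 for \<open>t\<close> settles the ratio and the
    exponent.\<close>
  have "j = k"
  proof (cases "n = 0")
    case True
    then show ?thesis using aj(3) P(1) by simp
  next
    case False
    have key: "norm \<mu> * 2 ^ (2 * k) = 2 ^ (2 * j) \<and> norm \<mu> = 1"
    proof -
      have main: "norm \<mu> * norm t ^ (2 * k) = norm t ^ (2 * j)" if t: "t \<noteq> 0" for t :: complex
      proof -
        have tO: "t \<in> \<Omega>" "\<sigma> t \<in> \<Omega>" "\<sigma> t = inverse (cnj t)" using t False by (auto simp: \<Omega>_def \<sigma>_def)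
        have "eval2 (conj2 h) (cnj (X t), cnj (Y t)) = cnj (eval2 h (X t, Y t))" by (rule eval2_conj2)
        moreover have "(cnj (X t), cnj (Y t)) = (X (\<sigma> t), Y (\<sigma> t))" using \<phi>_\<sigma>[OF tO(1)] unfolding \<phi>_def by simp
        ultimately have "eval2 h (X (\<sigma> t), Y (\<sigma> t)) * \<mu> = cnj (eval2 h (X t, Y t))" unfolding v \<mu>(2) by (simp add: mult.commute)
        then have eq: "norm (eval2 h (X (\<sigma> t), Y (\<sigma> t))) * norm \<mu> = norm (eval2 h (X t, Y t))"
          by (metis complex_mod_cnj norm_mult)
        have n1: "norm (eval2 h (X t, Y t)) * norm t ^ k = norm a * norm t ^ j"
          using h_val[OF tO(1)] by (metis norm_mult norm_power)
        have "norm (eval2 h (X (\<sigma> t), Y (\<sigma> t))) * norm (\<sigma> t) ^ k = norm a * norm (\<sigma> t) ^ j"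
          using h_val[OF tO(2)] by (metis norm_mult norm_power)
        then have n2: "norm (eval2 h (X (\<sigma> t), Y (\<sigma> t))) * norm t ^ j = norm a * norm t ^ k"
        proof -
          have "w * T ^ j = b * T ^ k" if "w * (1 / T) ^ k = b * (1 / T) ^ j" "T > 0" for w T b :: real
            using that by (simp add: power_one_over field_simps)
          moreover have "norm (\<sigma> t) = 1 / norm t" unfolding tO(3) by (simp add: inverse_eq_divide norm_divide)
          ultimately show ?thesis
            using \<open>norm (eval2 h (X (\<sigma> t), Y (\<sigma> t))) * norm (\<sigma> t) ^ k = norm a * norm (\<sigma> t) ^ j\<close> t
            by (metis zero_less_norm_iff)
        qed
        have "norm a * (norm \<mu> * norm t ^ (2 * k)) = norm a * norm t ^ (2 * j)"
        proof -
          have "norm a * (norm \<mu> * norm t ^ (2 * k)) = (norm a * norm t ^ k) * norm \<mu> * norm t ^ k"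
            by (simp add: power_add mult_2)
          also have "\<dots> = (norm (eval2 h (X (\<sigma> t), Y (\<sigma> t))) * norm \<mu>) * norm t ^ j * norm t ^ k"
            unfolding n2[symmetric] by simp
          also have "\<dots> = (norm (eval2 h (X t, Y t)) * norm t ^ k) * norm t ^ j" unfolding eq by simp
          also have "\<dots> = norm a * norm t ^ (2 * j)" unfolding n1 by (simp add: power_add mult_2)
          finally show ?thesis .
        qed
        then show ?thesis using aj(1) by simp
      qed
      have "norm (1::complex) = 1" "norm (2::complex) = 2" by simp_all
      then show ?thesis using main[of 1] main[of 2] by (metis one_neq_zero zero_neq_numeral mult_1_right power_one)
    qed
    then have "norm \<mu> * 2 ^ (2 * k) = 2 ^ (2 * j)" "norm \<mu> = 1" by (rule conjunct1, rule conjunct2)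
    then have "(2::real) ^ (2 * k) = 2 ^ (2 * j)" by (metis mult_1)
    moreover have "(1::real) < 2" by simp
    ultimately have "2 * k = 2 * j" by (metis power_inject_exp)
    then show ?thesis by simp
  qed
  then have h_const: "eval2 h (X z, Y z) = a" if "z \<in> \<Omega>" for z
    using h_val[OF that] \<Omega>_pow_e[OF that P(1)] by auto
  \<comment> \<open>This difference vanishes on the curve and must be a multiple of
    \<open>G\<close>, but its degree is that of \<open>h\<close>, below
    \<open>degree G\<close>.\<close>
  define g where "g = h - [:[:a:]:]"
  have dg: "degree g = degree h" unfolding g_def diff_conv_add_uminus using dh by (intro degree_add_eq_left) simp
  have g_zero: "eval2 g p = 0" if "p \<in> zero_locus G" for p
    using that h_const unfolding zero_locus_G g_def \<phi>_def by auto
  have "G dvd g"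
  proof (rule ccontr)
    assume nd: "\<not> G dvd g"
    obtain c where c: "c \<noteq> 0" "lead_coeff G = [:c:]" using ex_lead_coeff_G by blast
    have "finite {p. eval2 G p = 0 \<and> eval2 g p = 0}"
    proof (rule finite_common_zeros[OF c(2,1)])
      fix q assume q: "prime q" "q dvd G" "q dvd g"
      then have "G dvd q"
        using prime_G prime_elem_imp_irreducible by (meson irreducibleD' not_prime_unit)
      then show False using nd q(3) dvd_trans by blast
    qed
    moreover have "{p. eval2 G p = 0 \<and> eval2 g p = 0} = {p. eval2 G p = 0}"
      using g_zero unfolding zero_locus_def by blast
    ultimately show False using infinite_zeros[OF degree_G_pos] by simp
  qed
  moreover have "g \<noteq> 0" using dg dh by auto
  ultimately have "degree G \<le> degree g" by (rule dvd_imp_degree_le)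
  then show False using dg dh' by simp
qed

text \<open>At each of the \<open>degree G - 1\<close> roots of \<open>G_y\<close> over a distant
  \<open>x\<close>, \<open>polar_estimate\<close> bounds \<open>x * G_x\<close> by \<open>G\<close>;
  the product of these bounds compares the growth of \<open>Q\<close> and \<open>D\<close>. The
  branches at infinity are those of the power \<open>F\<close> of \<open>G\<close>, whose extra
  factors cancel.\<close>

lemma degree_Q_bound: "degree Q + (degree G - 1) \<le> degree D"
proof -
  obtain F c c' where F: "cover_degree > 0" "c \<noteq> 0" "F = [:[:c:]:] * G ^ cover_degree"
    "c' \<noteq> 0" "\<And>x. fibre_poly F x = Polynomial.smult c' (\<Prod>z\<in>#proots (\<Delta> x). [:- Y z, 1:])"
    using cover_degree by metis
  have eF: "eval2 F (x, y) = c' * (\<Prod>z\<in>#proots (\<Delta> x). y - Y z)" for x y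
  proof -
    have "poly (\<Prod>z\<in>#M. [:- Y z, 1:]) y = (\<Prod>z\<in>#M. y - Y z)" for M
      by (induction M) (auto simp: algebra_simps)
    then show ?thesis unfolding poly_fibre_poly[symmetric] F(5) poly_smult by simp
  qed
  obtain L and I :: "(complex \<times> bool) set" and \<zeta> where LI: "L > 0" "finite I"
    "\<And>i. i \<in> I \<Longrightarrow> \<zeta> i meromorphic_on {0}"
    "\<forall>\<^sub>F s in at 0. proots (fibre_eq A n (1 / s ^ L)) = image_mset (\<lambda>i. \<zeta> i s) (mset_set I)"
    by (rule puiseux_roots[OF degree_A], erule A_0) (rule that)
  define \<Phi> where "\<Phi> i s = Y (\<zeta> i s)" for i s
  have poly_mero: "(\<lambda>s. poly P (f s)) meromorphic_on {0}" if "f meromorphic_on {0}" for P and f :: "complex \<Rightarrow> complex"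
    using that by (induction P rule: pCons_induct) (auto intro!: meromorphic_intros)
  have mero: "\<Phi> i meromorphic_on {0}" if "i \<in> I" for i
    unfolding \<Phi>_def Y_def by (intro meromorphic_on_divide poly_mero meromorphic_on_power LI(3) that)
  have ev: "\<forall>\<^sub>F s in at 0. \<forall>y. eval2 F (1 / s ^ L, y) = c' * (\<Prod>i\<in>I. y - \<Phi> i s)"
    using LI(4)
  proof eventually_elim
    case (elim s)
    have "(\<Prod>z\<in>#image_mset (\<lambda>i. \<zeta> i s) (mset_set I). y - Y z) = (\<Prod>i\<in>I. y - \<Phi> i s)" for y
      unfolding \<Phi>_def prod_unfold_prod_mset by (simp add: image_mset.compositionality o_def)
    then show ?case unfolding eF \<Delta>_def elim by simp
  qed
  obtain C0 where C0: "\<forall>\<^sub>F s in at 0. \<forall>y. eval2 (partial_y F) (1 / s ^ L, y) = 0 \<longrightarrow> eval2 F (1 / s ^ L, y) \<noteq> 0 \<longrightarrow>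
    norm (1 / s ^ L) * norm (eval2 (partial_x F) (1 / s ^ L, y)) \<le> C0 * norm (eval2 F (1 / s ^ L, y))"
    using polar_estimate[OF LI(2,1) mero ev] by blast
  define C where "C = max C0 1"
  obtain d where d: "cover_degree = Suc d" using F(1) gr0_conv_Suc by blast
  have partial_pow: "eval2 (partial_x (H ^ Suc m)) p = of_nat (Suc m) * eval2 H p ^ m * eval2 (partial_x H) p"
    "eval2 (partial_y (H ^ Suc m)) p = of_nat (Suc m) * eval2 H p ^ m * eval2 (partial_y H) p" for H m p
    by (induction m) (simp_all add: eval2_partial_mult algebra_simps)
  have pF: "eval2 (partial_x F) p = c * (of_nat cover_degree * eval2 G p ^ d * eval2 Gx p)"
    "eval2 (partial_y F) p = c * (of_nat cover_degree * eval2 G p ^ d * eval2 Gy p)" for p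
    unfolding F(3) d eval2_partial_mult partial_pow by (simp_all add: partial_x_pCons partial_y_pCons)
  have D_ev: "\<forall>\<^sub>F s in at (0::complex). poly D (1 / s ^ L) \<noteq> 0"
  proof -
    have "filterlim (\<lambda>s::complex. s ^ L) (at 0) (at 0)"
      using LI(1) by (intro filterlim_atI) (auto intro!: tendsto_eq_intros simp: eventually_at_filter)
    then have "filterlim (\<lambda>s::complex. 1 / s ^ L) at_infinity (at 0)"
      unfolding divide_inverse mult_1 using filterlim_compose[OF filterlim_inverse_at_infinity] by blast
    with eventually_poly_nonzero[OF D_nonzero] show ?thesis by (rule eventually_compose_filterlim)
  qed
  obtain k1 where k1: "k1 \<noteq> 0" "\<And>x. poly D x = k1 * (\<Prod>y\<in>#proots (fibre_poly Gy x). eval2 G (x, y))"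
    using norm_Gy unfolding D_def by blast
  obtain k2 where k2: "k2 \<noteq> 0" "\<And>x. poly Q x = k2 * (\<Prod>y\<in>#proots (fibre_poly Gy x). eval2 Gx (x, y))"
    using norm_Gy unfolding Q_def by blast
  define m where "m = degree G - 1"
  have "\<forall>\<^sub>F s in at (0::complex). norm (1 / s ^ L) ^ m * norm (poly Q (1 / s ^ L))
      \<le> (norm k2 * C ^ m / norm k1) * norm (poly D (1 / s ^ L))"
    using C0 D_ev
  proof eventually_elim
    case (elim s)
    define x where "x = 1 / s ^ L"
    define M where "M = proots (fibre_poly Gy x)"
    have sizeM: "size M = m" unfolding M_def m_def by (simp add: size_proots_complex degree_fibre_Gy)
    have each: "norm x * norm (eval2 Gx (x, y)) \<le> C * norm (eval2 G (x, y))" if y: "y \<in># M" for y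
    proof -
      have Gy: "eval2 Gy (x, y) = 0" using y fibre_Gy_nonzero unfolding M_def by simp
      have G0: "eval2 G (x, y) \<noteq> 0"
        using elim(2) Gy unfolding x_def[symmetric] D_def norm_Gy_eq_0_iff by blast
      define g where "g = norm c * norm (eval2 G (x, y)) ^ d"
      have g: "g > 0" unfolding g_def using F(2) G0 by simp
      have "eval2 (partial_y F) (x, y) = 0" unfolding pF Gy by simp
      moreover have FG: "norm (eval2 F (x, y)) = g * norm (eval2 G (x, y))"
        unfolding F(3) g_def d by (simp add: norm_mult norm_power)
      then have "eval2 F (x, y) \<noteq> 0" using g G0 by auto
      ultimately have "norm x * norm (eval2 (partial_x F) (x, y)) \<le> C0 * norm (eval2 F (x, y))"
        using elim(1) unfolding x_def by blast
      also have "\<dots> \<le> C * norm (eval2 F (x, y))" unfolding C_def by (intro mult_right_mono) auto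
      finally have "norm x * norm (eval2 (partial_x F) (x, y)) \<le> C * (g * norm (eval2 G (x, y)))" unfolding FG .
      moreover have "norm (eval2 (partial_x F) (x, y)) = g * (real cover_degree * norm (eval2 Gx (x, y)))"
        unfolding pF g_def by (simp add: norm_mult norm_power)
      ultimately have "g * (real cover_degree * (norm x * norm (eval2 Gx (x, y)))) \<le> g * (C * norm (eval2 G (x, y)))"
        by (simp add: algebra_simps)
      then have "real cover_degree * (norm x * norm (eval2 Gx (x, y))) \<le> C * norm (eval2 G (x, y))"
        using g by simp
      moreover have "1 * (norm x * norm (eval2 Gx (x, y))) \<le> real cover_degree * (norm x * norm (eval2 Gx (x, y)))"
        using F(1) by (intro mult_right_mono) auto
      ultimately show ?thesis by linarith
    qed
    have "norm x ^ size M' * norm (\<Prod>y\<in>#M'. eval2 Gx (x, y)) \<le> C ^ size M' * norm (\<Prod>y\<in>#M'. eval2 G (x, y))"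
      if "M' \<subseteq># M" for M'
      using that
    proof (induction M')
      case (add y M')
      have "y \<in># M" "M' \<subseteq># M"
        using mset_subset_eq_insertD[OF add(2)] by (auto simp: subset_mset.less_imp_le)
      then have "(norm x * norm (eval2 Gx (x, y))) * (norm x ^ size M' * norm (\<Prod>y\<in>#M'. eval2 Gx (x, y)))
          \<le> (C * norm (eval2 G (x, y))) * (C ^ size M' * norm (\<Prod>y\<in>#M'. eval2 G (x, y)))"
        by (intro mult_mono[OF each add(1)]) (auto simp: C_def)
      moreover have "norm x ^ size (add_mset y M') * norm (\<Prod>y\<in>#add_mset y M'. eval2 Gx (x, y))
          = (norm x * norm (eval2 Gx (x, y))) * (norm x ^ size M' * norm (\<Prod>y\<in>#M'. eval2 Gx (x, y)))"
        by (simp only: size_add_mset image_mset_add_mset prod_mset.add_mset norm_mult power_Suc mult.assoc mult.left_commute mult.commute)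
      moreover have "C ^ size (add_mset y M') * norm (\<Prod>y\<in>#add_mset y M'. eval2 G (x, y))
          = (C * norm (eval2 G (x, y))) * (C ^ size M' * norm (\<Prod>y\<in>#M'. eval2 G (x, y)))"
        by (simp only: size_add_mset image_mset_add_mset prod_mset.add_mset norm_mult power_Suc mult.assoc mult.left_commute mult.commute)
      ultimately show ?case by (simp only:)
    qed simp
    from this[of M] have "norm x ^ m * norm (\<Prod>y\<in>#M. eval2 Gx (x, y)) \<le> C ^ m * norm (\<Prod>y\<in>#M. eval2 G (x, y))"
      unfolding sizeM by simp
    then have "norm k2 * (norm x ^ m * norm (\<Prod>y\<in>#M. eval2 Gx (x, y))) \<le> norm k2 * (C ^ m * norm (\<Prod>y\<in>#M. eval2 G (x, y)))"
      by (intro mult_left_mono) auto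
    then show ?case
      unfolding x_def[symmetric] k1(2) k2(2) M_def[symmetric] using k1(1) by (simp add: norm_mult algebra_simps)
  qed
  moreover have "norm k2 * C ^ m / norm k1 \<ge> 0" unfolding C_def by simp
  ultimately show ?thesis
    using degree_le_of_bound[OF Q_nonzero LI(1)] unfolding m_def by blast
qed

text \<open>With \<open>degree A = d * degree G\<close> the two degree bounds combine to
  \<open>d * card S \<le> d * (2 * \<nu> + 1)\<close>. For \<open>n = 0\<close> the right side is
  one smaller, so that cancelling \<open>d\<close> leaves \<open>2 * \<nu>\<close>.\<close>

theorem card_critical_le:
  assumes "finite S" "S \<subseteq> critical_points G" "inj_on fst S"
  shows "card S \<le> 2 * card (singular_points G) + (if n = 0 then 0 else 1)"
proof -
  define d where "d = cover_degree"
  have d: "d > 0" unfolding d_def by (rule cover_degree_pos)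
  have "fst ` S \<subseteq> {x. poly Q x = 0}"
  proof
    fix x assume "x \<in> fst ` S"
    then obtain y where "(x, y) \<in> critical_points G" using assms(2) by force
    then show "x \<in> {x. poly Q x = 0}" unfolding Q_def norm_Gy_eq_0_iff critical_points_def by auto
  qed
  then have "card (fst ` S) \<le> card {x. poly Q x = 0}"
    by (intro card_mono poly_roots_finite Q_nonzero)
  also have "\<dots> \<le> degree Q" by (rule card_poly_roots_bound[OF Q_nonzero])
  finally have "card S \<le> degree Q" using card_image[OF assms(3)] by simp
  then have "d * card S + d * (degree G - 1) \<le> d * degree D"
    using degree_Q_bound by (metis add_le_mono1 distrib_left mult_le_mono2 order_trans)
  also have "\<dots> \<le> degree A - (if n = 0 then 1 else 0) + 2 * d * card (singular_points G)"
    using degree_D_bound unfolding d_def .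
  finally have *: "d * card S + d * (degree G - 1) \<le> degree A - (if n = 0 then 1 else 0) + 2 * d * card (singular_points G)" .
  have dG: "d * (degree G - 1) + d = degree A"
    using degree_cover degree_G_pos unfolding d_def by (simp add: algebra_simps)
  show ?thesis
  proof (cases "n = 0")
    case True
    have "d * card S < d * (2 * card (singular_points G) + 1)"
      using * dG True d by (simp add: algebra_simps)
    then have "card S < 2 * card (singular_points G) + 1" by (metis mult_less_cancel1)
    then show ?thesis using True by simp
  next
    case False
    have "d * card S \<le> d * (2 * card (singular_points G) + 1)"
      using * dG False by (simp add: algebra_simps)
    then have "card S \<le> 2 * card (singular_points G) + 1" using d by (metis mult_le_cancel1)
    then show ?thesis using False by simp
  qed
qed

end

section \<open>Real parameters\<close>

lemma odd_card_fixed_point: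
  assumes "finite S" "\<And>x. x \<in> S \<Longrightarrow> f x \<in> S \<and> f (f x) = x"
  shows "even (card S) \<longleftrightarrow> even (card {x \<in> S. f x = x})"
  using assms
proof (induction "card S" arbitrary: S rule: less_induct)
  case less
  show ?case
  proof (cases "\<exists>x\<in>S. f x \<noteq> x")
    case False
    then have "{x \<in> S. f x = x} = S" by blast
    then show ?thesis by simp
  next
    case True
    then obtain x where x: "x \<in> S" "f x \<noteq> x" by blast
    have fx: "f x \<in> S" "f (f x) = x" using less(3) x(1) by auto
    define S' where "S' = S - {x, f x}"
    have "S = insert x (insert (f x) S')" "x \<notin> insert (f x) S'" "f x \<notin> S'" "finite S'"
      unfolding S'_def using less(2) x fx by auto
    then have cards: "card S = card S' + 2" by (metis add_2_eq_Suc' card_insert_disjoint finite_insert)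
    have "f y \<in> S' \<and> f (f y) = y" if "y \<in> S'" for y
    proof -
      have y: "y \<in> S" "y \<noteq> x" "y \<noteq> f x" using that unfolding S'_def by auto
      have "f y \<noteq> x" "f y \<noteq> f x" using less(3) y fx by metis+
      then show ?thesis using less(3)[OF y(1)] unfolding S'_def by simp
    qed
    then have "even (card S') \<longleftrightarrow> even (card {x \<in> S'. f x = x})"
      using less(1)[of S'] less(2) cards unfolding S'_def by simp
    moreover have "{y \<in> S'. f y = y} = {y \<in> S. f y = y}"
      unfolding S'_def using x fx by auto
    ultimately show ?thesis using cards by simp
  qed
qed

context nonvertical_param_curve
begin

definition R :: "complex set" where "R = {z \<in> \<Omega>. \<sigma> z = z}"

lemma R_real: "z \<in> R \<Longrightarrow> X z \<in> \<real> \<and> Y z \<in> \<real>"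
  using \<phi>_\<sigma>[of z] unfolding R_def \<phi>_def by (auto simp: Reals_cnj_iff)

text \<open>Each coincidence involves a parameter from the exceptional set \<open>F0\<close>, and
  only finitely many parameters share its abscissa.\<close>

lemma finite_coincidences: "finite {z \<in> R. \<exists>z'\<in>R. z' \<noteq> z \<and> \<phi> z' = \<phi> z}"
proof -
  obtain F0 where F0: "finite F0" "inj_on \<phi> (R - F0)" using inj_real unfolding R_def by blast
  have "{z \<in> R. \<exists>z'\<in>R. z' \<noteq> z \<and> \<phi> z' = \<phi> z} \<subseteq> F0 \<union> (\<Union>f\<in>F0. {z \<in> \<Omega>. X z = X f})"
  proof
    fix z assume "z \<in> {z \<in> R. \<exists>z'\<in>R. z' \<noteq> z \<and> \<phi> z' = \<phi> z}"
    then obtain z' where z: "z \<in> R" "z' \<in> R" "z' \<noteq> z" "\<phi> z' = \<phi> z" by blast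
    then have "z \<in> F0 \<or> z' \<in> F0" using F0(2) by (meson DiffI inj_onD)
    moreover have "X z = X z'" "z \<in> \<Omega>" using z unfolding \<phi>_def R_def by auto
    ultimately show "z \<in> F0 \<union> (\<Union>f\<in>F0. {z \<in> \<Omega>. X z = X f})" by auto
  qed
  then show ?thesis using F0(1) finite_fibre by (meson finite_UN_I finite_Un finite_subset)
qed

lemma R_line: "n = 0 \<Longrightarrow> R = \<real>"
  unfolding R_def \<Omega>_def \<sigma>_def by (auto simp: Reals_cnj_iff)

lemma R_circle:
  assumes "n > 0"
  shows "R = sphere 0 1"
proof (intro equalityI subsetI)
  fix z assume "z \<in> R"
  then have "z \<noteq> 0" "inverse (cnj z) = z" using assms unfolding R_def \<Omega>_def \<sigma>_def by auto
  then have "z * cnj z = 1" by (metis complex_cnj_zero_iff left_inverse)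
  then have "norm z * norm z = 1" by (metis complex_mod_cnj norm_mult norm_one)
  then show "z \<in> sphere 0 1" by (simp add: square_eq_1_iff) (use norm_ge_zero[of z] in linarith)
next
  fix z :: complex assume "z \<in> sphere 0 1"
  then have "norm z = 1" by simp
  then have "z \<noteq> 0" "z * cnj z = 1" by (auto simp: complex_norm_square[symmetric])
  then show "z \<in> R" unfolding R_def \<Omega>_def \<sigma>_def using assms
    by (auto simp: inverse_eq_divide field_simps)
qed

lemma infinite_R: "infinite R"
proof (cases "n = 0")
  case True
  then have "range complex_of_real \<subseteq> R" unfolding R_line[OF True] by auto
  moreover have "infinite (range complex_of_real)"
    using infinite_UNIV_char_0[where 'a = real] by (simp add: finite_image_iff inj_of_real)
  ultimately show ?thesis using finite_subset by blast
next
  case False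
  have "{0..1} \<subseteq> Re ` R"
  proof
    fix x :: real assume "x \<in> {0..1}"
    then have "x ^ 2 \<le> 1" by (simp add: power_le_one)
    then have "norm (Complex x (sqrt (1 - x ^ 2))) = 1" by (simp add: cmod_def)
    then have "Complex x (sqrt (1 - x ^ 2)) \<in> R" using False by (simp add: R_circle)
    then show "x \<in> Re ` R" by (metis complex.sel(1) imageI)
  qed
  moreover have "infinite {0..1::real}" by simp
  ultimately show ?thesis using finite_subset by blast
qed

lemma simple_fibre:
  assumes "poly D x \<noteq> 0" "eval2 G (x, y) = 0"
  shows "count (proots (fibre_poly G x)) y = 1"
proof -
  have "poly (fibre_poly G x) y = 0" using assms(2) by simp
  then have "order y (fibre_poly G x) \<noteq> 0" using fibre_G_nonzero order_root by blast
  moreover have "\<not> order y (fibre_poly G x) \<ge> 2"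
  proof
    assume o: "order y (fibre_poly G x) \<ge> 2"
    have r: "poly (fibre_poly G x) y = 0" using assms(2) by simp
    then have "order y (pderiv (fibre_poly G x)) \<noteq> 0"
      using order_pderiv[OF fibre_G_nonzero r] o by linarith
    then have "poly (pderiv (fibre_poly G x)) y = 0" using order_root by blast
    then have "eval2 Gy (x, y) = 0" "eval2 G (x, y) = 0" using r unfolding fibre_poly_pderiv by simp_all
    then have "poly D x = 0" unfolding D_def norm_Gy_eq_0_iff by blast
    then show False using assms(1) by simp
  qed
  ultimately show ?thesis using fibre_G_nonzero by simp
qed

text \<open>The abscissas over which counting fails: vertical tangents and singular points,
  ramification of \<open>X\<close>, and real parameters not determined by their point.\<close>

definition bad :: "complex set" where
  "bad = {x. poly D x = 0} \<union> X ` {z. poly (numer_deriv A) z = 0} \<union> X ` {z \<in> R. \<exists>z'\<in>R. z' \<noteq> z \<and> \<phi> z' = \<phi> z}"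

lemma finite_bad: "finite bad"
  unfolding bad_def using poly_roots_finite[OF D_nonzero] poly_roots_finite[OF numer_deriv_A(1)] finite_coincidences
  by blast

text \<open>Neither \<open>\<Delta> x\<close> nor the fibre of \<open>G\<close> has multiple roots
  here, so \<open>fibre_roots\<close> counts parameters instead of multiplicities.\<close>

lemma card_generic_fibre:
  assumes "x \<notin> bad" "eval2 G (x, y) = 0"
  shows "card {z \<in> \<Omega>. \<phi> z = (x, y)} = cover_degree"
proof -
  have D: "poly D x \<noteq> 0" and ram: "\<And>z. X z = x \<Longrightarrow> poly (numer_deriv A) z \<noteq> 0"
    using assms(1) unfolding bad_def by auto
  have simple: "count (proots (\<Delta> x)) z \<le> 1" for z
  proof (rule ccontr)
    assume neg: "\<not> ?thesis"
    then have "count (proots (\<Delta> x)) z > 0" by linarith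
    then have "z \<in># proots (\<Delta> x)" by (simp only: count_greater_zero_iff)
    then have Xz: "X z = x" using in_proots_\<Delta> by blast
    have o: "order z (\<Delta> x) \<ge> 2" using neg by simp
    then have r: "poly (\<Delta> x) z = 0" using order_root[of "\<Delta> x" z] by (metis not_numeral_le_zero)
    then have "order z (pderiv (\<Delta> x)) \<noteq> 0" using order_pderiv[OF \<Delta>_nonzero r] o by linarith
    then have "poly (pderiv (\<Delta> x)) z = 0" using order_root by blast
    then have "poly (numer_deriv (\<Delta> x)) z = 0" using r unfolding numer_deriv_def by (cases "n = 0") simp_all
    then show False using ram[OF Xz] unfolding numer_deriv_\<Delta> by simp
  qed
  have fin: "finite {z \<in> \<Omega>. \<phi> z = (x, y)}"
    by (rule finite_subset[OF _ finite_fibre[of x]]) (auto simp: \<phi>_def)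
  have "mset_set {z \<in> \<Omega>. \<phi> z = (x, y)} = filter_mset (\<lambda>z. Y z = y) (proots (\<Delta> x))"
  proof (rule multiset_eqI)
    fix z
    have z: "z \<in># proots (\<Delta> x) \<longleftrightarrow> z \<in> \<Omega> \<and> X z = x" by (rule in_proots_\<Delta>)
    show "count (mset_set {z \<in> \<Omega>. \<phi> z = (x, y)}) z = count (filter_mset (\<lambda>z. Y z = y) (proots (\<Delta> x))) z"
    proof (cases "z \<in># proots (\<Delta> x)")
      case True
      then have "count (proots (\<Delta> x)) z \<ge> 1" by (simp only: count_greater_eq_one_iff)
      then have "count (proots (\<Delta> x)) z = 1" using simple[of z] by (rule le_antisym[rotated])
      then show ?thesis using fin z True by (auto simp del: count_proots simp: count_mset_set' \<phi>_def)
    next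
      case False
      then have "count (proots (\<Delta> x)) z = 0" by (rule not_in_iff[THEN iffD1])
      then show ?thesis using fin z False by (auto simp del: count_proots simp: count_mset_set' \<phi>_def)
    qed
  qed
  then have "card {z \<in> \<Omega>. \<phi> z = (x, y)} = size (filter_mset (\<lambda>z. Y z = y) (proots (\<Delta> x)))"
    by (metis size_mset_set)
  also have "\<dots> = count (image_mset Y (proots (\<Delta> x))) y"
    by (simp only: count_conv_size_mset filter_mset_image_mset size_image_mset)
  also have "\<dots> = cover_degree * count (proots (fibre_poly G x)) y"
    unfolding fibre_roots[symmetric] by (rule count_repeat_mset)
  finally show ?thesis using simple_fibre[OF D assms(2)] by simp
qed

text \<open>The involution acts on the \<open>cover_degree\<close> parameters of a generic real point; since one such
  point has exactly one real parameter, this number is odd.\<close>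

lemma generic_real_parameter:
  assumes "x \<in> \<real>" "y \<in> \<real>" "x \<notin> bad" "eval2 G (x, y) = 0"
  obtains z where "z \<in> R" "\<phi> z = (x, y)"
proof -
  have parity: "even cover_degree \<longleftrightarrow> even (card {z \<in> R. \<phi> z = (x, y)})"
    if "x \<in> \<real>" "y \<in> \<real>" "x \<notin> bad" "eval2 G (x, y) = 0" for x y
  proof -
    let ?S = "{z \<in> \<Omega>. \<phi> z = (x, y)}"
    have "finite ?S" by (rule finite_subset[OF _ finite_fibre[of x]]) (auto simp: \<phi>_def)
    moreover have "\<sigma> z \<in> ?S \<and> \<sigma> (\<sigma> z) = z" if "z \<in> ?S" for z
      using that \<open>x \<in> \<real>\<close> \<open>y \<in> \<real>\<close> \<phi>_\<sigma>[of z] \<sigma>_in \<sigma>_\<sigma> by (auto simp: \<phi>_def Reals_cnj_iff)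
    ultimately have "even (card ?S) \<longleftrightarrow> even (card {z \<in> ?S. \<sigma> z = z})" by (rule odd_card_fixed_point)
    moreover have "{z \<in> ?S. \<sigma> z = z} = {z \<in> R. \<phi> z = (x, y)}" unfolding R_def by auto
    ultimately show ?thesis using card_generic_fibre[OF that(3,4)] by simp
  qed
  have "odd cover_degree"
  proof -
    have "finite (\<Union>x\<in>bad. {z \<in> \<Omega>. X z = x})" using finite_bad finite_fibre by blast
    then obtain z where z: "z \<in> R" "z \<notin> (\<Union>x\<in>bad. {z \<in> \<Omega>. X z = x})"
      using infinite_R by (meson finite_subset subsetI)
    then have zO: "z \<in> \<Omega>" "X z \<notin> bad" unfolding R_def by auto
    then have "{z' \<in> R. \<phi> z' = (X z, Y z)} = {z}"
      using z(1) unfolding bad_def \<phi>_def by auto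
    then have "card {z' \<in> R. \<phi> z' = (X z, Y z)} = 1" by simp
    then show ?thesis using parity[of "X z" "Y z"] R_real[OF z(1)] zO eval2_G_\<phi>[OF zO(1)] by simp
  qed
  then have "{z \<in> R. \<phi> z = (x, y)} \<noteq> {}" using parity[OF assms] by (metis card.empty even_zero)
  then show thesis using that by blast
qed

lemma continuous_on_XY: "continuous_on \<Omega> X" "continuous_on \<Omega> Y"
  unfolding X_def Y_def using \<Omega>_pow
  by (intro continuous_on_divide continuous_on_poly continuous_on_power continuous_on_id, blast)+

text \<open>Supplies limits of real parameters. On the line this is properness of a nonconstant
  polynomial, on the circle compactness of the circle itself.\<close>

lemma compact_real_parameters: "compact {z \<in> R. norm (X z) \<le> r}"
proof -
  have "closed {z \<in> R. norm (X z) \<le> r} \<and> bounded {z \<in> R. norm (X z) \<le> r}"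
  proof (cases "n = 0")
    case True
    have RX: "R = \<real>" "X = poly A" using R_line[OF True] unfolding X_def using True by auto
    have "closed ((\<lambda>z. norm (poly A z)) -` {..r})"
      by (rule closed_vimage) (auto intro!: continuous_intros)
    then have "closed (\<real> \<inter> (\<lambda>z. norm (poly A z)) -` {..r})" by (intro closed_Int closed_complex_Reals)
    moreover have "\<real> \<inter> (\<lambda>z. norm (poly A z)) -` {..r} = {z \<in> R. norm (X z) \<le> r}" unfolding RX by auto
    moreover have "bounded {z \<in> R. norm (X z) \<le> r}"
    proof -
      have "filterlim (poly A) at_infinity at_infinity"
        using degree_A by (intro filterlim_poly_at_infinity) simp
      then have "filterlim (\<lambda>z. norm (poly A z)) at_top at_infinity"
        by (rule filterlim_at_infinity_imp_norm_at_top)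
      then have "\<forall>\<^sub>F z in at_infinity. norm (poly A z) > r" unfolding filterlim_at_top_dense by blast
      then obtain b where "\<And>z. norm z \<ge> b \<Longrightarrow> norm (poly A z) > r" unfolding eventually_at_infinity by blast
      then have "norm z \<le> b" if "z \<in> {z \<in> R. norm (X z) \<le> r}" for z
        using that unfolding RX by (metis (no_types, lifting) linorder_not_less linorder_le_cases mem_Collect_eq)
      then show ?thesis unfolding bounded_iff by blast
    qed
    ultimately show ?thesis by simp
  next
    case False
    then have RS: "R = sphere 0 1" by (intro R_circle) simp
    have "R \<subseteq> \<Omega>" unfolding R_def by blast
    then have "continuous_on (sphere 0 1) (\<lambda>z. norm (X z))"
      unfolding RS by (intro continuous_intros continuous_on_subset[OF continuous_on_XY(1)])
    then have "closed (sphere 0 1 \<inter> (\<lambda>z. norm (X z)) -` {..r})"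
      by (intro continuous_closed_preimage) auto
    moreover have "sphere 0 1 \<inter> (\<lambda>z. norm (X z)) -` {..r} = {z \<in> R. norm (X z) \<le> r}" unfolding RS by auto
    moreover have "bounded {z \<in> R. norm (X z) \<le> r}"
      by (rule bounded_subset[of "sphere 0 1"]) (auto simp: RS)
    ultimately show ?thesis by simp
  qed
  then show ?thesis by (simp add: compact_eq_bounded_closed)
qed

section \<open>Real branches at a node\<close>

lemma G_real:
  assumes "x \<in> \<real>" "y \<in> \<real>"
  shows "eval2 G (x, y) \<in> \<real>"
  using eval2_conj2[of G x y] assms unfolding real_G by (simp add: Reals_cnj_iff)

text \<open>On the line of slope \<open>w\<close> through the node, \<open>G\<close> divided by
  \<open>\<xi> ^ 2\<close> tends to a nonzero real constant times
  \<open>(w - \<alpha>) * (w - \<beta>)\<close>. This changes sign at the simple root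
  \<open>\<alpha>\<close>, and the intermediate value theorem in \<open>w\<close> finds a zero for
  every small \<open>\<xi>\<close>.\<close>

lemma real_points_near_node:
  assumes sing: "p \<in> singular_points G" and p: "p = (of_real x0, of_real y0)"
    and slopes: "\<alpha> \<noteq> \<beta>"
      "\<And>t. eval2 (partial_x Gx) p + 2 * eval2 (partial_y Gx) p * t + eval2 (partial_y Gy) p * t ^ 2
        = eval2 (partial_y Gy) p * (t - of_real \<alpha>) * (t - of_real \<beta>)"
    and \<epsilon>: "\<epsilon> > 0"
  obtains \<delta> where "\<delta> > 0" "\<And>\<xi>. 0 < \<xi> \<Longrightarrow> \<xi> < \<delta> \<Longrightarrow>
    \<exists>w. \<bar>w - \<alpha>\<bar> < \<epsilon> \<and> eval2 G (of_real (x0 + \<xi>), of_real (y0 + \<xi> * w)) = 0"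
proof -
  let ?c = "eval2 (partial_y Gy) p"
  have c0: "?c \<noteq> 0" using not_vertical[OF sing] .
  have pc: "p = (complex_of_real x0, complex_of_real y0)" by fact
  obtain P0 P1 P2 where dec:
    "G = [:[:- of_real x0, 1:]:] * [:[:- of_real x0, 1:]:] * P0 + [:[:- of_real x0, 1:]:] * [:[:- of_real y0:], 1:] * P1
      + [:[:- of_real y0:], 1:] * [:[:- of_real y0:], 1:] * P2"
    "eval2 (partial_x Gx) p = 2 * eval2 P0 p"
    "eval2 (partial_y Gx) p = eval2 P1 p"
    "?c = 2 * eval2 P2 p"
    using second_order_decomposition[OF sing pc] by metis
  define g where "g w \<xi> = eval2 P0 (of_real (x0 + \<xi>), of_real (y0 + \<xi> * w)) + of_real w * eval2 P1 (of_real (x0 + \<xi>), of_real (y0 + \<xi> * w))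
    + of_real w ^ 2 * eval2 P2 (of_real (x0 + \<xi>), of_real (y0 + \<xi> * w))" for w \<xi> :: real
  have Gg: "eval2 G (of_real (x0 + \<xi>), of_real (y0 + \<xi> * w)) = of_real (\<xi> ^ 2) * g w \<xi>" for w \<xi>
    unfolding dec(1) g_def by (simp add: algebra_simps power2_eq_square)
  have g0: "2 * g w 0 = ?c * of_real ((w - \<alpha>) * (w - \<beta>))" for w
    using slopes(2)[of "of_real w"] unfolding g_def dec(2-4) unfolding p by (simp add: algebra_simps)
  have greal: "g w \<xi> \<in> \<real>" if "\<xi> \<noteq> 0" for w \<xi>
  proof -
    have "g w \<xi> = eval2 G (of_real (x0 + \<xi>), of_real (y0 + \<xi> * w)) / of_real (\<xi> ^ 2)"
      unfolding Gg using that by simp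
    also have "\<dots> \<in> \<real>" by (intro Reals_divide G_real) auto
    finally show ?thesis .
  qed
  have glim: "((\<lambda>\<xi>. Re (g w \<xi>)) \<longlongrightarrow> Re ?c / 2 * ((w - \<alpha>) * (w - \<beta>))) (at_right 0)" for w
  proof -
    have "continuous (at 0) (g w)" unfolding g_def
      by (intro continuous_intros continuous_on_compose2[OF continuous_on_eval2] continuous_on_eq_continuous_at[THEN iffD1, rule_format, of UNIV]) auto
    then have "((\<lambda>\<xi>. Re (g w \<xi>)) \<longlongrightarrow> Re (g w 0)) (at 0)"
      unfolding isCont_def[symmetric] continuous_at[symmetric] by (intro tendsto_Re) (simp add: isCont_def)
    moreover have "Re (g w 0) = Re ?c / 2 * ((w - \<alpha>) * (w - \<beta>))"
      using arg_cong[OF g0[of w], of Re] by simp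
    ultimately show ?thesis by (metis filterlim_at_split)
  qed
  have creal: "Re ?c \<noteq> 0"
  proof -
    have "eval2 (partial_y Gy) p \<in> \<real>"
    proof -
      have "eval2 (conj2 (partial_y Gy)) (cnj (of_real x0), cnj (of_real y0)) = cnj (eval2 (partial_y Gy) p)"
        unfolding p by (rule eval2_conj2)
      then show ?thesis by (simp add: conj2_partial real_G p Reals_cnj_iff)
    qed
    then show ?thesis using c0 by (auto simp: complex_eq_iff complex_is_Real_iff)
  qed
  \<comment> \<open>Small enough to keep \<open>\<beta>\<close> away from the interval around
    \<open>\<alpha>\<close>, so that the limits at its ends have opposite signs.\<close>
  define \<eta> where "\<eta> = min (\<epsilon> / 2) (\<bar>\<alpha> - \<beta>\<bar> / 2)"
  have \<eta>: "\<eta> > 0" "\<eta> < \<epsilon>" "\<eta> < \<bar>\<alpha> - \<beta>\<bar>" using \<epsilon> slopes(1) unfolding \<eta>_def min_def by auto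
  define u v where "u = Re ?c / 2 * ((\<alpha> - \<eta> - \<alpha>) * (\<alpha> - \<eta> - \<beta>))" and "v = Re ?c / 2 * ((\<alpha> + \<eta> - \<alpha>) * (\<alpha> + \<eta> - \<beta>))"
  have uv: "u * v < 0"
  proof -
    have "\<bar>\<alpha> - \<beta>\<bar> ^ 2 > \<eta> ^ 2" using \<eta>(1,3) by (intro power_strict_mono) auto
    then have "(\<alpha> - \<beta>) ^ 2 > \<eta> ^ 2" by simp
    moreover have "u * v = - ((Re ?c / 2) ^ 2 * (\<eta> ^ 2 * ((\<alpha> - \<beta>) ^ 2 - \<eta> ^ 2)))"
    proof -
      have "(r * ((a - e - a) * (a - e - b))) * (r * ((a + e - a) * (a + e - b))) = - (r ^ 2 * (e ^ 2 * ((a - b) ^ 2 - e ^ 2)))"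
        for r a b e :: real by (simp add: power2_eq_square algebra_simps)
      then show ?thesis unfolding u_def v_def .
    qed
    moreover have "(Re ?c / 2) ^ 2 > 0" "\<eta> ^ 2 > 0" using creal \<eta>(1) by simp_all
    ultimately show ?thesis by (metis diff_gt_0_iff_gt mult_pos_pos neg_less_0_iff_less)
  qed
  have "((\<lambda>\<xi>. Re (g (\<alpha> - \<eta>) \<xi>) * Re (g (\<alpha> + \<eta>) \<xi>)) \<longlongrightarrow> u * v) (at_right 0)"
    unfolding u_def v_def by (intro tendsto_mult glim)
  then have "\<forall>\<^sub>F \<xi> in at_right 0. Re (g (\<alpha> - \<eta>) \<xi>) * Re (g (\<alpha> + \<eta>) \<xi>) < 0"
    using uv by (rule order_tendstoD)
  then obtain \<delta> where \<delta>: "\<delta> > 0" "\<And>\<xi>. 0 < \<xi> \<Longrightarrow> \<xi> < \<delta> \<Longrightarrow> Re (g (\<alpha> - \<eta>) \<xi>) * Re (g (\<alpha> + \<eta>) \<xi>) < 0"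
    unfolding eventually_at_right_field by blast
  show thesis
  proof (rule that[OF \<delta>(1)])
    fix \<xi> :: real assume \<xi>: "0 < \<xi>" "\<xi> < \<delta>"
    have cont: "continuous_on {\<alpha> - \<eta>..\<alpha> + \<eta>} (\<lambda>w. Re (g w \<xi>))"
      unfolding g_def by (intro continuous_intros continuous_on_compose2[OF continuous_on_eval2]) auto
    have "\<exists>w. \<alpha> - \<eta> \<le> w \<and> w \<le> \<alpha> + \<eta> \<and> Re (g w \<xi>) = 0"
    proof (cases "Re (g (\<alpha> - \<eta>) \<xi>) < 0")
      case True
      then have "Re (g (\<alpha> + \<eta>) \<xi>) \<ge> 0" using \<delta>(2)[OF \<xi>] by (smt (verit) mult_neg_neg)
      then show ?thesis using IVT'[of "\<lambda>w. Re (g w \<xi>)" "\<alpha> - \<eta>" 0 "\<alpha> + \<eta>"] True cont \<eta>(1) by force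
    next
      case False
      then have "Re (g (\<alpha> + \<eta>) \<xi>) \<le> 0" using \<delta>(2)[OF \<xi>] by (smt (verit) mult_nonneg_nonneg)
      then show ?thesis using IVT2'[of "\<lambda>w. Re (g w \<xi>)" "\<alpha> + \<eta>" 0 "\<alpha> - \<eta>"] False cont \<eta>(1) by force
    qed
    then obtain w where w: "\<alpha> - \<eta> \<le> w" "w \<le> \<alpha> + \<eta>" "Re (g w \<xi>) = 0" by blast
    have "\<bar>w - \<alpha>\<bar> < \<epsilon>" using w(1,2) \<eta>(2) by auto
    moreover have "g w \<xi> = 0" using w(3) greal[of \<xi> w] \<xi>(1) by (auto simp: complex_is_Real_iff complex_eq_iff)
    ultimately show "\<exists>w. \<bar>w - \<alpha>\<bar> < \<epsilon> \<and> eval2 G (of_real (x0 + \<xi>), of_real (y0 + \<xi> * w)) = 0"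
      using Gg by (intro exI[of _ w]) simp
  qed
qed

text \<open>The node lies over an abscissa in \<open>bad\<close>. Real parameters are therefore
  first found over real points that approach it with slope tending to \<open>\<alpha>\<close>; a
  limit of these parameters lies over the node, and its branch has the same slope.\<close>

lemma real_branch:
  assumes sing: "p \<in> singular_points G" and p: "p = (of_real x0, of_real y0)"
    and slopes: "\<alpha> \<noteq> \<beta>"
      "\<And>t. eval2 (partial_x Gx) p + 2 * eval2 (partial_y Gx) p * t + eval2 (partial_y Gy) p * t ^ 2
        = eval2 (partial_y Gy) p * (t - of_real \<alpha>) * (t - of_real \<beta>)"
  obtains z where "z \<in> R" "\<phi> z = p" "((\<lambda>z'. (Y z' - Y z) / (X z' - X z)) \<longlongrightarrow> of_real \<alpha>) (at z)"
proof -
  have ex: "\<exists>z w \<xi>. z \<in> R \<and> 0 < \<xi> \<and> \<xi> < 1 / real (Suc k) \<and> \<bar>w - \<alpha>\<bar> < 1 / real (Suc k) \<and>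
      \<phi> z = (of_real (x0 + \<xi>), of_real (y0 + \<xi> * w))" for k
  proof -
    obtain \<delta> where \<delta>: "\<delta> > 0" "\<And>\<xi>. 0 < \<xi> \<Longrightarrow> \<xi> < \<delta> \<Longrightarrow>
      \<exists>w. \<bar>w - \<alpha>\<bar> < 1 / real (Suc k) \<and> eval2 G (of_real (x0 + \<xi>), of_real (y0 + \<xi> * w)) = 0"
      using real_points_near_node[OF sing p slopes, of "1 / real (Suc k)"] by auto
    define m where "m = min \<delta> (1 / real (Suc k))"
    have "m > 0" unfolding m_def using \<delta>(1) by simp
    then have "infinite {0<..<m}" by simp
    moreover have "finite ((\<lambda>\<xi>. complex_of_real (x0 + \<xi>)) -` bad)"
      using finite_bad by (intro finite_vimageI) (auto intro: injI)
    ultimately obtain \<xi> where \<xi>: "\<xi> \<in> {0<..<m}" "complex_of_real (x0 + \<xi>) \<notin> bad"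
    proof -
      have "\<not> {0<..<m} \<subseteq> (\<lambda>\<xi>. complex_of_real (x0 + \<xi>)) -` bad"
        using \<open>infinite {0<..<m}\<close> \<open>finite ((\<lambda>\<xi>. complex_of_real (x0 + \<xi>)) -` bad)\<close> finite_subset by blast
      then show ?thesis using that by blast
    qed
    then obtain w where w: "\<bar>w - \<alpha>\<bar> < 1 / real (Suc k)" "eval2 G (of_real (x0 + \<xi>), of_real (y0 + \<xi> * w)) = 0"
      using \<delta>(2)[of \<xi>] unfolding m_def by auto
    obtain z where "z \<in> R" "\<phi> z = (of_real (x0 + \<xi>), of_real (y0 + \<xi> * w))"
      using generic_real_parameter[OF _ _ \<xi>(2) w(2)] by auto
    then show ?thesis using w(1) \<xi>(1) unfolding m_def by auto
  qed
  then obtain z w \<xi> where zw: "\<And>k. z k \<in> R" "\<And>k. 0 < \<xi> k" "\<And>k. \<xi> k < 1 / real (Suc k)"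
    "\<And>k. \<bar>w k - \<alpha>\<bar> < 1 / real (Suc k)" "\<And>k. \<phi> (z k) = (of_real (x0 + \<xi> k), of_real (y0 + \<xi> k * w k))"
    by metis
  have Xz: "X (z k) = of_real (x0 + \<xi> k)" and Yz: "Y (z k) = of_real (y0 + \<xi> k * w k)" for k
    using zw(5)[of k] unfolding \<phi>_def by auto
  have in_K: "z k \<in> {z \<in> R. norm (X z) \<le> \<bar>x0\<bar> + 1}" for k
  proof -
    have "1 / real (Suc k) \<le> 1" by simp
    then have "\<bar>x0 + \<xi> k\<bar> \<le> \<bar>x0\<bar> + 1" using zw(2,3)[of k] by linarith
    then show ?thesis using zw(1) Xz by (simp only: mem_Collect_eq norm_of_real simp_thms)
  qed
  obtain l r where l: "l \<in> {z \<in> R. norm (X z) \<le> \<bar>x0\<bar> + 1}" "strict_mono r" "(z \<circ> r) \<longlonglongrightarrow> l"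
    using compact_real_parameters[unfolded compact_def, rule_format, of z, OF in_K] by blast
  have lR: "l \<in> R" "l \<in> \<Omega>" using l(1) unfolding R_def by auto
  have inv0: "(\<lambda>k. 1 / real (Suc k)) \<longlonglongrightarrow> 0" using LIMSEQ_inverse_real_of_nat by (simp add: inverse_eq_divide)
  have \<xi>0: "\<xi> \<longlonglongrightarrow> 0"
    by (rule tendsto_sandwich[OF _ _ tendsto_const inv0]) (use zw(2,3) in \<open>auto intro!: always_eventually simp: less_imp_le\<close>)
  have w\<alpha>: "w \<longlonglongrightarrow> \<alpha>"
  proof -
    have "(\<lambda>k. \<bar>w k - \<alpha>\<bar>) \<longlonglongrightarrow> 0"
      by (rule tendsto_sandwich[OF _ _ tendsto_const inv0]) (use zw(4) in \<open>auto intro!: always_eventually simp: less_imp_le\<close>)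
    then show ?thesis by (simp add: tendsto_rabs_zero_iff LIM_zero_iff)
  qed
  note sub = LIMSEQ_subseq_LIMSEQ[OF _ l(2)]
  have zl: "(\<lambda>k. z (r k)) \<longlonglongrightarrow> l" using l(3) by (simp add: o_def)
  have isc: "isCont X l" "isCont Y l"
    using continuous_on_XY lR(2) open_\<Omega> by (auto simp: continuous_on_eq_continuous_at)
  have "(\<lambda>k. X (z (r k))) \<longlonglongrightarrow> X l" "(\<lambda>k. Y (z (r k))) \<longlonglongrightarrow> Y l"
    using isCont_tendsto_compose[OF isc(1) zl] isCont_tendsto_compose[OF isc(2) zl] by auto
  moreover have "(\<lambda>k. X (z (r k))) \<longlonglongrightarrow> of_real (x0 + 0)"
    unfolding Xz using sub[OF \<xi>0] by (intro tendsto_of_real tendsto_add tendsto_const) (simp add: o_def)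
  moreover have "(\<lambda>k. Y (z (r k))) \<longlonglongrightarrow> of_real (y0 + 0 * \<alpha>)"
    unfolding Yz using sub[OF \<xi>0] sub[OF w\<alpha>] by (intro tendsto_of_real tendsto_add tendsto_mult tendsto_const) (simp_all add: o_def)
  ultimately have XYl: "X l = of_real x0" "Y l = of_real y0" using LIMSEQ_unique by fastforce+
  then have \<phi>l: "\<phi> l = p" unfolding \<phi>_def p by simp
  obtain s where s: "((\<lambda>z'. (Y z' - Y l) / (X z' - X l)) \<longlongrightarrow> s) (at l)"
    using branch_slope[OF lR(2)] \<phi>l sing by metis
  \<comment> \<open>Positive \<open>\<xi>\<close> keeps the parameters away from their limit, so the
    slope of the branch can be read off along the sequence.\<close>
  have "filterlim (\<lambda>k. z (r k)) (at l) sequentially"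
  proof (rule filterlim_atI[OF zl])
    have "z (r k) \<noteq> l" for k using zw(2)[of "r k"] Xz[of "r k"] XYl(1) by auto
    then show "\<forall>\<^sub>F k in sequentially. z (r k) \<noteq> l" by simp
  qed
  from filterlim_compose[OF s this]
  have "(\<lambda>k. (Y (z (r k)) - Y l) / (X (z (r k)) - X l)) \<longlonglongrightarrow> s" .
  moreover have "(Y (z (r k)) - Y l) / (X (z (r k)) - X l) = of_real (w (r k))" for k
    unfolding Xz Yz XYl using zw(2)[of "r k"] by simp
  moreover have "(\<lambda>k. complex_of_real (w (r k))) \<longlonglongrightarrow> of_real \<alpha>"
    using sub[OF w\<alpha>] by (intro tendsto_of_real) (simp add: o_def)
  ultimately have "s = of_real \<alpha>" using LIMSEQ_unique by auto
  then show thesis using that[OF lR(1) \<phi>l] s by simp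
qed

text \<open>One real parameter is obtained for each of the two slopes, and a single parameter has
  only one slope.\<close>

lemma two_real_parameters:
  assumes sing: "p \<in> singular_points G"
  obtains z z' where "z \<in> R" "z' \<in> R" "z \<noteq> z'" "\<phi> z = p" "\<phi> z' = p"
proof -
  have "real_point p" using nodes[OF sing] unfolding real_tangent_pair_def by blast
  then obtain x0 y0 where p: "p = (of_real x0, of_real y0)"
    unfolding real_point_def by (metis Reals_cases prod.collapse)
  obtain \<alpha> \<beta> :: real where ab: "\<alpha> \<noteq> \<beta>"
    "\<And>t. eval2 (partial_x Gx) p + 2 * eval2 (partial_y Gx) p * t + eval2 (partial_y Gy) p * t ^ 2
      = eval2 (partial_y Gy) p * (t - of_real \<alpha>) * (t - of_real \<beta>)"
    using tangent_slopes[OF nodes[OF sing] not_vertical[OF sing]] by metis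
  have ba: "eval2 (partial_x Gx) p + 2 * eval2 (partial_y Gx) p * t + eval2 (partial_y Gy) p * t ^ 2
      = eval2 (partial_y Gy) p * (t - of_real \<beta>) * (t - of_real \<alpha>)" for t
    unfolding ab(2) by (simp add: mult.commute mult.left_commute)
  obtain z where z: "z \<in> R" "\<phi> z = p" "((\<lambda>z'. (Y z' - Y z) / (X z' - X z)) \<longlongrightarrow> of_real \<alpha>) (at z)"
    using real_branch[OF sing p ab] by blast
  obtain z' where z': "z' \<in> R" "\<phi> z' = p" "((\<lambda>w. (Y w - Y z') / (X w - X z')) \<longlongrightarrow> of_real \<beta>) (at z')"
    using real_branch[OF sing p ab(1)[symmetric] ba] by blast
  have "z \<noteq> z'"
  proof
    assume "z = z'"
    then have "complex_of_real \<alpha> = of_real \<beta>"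
      using z(3) z'(3) tendsto_unique[of "at z'"] by (metis trivial_limit_at)
    then show False using ab(1) by simp
  qed
  then show thesis using that z z' by blast
qed

end

section \<open>Real critical points\<close>

context nonvertical_param_curve
begin

lemma vertical_line_finite: "finite {y :: real. eval2 G (of_real x, of_real y) = 0}"
proof -
  have "finite {y. poly (fibre_poly G (of_real x)) y = 0}" by (rule poly_roots_finite[OF fibre_G_nonzero])
  then have "finite (complex_of_real -` {y. poly (fibre_poly G (of_real x)) y = 0})"
    by (rule finite_vimageI) (rule inj_of_real)
  then show ?thesis by (simp add: vimage_def)
qed

lemma open_not_in_locus:
  assumes "open U" "q \<in> U"
  obtains q' where "q' \<in> U" "eval2 G (of_real (Re q'), of_real (Im q')) \<noteq> 0"
proof -
  obtain e where e: "e > 0" "ball q e \<subseteq> U" using assms openE by blast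
  have "infinite {Im q - e <..< Im q + e}" using e(1) by simp
  then have "\<not> {Im q - e <..< Im q + e} \<subseteq> {y. eval2 G (of_real (Re q), of_real y) = 0}"
    using vertical_line_finite finite_subset by blast
  then obtain y where y: "\<bar>y - Im q\<bar> < e" "eval2 G (of_real (Re q), of_real y) \<noteq> 0"
    by (auto simp: abs_if subset_iff) (smt (verit))+
  have "dist q (Complex (Re q) y) = \<bar>y - Im q\<bar>" by (simp add: dist_norm cmod_def)
  then have "Complex (Re q) y \<in> U" using e(2) y(1) by auto
  then show thesis using that y(2) by simp
qed

text \<open>The point is a maximum of \<open>\<bar>G\<bar>\<close> on the closure of the region.\<close>

lemma critical_point_in_region:
  assumes U: "open U" "bounded U" "U \<noteq> {}"
    and frontier: "\<And>q. q \<in> frontier U \<Longrightarrow> eval2 G (of_real (Re q), of_real (Im q)) = 0"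
  obtains q where "q \<in> U" "(complex_of_real (Re q), complex_of_real (Im q)) \<in> critical_points G"
    "eval2 G (of_real (Re q), of_real (Im q)) \<noteq> 0"
proof -
  define h where "h q = eval2 G (of_real (Re q), of_real (Im q))" for q
  have cont: "continuous_on (closure U) (\<lambda>q. norm (h q))"
    unfolding h_def by (intro continuous_intros continuous_on_eval2)
  have "compact (closure U)" using U(2) by (simp add: compact_closure)
  moreover have "closure U \<noteq> {}" using U(3) by simp
  ultimately obtain q where q: "q \<in> closure U" "\<And>q'. q' \<in> closure U \<Longrightarrow> norm (h q') \<le> norm (h q)"
    using continuous_attains_sup[OF _ _ cont] by blast
  obtain q0 where "q0 \<in> U" using U(3) by blast
  then obtain q1 where q1: "q1 \<in> U" "h q1 \<noteq> 0" using open_not_in_locus[OF U(1)] unfolding h_def by blast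
  have "norm (h q1) \<le> norm (h q)" using q(2)[of q1] q1(1) closure_subset by blast
  then have hq: "h q \<noteq> 0" using q1(2) by auto
  then have "q \<notin> frontier U" using frontier unfolding h_def by blast
  then have qU: "q \<in> U" using q(1) U(1) by (simp add: frontier_def interior_open)
  obtain e where e: "e > 0" "ball q e \<subseteq> U" using U(1) qU openE by blast
  obtain x0 y0 where q_eq: "q = Complex x0 y0" by (cases q)
  have extremum: "eval2 H (of_real x0, of_real y0) = 0"
    if path: "\<And>t. norm (k t - q) = \<bar>t\<bar>" "k 0 = q"
      and der: "((\<lambda>t. h (k t)) has_vector_derivative eval2 H (of_real x0, of_real y0)) (at 0)"
    for k :: "real \<Rightarrow> complex" and H
  proof -
    \<comment> \<open>Division by the real value at \<open>q\<close> turns a maximum of the modulus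
      into \<open>f \<le> 1 = f 0\<close>, whatever the sign of that value.\<close>
    define f where "f t = Re (h (k t)) / Re (h q)" for t
    have real: "h q' \<in> \<real>" for q' unfolding h_def by (intro G_real) auto
    then have hre: "norm (h q') = \<bar>Re (h q')\<bar>" for q' by (simp add: in_Reals_norm)
    have re0: "Re (h q) \<noteq> 0" using hq hre[of q] by auto
    have "f t \<le> f 0" if "\<bar>0 - t\<bar> < e" for t
    proof -
      have "k t \<in> closure U" using path(1)[of t] that e(2) closure_subset
        by (metis abs_minus_commute diff_zero dist_commute dist_norm mem_ball subsetD)
      then have "\<bar>Re (h (k t))\<bar> \<le> \<bar>Re (h q)\<bar>" using q(2) hre by metis
      then have "\<bar>f t\<bar> \<le> 1" unfolding f_def abs_divide using re0 by (simp add: divide_le_eq_1)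
      moreover have "f 0 = 1" unfolding f_def path(2) using re0 by simp
      ultimately show ?thesis by linarith
    qed
    moreover have "(f has_real_derivative Re (eval2 H (of_real x0, of_real y0)) / Re (h q)) (at 0)"
      unfolding f_def using der by (intro DERIV_cdivide) (auto simp: has_real_derivative_iff_has_vector_derivative
        intro: bounded_linear.has_vector_derivative[OF bounded_linear_Re])
    ultimately have "Re (eval2 H (of_real x0, of_real y0)) / Re (h q) = 0"
      using DERIV_local_max[of f _ 0 e] e(1) by blast
    then have re: "Re (eval2 H (of_real x0, of_real y0)) = 0" using re0 by simp
    have "((\<lambda>t. Im (h (k t))) has_vector_derivative Im (eval2 H (of_real x0, of_real y0))) (at 0)"
      using der by (rule bounded_linear.has_vector_derivative[OF bounded_linear_Im])
    moreover have "(\<lambda>t. Im (h (k t))) = (\<lambda>t. 0)" using real by (auto simp: complex_is_Real_iff)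
    ultimately have "Im (eval2 H (of_real x0, of_real y0)) = 0"
      using vector_derivative_unique_at[OF _ has_vector_derivative_const] by metis
    then show ?thesis using re by (simp add: complex_eq_iff)
  qed
  have lin: "((\<lambda>t. complex_of_real (a + t)) has_vector_derivative 1) (at 0)" for a
    by (auto intro!: derivative_eq_intros)
  have "eval2 Gx (of_real x0, of_real y0) = 0"
  proof (rule extremum)
    show "norm (Complex (x0 + t) y0 - q) = \<bar>t\<bar>" "Complex (x0 + 0) y0 = q" for t
      unfolding q_eq by (simp_all add: cmod_def)
    have "((\<lambda>x. eval2 G (x, of_real y0)) has_field_derivative eval2 Gx (of_real x0, of_real y0)) (at (of_real (x0 + 0)))"
      by (simp add: eval2_DERIV_x)
    from field_vector_diff_chain_at[OF lin this]
    show "((\<lambda>t. h (Complex (x0 + t) y0)) has_vector_derivative eval2 Gx (of_real x0, of_real y0)) (at 0)"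
      unfolding h_def by (simp add: o_def)
  qed
  moreover have "eval2 Gy (of_real x0, of_real y0) = 0"
  proof (rule extremum)
    show "norm (Complex x0 (y0 + t) - q) = \<bar>t\<bar>" "Complex x0 (y0 + 0) = q" for t
      unfolding q_eq by (simp_all add: cmod_def)
    have "((\<lambda>y. eval2 G (of_real x0, y)) has_field_derivative eval2 Gy (of_real x0, of_real y0)) (at (of_real (y0 + 0)))"
      by (simp add: eval2_DERIV_y)
    from field_vector_diff_chain_at[OF lin this]
    show "((\<lambda>t. h (Complex x0 (y0 + t))) has_vector_derivative eval2 Gy (of_real x0, of_real y0)) (at 0)"
      unfolding h_def by (simp add: o_def)
  qed
  ultimately show thesis using that[OF qU] hq unfolding critical_points_def h_def q_eq by simp
qed

section \<open>The real curve and the regions it bounds\<close>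

definition real_arc :: "real \<Rightarrow> complex" where
  "real_arc t = (if n = 0 then of_real t else cis t)"

definition real_curve :: "real \<Rightarrow> complex" where
  "real_curve t = Complex (Re (X (real_arc t))) (Re (Y (real_arc t)))"

lemma real_arc_in_R: "real_arc t \<in> R"
proof (cases "n = 0")
  case True
  show ?thesis unfolding R_line[OF True] real_arc_def if_P[OF True] by simp
next
  case False
  show ?thesis unfolding real_arc_def if_not_P[OF False] using False by (simp add: R_circle)
qed

lemma R_imp_\<Omega>: "z \<in> R \<Longrightarrow> z \<in> \<Omega>"
  unfolding R_def by blast

lemma real_curve_X: "complex_of_real (Re (real_curve t)) = X (real_arc t)" "complex_of_real (Im (real_curve t)) = Y (real_arc t)"
  using R_real[OF real_arc_in_R, of t] unfolding real_curve_def by simp_all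

lemma real_curve_eq_iff: "real_curve s = real_curve t \<longleftrightarrow> \<phi> (real_arc s) = \<phi> (real_arc t)"
proof -
  have "\<phi> (real_arc u) = (of_real (Re (real_curve u)), of_real (Im (real_curve u)))" for u
    unfolding real_curve_X \<phi>_def ..
  then show ?thesis by (simp add: complex_eq_iff)
qed

lemma G_real_curve: "eval2 G (of_real (Re (real_curve t)), of_real (Im (real_curve t))) = 0"
  unfolding real_curve_X by (intro eval2_G_\<phi> R_imp_\<Omega> real_arc_in_R)

lemma continuous_on_real_curve: "continuous_on S real_curve"
proof -
  have "continuous_on S real_arc"
    unfolding real_arc_def by (cases "n = 0") (auto intro!: continuous_intros)
  then have "continuous_on S (\<lambda>t. X (real_arc t))" "continuous_on S (\<lambda>t. Y (real_arc t))"
    using R_imp_\<Omega> real_arc_in_R by (intro continuous_on_compose2[OF continuous_on_XY(1)] continuous_on_compose2[OF continuous_on_XY(2)]; blast)+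
  then show ?thesis unfolding real_curve_def by (intro continuous_intros) 
qed

text \<open>On the line a bounded interval suffices, because only finitely many parameters lie over
  nodes. On the circle the two ends of the interval coincide, which provides one return that is not
  due to a node.\<close>

lemma ex_real_interval:
  obtains a b where "a < b" "\<And>s t. s \<in> {a..b} \<Longrightarrow> t \<in> {a..b} \<Longrightarrow> real_arc s = real_arc t \<Longrightarrow> s = t \<or> n > 0 \<and> {s, t} = {a, b}"
    "n > 0 \<Longrightarrow> real_arc a = real_arc b"
    "\<And>z. z \<in> R \<Longrightarrow> \<phi> z \<in> singular_points G \<Longrightarrow> \<exists>t\<in>{a..<b}. real_arc t = z"
proof (cases "n = 0")
  case True
  have ra: "real_arc t = of_real t" for t unfolding real_arc_def using True by simp
  let ?S = "{z \<in> R. \<phi> z \<in> singular_points G}"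
  have "?S \<subseteq> (\<Union>p\<in>singular_points G. {w \<in> \<Omega>. \<phi> w = p})" unfolding R_def by blast
  then have "finite ?S" using finite_singular card_over_node finite_subset by (metis (no_types, lifting) finite_UN_I)
  then obtain T where T: "\<And>z. z \<in> ?S \<Longrightarrow> norm z \<le> T" using finite_imp_bounded bounded_iff by metis
  define T' where "T' = \<bar>T\<bar> + 1"
  show ?thesis
  proof (rule that[of "- T'" T'])
    fix z assume z: "z \<in> R" "\<phi> z \<in> singular_points G"
    then obtain t where t: "z = of_real t" using R_line[OF True] by (auto elim: Reals_cases)
    then have "\<bar>t\<bar> \<le> T" using T[of z] z by simp
    then show "\<exists>t\<in>{- T'..<T'}. real_arc t = z" unfolding T'_def ra t by (intro bexI[of _ t]) auto
  next
    fix s t assume "real_arc s = real_arc t"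
    then show "s = t \<or> n > 0 \<and> {s, t} = {- T', T'}" unfolding ra by simp
  next
    assume "n > 0"
    then show "real_arc (- T') = real_arc T'" using True by blast
  qed (simp add: T'_def)
next
  case False
  have ra: "real_arc t = cis t" for t unfolding real_arc_def using False by simp
  show ?thesis
  proof (rule that[of 0 "2 * pi"])
    fix s t assume st: "s \<in> {0..2 * pi}" "t \<in> {0..2 * pi}" "real_arc s = real_arc t"
    then have "cis s = cis t" unfolding ra by simp
    then have "cis (s - t) = 1" by (simp add: cis_divide[symmetric])
    then obtain m :: int where "s - t = 2 * pi * m" unfolding cis_conv_exp exp_eq_1 by (auto simp: mult.commute mult.left_commute)
    moreover have "\<bar>s - t\<bar> \<le> 2 * pi" using st(1,2) by auto
    ultimately have m: "\<bar>2 * pi * m\<bar> \<le> 2 * pi * 1" "s = t + 2 * pi * m" by auto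
    then have "\<bar>real_of_int m\<bar> \<le> 1" using pi_gt_zero by (simp add: abs_mult)
    then have "m \<in> {-1, 0, 1}" by auto
    then show "s = t \<or> 0 < n \<and> {s, t} = {0, 2 * pi}" using m(2) st(1,2) False by auto
  next
    fix z assume "z \<in> R"
    then have "norm z = 1" using False by (simp add: R_circle)
    then obtain t where "0 \<le> t" "t < 2 * pi" "z = cis t"
      using Arg2pi_ge_0[of z] Arg2pi_lt_2pi[of z] Arg2pi_eq[of z]
      by (metis cis_conv_exp mult_1 of_real_1)
    then show "\<exists>t\<in>{0..<2 * pi}. real_arc t = z" unfolding ra by auto
  qed (auto simp: ra)
qed

theorem real_critical_points:
  obtains S where "finite S" "S \<subseteq> critical_points G" "\<And>p. p \<in> S \<Longrightarrow> real_point p"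
    "card S \<ge> 2 * card (singular_points G) + (if n = 0 then 0 else 1)"
proof -
  obtain a b where ab: "a < b" "\<And>s t. s \<in> {a..b} \<Longrightarrow> t \<in> {a..b} \<Longrightarrow> real_arc s = real_arc t \<Longrightarrow> s = t \<or> n > 0 \<and> {s, t} = {a, b}"
    "n > 0 \<Longrightarrow> real_arc a = real_arc b"
    "\<And>z. z \<in> R \<Longrightarrow> \<phi> z \<in> singular_points G \<Longrightarrow> \<exists>t\<in>{a..<b}. real_arc t = z"
    using ex_real_interval by metis
  let ?V = "{u \<in> {a..b}. \<exists>s\<in>{a..<u}. real_curve s = real_curve u}"
  let ?C = "{t \<in> {a..b}. \<exists>s\<in>{a..b}. s \<noteq> t \<and> real_curve s = real_curve t}"
  let ?Co = "{z \<in> R. \<exists>z'\<in>R. z' \<noteq> z \<and> \<phi> z' = \<phi> z}"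
  have inj: "inj_on real_arc {a..<b}" using ab(2) by (intro inj_onI) (fastforce simp: doubleton_eq_iff)
  have "?C \<subseteq> {a, b} \<union> {t \<in> {a..<b}. real_arc t \<in> ?Co}"
  proof
    fix t assume "t \<in> ?C"
    then obtain s where st: "t \<in> {a..b}" "s \<in> {a..b}" "s \<noteq> t" "\<phi> (real_arc s) = \<phi> (real_arc t)"
      unfolding real_curve_eq_iff by blast
    show "t \<in> {a, b} \<union> {t \<in> {a..<b}. real_arc t \<in> ?Co}"
    proof (cases "real_arc s = real_arc t")
      case True
      then show ?thesis using ab(2)[OF st(2,1)] st(3) by (auto simp: doubleton_eq_iff)
    next
      case False
      then have "real_arc t \<in> ?Co" using st(4) real_arc_in_R by blast
      then show ?thesis using st(1) by auto
    qed
  qed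
  moreover have "finite {t \<in> {a..<b}. real_arc t \<in> ?Co}"
    by (rule rev_finite_subset[OF finite_vimage_IntI[OF finite_coincidences inj]]) blast
  ultimately have fin: "finite ?C" by (meson finite.emptyI finite.insertI finite_Un finite_subset)
  have int: "interior (real_curve ` {a..b}) = {}"
  proof (rule ccontr)
    assume "interior (real_curve ` {a..b}) \<noteq> {}"
    then obtain q where "q \<in> interior (real_curve ` {a..b})" by blast
    then obtain q' where "q' \<in> interior (real_curve ` {a..b})" "eval2 G (of_real (Re q'), of_real (Im q')) \<noteq> 0"
      using open_not_in_locus[OF open_interior] by blast
    then obtain t where "q' = real_curve t" using interior_subset by blast
    then show False using \<open>eval2 G (of_real (Re q'), of_real (Im q')) \<noteq> 0\<close> G_real_curve[of t] by simp
  qed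
  obtain \<U> where \<U>: "finite \<U>" "card \<U> \<ge> card ?V"
    "\<And>U. U \<in> \<U> \<Longrightarrow> U \<in> components (- real_curve ` {a..b}) \<and> bounded U"
    using bounded_components_curve[OF less_imp_le[OF ab(1)] continuous_on_real_curve fin int] by blast
  \<comment> \<open>Of two real parameters of a node the later one is a return to an earlier point,
    and returns are what the count of bounded components uses.\<close>
  have node: "\<exists>u\<in>{a..<b}. u \<in> ?V \<and> \<phi> (real_arc u) = p" if p: "p \<in> singular_points G" for p
  proof -
    obtain z z' where z: "z \<in> R" "z' \<in> R" "z \<noteq> z'" "\<phi> z = p" "\<phi> z' = p"
      using two_real_parameters[OF p] by metis
    obtain t where t: "t \<in> {a..<b}" "real_arc t = z" using ab(4)[OF z(1)] z(4) p by blast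
    obtain t' where t': "t' \<in> {a..<b}" "real_arc t' = z'" using ab(4)[OF z(2)] z(5) p by blast
    have eq: "real_curve t = real_curve t'" unfolding real_curve_eq_iff t(2) t'(2) z by simp
    have "t \<noteq> t'" using t t' z(3) by blast
    then consider "t < t'" | "t' < t" by linarith
    then show ?thesis
    proof cases
      case 1
      then have "t' \<in> ?V" using t t' eq by auto
      then show ?thesis using t' z(5) by blast
    next
      case 2
      then have "t \<in> ?V" using t t' eq[symmetric] by auto
      then show ?thesis using t z(4) by blast
    qed
  qed
  then have "\<forall>p\<in>singular_points G. \<exists>u. u \<in> {a..<b} \<and> u \<in> ?V \<and> \<phi> (real_arc u) = p" by blast
  from bchoice[OF this] obtain u where
    u: "\<And>p. p \<in> singular_points G \<Longrightarrow> u p \<in> {a..<b} \<and> u p \<in> ?V \<and> \<phi> (real_arc (u p)) = p" by blast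
  have inju: "inj_on u (singular_points G)"
    by (rule inj_on_inverseI[where g = "\<lambda>t. \<phi> (real_arc t)"]) (use u in blast)
  have finV: "finite ?V"
  proof (rule finite_subset[OF _ fin], rule subsetI)
    fix t assume "t \<in> ?V"
    then obtain s where "s \<in> {a..<t}" "real_curve s = real_curve t" "t \<in> {a..b}" by blast
    then show "t \<in> ?C" by (auto intro!: bexI[of _ s])
  qed
  have cardV: "card (singular_points G) + (if n = 0 then 0 else 1) \<le> card ?V"
  proof (cases "n = 0")
    case True
    have "card (u ` singular_points G) \<le> card ?V" using u by (intro card_mono[OF finV]) blast
    then show ?thesis using True card_image[OF inju] by simp
  next
    case False
    \<comment> \<open>The closing point \<open>b\<close> is one more return. The returns chosen for
      the nodes lie below \<open>b\<close>, so it is a new one.\<close>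
    have "real_curve a = real_curve b" unfolding real_curve_eq_iff using ab(3) False by simp
    then have "b \<in> ?V" using ab(1) by auto
    then have "insert b (u ` singular_points G) \<subseteq> ?V" using u by blast
    then have "card (insert b (u ` singular_points G)) \<le> card ?V" by (rule card_mono[OF finV])
    moreover have "b \<notin> u ` singular_points G" using u by force
    ultimately show ?thesis using False card_image[OF inju] finite_singular by simp
  qed
  have cl: "closed (real_curve ` {a..b})"
    using compact_continuous_image[OF continuous_on_real_curve] compact_imp_closed by blast
  have "\<exists>q. q \<in> U \<and> (complex_of_real (Re q), complex_of_real (Im q)) \<in> critical_points G
      \<and> eval2 G (of_real (Re q), of_real (Im q)) \<noteq> 0" if "U \<in> \<U>" for U
  proof -
    have U: "U \<in> components (- real_curve ` {a..b})" "bounded U" using \<U>(3)[OF that] by auto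
    have "open U" using open_components[OF _ U(1)] cl by (simp add: open_Compl)
    moreover have "U \<noteq> {}" using U(1) by (rule in_components_nonempty)
    moreover have "eval2 G (of_real (Re q), of_real (Im q)) = 0" if "q \<in> frontier U" for q
    proof -
      have "q \<in> real_curve ` {a..b}" using frontier_of_components_closed_complement[OF cl U(1)] that by blast
      then show ?thesis using G_real_curve by blast
    qed
    ultimately show ?thesis using critical_point_in_region U(2) by metis
  qed
  then obtain q where q: "\<And>U. U \<in> \<U> \<Longrightarrow> q U \<in> U \<and> (complex_of_real (Re (q U)), complex_of_real (Im (q U))) \<in> critical_points G
      \<and> eval2 G (of_real (Re (q U)), of_real (Im (q U))) \<noteq> 0" by metis
  define e where "e U = (complex_of_real (Re (q U)), complex_of_real (Im (q U)))" for U
  \<comment> \<open>Different components are disjoint, so their extrema are different points; these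
    are not nodes either, since \<open>G\<close> does not vanish at them.\<close>
  have inje: "inj_on e \<U>"
  proof (rule inj_onI)
    fix U U' assume U: "U \<in> \<U>" "U' \<in> \<U>" "e U = e U'"
    then have "q U = q U'" unfolding e_def by (simp add: complex_eq_iff)
    then have "U \<inter> U' \<noteq> {}" using q U by (metis disjoint_iff)
    then show "U = U'" using \<U>(3) U components_nonoverlap by blast
  qed
  have disj: "e ` \<U> \<inter> singular_points G = {}"
    using q unfolding e_def singular_points_def zero_locus_def by auto
  show thesis
  proof (rule that[of "e ` \<U> \<union> singular_points G"])
    show "finite (e ` \<U> \<union> singular_points G)" using \<U>(1) finite_singular by simp
    show "e ` \<U> \<union> singular_points G \<subseteq> critical_points G"
      using q unfolding e_def singular_points_def by blast
    have "real_point p" if "p \<in> singular_points G" for p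
      using nodes[OF that] unfolding real_tangent_pair_def by blast
    moreover have "real_point (e U)" for U unfolding e_def real_point_def by simp
    ultimately show "real_point p" if "p \<in> e ` \<U> \<union> singular_points G" for p using that by blast
    have "card (e ` \<U> \<union> singular_points G) = card \<U> + card (singular_points G)"
      using card_Un_disjoint[OF _ finite_singular disj] \<U>(1) card_image[OF inje] by simp
    then show "2 * card (singular_points G) + (if n = 0 then 0 else 1) \<le> card (e ` \<U> \<union> singular_points G)"
      using cardV \<U>(2) by linarith
  qed
qed

end

section \<open>Shears\<close>

text \<open>The linear map of points whose pullback is \<open>shear\<close>; it carries the sheared
  curve back to the original one.\<close>

definition unshear :: "complex \<Rightarrow> complex \<times> complex \<Rightarrow> complex \<times> complex" where
  "unshear l p = (fst p + l * snd p, snd p)"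

lemma inj_unshear: "inj (unshear l)"
  by (rule injI) (auto simp: unshear_def prod_eq_iff)

lemma unshear_unshear [simp]: "unshear l (unshear (- l) p) = p" "unshear (- l) (unshear l p) = p"
  by (simp_all add: unshear_def)

lemma eval2_shear_unshear: "eval2 (shear l H) p = eval2 H (unshear l p)"
  unfolding unshear_def by (rule eval2_shear')

lemma partial_shear_unshear:
  "eval2 (partial_x (shear l H)) p = eval2 (partial_x H) (unshear l p)"
  "eval2 (partial_y (shear l H)) p = l * eval2 (partial_x H) (unshear l p) + eval2 (partial_y H) (unshear l p)"
  unfolding partial_shear by (simp_all add: eval2_shear_unshear)

lemma critical_points_shear: "p \<in> critical_points (shear l H) \<longleftrightarrow> unshear l p \<in> critical_points H"
  unfolding critical_points_def by (auto simp: partial_shear_unshear)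

lemma singular_points_shear: "p \<in> singular_points (shear l H) \<longleftrightarrow> unshear l p \<in> singular_points H"
  unfolding singular_points_def zero_locus_def using critical_points_shear by (auto simp: eval2_shear_unshear)

lemma card_singular_points_shear: "card (singular_points (shear l H)) = card (singular_points H)"
proof -
  have "singular_points H = unshear l ` singular_points (shear l H)"
  proof (intro equalityI subsetI)
    fix p assume "p \<in> singular_points H"
    then have "unshear (- l) p \<in> singular_points (shear l H)" by (simp add: singular_points_shear)
    then show "p \<in> unshear l ` singular_points (shear l H)" by (metis imageI unshear_unshear(1))
  qed (auto simp: singular_points_shear)
  then show ?thesis using card_image[OF inj_on_subset[OF inj_unshear subset_UNIV]] by metis
qed

lemma second_partials_shear:
  fixes l p and H :: "complex poly poly"
  defines "q \<equiv> unshear l p"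
  shows "eval2 (partial_x (partial_x (shear l H))) p = eval2 (partial_x (partial_x H)) q"
    "eval2 (partial_y (partial_x (shear l H))) p = l * eval2 (partial_x (partial_x H)) q + eval2 (partial_y (partial_x H)) q"
    "eval2 (partial_y (partial_y (shear l H))) p = l ^ 2 * eval2 (partial_x (partial_x H)) q
      + 2 * l * eval2 (partial_y (partial_x H)) q + eval2 (partial_y (partial_y H)) q"
proof -
  show "eval2 (partial_x (partial_x (shear l H))) p = eval2 (partial_x (partial_x H)) q"
    "eval2 (partial_y (partial_x (shear l H))) p = l * eval2 (partial_x (partial_x H)) q + eval2 (partial_y (partial_x H)) q"
    unfolding partial_shear(1)[of l H] partial_shear_unshear q_def by simp_all
  have add: "eval2 (partial_y (U + V)) p = eval2 (partial_y U) p + eval2 (partial_y V) p" for U V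
    by (simp add: partial_add)
  have const: "eval2 (partial_y ([:[:l:]:] * U)) p = l * eval2 (partial_y U) p" for U
    unfolding eval2_partial_mult by (simp add: partial_y_pCons)
  have "eval2 (partial_x (partial_y H)) q = eval2 (partial_y (partial_x H)) q" by (simp add: partial_xy_commute)
  then show "eval2 (partial_y (partial_y (shear l H))) p = l ^ 2 * eval2 (partial_x (partial_x H)) q
      + 2 * l * eval2 (partial_y (partial_x H)) q + eval2 (partial_y (partial_y H)) q"
    unfolding partial_shear(2)[of l H] add const partial_shear_unshear q_def[symmetric]
    by (simp add: algebra_simps power2_eq_square)
qed

lemma real_tangent_pair_shear:
  assumes "real_tangent_pair H (unshear (of_real l) p)"
  shows "real_tangent_pair (shear (of_real l) H) p"
proof -
  let ?q = "unshear (of_real l) p"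
  define a b c where "a = eval2 (partial_x (partial_x H)) ?q" and "b = eval2 (partial_y (partial_x H)) ?q"
    and "c = eval2 (partial_y (partial_y H)) ?q"
  let ?L = "complex_of_real l"
  obtain v1 v2 w1 w2 :: real where vw: "real_point ?q" "a \<noteq> 0 \<or> b \<noteq> 0 \<or> c \<noteq> 0" "v1 * w2 \<noteq> v2 * w1"
    "a * of_real v1 ^ 2 + 2 * b * of_real v1 * of_real v2 + c * of_real v2 ^ 2 = 0"
    "a * of_real w1 ^ 2 + 2 * b * of_real w1 * of_real w2 + c * of_real w2 ^ 2 = 0"
    using assms unfolding real_tangent_pair_def Let_def a_def b_def c_def by blast
  have rp: "real_point p"
  proof -
    have "fst p = fst ?q - ?L * snd ?q" "snd p = snd ?q" by (simp_all add: unshear_def)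
    then show ?thesis using vw(1) unfolding real_point_def by simp
  qed
  have quad: "a * of_real (v - l * w) ^ 2 + 2 * (?L * a + b) * of_real (v - l * w) * of_real w
      + (?L ^ 2 * a + 2 * ?L * b + c) * of_real w ^ 2 = a * of_real v ^ 2 + 2 * b * of_real v * of_real w + c * of_real w ^ 2" for v w
    by (simp add: algebra_simps power2_eq_square)
  have nz: "a \<noteq> 0 \<or> ?L * a + b \<noteq> 0 \<or> ?L ^ 2 * a + 2 * ?L * b + c \<noteq> 0" using vw(2) by auto
  have "(v1 - l * v2) * w2 \<noteq> v2 * (w1 - l * w2)" using vw(3) by (simp add: algebra_simps)
  then show ?thesis
    unfolding real_tangent_pair_def Let_def second_partials_shear a_def[symmetric] b_def[symmetric] c_def[symmetric]
    using rp nz quad[of v1 v2] quad[of w1 w2] vw(4,5)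
    by (intro conjI exI[of _ "v1 - l * v2"] exI[of _ v2] exI[of _ "w1 - l * w2"] exI[of _ w2]) simp_all
qed

lemma conj2_shear: "conj2 (shear (of_real l) H) = shear (of_real l) (conj2 H)"
  by (rule eval2_eqI) (simp add: eval2_conj2')

text \<open>Properness is lost only if a fixed coefficient above \<open>z ^ n\<close>, or for
  \<open>n > 0\<close> the constant term, vanishes. Each is a linear function of \<open>l\<close>
  that is not identically zero, because at each end of the parameter domain some coordinate has a
  pole.\<close>

lemma finite_bad_shears_proper:
  fixes A B :: "complex poly"
  assumes "n < degree A \<or> n < degree B" "n > 0 \<Longrightarrow> poly A 0 \<noteq> 0 \<or> poly B 0 \<noteq> 0"
  shows "finite {l :: real. \<not> (n < degree (A - Polynomial.smult (of_real l) B)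
    \<and> (n > 0 \<longrightarrow> poly (A - Polynomial.smult (of_real l) B) 0 \<noteq> 0))}"
proof -
  have unique: "finite {l :: real. u - of_real l * v = 0}" if "u \<noteq> 0 \<or> v \<noteq> 0" for u v :: complex
  proof (cases "v = 0")
    case False
    have "{l. u - of_real l * v = 0} \<subseteq> {Re (u / v)}"
    proof
      fix l :: real assume "l \<in> {l. u - of_real l * v = 0}"
      then have "u / v = of_real l" using False by (simp add: field_simps)
      then show "l \<in> {Re (u / v)}" by simp
    qed
    then show ?thesis using finite_subset by blast
  qed (use that in simp)
  obtain m where m: "m > n" "coeff A m \<noteq> 0 \<or> coeff B m \<noteq> 0"
    using assms(1) by (metis leading_coeff_0_iff less_nat_zero_code degree_0)
  have deg: "n < degree (A - Polynomial.smult (of_real l) B)" if "coeff A m - of_real l * coeff B m \<noteq> 0" for l :: real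
    using le_degree[of "A - Polynomial.smult (of_real l) B" m] m(1) that by simp
  have "{l :: real. \<not> (n < degree (A - Polynomial.smult (of_real l) B)
    \<and> (n > 0 \<longrightarrow> poly (A - Polynomial.smult (of_real l) B) 0 \<noteq> 0))}
    \<subseteq> {l. coeff A m - of_real l * coeff B m = 0} \<union> (if n = 0 then {} else {l. poly A 0 - of_real l * poly B 0 = 0})"
  proof
    fix l :: real
    assume "l \<in> {l :: real. \<not> (n < degree (A - Polynomial.smult (of_real l) B)
      \<and> (n > 0 \<longrightarrow> poly (A - Polynomial.smult (of_real l) B) 0 \<noteq> 0))}"
    then consider "\<not> n < degree (A - Polynomial.smult (of_real l) B)" | "n > 0" "poly A 0 - of_real l * poly B 0 = 0" by auto
    then show "l \<in> {l. coeff A m - of_real l * coeff B m = 0} \<union> (if n = 0 then {} else {l. poly A 0 - of_real l * poly B 0 = 0})"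
    proof cases
      case 1
      then show ?thesis using deg[of l] by blast
    next
      case 2
      then show ?thesis by simp
    qed
  qed
  moreover have "finite (if n = 0 then {} else {l :: real. poly A 0 - of_real l * poly B 0 = 0})"
    using unique assms(2) by auto
  ultimately show ?thesis using unique[OF m(2)] finite_subset by blast
qed

section \<open>Choice of the projection and the final count\<close>

context param_curve
begin

text \<open>Substituting \<open>x + l * y\<close> in the equation moves the points in the opposite
  direction, whence \<open>A - l * B\<close>.\<close>

lemma param_curve_shear:
  "param_curve (shear (of_real l) G) (A - Polynomial.smult (of_real l) B) B n"
proof -
  let ?L = "complex_of_real l"
  let ?X = "\<lambda>z. poly (A - Polynomial.smult ?L B) z / z ^ n"
  have X': "?X z = X z - ?L * Y z" for z unfolding X_def Y_def by (simp add: diff_divide_distrib)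
  have \<phi>': "(?X z, poly B z / z ^ n) = unshear (- ?L) (\<phi> z)" for z
    unfolding X' unfolding \<phi>_def unshear_def by (simp add: Y_def)
  have \<Omega>s: "{z. n = 0 \<or> z \<noteq> 0} = \<Omega>" unfolding \<Omega>_def ..
  have \<sigma>s: "(if n = 0 then cnj z else inverse (cnj z)) = \<sigma> z" for z unfolding \<sigma>_def ..
  show ?thesis
  proof (unfold_locales, unfold \<phi>' \<Omega>s \<sigma>s)
    show "conj2 (shear ?L G) = shear ?L G" by (simp add: conj2_shear real_G)
    show "squarefree (shear ?L G)" using squarefree_G by (rule squarefree_shear)
    show "zero_locus (shear ?L G) = (\<lambda>z. unshear (- ?L) (\<phi> z)) ` \<Omega>"
    proof (intro equalityI subsetI)
      fix p assume "p \<in> zero_locus (shear ?L G)"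
      then have "unshear ?L p \<in> zero_locus G" unfolding zero_locus_def by (simp add: eval2_shear_unshear)
      then obtain z where "z \<in> \<Omega>" "unshear ?L p = \<phi> z" using zero_locus_G by blast
      then have "p = unshear (- ?L) (\<phi> z)" by (metis unshear_unshear(2))
      with \<open>z \<in> \<Omega>\<close> show "p \<in> (\<lambda>z. unshear (- ?L) (\<phi> z)) ` \<Omega>" by (rule image_eqI[rotated])
    next
      fix p assume "p \<in> (\<lambda>z. unshear (- ?L) (\<phi> z)) ` \<Omega>"
      then obtain z where "z \<in> \<Omega>" "p = unshear (- ?L) (\<phi> z)" by blast
      then show "p \<in> zero_locus (shear ?L G)"
        unfolding zero_locus_def using zero_locus_G by (auto simp: eval2_shear_unshear zero_locus_def)
    qed
    show "unshear (- ?L) (\<phi> (\<sigma> z)) = (cnj (?X z), cnj (poly B z / z ^ n))" if "z \<in> \<Omega>" for z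
      unfolding X' \<phi>_\<sigma>[OF that] unshear_def by (simp add: Y_def)
    obtain F0 where F0: "finite F0" "inj_on \<phi> ({z \<in> \<Omega>. \<sigma> z = z} - F0)" using inj_real by blast
    then have "inj_on (\<lambda>z. unshear (- ?L) (\<phi> z)) ({z \<in> \<Omega>. \<sigma> z = z} - F0)"
      by (intro comp_inj_on[of \<phi> _ "unshear (- ?L)", unfolded o_def] inj_on_subset[OF inj_unshear subset_UNIV])
    then show "\<exists>F0. finite F0 \<and> inj_on (\<lambda>z. unshear (- ?L) (\<phi> z)) ({z \<in> \<Omega>. \<sigma> z = z} - F0)" using F0(1) by blast
    show "real_tangent_pair (shear ?L G) p" if "p \<in> singular_points (shear ?L G)" for p
      using nodes that real_tangent_pair_shear by (simp add: singular_points_shear)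
  qed
qed

lemma ex_good_shear:
  assumes "n < degree A \<or> n < degree B" "n > 0 \<Longrightarrow> poly A 0 \<noteq> 0 \<or> poly B 0 \<noteq> 0"
    and "finite T"
  obtains l where "nonvertical_param_curve (shear (of_real l) G) (A - Polynomial.smult (of_real l) B) B n"
    "inj_on (\<lambda>p. fst (unshear (- of_real l) p)) T"
proof -
  have proper: "finite {l :: real. \<not> proper_param_curve (shear (of_real l) G) (A - Polynomial.smult (of_real l) B) B n}"
    by (rule finite_subset[OF _ finite_bad_shears_proper[OF assms(1,2)]])
      (auto simp: proper_param_curve_def proper_param_curve_axioms_def param_curve_shear)
  then have "\<not> (UNIV :: real set) \<subseteq> {l. \<not> proper_param_curve (shear (of_real l) G) (A - Polynomial.smult (of_real l) B) B n}"
    using infinite_UNIV_char_0 finite_subset by blast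
  then obtain l0 :: real where l0: "proper_param_curve (shear (of_real l0) G) (A - Polynomial.smult (of_real l0) B) B n" by blast
  \<comment> \<open>Finiteness of the singular points was obtained for proper curves; one proper
    shear transfers it to \<open>G\<close> itself.\<close>
  have fin_sing: "finite (singular_points G)"
  proof -
    have "singular_points G \<subseteq> unshear (of_real l0) ` singular_points (shear (of_real l0) G)"
      by (metis image_eqI singular_points_shear subsetI unshear_unshear(1))
    then show ?thesis using proper_param_curve.finite_singular[OF l0] finite_subset by blast
  qed
  \<comment> \<open>The condition is the vanishing of the second \<open>y\<close>-derivative of the
    sheared polynomial, written at the original node. It is polynomial in \<open>l\<close>, and not
    identically zero because the Hessian is not.\<close>
  define vert where "vert p = {l :: real. of_real l ^ 2 * eval2 (partial_x (partial_x G)) p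
      + 2 * of_real l * eval2 (partial_y (partial_x G)) p + eval2 (partial_y (partial_y G)) p = 0}" for p
  have fin_vert: "finite (vert p)" if "p \<in> singular_points G" for p
  proof -
    let ?Q = "[:eval2 (partial_y (partial_y G)) p, 2 * eval2 (partial_y (partial_x G)) p, eval2 (partial_x (partial_x G)) p:]"
    have "?Q \<noteq> 0" using nodes[OF that] unfolding real_tangent_pair_def Let_def by auto
    then have "finite {l. poly ?Q l = 0}" by (rule poly_roots_finite)
    then have "finite (complex_of_real -` {l. poly ?Q l = 0})" by (rule finite_vimageI) (rule inj_of_real)
    moreover have "vert p = complex_of_real -` {l. poly ?Q l = 0}"
      unfolding vert_def by (auto simp: algebra_simps power2_eq_square)
    ultimately show ?thesis by simp
  qed
  define coll where "coll = (\<Union>p\<in>T. \<Union>q\<in>T. {l :: real. p \<noteq> q \<and> fst (unshear (- of_real l) p) = fst (unshear (- of_real l) q)})"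
  have fin_coll: "finite coll"
  proof -
    have "finite {l :: real. p \<noteq> q \<and> fst (unshear (- of_real l) p) = fst (unshear (- of_real l) q)}" for p q
    proof (cases "p = q \<or> snd p = snd q")
      case False
      have "{l :: real. p \<noteq> q \<and> fst (unshear (- of_real l) p) = fst (unshear (- of_real l) q)}
          \<subseteq> {Re ((fst p - fst q) / (snd p - snd q))}"
      proof
        fix l :: real assume "l \<in> {l :: real. p \<noteq> q \<and> fst (unshear (- of_real l) p) = fst (unshear (- of_real l) q)}"
        then have "(fst p - fst q) = of_real l * (snd p - snd q)" unfolding unshear_def by (simp add: algebra_simps)
        then have "(fst p - fst q) / (snd p - snd q) = of_real l" using False by simp
        then show "l \<in> {Re ((fst p - fst q) / (snd p - snd q))}" by (metis Re_complex_of_real singletonI)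
      qed
      then show ?thesis using finite_subset by blast
    qed (auto simp: unshear_def prod_eq_iff)
    then show ?thesis unfolding coll_def using assms(3) by blast
  qed
  let ?bad = "{l :: real. \<not> proper_param_curve (shear (of_real l) G) (A - Polynomial.smult (of_real l) B) B n}
    \<union> (\<Union>p\<in>singular_points G. vert p) \<union> coll"
  have "finite ?bad" using proper fin_sing fin_vert fin_coll by blast
  then have "\<not> (UNIV :: real set) \<subseteq> ?bad" using infinite_UNIV_char_0 finite_subset by blast
  then obtain l where l: "l \<notin> ?bad" by blast
  show thesis
  proof (rule that[of l])
    have "eval2 (partial_y (partial_y (shear (of_real l) G))) p \<noteq> 0" if "p \<in> singular_points (shear (of_real l) G)" for p
      using that l unfolding second_partials_shear singular_points_shear vert_def by blast
    then show "nonvertical_param_curve (shear (of_real l) G) (A - Polynomial.smult (of_real l) B) B n"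
      unfolding nonvertical_param_curve_def nonvertical_param_curve_axioms_def using l by blast
    show "inj_on (\<lambda>p. fst (unshear (- of_real l) p)) T"
      using l unfolding coll_def by (intro inj_onI) blast
  qed
qed

theorem critical_points_real:
  assumes A: "n < degree A \<or> n < degree B" and A0: "n > 0 \<Longrightarrow> poly A 0 \<noteq> 0 \<or> poly B 0 \<noteq> 0"
    and p: "p \<in> critical_points G"
  shows "real_point p"
proof (rule ccontr)
  assume nr: "\<not> real_point p"
  obtain l where l: "nonvertical_param_curve (shear (of_real l) G) (A - Polynomial.smult (of_real l) B) B n"
    using ex_good_shear[OF A A0 finite.emptyI] by metis
  let ?N = "2 * card (singular_points G) + (if n = 0 then 0 else 1)"
  obtain S where S: "finite S" "S \<subseteq> critical_points (shear (of_real l) G)" "\<And>p. p \<in> S \<Longrightarrow> real_point p" "?N \<le> card S"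
    using nonvertical_param_curve.real_critical_points[OF l] unfolding card_singular_points_shear by metis
  let ?S = "unshear (of_real l) ` S"
  have "real_point q" if "q \<in> ?S" for q
    using that S(3) unfolding real_point_def unshear_def by auto
  then have pS: "p \<notin> ?S" using nr by blast
  have fin: "finite (insert p ?S)" using S(1) by simp
  have "card ?S = card S" by (rule card_image[OF inj_on_subset[OF inj_unshear subset_UNIV]])
  then have card: "card (insert p ?S) > ?N" using S(1,4) pS by simp
  \<comment> \<open>The upper bound counts abscissas, but the shear that produced the real critical
    points may leave several of them, or one of them and \<open>p\<close>, on a common vertical
    line; hence the second shear.\<close>
  obtain m where m: "nonvertical_param_curve (shear (of_real m) G) (A - Polynomial.smult (of_real m) B) B n"
    "inj_on (\<lambda>p. fst (unshear (- of_real m) p)) (insert p ?S)"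
    using ex_good_shear[OF A A0 fin] by metis
  let ?T = "unshear (- of_real m) ` insert p ?S"
  have inj: "inj_on (unshear (- of_real m)) (insert p ?S)" by (rule inj_on_subset[OF inj_unshear subset_UNIV])
  have "insert p ?S \<subseteq> critical_points G" using p S(2) by (auto simp: critical_points_shear)
  then have "?T \<subseteq> critical_points (shear (of_real m) G)"
    unfolding image_subset_iff critical_points_shear unshear_unshear by blast
  moreover have "inj_on fst ?T"
    using m(2) comp_inj_on_iff[OF inj, of fst] by (simp add: o_def)
  ultimately have "card ?T \<le> ?N"
    using nonvertical_param_curve.card_critical_le[OF m(1), of ?T] fin unfolding card_singular_points_shear by blast
  then show False using card card_image[OF inj] by simp
qed

end

section \<open>Polynomial curves\<close>

text \<open>Local boundedness at every point allows Riemann's theorem to remove the exceptional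
  points one at a time.\<close>

lemma entire_extension:
  fixes f :: "complex \<Rightarrow> complex"
  assumes "finite F" "f holomorphic_on - F" "\<And>\<xi>. \<exists>b. \<forall>\<^sub>F z in at \<xi>. norm (f z) \<le> b"
  shows "\<exists>g. g holomorphic_on UNIV \<and> (\<forall>z. z \<notin> F \<longrightarrow> g z = f z)"
  using assms
proof (induction F arbitrary: f rule: finite_induct)
  case (insert \<xi> F)
  have op: "open (- F)" using finite_imp_closed[OF insert(1)] by (simp add: open_Compl)
  have "f holomorphic_on (- F - {\<xi>})" using insert(4) by (rule back_subst[of "\<lambda>S. f holomorphic_on S"]) blast
  moreover have "\<xi> \<in> interior (- F)" using op insert(2) by (simp add: interior_open)
  ultimately obtain g where g: "g holomorphic_on - F" "\<And>z. z \<in> - F - {\<xi>} \<Longrightarrow> g z = f z"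
    using holomorphic_on_extend_bounded[of f "- F" \<xi>] insert(5) by blast
  have "\<exists>b. \<forall>\<^sub>F z in at w. norm (g z) \<le> b" for w
  proof -
    obtain b where b: "\<forall>\<^sub>F z in at w. norm (f z) \<le> b" using insert(5) by blast
    have "\<forall>\<^sub>F z in at w. z \<notin> insert \<xi> F - {w}"
    proof -
      have "open (- (insert \<xi> F - {w}))" using insert(1) by (intro open_Compl finite_imp_closed) simp
      then have "\<forall>\<^sub>F z in at w. z \<in> - (insert \<xi> F - {w})" by (rule eventually_at_in_open') simp
      then show ?thesis by (rule eventually_mono) auto
    qed
    moreover have "\<forall>\<^sub>F z in at w. z \<noteq> w" by (simp add: eventually_at_filter)
    ultimately have "\<forall>\<^sub>F z in at w. norm (g z) \<le> b"
      using b by eventually_elim (use g(2) in auto)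
    then show ?thesis by blast
  qed
  then obtain h where "h holomorphic_on UNIV" "\<forall>z. z \<notin> F \<longrightarrow> h z = g z" using insert(3)[OF g(1)] by blast
  then show ?case using g(2) by auto
qed auto

text \<open>The factorization \<open>P w - P (u s) = (w - u s) * R w\<close> turns the difference
  quotient of \<open>u\<close> into that of \<open>Q\<close> divided by \<open>R (u t)\<close>. By
  continuity the divisor tends to \<open>R (u s)\<close>, the derivative of \<open>P\<close> at
  \<open>u s\<close>.\<close>

lemma implicit_derivative:
  fixes P Q :: "complex poly" and u :: "complex \<Rightarrow> complex"
  assumes "open S" "s \<in> S" "\<And>t. t \<in> S \<Longrightarrow> poly P (u t) = poly Q t" "isCont u s" "poly (pderiv P) (u s) \<noteq> 0"
  shows "u field_differentiable at s"
proof -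
  obtain R where R: "P - [:poly P (u s):] = [:- u s, 1:] * R"
    using poly_eq_0_iff_dvd[of "P - [:poly P (u s):]" "u s"] by (auto elim: dvdE)
  have "pderiv P = pderiv (P - [:poly P (u s):])" by (simp add: pderiv_diff)
  also have "poly \<dots> (u s) = poly R (u s)" unfolding R pderiv_mult by (simp add: pderiv_pCons)
  finally have R0: "poly R (u s) \<noteq> 0" using assms(5) by simp
  have val: "poly P w - poly P (u s) = (w - u s) * poly R w" for w
    using arg_cong[OF R, of "\<lambda>p. poly p w"] by (simp add: algebra_simps)
  have lim: "((\<lambda>t. poly R (u t)) \<longlongrightarrow> poly R (u s)) (at s)"
    using assms(4) by (intro tendsto_poly) (simp add: isCont_def)
  have "((\<lambda>t. (poly Q t - poly Q s) / (t - s)) \<longlongrightarrow> poly (pderiv Q) s) (at s)"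
    using poly_DERIV[of Q s] by (simp add: has_field_derivative_iff)
  from tendsto_divide[OF this lim R0]
  have "((\<lambda>t. (poly Q t - poly Q s) / (t - s) / poly R (u t)) \<longlongrightarrow> poly (pderiv Q) s / poly R (u s)) (at s)" .
  moreover have "\<forall>\<^sub>F t in at s. (poly Q t - poly Q s) / (t - s) / poly R (u t) = (u t - u s) / (t - s)"
  proof -
    have "\<forall>\<^sub>F t in at s. poly R (u t) \<noteq> 0" using tendsto_imp_eventually_ne[OF lim R0] .
    moreover have "\<forall>\<^sub>F t in at s. t \<in> S" using assms(1,2) by (rule eventually_at_in_open')
    ultimately show ?thesis
    proof eventually_elim
      case (elim t)
      have "poly Q t - poly Q s = (u t - u s) * poly R (u t)"
        using val[of "u t"] assms(2,3) elim(2) by simp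
      then show ?case using elim(1) by simp
    qed
  qed
  ultimately have "((\<lambda>t. (u t - u s) / (t - s)) \<longlongrightarrow> poly (pderiv Q) s / poly R (u s)) (at s)"
    by (rule Lim_transform_eventually)
  then show ?thesis unfolding field_differentiable_def has_field_derivative_iff by blast
qed

lemma poly_growth_at_infinity:
  fixes P :: "complex poly"
  assumes "P \<noteq> 0"
  obtains b where "\<And>z. norm z \<ge> b \<Longrightarrow> norm (lead_coeff P) / 2 * norm z ^ degree P \<le> norm (poly P z)"
    "\<And>z. norm z \<ge> b \<Longrightarrow> norm (poly P z) \<le> 2 * norm (lead_coeff P) * norm z ^ degree P" "b > 0"
proof -
  let ?c = "norm (lead_coeff P)"
  have c: "?c > 0" using assms by simp
  have "((\<lambda>z. norm (poly P z / z ^ degree P)) \<longlongrightarrow> ?c) at_infinity"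
    by (intro tendsto_norm poly_divide_tendsto_aux)
  then have "\<forall>\<^sub>F z in at_infinity. norm (poly P z / z ^ degree P) > ?c / 2 \<and> norm (poly P z / z ^ degree P) < 2 * ?c"
    using c by (intro eventually_conj order_tendstoD) auto
  then obtain b where b: "\<And>z. norm z \<ge> b \<Longrightarrow> norm (poly P z / z ^ degree P) > ?c / 2 \<and> norm (poly P z / z ^ degree P) < 2 * ?c"
    unfolding eventually_at_infinity by blast
  have "?c / 2 * norm z ^ degree P \<le> norm (poly P z) \<and> norm (poly P z) \<le> 2 * ?c * norm z ^ degree P" if "norm z \<ge> max b 1" for z
  proof -
    have "norm z ^ degree P > 0" using that by (intro zero_less_power) linarith
    then show ?thesis using b[of z] that by (simp add: norm_divide norm_power pos_less_divide_eq pos_divide_less_eq less_imp_le)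
  qed
  then show thesis using that[of "max b 1"] by simp
qed

lemma bounded_poly_preimage:
  fixes P :: "complex poly"
  assumes "degree P > 0"
  obtains m where "\<And>z. norm (poly P z) \<le> r \<Longrightarrow> norm z \<le> m"
proof -
  have "filterlim (poly P) at_infinity at_infinity"
    using assms by (intro filterlim_poly_at_infinity) simp
  then have "filterlim (\<lambda>z. norm (poly P z)) at_top at_infinity"
    by (rule filterlim_at_infinity_imp_norm_at_top)
  then have "\<forall>\<^sub>F z in at_infinity. norm (poly P z) > r" unfolding filterlim_at_top_dense by blast
  then obtain b where "\<And>z. norm z \<ge> b \<Longrightarrow> norm (poly P z) > r" unfolding eventually_at_infinity by blast
  then show thesis by (intro that[of b]) (meson linorder_le_cases linorder_not_less)
qed

lemma finite_poly_preimage: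
  fixes P :: "complex poly"
  assumes "degree P > 0" "finite S"
  shows "finite {z. poly P z \<in> S}"
proof -
  have "finite {z. poly P z = c}" for c
  proof -
    have "P - [:c:] \<noteq> 0" using assms(1) by auto
    from poly_roots_finite[OF this] show ?thesis by simp
  qed
  moreover have "{z. poly P z \<in> S} = (\<Union>c\<in>S. {z. poly P z = c})" by auto
  ultimately show ?thesis using assms(2) by simp
qed

text \<open>Two polynomial parametrizations of a curve differ by a change of parameter that is
  continuous by properness, hence entire of linear growth, hence affine.\<close>

lemma affine_reparametrization:
  fixes X Y X' Y' :: "complex poly"
  assumes F: "finite F" "inj_on (\<lambda>t. (poly X t, poly Y t)) (- F)"
    and sub: "\<And>s. \<exists>t. poly X t = poly X' s \<and> poly Y t = poly Y' s"
    and deg: "degree X > 0" "degree X' = degree X"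
  obtains \<beta> \<mu> where "\<And>s. poly X (\<beta> + \<mu> * s) = poly X' s \<and> poly Y (\<beta> + \<mu> * s) = poly Y' s"
proof -
  define u where "u s = (SOME t. poly X t = poly X' s \<and> poly Y t = poly Y' s)" for s
  have u: "poly X (u s) = poly X' s" "poly Y (u s) = poly Y' s" for s
    using someI_ex[OF sub[of s]] unfolding u_def by auto
  \<comment> \<open>Off this finite set \<open>u s\<close> avoids \<open>F\<close>, so that it is
    the only parameter of its point, and \<open>X\<close> is unramified at it.\<close>
  define N where "N = {s. poly X' s \<in> poly X ` F} \<union> {s. poly X' s \<in> poly X ` {w. poly (pderiv X) w = 0}}"
  have "pderiv X \<noteq> 0" using deg(1) by (simp add: pderiv_eq_0_iff)
  then have finN: "finite N" unfolding N_def using deg F(1)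
    by (intro finite_UnI finite_poly_preimage finite_imageI poly_roots_finite) auto
  have opN: "open (- N)" using finite_imp_closed[OF finN] by (simp add: open_Compl)
  have unique: "w = u s" if "s \<notin> N" "poly X w = poly X' s" "poly Y w = poly Y' s" for s w
  proof -
    have "w \<notin> F" "u s \<notin> F" using that(1,2) u(1)[of s] unfolding N_def by force+
    then show ?thesis using F(2) that u[of s] by (auto dest!: inj_onD[of _ _ w "u s"])
  qed
  have bnd: "\<exists>m. \<forall>s\<in>ball 0 r. norm (u s) \<le> m" for r
  proof -
    have "compact (poly X' ` cball 0 r)" by (intro compact_continuous_image continuous_intros) auto
    then obtain k where k: "\<And>s. s \<in> cball 0 r \<Longrightarrow> norm (poly X' s) \<le> k"
      using compact_imp_bounded bounded_iff by (metis imageI)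
    obtain m where "\<And>z. norm (poly X z) \<le> k \<Longrightarrow> norm z \<le> m" using bounded_poly_preimage[OF deg(1)] by blast
    then have "norm (u s) \<le> m" if "s \<in> ball 0 r" for s using k[of s] u(1)[of s] that by auto
    then show ?thesis by blast
  qed
  have cont: "isCont u s" if s: "s \<notin> N" for s
  proof -
    define r where "r = norm s + 1"
    obtain m where m: "\<And>s. s \<in> ball 0 r \<Longrightarrow> norm (u s) \<le> m" using bnd by blast
    let ?S = "ball 0 r - N"
    have "continuous_on ?S u"
    proof -
      have T: "compact (cball (0::complex) m)" by simp
      have fim: "u \<in> ?S \<rightarrow> cball 0 m" using m by auto
      \<comment> \<open>A function into a compact set is continuous if its graph is closed, and
        uniqueness identifies the graph with the solution set of the two equations.\<close>
      have eq: "(\<lambda>x. (x, u x)) ` ?S = (?S \<times> cball 0 m) \<inter>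
          ((\<lambda>q. poly X (snd q) - poly X' (fst q)) -` {0} \<inter> (\<lambda>q. poly Y (snd q) - poly Y' (fst q)) -` {0})"
        using m u unique by (auto simp: image_iff)
      show ?thesis
        unfolding continuous_closed_graph_eq[OF T fim] eq
        by (intro closedin_closed_Int closed_Int closed_vimage continuous_intros)
    qed
    moreover have "open ?S" using finN finite_imp_closed by (intro open_Diff) auto
    moreover have "s \<in> ?S" using s unfolding r_def by simp
    ultimately show ?thesis by (simp add: continuous_on_eq_continuous_at)
  qed
  have "u holomorphic_on - N"
  proof -
    have "u field_differentiable at s" if s: "s \<in> - N" for s
    proof (rule implicit_derivative[of UNIV _ X _ X'])
      show "isCont u s" using cont s by simp
      show "poly (pderiv X) (u s) \<noteq> 0" using s u(1)[of s] unfolding N_def by force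
    qed (use u in auto)
    then show ?thesis unfolding holomorphic_on_def by (simp add: field_differentiable_at_within)
  qed
  moreover have "\<exists>b. \<forall>\<^sub>F z in at \<xi>. norm (u z) \<le> b" for \<xi>
  proof -
    obtain m where m: "\<And>s. s \<in> ball 0 (norm \<xi> + 1) \<Longrightarrow> norm (u s) \<le> m" using bnd by blast
    have "\<forall>\<^sub>F z in at \<xi>. z \<in> ball 0 (norm \<xi> + 1)" by (intro eventually_at_in_open') auto
    then have "\<forall>\<^sub>F z in at \<xi>. norm (u z) \<le> m" by eventually_elim (rule m)
    then show ?thesis by blast
  qed
  ultimately obtain v where v: "v holomorphic_on UNIV" "\<And>z. z \<notin> N \<Longrightarrow> v z = u z"
    using entire_extension[OF finN] by blast
  have vXY: "poly X (v s) = poly X' s \<and> poly Y (v s) = poly Y' s" for s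
  proof -
    have cv: "continuous_on UNIV v" using v(1) by (rule holomorphic_on_imp_continuous_on)
    have dense: "closure (- N) = UNIV"
    proof -
      have "interior N = {}" using finN by (rule empty_interior_finite)
      then show ?thesis by (simp add: closure_complement)
    qed
    have "poly P (v s) - poly P' s = 0" if "\<And>z. z \<notin> N \<Longrightarrow> poly P (v z) = poly P' z" for P P' :: "complex poly"
    proof (rule continuous_constant_on_closure[of "- N" "\<lambda>s. poly P (v s) - poly P' s"])
      show "continuous_on (closure (- N)) (\<lambda>s. poly P (v s) - poly P' s)"
        unfolding dense by (intro continuous_intros cv)
    qed (use that dense in auto)
    from this[of X X'] this[of Y Y'] show ?thesis using u v(2) by simp
  qed
  have X0: "X \<noteq> 0" "X' \<noteq> 0" using deg by auto
  obtain b where b: "\<And>z. norm z \<ge> b \<Longrightarrow> norm (lead_coeff X) / 2 * norm z ^ degree X \<le> norm (poly X z)" "b > 0"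
    using poly_growth_at_infinity[OF X0(1)] by metis
  obtain b' where b': "\<And>z. norm z \<ge> b' \<Longrightarrow> norm (poly X' z) \<le> 2 * norm (lead_coeff X') * norm z ^ degree X'" "b' > 0"
    using poly_growth_at_infinity[OF X0(2)] by metis
  define c where "c = norm (lead_coeff X) / 2"
  define c' where "c' = 2 * norm (lead_coeff X')"
  have cc: "c > 0" "c' > 0" unfolding c_def c'_def using X0 by auto
  \<comment> \<open>Since \<open>X\<close> and \<open>X'\<close> have the same degree,
    \<open>X (v s) = X' s\<close> forces linear growth of \<open>v\<close>, and Liouville makes it
    affine. The maximum with 1 covers the places where \<open>v s\<close> is too small for the
    growth estimate of \<open>X\<close>.\<close>
  define K where "K = max 1 (c' / c)"
  have growth: "norm (v s) \<le> K * norm s ^ 1" if s: "max b b' \<le> norm s" for s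
  proof (cases "norm (v s) \<ge> b")
    case True
    have "c * norm (v s) ^ degree X \<le> norm (poly X' s)" using b(1)[OF True] vXY[of s] unfolding c_def by simp
    also have "\<dots> \<le> c' * norm s ^ degree X" using b'(1)[of s] s deg(2) unfolding c'_def by simp
    finally have "norm (v s) ^ degree X \<le> (c' / c) * norm s ^ degree X" using cc by (simp add: field_simps)
    also have "\<dots> \<le> K ^ degree X * norm s ^ degree X"
    proof (rule mult_right_mono)
      have "c' / c \<le> K" "K \<ge> 1" unfolding K_def by auto
      then show "c' / c \<le> K ^ degree X" using self_le_power[OF \<open>K \<ge> 1\<close> deg(1)] by linarith
    qed simp
    also have "\<dots> = (K * norm s) ^ degree X" by (simp add: power_mult_distrib)
    finally show ?thesis using deg(1) by (simp add: power_mono_iff K_def)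
  next
    case False
    then have "norm (v s) \<le> 1 * norm s" using s by simp
    also have "\<dots> \<le> K * norm s" by (rule mult_right_mono) (simp_all add: K_def)
    finally show ?thesis by simp
  qed
  have "v s = v 0 + deriv v 0 * s" for s
  proof -
    have "v s = (\<Sum>k\<le>1. (deriv ^^ k) v 0 / fact k * s ^ k)"
      by (rule Liouville_polynomial[OF v(1)]) (rule growth)
    then show ?thesis by simp
  qed
  then show thesis using that[of "v 0" "deriv v 0"] vXY by metis
qed

text \<open>The curve is real, but its parametrization need not be. The conjugate parametrization
  differs from it by an affine change of parameter, which yields an antiholomorphic affine
  involution \<open>\<tau>\<close> compatible with conjugation on the curve. In a suitable affine
  parameter \<open>\<tau>\<close> is complex conjugation, as the locale demands.\<close>

theorem polynomial_curve_critical_points_real: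
  fixes G :: "complex poly poly"
  assumes real: "conj2 G = G" and sqf: "squarefree G" and curve: "polynomial_curve (zero_locus G)"
    and nodes: "\<And>p. p \<in> singular_points G \<Longrightarrow> real_tangent_pair G p"
    and p: "p \<in> critical_points G"
  shows "real_point p"
proof -
  obtain X Y F where F: "finite F" "inj_on (\<lambda>t. (poly X t, poly Y t)) (UNIV - F)"
    and locus: "zero_locus G = range (\<lambda>t. (poly X t, poly Y t))"
    using curve unfolding polynomial_curve_def by blast
  have injF: "inj_on (\<lambda>t. (poly X t, poly Y t)) (- F)" using F(2) by (simp add: Compl_eq_Diff_UNIV)
  have infF: "infinite (- F)" using F(1) infinite_UNIV_char_0[where 'a = complex] by (simp add: Compl_eq_Diff_UNIV)
  have nonconst: "degree X > 0 \<or> degree Y > 0"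
  proof (rule ccontr)
    assume "\<not> ?thesis"
    then obtain a b where ab: "X = [:a:]" "Y = [:b:]" by (metis degree_eq_zeroE neq0_conv)
    then have "inj_on (\<lambda>t :: complex. (a, b)) (- F)" using injF by simp
    then have "finite (- F)" by (rule inj_on_finite[of _ _ "{(a, b)}"]) auto
    then show False using infF by simp
  qed
  let ?c = "map_poly cnj"
  have cdeg: "degree (?c P) = degree P" for P by (rule degree_map_poly) simp
  have cpoly: "poly (?c P) s = cnj (poly P (cnj s))" for P s using poly_map_cnj[of P "cnj s"] by simp
  have sub: "\<exists>t. poly X t = poly (?c X) s \<and> poly Y t = poly (?c Y) s" for s
  proof -
    have "eval2 G (poly X (cnj s), poly Y (cnj s)) = 0" using locus unfolding zero_locus_def by blast
    then have "eval2 G (poly (?c X) s, poly (?c Y) s) = 0"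
      using eval2_conj2[of G "poly X (cnj s)" "poly Y (cnj s)"] unfolding real cpoly by simp
    then have "(poly (?c X) s, poly (?c Y) s) \<in> range (\<lambda>t. (poly X t, poly Y t))"
      using locus unfolding zero_locus_def by blast
    then show ?thesis by auto
  qed
  obtain \<beta> \<mu> where \<mu>: "\<And>s. poly X (\<beta> + \<mu> * s) = poly (?c X) s \<and> poly Y (\<beta> + \<mu> * s) = poly (?c Y) s"
  proof (cases "degree X > 0")
    case True
    show ?thesis by (rule affine_reparametrization[OF F(1) injF sub True cdeg]) (rule that)
  next
    case False
    then have Y: "degree Y > 0" using nonconst by linarith
    have injF': "inj_on (\<lambda>t. (poly Y t, poly X t)) (- F)" using injF by (auto simp: inj_on_def)
    have sub': "\<exists>t. poly Y t = poly (?c Y) s \<and> poly X t = poly (?c X) s" for s using sub[of s] by blast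
    obtain \<beta> \<mu> where "\<And>s. poly Y (\<beta> + \<mu> * s) = poly (?c Y) s \<and> poly X (\<beta> + \<mu> * s) = poly (?c X) s"
      using affine_reparametrization[OF F(1) injF' sub' Y cdeg] by blast
    then show ?thesis using that by blast
  qed
  define \<tau> where "\<tau> s = \<beta> + \<mu> * cnj s" for s
  have \<tau>: "poly X (\<tau> s) = cnj (poly X s)" "poly Y (\<tau> s) = cnj (poly Y s)" for s
    using \<mu>[of "cnj s"] unfolding \<tau>_def cpoly by simp_all
  have \<tau>\<tau>: "\<tau> (\<tau> s) = (\<beta> + \<mu> * cnj \<beta>) + \<mu> * cnj \<mu> * s" for s
    unfolding \<tau>_def by (simp add: algebra_simps)
  \<comment> \<open>Applying \<open>\<tau>\<close> twice fixes the point of the curve, hence the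
    parameter for all but finitely many parameters; comparing affine maps gives both
    equations.\<close>
  have involution: "\<beta> + \<mu> * cnj \<beta> = 0 \<and> \<mu> * cnj \<mu> = 1"
  proof -
    let ?q = "[:\<beta> + \<mu> * cnj \<beta>, \<mu> * cnj \<mu> - 1:]"
    let ?N = "{s. s \<in> F \<or> \<tau> (\<tau> s) \<in> F}"
    have "\<mu> \<noteq> 0"
    proof
      assume \<mu>0: "\<mu> = 0"
      have const: "degree P = 0" if "\<And>s. poly P (\<beta> + \<mu> * s) = poly (?c P) s" for P
      proof -
        have "poly (?c P) s = poly [:poly P \<beta>:] s" for s using that[of s] \<mu>0 by simp
        then have "?c P = [:poly P \<beta>:]" by (metis poly_eq_poly_eq_iff ext)
        then show ?thesis using cdeg[of P] by simp
      qed
      from const[of X] const[of Y] nonconst \<mu> show False by auto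
    qed
    then have "inj (\<lambda>s. \<tau> (\<tau> s))" unfolding \<tau>\<tau> by (auto intro!: injI)
    then have "finite ((\<lambda>s. \<tau> (\<tau> s)) -` F)" using F(1) by (rule finite_vimageI[rotated])
    then have "finite ?N" using F(1) by (simp add: vimage_def Collect_disj_eq)
    then have "infinite (- ?N)" using infinite_UNIV_char_0[where 'a = complex] by (simp add: Compl_eq_Diff_UNIV)
    moreover have "poly ?q s = 0" if "s \<in> - ?N" for s
    proof -
      have "poly X (\<tau> (\<tau> s)) = poly X s" "poly Y (\<tau> (\<tau> s)) = poly Y s" unfolding \<tau> by simp_all
      then have "\<tau> (\<tau> s) = s" using that injF by (auto dest: inj_onD)
      then show ?thesis unfolding \<tau>\<tau> by (simp add: algebra_simps)
    qed
    ultimately have "?q = 0" by (rule poly_infinite_roots_eq_0)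
    then show ?thesis by simp
  qed
  \<comment> \<open>As \<open>\<mu>\<close> has modulus 1, its square root satisfies
    \<open>\<mu> * cnj \<alpha> = \<alpha>\<close>. With the fixed point \<open>\<beta> / 2\<close>
    of \<open>\<tau>\<close> as origin and \<open>\<alpha>\<close> as unit, \<open>\<tau>\<close>
    becomes conjugation.\<close>
  define \<alpha> where "\<alpha> = csqrt \<mu>"
  have \<alpha>2: "\<alpha> * \<alpha> = \<mu>" unfolding \<alpha>_def using power2_csqrt[of \<mu>] by (simp add: power2_eq_square)
  have \<mu>\<alpha>: "\<mu> * cnj \<alpha> = \<alpha>"
  proof -
    have "norm (\<mu> * cnj \<mu>) = 1" using involution by simp
    then have "norm \<mu> ^ 2 = 1" by (simp add: norm_mult power2_eq_square)
    then have "norm \<mu> = 1" by (simp add: power2_eq_1_iff) (use norm_ge_zero[of \<mu>] in linarith)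
    then have "norm \<alpha> ^ 2 = 1" using \<alpha>2 by (metis norm_mult power2_eq_square)
    then have "\<alpha> * cnj \<alpha> = 1" by (metis complex_norm_square of_real_1)
    then show ?thesis unfolding \<alpha>2[symmetric] by (simp add: mult.assoc)
  qed
  have \<alpha>0: "\<alpha> \<noteq> 0" using \<alpha>2 involution by auto
  define \<kappa> where "\<kappa> z = \<beta> / 2 + \<alpha> * z" for z
  have \<tau>\<kappa>: "\<tau> (\<kappa> z) = \<kappa> (cnj z)" for z
  proof -
    have "\<mu> * cnj \<beta> = - \<beta>" using involution by (simp add: eq_neg_iff_add_eq_0 add.commute)
    then have "\<tau> (\<kappa> z) = \<beta> + (- \<beta>) / 2 + \<mu> * cnj \<alpha> * cnj z"
      unfolding \<tau>_def \<kappa>_def by (simp add: algebra_simps)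
    then show ?thesis unfolding \<mu>\<alpha> \<kappa>_def by simp
  qed
  have bij: "bij \<kappa>"
  proof (rule o_bij)
    show "(\<lambda>w. (w - \<beta> / 2) / \<alpha>) \<circ> \<kappa> = id" "\<kappa> \<circ> (\<lambda>w. (w - \<beta> / 2) / \<alpha>) = id"
      using \<alpha>0 by (auto simp: \<kappa>_def fun_eq_iff)
  qed
  define A B where "A = pcompose X [:\<beta> / 2, \<alpha>:]" and "B = pcompose Y [:\<beta> / 2, \<alpha>:]"
  have AB: "poly A z = poly X (\<kappa> z)" "poly B z = poly Y (\<kappa> z)" for z
    unfolding A_def B_def \<kappa>_def poly_pcompose by (simp_all add: mult.commute)
  have deg: "degree A = degree X" "degree B = degree Y" unfolding A_def B_def using \<alpha>0 by simp_all
  have "param_curve G A B 0"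
  proof unfold_locales
    show "zero_locus G = (\<lambda>z. (poly A z / z ^ 0, poly B z / z ^ 0)) ` {z. (0::nat) = 0 \<or> z \<noteq> 0}"
      unfolding locus AB using bij_is_surj[OF bij] by (auto simp: image_iff) (metis surj_def)
    show "(poly A (if (0::nat) = 0 then cnj z else inverse (cnj z)) / (if (0::nat) = 0 then cnj z else inverse (cnj z)) ^ 0,
        poly B (if (0::nat) = 0 then cnj z else inverse (cnj z)) / (if (0::nat) = 0 then cnj z else inverse (cnj z)) ^ 0)
      = (cnj (poly A z / z ^ 0), cnj (poly B z / z ^ 0))" for z
      unfolding AB by (simp add: \<tau>\<kappa>[symmetric] \<tau>)
    have "inj_on (\<lambda>z. (poly A z, poly B z)) (- (\<kappa> -` F))"
      unfolding AB using injF bij_is_inj[OF bij] by (auto simp: inj_on_def)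
    then have "inj_on (\<lambda>z. (poly A z, poly B z)) ({z. cnj z = z} - \<kappa> -` F)"
      by (rule inj_on_subset) auto
    moreover have "finite (\<kappa> -` F)" using F(1) bij_is_inj[OF bij] by (rule finite_vimageI)
    ultimately show "\<exists>F0. finite F0 \<and> inj_on (\<lambda>z. (poly A z / z ^ 0, poly B z / z ^ 0))
        ({z \<in> {z. (0::nat) = 0 \<or> z \<noteq> 0}. (if (0::nat) = 0 then cnj z else inverse (cnj z)) = z} - F0)"
      by (intro exI[of _ "\<kappa> -` F"]) simp
  qed (use real sqf nodes in auto)
  then show ?thesis
    using param_curve.critical_points_real[of G A B 0 p] nonconst deg p by simp
qed

section \<open>Trigonometric curves\<close>

text \<open>Sine and cosine of \<open>k * t\<close> are combinations of the powers \<open>k\<close>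
  and \<open>- k\<close> of \<open>cis t\<close>. Every sufficiently large \<open>n\<close> is
  allowed so that two coordinates can share one denominator.\<close>

lemma trig_numerator:
  assumes "trig_polynomial X"
  shows "\<exists>m. \<forall>n\<ge>m. \<exists>A. degree A \<le> 2 * n \<and> (\<forall>t. poly A (cis t) = cis t ^ n * of_real (X t))"
proof -
  obtain m a b where X: "\<And>t. X t = (\<Sum>k\<le>m. a k * cos (real k * t) + b k * sin (real k * t))"
    using assms unfolding trig_polynomial_def by blast
  have split: "of_real (a k * cos (real k * t) + b k * sin (real k * t))
      = (of_real (a k) - \<i> * of_real (b k)) / 2 * cis (real k * t) + (of_real (a k) + \<i> * of_real (b k)) / 2 * cis (- (real k * t))" for k t
    by (simp add: complex_eq_iff field_simps)
  have "\<exists>A. degree A \<le> 2 * n \<and> (\<forall>t. poly A (cis t) = cis t ^ n * of_real (X t))" if n: "n \<ge> m" for n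
  proof -
    define A where "A = (\<Sum>k\<le>m. monom ((of_real (a k) - \<i> * of_real (b k)) / 2) (n + k)
      + monom ((of_real (a k) + \<i> * of_real (b k)) / 2) (n - k))"
    have "degree A \<le> 2 * n" unfolding A_def
    proof (rule degree_sum_le)
      fix k assume "k \<in> {..m}"
      then have "k \<le> n" using n by simp
      then show "degree (monom ((of_real (a k) - \<i> * of_real (b k)) / 2) (n + k)
        + monom ((of_real (a k) + \<i> * of_real (b k)) / 2) (n - k)) \<le> 2 * n"
        by (intro degree_add_le order_trans[OF degree_monom_le]) auto
    qed simp
    moreover have "poly A (cis t) = cis t ^ n * of_real (X t)" for t
    proof -
      have "(of_real (a k) - \<i> * of_real (b k)) / 2 * cis t ^ (n + k) + (of_real (a k) + \<i> * of_real (b k)) / 2 * cis t ^ (n - k)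
          = cis t ^ n * of_real (a k * cos (real k * t) + b k * sin (real k * t))" if k: "k \<le> m" for k
      proof -
        have "cis t ^ (n + k) = cis t ^ n * cis (real k * t)" by (simp only: power_add Complex.DeMoivre)
        moreover have "cis t ^ (n - k) = cis t ^ n * cis (- (real k * t))"
        proof -
          have "cis t ^ (n - k) = cis (real (n - k) * t)" by (rule Complex.DeMoivre)
          also have "real (n - k) * t = real n * t + - (real k * t)" using k n by (simp add: of_nat_diff algebra_simps)
          also have "cis \<dots> = cis t ^ n * cis (- (real k * t))" by (simp only: cis_mult[symmetric] Complex.DeMoivre)
          finally show ?thesis .
        qed
        ultimately show ?thesis unfolding split by (simp only: algebra_simps)
      qed
      then have "(\<Sum>k\<le>m. (of_real (a k) - \<i> * of_real (b k)) / 2 * cis t ^ (n + k) + (of_real (a k) + \<i> * of_real (b k)) / 2 * cis t ^ (n - k))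
          = (\<Sum>k\<le>m. cis t ^ n * of_real (a k * cos (real k * t) + b k * sin (real k * t)))"
        by (intro sum.cong) auto
      then show ?thesis unfolding A_def X by (simp add: poly_sum poly_monom sum_distrib_left)
    qed
    ultimately show ?thesis by blast
  qed
  then show ?thesis by blast
qed

lemma infinite_unit_circle: "infinite (range cis)"
proof -
  have "{0..1} \<subseteq> Re ` range cis"
  proof
    fix x :: real assume "x \<in> {0..1}"
    then have "cos (arccos x) = x" by simp
    then show "x \<in> Re ` range cis" by (metis cis.sel(1) image_eqI rangeI)
  qed
  moreover have "infinite {0..1::real}" by simp
  ultimately show ?thesis using finite_subset by blast
qed

text \<open>The reversed polynomial with conjugate coefficients agrees with \<open>A\<close> on the
  unit circle, because \<open>A z / z ^ n\<close> is real there, and hence everywhere. Both claims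
  restate this symmetry.\<close>

lemma laurent_reality:
  fixes A :: "complex poly" and X :: "real \<Rightarrow> real"
  assumes deg: "degree A \<le> 2 * n" and X: "\<And>t. poly A (cis t) = cis t ^ n * of_real (X t)"
  shows "coeff A (2 * n) = cnj (coeff A 0)"
    "z \<noteq> 0 \<Longrightarrow> poly A (inverse (cnj z)) / inverse (cnj z) ^ n = cnj (poly A z / z ^ n)"
proof -
  define A' where "A' = (\<Sum>j\<le>2 * n. monom (cnj (coeff A (2 * n - j))) j)"
  have A': "poly A' z = z ^ (2 * n) * cnj (poly A (inverse (cnj z)))" if z: "z \<noteq> 0" for z
  proof -
    have pA: "poly A w = (\<Sum>j\<le>2 * n. coeff A j * w ^ j)" for w
      unfolding poly_altdef using deg by (intro sum.mono_neutral_left) (auto simp: coeff_eq_0)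
    have "poly A' z = (\<Sum>j\<le>2 * n. cnj (coeff A (2 * n - j)) * z ^ j)" unfolding A'_def by (simp add: poly_sum poly_monom)
    also have "\<dots> = (\<Sum>j\<le>2 * n. cnj (coeff A j) * z ^ (2 * n - j))"
      by (rule sum.reindex_bij_witness[of _ "\<lambda>j. 2 * n - j" "\<lambda>j. 2 * n - j"]) auto
    also have "\<dots> = (\<Sum>j\<le>2 * n. z ^ (2 * n) * (cnj (coeff A j) * inverse z ^ j))"
    proof (rule sum.cong)
      fix j assume "j \<in> {..2 * n}"
      then have "z ^ (2 * n - j) = z ^ (2 * n) * inverse z ^ j" using z by (simp add: power_diff power_inverse divide_inverse)
      then show "cnj (coeff A j) * z ^ (2 * n - j) = z ^ (2 * n) * (cnj (coeff A j) * inverse z ^ j)" by simp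
    qed simp
    also have "\<dots> = z ^ (2 * n) * cnj (poly A (inverse (cnj z)))" unfolding pA by (simp add: sum_distrib_left)
    finally show ?thesis .
  qed
  have AA': "A' = A"
  proof -
    have "poly (A' - A) z = 0" if z_cis: "z \<in> range cis" for z
    proof -
      obtain t where t: "z = cis t" using z_cis by blast
      have z: "z \<noteq> 0" "inverse (cnj z) = z" "cnj z = inverse z" unfolding t by (simp_all add: cis_cnj)
      have pz: "poly A z = z ^ n * of_real (X t)" using X unfolding t by simp
      have "poly A' z = z ^ (2 * n) * cnj (z ^ n * of_real (X t))" using A'[OF z(1)] unfolding z(2) pz .
      also have "\<dots> = z ^ n * z ^ n * inverse z ^ n * of_real (X t)" by (simp add: z(3) power_add mult_2)
      also have "\<dots> = z ^ n * of_real (X t)" using z(1) by (simp add: power_inverse)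
      finally show ?thesis by (simp add: pz)
    qed
    then have "A' - A = 0" using infinite_unit_circle by (rule poly_infinite_roots_eq_0[rotated])
    then show ?thesis by simp
  qed
  have "coeff A' (2 * n) = (\<Sum>j\<le>2 * n. if j = 2 * n then cnj (coeff A (2 * n - j)) else 0)"
    unfolding A'_def coeff_sum by (intro sum.cong) auto
  then show "coeff A (2 * n) = cnj (coeff A 0)" unfolding AA' by simp
  show "poly A (inverse (cnj z)) / inverse (cnj z) ^ n = cnj (poly A z / z ^ n)" if z: "z \<noteq> 0"
  proof -
    let ?w = "cnj (poly A (inverse (cnj z)))"
    have "poly A z = z ^ n * z ^ n * ?w" using A'[OF z] unfolding AA' by (simp add: mult_2 power_add)
    then have "poly A z / z ^ n = z ^ n * ?w" using z by simp
    then have "cnj (poly A z / z ^ n) = cnj z ^ n * poly A (inverse (cnj z))" by simp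
    then show ?thesis using z by (simp add: power_inverse divide_inverse mult.commute)
  qed
qed

text \<open>A polynomial vanishing at infinitely many parameters has numerator 0, so the closure
  contains the whole image. The image is closed because, after a shear that makes the projection
  proper, it is the zero set of the norm equation.\<close>

lemma zariski_closure_laurent:
  fixes A B :: "complex poly"
  assumes deg: "n < degree A \<or> n < degree B" and A0: "n > 0 \<Longrightarrow> poly A 0 \<noteq> 0 \<or> poly B 0 \<noteq> 0"
    and T: "infinite T" "T \<subseteq> {z. n = 0 \<or> z \<noteq> 0}"
  defines "\<phi> \<equiv> \<lambda>z. (poly A z / z ^ n, poly B z / z ^ n)"
  shows "zariski_closure (\<phi> ` T) = \<phi> ` {z. n = 0 \<or> z \<noteq> 0}"
proof
  show "\<phi> ` {z. n = 0 \<or> z \<noteq> 0} \<subseteq> zariski_closure (\<phi> ` T)"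
  proof
    fix p assume "p \<in> \<phi> ` {z. n = 0 \<or> z \<noteq> 0}"
    then obtain z where z: "n = 0 \<or> z \<noteq> 0" "p = \<phi> z" by blast
    have "p \<in> zero_locus H" if H: "\<phi> ` T \<subseteq> zero_locus H" for H
    proof -
      obtain E e where E: "n = 0 \<longrightarrow> e = 0" "\<And>z. n = 0 \<or> z \<noteq> 0 \<Longrightarrow> poly E z = z ^ e * eval2 H (poly A z / z ^ n, poly B z / z ^ n)"
        using ex_laurent_numerator[where A = A and B = B and n = n and H = H] by (metis (mono_tags, lifting) mem_Collect_eq)
      have "poly E w = 0" if "w \<in> T" for w
      proof -
        have "eval2 H (poly A w / w ^ n, poly B w / w ^ n) = 0"
          using H that unfolding \<phi>_def zero_locus_def by blast
        moreover have "n = 0 \<or> w \<noteq> 0" using T(2) that by blast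
        ultimately show ?thesis using E(2)[of w] by simp
      qed
      then have "E = 0" using T(1) by (rule poly_infinite_roots_eq_0[rotated])
      moreover have "z ^ e \<noteq> 0" using E(1) z(1) by auto
      ultimately show ?thesis using E(2)[OF z(1)] unfolding z(2) \<phi>_def zero_locus_def by auto
    qed
    then show "p \<in> zariski_closure (\<phi> ` T)" unfolding zariski_closure_def by blast
  qed
  have "\<not> (UNIV :: real set) \<subseteq> {l. \<not> (n < degree (A - Polynomial.smult (of_real l) B)
    \<and> (n > 0 \<longrightarrow> poly (A - Polynomial.smult (of_real l) B) 0 \<noteq> 0))}"
    using finite_bad_shears_proper[OF deg A0] infinite_UNIV_char_0[where 'a = real] finite_subset by blast
  then obtain l :: real where l: "n < degree (A - Polynomial.smult (of_real l) B)"
    "n > 0 \<Longrightarrow> poly (A - Polynomial.smult (of_real l) B) 0 \<noteq> 0" by blast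
  let ?A = "A - Polynomial.smult (of_real l) B"
  obtain H c where H: "c \<noteq> 0"
    "\<And>x. fibre_poly H x = Polynomial.smult c (\<Prod>z\<in>#proots (fibre_eq ?A n x). [:- (poly B z / z ^ n), 1:])"
    using ex_locus_equation[OF l, of B] by metis
  have locus: "zero_locus H = (\<lambda>z. (poly ?A z / z ^ n, poly B z / z ^ n)) ` {z. n = 0 \<or> z \<noteq> 0}"
    by (rule locus_of_fibres[OF l H])
  have shear: "(poly ?A z / z ^ n, poly B z / z ^ n) = unshear (- of_real l) (\<phi> z)" for z
    unfolding \<phi>_def unshear_def by (simp add: diff_divide_distrib)
  have mem: "p \<in> zero_locus (shear (- of_real l) H) \<longleftrightarrow> p \<in> \<phi> ` {z. n = 0 \<or> z \<noteq> 0}" for p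
  proof -
    have "p \<in> zero_locus (shear (- of_real l) H) \<longleftrightarrow> unshear (- of_real l) p \<in> zero_locus H"
      unfolding zero_locus_def by (simp add: eval2_shear_unshear)
    also have "\<dots> \<longleftrightarrow> (\<exists>z. (n = 0 \<or> z \<noteq> 0) \<and> unshear (- of_real l) p = unshear (- of_real l) (\<phi> z))"
      unfolding locus shear by auto
    also have "\<dots> \<longleftrightarrow> (\<exists>z. (n = 0 \<or> z \<noteq> 0) \<and> p = \<phi> z)"
      using inj_unshear by (simp only: inj_eq)
    finally show ?thesis by blast
  qed
  then have "zero_locus (shear (- of_real l) H) = \<phi> ` {z. n = 0 \<or> z \<noteq> 0}" by (intro equalityI subsetI) simp_all
  moreover have "\<phi> ` T \<subseteq> \<phi> ` {z. n = 0 \<or> z \<noteq> 0}" using T(2) by (rule image_mono)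
  ultimately have "\<phi> ` T \<subseteq> zero_locus (shear (- of_real l) H)" by simp
  then have "zariski_closure (\<phi> ` T) \<subseteq> zero_locus (shear (- of_real l) H)"
    unfolding zariski_closure_def by (intro Inter_lower CollectI exI[of _ "shear (- of_real l) H"] conjI refl)
  also have "\<dots> = \<phi> ` {z. n = 0 \<or> z \<noteq> 0}" by fact
  finally show "zariski_closure (\<phi> ` T) \<subseteq> \<phi> ` {z. n = 0 \<or> z \<noteq> 0}" .
qed

text \<open>The curve is given as the closure of its real image. With \<open>z = cis t\<close> it
  becomes the image of the punctured line under Laurent polynomials that are real on the unit
  circle.\<close>

theorem trigonometric_curve_critical_points_real:
  fixes G :: "complex poly poly"
  assumes real: "conj2 G = G" and sqf: "squarefree G" and curve: "trigonometric_curve (zero_locus G)"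
    and nodes: "\<And>p. p \<in> singular_points G \<Longrightarrow> real_tangent_pair G p"
    and p: "p \<in> critical_points G"
  shows "real_point p"
proof -
  obtain X Y F where XY: "trig_polynomial X" "trig_polynomial Y" and F: "finite F" "inj_on (\<lambda>t. (X t, Y t)) ({0..<2 * pi} - F)"
    and locus: "zero_locus G = zariski_closure ((\<lambda>t. (complex_of_real (X t), complex_of_real (Y t))) ` {0..<2 * pi})"
    using curve unfolding trigonometric_curve_def by blast
  define rep where "rep n A B \<longleftrightarrow> degree A \<le> 2 * n \<and> degree B \<le> 2 * n \<and> (\<forall>t. poly A (cis t) = cis t ^ n * of_real (X t))
    \<and> (\<forall>t. poly B (cis t) = cis t ^ n * of_real (Y t))" for n A B
  have "\<exists>n A B. rep n A B"
  proof -
    obtain m where m: "\<And>n. n \<ge> m \<Longrightarrow> \<exists>A. degree A \<le> 2 * n \<and> (\<forall>t. poly A (cis t) = cis t ^ n * of_real (X t))"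
      using trig_numerator[OF XY(1)] by blast
    obtain m' where m': "\<And>n. n \<ge> m' \<Longrightarrow> \<exists>A. degree A \<le> 2 * n \<and> (\<forall>t. poly A (cis t) = cis t ^ n * of_real (Y t))"
      using trig_numerator[OF XY(2)] by blast
    show ?thesis unfolding rep_def using m[of "max m m'"] m'[of "max m m'"] by (metis max.cobounded1 max.cobounded2)
  qed
  \<comment> \<open>The exponent is taken minimal, so that at least one coordinate has a pole at 0
    and, by the reality symmetry, at infinity.\<close>
  then obtain n where n: "\<exists>A B. rep n A B" "\<And>k. k < n \<Longrightarrow> \<not> (\<exists>A B. rep k A B)"
    using exists_least_iff[of "\<lambda>n. \<exists>A B. rep n A B"] by blast
  then obtain A B where "rep n A B" by blast
  then have A: "degree A \<le> 2 * n" "\<And>t. poly A (cis t) = cis t ^ n * of_real (X t)"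
    and B: "degree B \<le> 2 * n" "\<And>t. poly B (cis t) = cis t ^ n * of_real (Y t)" unfolding rep_def by auto
  have cis_n: "cis t ^ n \<noteq> 0" for t by simp
  have val: "poly A (cis t) / cis t ^ n = of_real (X t)" "poly B (cis t) / cis t ^ n = of_real (Y t)" for t
    using A(2) B(2) cis_n by simp_all
  have n0: "n > 0"
  proof (rule ccontr)
    assume "\<not> n > 0"
    then have "degree A = 0" "degree B = 0" "n = 0" using A(1) B(1) by auto
    then obtain a b where ab: "A = [:a:]" "B = [:b:]" by (meson degree_eq_zeroE)
    have "(X t, Y t) = (Re a, Re b)" for t
      using A(2)[of t] B(2)[of t] \<open>n = 0\<close> unfolding ab by simp
    then have "inj_on (\<lambda>t :: real. (Re a, Re b)) ({0..<2 * pi} - F)" using F(2) by simp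
    then have "finite ({0..<2 * pi} - F)" by (rule inj_on_finite[of _ _ "{(Re a, Re b)}"]) auto
    moreover have "infinite {0..<2 * pi}" by (rule infinite_Ico) simp
    ultimately show False using F(1) by simp
  qed
  have A0: "poly A 0 \<noteq> 0 \<or> poly B 0 \<noteq> 0"
  proof (rule ccontr)
    assume neg: "\<not> ?thesis"
    have reduce: "\<exists>P'. degree P' \<le> 2 * (n - 1) \<and> (\<forall>t. poly P' (cis t) = cis t ^ (n - 1) * of_real (Z t))"
      if P: "degree P \<le> 2 * n" "\<And>t. poly P (cis t) = cis t ^ n * of_real (Z t)" "poly P 0 = 0" for P Z
    proof -
      obtain P' where P': "P = [:0, 1:] * P'" using P(3) poly_eq_0_iff_dvd[of P 0] by (auto elim: dvdE)
      \<comment> \<open>The symmetry makes the top coefficient vanish together with the constant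
        one, so cancelling \<open>z\<close> lowers the degree bound by two and leaves the form for
        \<open>n - 1\<close>.\<close>
      have "coeff P (2 * n) = 0" using laurent_reality(1)[OF P(1,2)] P(3) by (simp add: poly_0_coeff_0)
      then have dP: "degree P < 2 * n" using P(1) n0 by (metis degree_0 leading_coeff_0_iff le_neq_implies_less mult_pos_pos zero_less_numeral)
      have "degree P' \<le> 2 * (n - 1)"
      proof (cases "P' = 0")
        case False
        then have "degree P = Suc (degree P')" unfolding P' by (simp add: degree_mult_eq)
        then show ?thesis using dP by simp
      qed simp
      moreover have "poly P' (cis t) = cis t ^ (n - 1) * of_real (Z t)" for t
      proof -
        have "cis t * poly P' (cis t) = cis t * (cis t ^ (n - 1) * of_real (Z t))"
          using P(2)[of t] n0 unfolding P' by (simp add: power_eq_if)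
        then show ?thesis by simp
      qed
      ultimately show ?thesis by blast
    qed
    have "\<exists>A B. rep (n - 1) A B"
      using reduce[OF A] reduce[OF B] neg unfolding rep_def by blast
    then show False using n(2)[of "n - 1"] n0 by simp
  qed
  have deg: "n < degree A \<or> n < degree B"
  proof -
    have "coeff A (2 * n) \<noteq> 0 \<or> coeff B (2 * n) \<noteq> 0"
      using A0 laurent_reality(1)[OF A] laurent_reality(1)[OF B] by (auto simp: poly_0_coeff_0)
    then show ?thesis using le_degree[of A "2 * n"] le_degree[of B "2 * n"] n0 by auto
  qed
  have circle: "cis ` {0..<2 * pi} = sphere 0 1"
  proof (intro equalityI subsetI)
    fix z :: complex assume "z \<in> sphere 0 1"
    then have "z = cis (Arg2pi z)" using Arg2pi_eq[of z] by (simp add: cis_conv_exp)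
    moreover have "Arg2pi z \<in> {0..<2 * pi}" using Arg2pi_ge_0 Arg2pi_lt_2pi by simp
    ultimately show "z \<in> cis ` {0..<2 * pi}" by blast
  qed auto
  have "range cis \<subseteq> sphere 0 1" by auto
  then have inf: "infinite (sphere (0::complex) 1)" using infinite_unit_circle finite_subset by blast
  have "(\<lambda>t. (complex_of_real (X t), complex_of_real (Y t))) ` {0..<2 * pi} = (\<lambda>z. (poly A z / z ^ n, poly B z / z ^ n)) ` sphere 0 1"
    unfolding circle[symmetric] image_image val ..
  then have locus': "zero_locus G = (\<lambda>z. (poly A z / z ^ n, poly B z / z ^ n)) ` {z. n = 0 \<or> z \<noteq> 0}"
  proof -
    have "sphere 0 1 \<subseteq> {z. n = 0 \<or> z \<noteq> (0::complex)}" by auto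
    then show ?thesis
      unfolding locus \<open>_ ` {0..<2 * pi} = _ ` sphere 0 1\<close> by (rule zariski_closure_laurent[OF deg A0 inf])
  qed
  have "param_curve G A B n"
  proof unfold_locales
    show "zero_locus G = (\<lambda>z. (poly A z / z ^ n, poly B z / z ^ n)) ` {z. n = 0 \<or> z \<noteq> 0}" by (rule locus')
    show "(poly A (if n = 0 then cnj z else inverse (cnj z)) / (if n = 0 then cnj z else inverse (cnj z)) ^ n,
        poly B (if n = 0 then cnj z else inverse (cnj z)) / (if n = 0 then cnj z else inverse (cnj z)) ^ n)
      = (cnj (poly A z / z ^ n), cnj (poly B z / z ^ n))" if "z \<in> {z. n = 0 \<or> z \<noteq> 0}" for z
    proof -
      have "z \<noteq> 0" using that n0 by simp
      then show ?thesis using laurent_reality(2)[OF A] laurent_reality(2)[OF B] n0 by simp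
    qed
    show "\<exists>F0. finite F0 \<and> inj_on (\<lambda>z. (poly A z / z ^ n, poly B z / z ^ n))
        ({z \<in> {z. n = 0 \<or> z \<noteq> 0}. (if n = 0 then cnj z else inverse (cnj z)) = z} - F0)"
    proof (intro exI[of _ "cis ` F"] conjI inj_onI)
      fix z w
      assume zw: "z \<in> {z \<in> {z. n = 0 \<or> z \<noteq> 0}. (if n = 0 then cnj z else inverse (cnj z)) = z} - cis ` F"
        "w \<in> {z \<in> {z. n = 0 \<or> z \<noteq> 0}. (if n = 0 then cnj z else inverse (cnj z)) = z} - cis ` F"
        "(poly A z / z ^ n, poly B z / z ^ n) = (poly A w / w ^ n, poly B w / w ^ n)"
      have on_circle: "\<exists>t\<in>{0..<2 * pi} - F. v = cis t"
        if "v \<in> {z \<in> {z. n = 0 \<or> z \<noteq> 0}. (if n = 0 then cnj z else inverse (cnj z)) = z} - cis ` F" for v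
      proof -
        have v: "v \<noteq> 0" "inverse (cnj v) = v" "v \<notin> cis ` F" using that n0 by auto
        then have "v * cnj v = 1" by (metis complex_cnj_zero_iff left_inverse)
        then have "norm v * norm v = 1" by (metis complex_mod_cnj norm_mult norm_one)
        then have "norm v = 1" by (simp add: square_eq_1_iff) (use norm_ge_zero[of v] in linarith)
        then have "v \<in> cis ` {0..<2 * pi}" unfolding circle by simp
        then show ?thesis using v(3) by blast
      qed
      obtain s t where st: "s \<in> {0..<2 * pi} - F" "z = cis s" "t \<in> {0..<2 * pi} - F" "w = cis t"
        using on_circle[OF zw(1)] on_circle[OF zw(2)] by blast
      have "(X s, Y s) = (X t, Y t)" using zw(3) unfolding st val by simp
      then have "s = t" using F(2) st(1,3) by (auto dest: inj_onD)
      then show "z = w" unfolding st by simp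
    qed (use F(1) in simp)
  qed (use real sqf nodes in auto)
  then show ?thesis by (rule param_curve.critical_points_real[OF _ deg A0 p])
qed

theorem corollary7p19:
  fixes G :: "real poly poly" and C :: "(complex \<times> complex) set"
  assumes "C = zero_locus (complexify G)"
    and "squarefree (complexify G)"
    and "polynomial_curve C \<or> trigonometric_curve C"
    and "\<forall>p \<in> singular_points (complexify G). hyperbolic_node (complexify G) p"
  shows "\<forall>p \<in> critical_points (complexify G). real_point p"
proof
  fix p assume p: "p \<in> critical_points (complexify G)"
  have real: "conj2 (complexify G) = complexify G" by (rule conj2_complexify)
  have nodes: "real_tangent_pair (complexify G) q" if "q \<in> singular_points (complexify G)" for q
    using hyperbolic_node_real_tangent_pair[OF assms(2) that] assms(4) that by blast
  show "real_point p"
    using assms(3) polynomial_curve_critical_points_real[OF real assms(2) _ nodes p]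
      trigonometric_curve_critical_points_real[OF real assms(2) _ nodes p]
    unfolding assms(1) by blast
qed

end
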